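(* (1) The map $F:(0,\infty)\times(0,\infty)\to(0,\infty)\times(0,\infty)$, $F(a_0,-f_0)=(a'_\infty,b'_\infty)$, is proper in the case of $S^1\times\mathbb{R}^3$ topology. (2) The map $F:(0,\infty)\times(0,\infty)\to(0,\infty)\times(0,\infty)$, $F(b_0,-f_0)=(a'_\infty,b'_\infty)$, is proper in the case of $S^2\times\mathbb{R}^2$ topology.
   Context: Consider smooth functions $a,b,f$ of $r\ge0$, with $a,b>0$ for $r>0$, satisfying for $r>0$ the soliton equations $$f''=\frac{a''}{a}+2\frac{b''}{b}-1,\qquad a''=-2\frac{a'b'}{b}+a'f'+a,\qquad b''=\frac{1-(b')^2}{b}-\frac{a'b'}{a}+b'f'+b.$$ $S^1\times\mathbb{R}^3$ boundary conditions, $a_0>0$, $f_0<0$: $a(0)=a_0$, $a'(0)=0$, $b(0)=0$, $b'(0)=1$, $f(0)=f'(0)=0$, $f''(0)=f_0$. $S^2\times\mathbb{R}^2$ boundary conditions, $b_0>0$, $f_0<0$: $a(0)=0$, $a'(0)=1$, $b(0)=b_0$, $b'(0)=0$, $f(0)=f'(0)=0$, $f''(0)=f_0$. In each case there is a unique solution, defined on $[0,\infty)$, and the limits $a'_\infty=\lim_{r\to\infty}a'(r)$, $b'_\infty=\lim_{r\to\infty}b'(r)$ exist and are finite and positive; $F$ is defined by sending the parameters $(a_0,-f_0)$ (respectively $(b_0,-f_0)$) to $(a'_\infty,b'_\infty)$. Proper means that preimages of compact sets are compact. *)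

theory Defs
  imports "HOL-Analysis.Analysis"
begin

text \<open>
  Functions of \<open>r \<ge> 0\<close> are represented by functions on all of \<^typ>\<open>real\<close>; only their
  restriction to \<open>{0..}\<close> matters. The derivative is taken within \<open>{0..}\<close>, so it is the
  one-sided derivative at \<open>0\<close> and the ordinary derivative at every \<open>r > 0\<close>.
\<close>

definition hderiv :: "(real \<Rightarrow> real) \<Rightarrow> real \<Rightarrow> real" where
  "hderiv g r = vector_derivative g (at r within {0..})"

definition smooth_halfline :: "(real \<Rightarrow> real) \<Rightarrow> bool" where
  "smooth_halfline g \<longleftrightarrow> (\<forall>n. (hderiv ^^ n) g differentiable_on {0..})"

definition soliton :: "(real \<Rightarrow> real) \<Rightarrow> (real \<Rightarrow> real) \<Rightarrow> (real \<Rightarrow> real) \<Rightarrow> bool" where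
  "soliton a b f \<longleftrightarrow>
     smooth_halfline a \<and> smooth_halfline b \<and> smooth_halfline f \<and>
     (\<forall>r>0. a r > 0 \<and> b r > 0 \<and>
        hderiv (hderiv f) r =
          hderiv (hderiv a) r / a r + 2 * (hderiv (hderiv b) r / b r) - 1 \<and>
        hderiv (hderiv a) r =
          - 2 * (hderiv a r * hderiv b r / b r) + hderiv a r * hderiv f r + a r \<and>
        hderiv (hderiv b) r =
          (1 - (hderiv b r)\<^sup>2) / b r - hderiv a r * hderiv b r / a r
            + hderiv b r * hderiv f r + b r)"

definition soliton_S1R3 ::
    "real \<Rightarrow> real \<Rightarrow> (real \<Rightarrow> real) \<Rightarrow> (real \<Rightarrow> real) \<Rightarrow> (real \<Rightarrow> real) \<Rightarrow> bool" where
  "soliton_S1R3 a0 f0 a b f \<longleftrightarrow> soliton a b f \<and>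
     a 0 = a0 \<and> hderiv a 0 = 0 \<and> b 0 = 0 \<and> hderiv b 0 = 1 \<and>
     f 0 = 0 \<and> hderiv f 0 = 0 \<and> hderiv (hderiv f) 0 = f0"

definition soliton_S2R2 ::
    "real \<Rightarrow> real \<Rightarrow> (real \<Rightarrow> real) \<Rightarrow> (real \<Rightarrow> real) \<Rightarrow> (real \<Rightarrow> real) \<Rightarrow> bool" where
  "soliton_S2R2 b0 f0 a b f \<longleftrightarrow> soliton a b f \<and>
     a 0 = 0 \<and> hderiv a 0 = 1 \<and> b 0 = b0 \<and> hderiv b 0 = 0 \<and>
     f 0 = 0 \<and> hderiv f 0 = 0 \<and> hderiv (hderiv f) 0 = f0"

definition has_asymptotic_slopes ::
    "(real \<Rightarrow> real) \<Rightarrow> (real \<Rightarrow> real) \<Rightarrow> real \<times> real \<Rightarrow> bool" where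
  "has_asymptotic_slopes a b L \<longleftrightarrow>
     (hderiv a \<longlongrightarrow> fst L) at_top \<and> (hderiv b \<longlongrightarrow> snd L) at_top"

text \<open>
  The second component of the argument is \<open>-f\<^sub>0\<close>. The description is over the pair of limits
  rather than over the solution, as the latter is determined on \<open>{0..}\<close> only.
\<close>

definition F_S1R3 :: "real \<times> real \<Rightarrow> real \<times> real" where
  "F_S1R3 = (\<lambda>(a0, c). THE L. \<exists>a b f. soliton_S1R3 a0 (- c) a b f \<and> has_asymptotic_slopes a b L)"

definition F_S2R2 :: "real \<times> real \<Rightarrow> real \<times> real" where
  "F_S2R2 = (\<lambda>(b0, c). THE L. \<exists>a b f. soliton_S2R2 b0 (- c) a b f \<and> has_asymptotic_slopes a b L)"

definition quadrant :: "(real \<times> real) set" where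
  "quadrant = {0<..} \<times> {0<..}"

definition is_proper_map ::
    "'a::topological_space set \<Rightarrow> 'b::topological_space set \<Rightarrow> ('a \<Rightarrow> 'b) \<Rightarrow> bool" where
  "is_proper_map S T F \<longleftrightarrow>
     F \<in> S \<rightarrow> T \<and> (\<forall>K. K \<subseteq> T \<and> compact K \<longrightarrow> compact (S \<inter> F -` K))"

end

(*
With L = a'/a, M = b'/b, W = 1/b, q = -f' and X = L + 2M + q the soliton equations and Hamilton's
identity form a polynomial system whose solutions stay in the positive orthant. At r = 0 it has a
regular singular point, and suitable variables turn it into a singular initial value problem whose
solution is unique, global, smooth and continuous in the parameters. Every trajectory enters an open
forward invariant set in which the remaining variation of ln a' and ln b' is bounded by a function of
the current state that tends to 0 along the trajectory. Hence the slopes at infinity exist, are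
positive and depend continuously on the parameters.

Properness is then a matter of a priori bounds. In both cases b' has no interior maximum with a value
above 1, so the limit of b' is at least any value above 1 that b' attains, and it becomes large as
f_0 tends to 0. For S^1 x R^3 the value a(0) only scales a, and the limit of b' tends to 0 as -f_0
tends to infinity. For S^2 x R^2 the limit of a' is at most a constant times a(1) (1 + lim b'), where
a(1) tends to 0 when -f_0 tends to infinity or b_0 tends to 0; and for bounded f_0 the limit of b'
tends to infinity with b_0.
*)

theory Submission
  imports Defs "HOL-Real_Asymp.Real_Asymp"
begin

text \<open>Continuous dependence controls compact ranges of r only, while F is read off at
  infinity. The logarithmic derivatives E = a''/a' and G = b''/b' bridge this gap: they satisfy
  linear equations whose damping, at least 1/L - L and 1/M - M, is large once L and M are small, and
  whose forcing is O(1/X^2), which is integrable because X grows linearly. So the tail is bounded by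
  quantities taken at one finite time, and these vary continuously. The positivity arguments run on
  intervals (0, T), because they must first exclude blow-up. As F is a definite description over all
  smooth solitons, every such soliton has to be brought back to the singular problem; its missing
  initial values are found by letting r tend to 0 in the equations. In the S^2 x R^2 bounds the
  delicate point is an estimate of a' that is uniform in both parameters: large C is handled by
  comparing a^2 with U, bounded C by comparing a with b.\<close>

section \<open>Differential inequalities\<close>

text \<open>At a first zero the function has come down from positive values, so its derivative there
  cannot be positive. Positivity is assumed in a right neighbourhood of \<open>a\<close> and not at
  \<open>a\<close>, since most functions below are singular at r = 0; \<open>cross\<close> may use
  positivity at all earlier times.\<close>

lemma first_zero_pos:
  fixes g g' :: "real \<Rightarrow> real"
  assumes ar: "a < r"
    and deriv: "\<And>s. a < s \<Longrightarrow> s \<le> r \<Longrightarrow> (g has_real_derivative g' s) (at s)"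
    and init: "eventually (\<lambda>s. g s > 0) (at_right a)"
    and cross: "\<And>s. a < s \<Longrightarrow> s \<le> r \<Longrightarrow> g s = 0 \<Longrightarrow> (\<And>t. a < t \<Longrightarrow> t < s \<Longrightarrow> g t > 0) \<Longrightarrow> g' s > 0"
  shows "g r > 0"
proof (rule ccontr)
  assume neg: "\<not> g r > 0"
  obtain d where d: "d > a" "\<And>s. a < s \<Longrightarrow> s < d \<Longrightarrow> g s > 0"
    using init unfolding eventually_at_right_field by auto
  \<comment> \<open>The first zero is sought in the compact interval [s0, r], away from
    \<open>a\<close>, where \<open>g\<close> need not be continuous.\<close>
  define s0 where "s0 = (a + min d r) / 2"
  have s0: "a < s0" "s0 < d" "s0 < r" using d(1) ar unfolding s0_def by (auto simp: min_def field_simps)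
  have cont: "continuous_on {s0..r} g"
  proof (rule DERIV_atLeastAtMost_imp_continuous_on)
    fix s assume "s0 \<le> s" "s \<le> r"
    then show "\<exists>y. (g has_real_derivative y) (at s)" using deriv[of s] s0 by auto
  qed
  define S where "S = {s \<in> {s0..r}. g s \<in> {..0}}"
  have "closed S" unfolding S_def
    by (intro continuous_closed_preimage[OF cont, unfolded vimage_def Int_def mem_Collect_eq] closed_atMost)
       (auto simp: closed_atLeastAtMost)
  moreover have "r \<in> S" using neg s0 by (auto simp: S_def)
  moreover have "bdd_below S" by (auto simp: S_def intro: bdd_belowI[of _ s0])
  ultimately have tS: "Inf S \<in> S" by (intro closed_contains_Inf) auto
  define t where "t = Inf S"
  have t: "s0 \<le> t" "t \<le> r" "g t \<le> 0" using tS by (auto simp: S_def t_def)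
  have "g s0 > 0" using d s0 by auto
  then have t0: "s0 < t" using t by (cases "s0 = t") auto
  have pos: "g s > 0" if "a < s" "s < t" for s
  proof (cases "s < s0")
    case True then show ?thesis using d s0 that by auto
  next
    case False
    have "s \<notin> S"
      using that \<open>bdd_below S\<close> cInf_lower[of s S] by (auto simp: t_def)
    then show ?thesis using False that t by (auto simp: S_def)
  qed
  have dt: "(g has_real_derivative g' t) (at t)" using deriv t t0 s0 by auto
  have "g t = 0"
  proof (rule ccontr)
    assume "g t \<noteq> 0"
    then have "g t < 0" using t by auto
    moreover have "isCont g t" using dt DERIV_isCont by blast
    ultimately have "eventually (\<lambda>s. g s < 0) (at t)"
      unfolding isCont_def using order_tendstoD(2) by blast
    then have "eventually (\<lambda>s. g s < 0) (at_left t)"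
      by (simp add: eventually_at_split)
    moreover have "eventually (\<lambda>s. s > s0) (at_left t)"
      using t0 eventually_at_left_real[OF t0] by (auto elim: eventually_mono)
    moreover have "eventually (\<lambda>s. s < t) (at_left t)"
      by (auto simp: eventually_at_filter)
    ultimately have "eventually (\<lambda>s. False) (at_left t)"
      by eventually_elim (use pos s0 in \<open>meson less_trans not_less_iff_gr_or_eq\<close>)
    then show False by simp
  qed
  then have "g' t > 0" using cross[of t] t t0 s0 pos by auto
  then obtain d' where d': "d' > 0" "\<And>h. h > 0 \<Longrightarrow> h < d' \<Longrightarrow> g (t - h) < g t"
    using DERIV_pos_inc_left[OF dt] by auto
  define h where "h = min d' (t - s0) / 2"
  have "h > 0" "h < d'" "t - h > a" using d' t0 s0 by (auto simp: h_def min_def field_simps)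
  then show False using d'(2)[of h] pos[of "t-h"] \<open>g t = 0\<close> by auto
qed

lemma stays_pos:
  fixes g g' :: "real \<Rightarrow> real"
  assumes "s \<le> r"
    and deriv: "\<And>t. s \<le> t \<Longrightarrow> t \<le> r \<Longrightarrow> (g has_real_derivative g' t) (at t)"
    and init: "g s > 0"
    and cross: "\<And>t. s < t \<Longrightarrow> t \<le> r \<Longrightarrow> g t = 0 \<Longrightarrow> (\<And>t'. s \<le> t' \<Longrightarrow> t' < t \<Longrightarrow> g t' > 0) \<Longrightarrow> g' t > 0"
  shows "g r > 0"
proof (cases "s = r")
  case False
  show ?thesis
  proof (rule first_zero_pos[where a = s and g = g and g' = g' and r = r])
    have "isCont g s" using deriv[of s] assms(1) DERIV_isCont by blast
    then have "eventually (\<lambda>t. g t > 0) (at s)"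
      unfolding isCont_def using order_tendstoD(1) init by blast
    then show "eventually (\<lambda>t. g t > 0) (at_right s)" by (simp add: eventually_at_split)
  next
    fix t assume "s < t" "t \<le> r" "g t = 0" "\<And>t'. s < t' \<Longrightarrow> t' < t \<Longrightarrow> g t' > 0"
    then show "g' t > 0" using cross[of t] init by (metis order_le_less)
  qed (use False assms in auto)
qed (use init in auto)

lemma deriv_nonneg_le:
  fixes g g' :: "real \<Rightarrow> real"
  assumes "s \<le> r" "\<And>t. s \<le> t \<Longrightarrow> t \<le> r \<Longrightarrow> (g has_real_derivative g' t) (at t)"
    "\<And>t. s \<le> t \<Longrightarrow> t \<le> r \<Longrightarrow> g' t \<ge> 0"
  shows "g s \<le> g r"
  by (rule DERIV_nonneg_imp_nondecreasing[of s r g]) (use assms in blast)+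

lemma deriv_nonpos_ge:
  fixes g g' :: "real \<Rightarrow> real"
  assumes "s \<le> r" "\<And>t. s \<le> t \<Longrightarrow> t \<le> r \<Longrightarrow> (g has_real_derivative g' t) (at t)"
    "\<And>t. s \<le> t \<Longrightarrow> t \<le> r \<Longrightarrow> g' t \<le> 0"
  shows "g r \<le> g s"
  by (rule DERIV_nonpos_imp_nonincreasing[of s r g]) (use assms in blast)+

text \<open>The initial value enters as a one-sided limit, because \<open>a\<close> will be the
  singular point r = 0.\<close>

lemma deriv_nonpos_le_limit:
  fixes g g' :: "real \<Rightarrow> real"
  assumes "a < r" "\<And>t. a < t \<Longrightarrow> t \<le> r \<Longrightarrow> (g has_real_derivative g' t) (at t)"
    "\<And>t. a < t \<Longrightarrow> t \<le> r \<Longrightarrow> g' t \<le> 0" "(g \<longlongrightarrow> l) (at_right a)"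
  shows "g r \<le> l"
proof (rule tendsto_lowerbound[OF assms(4)])
  have "eventually (\<lambda>s. s \<in> {a<..<r}) (at_right a)" by (rule eventually_at_right_real) (use assms in auto)
  then show "eventually (\<lambda>s. g r \<le> g s) (at_right a)"
    by eventually_elim (rule deriv_nonpos_ge[where g' = g'], use assms in auto)
qed auto

lemma deriv_nonneg_ge_limit:
  fixes g g' :: "real \<Rightarrow> real"
  assumes "a < r" "\<And>t. a < t \<Longrightarrow> t \<le> r \<Longrightarrow> (g has_real_derivative g' t) (at t)"
    "\<And>t. a < t \<Longrightarrow> t \<le> r \<Longrightarrow> g' t \<ge> 0" "(g \<longlongrightarrow> l) (at_right a)"
  shows "l \<le> g r"
proof -
  have "- g r \<le> - l"
    by (rule deriv_nonpos_le_limit[where a = a and g' = "\<lambda>t. - g' t"])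
       (use assms in \<open>auto intro!: derivative_eq_intros tendsto_intros\<close>)
  then show ?thesis by simp
qed

lemma gronwall:
  fixes y y' :: "real \<Rightarrow> real"
  assumes "a \<le> b" and cont: "continuous_on {a..b} y"
    and deriv: "\<And>t. a < t \<Longrightarrow> t < b \<Longrightarrow> (y has_real_derivative y' t) (at t)"
    and le: "\<And>t. a < t \<Longrightarrow> t < b \<Longrightarrow> y' t \<le> K * y t"
  shows "y b \<le> y a * exp (K * (b - a))"
proof -
  have "y b * exp (- K * b) \<le> y a * exp (- K * a)"
  proof (rule DERIV_nonpos_imp_decreasing_open[OF \<open>a \<le> b\<close>])
    fix t assume t: "a < t" "t < b"
    have "((\<lambda>t. y t * exp (- K * t)) has_real_derivative (y' t - K * y t) * exp (- K * t)) (at t)"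
      by (auto intro!: derivative_eq_intros deriv t simp: algebra_simps)
    moreover have "(y' t - K * y t) * exp (- K * t) \<le> 0"
      using le[OF t] by (simp add: mult_nonpos_nonneg)
    ultimately show "\<exists>z. ((\<lambda>t. y t * exp (- K * t)) has_real_derivative z) (at t) \<and> z \<le> 0" by blast
  qed (auto intro!: continuous_intros cont)
  then have "y b * exp (- K * b) * exp (K * b) \<le> y a * exp (- K * a) * exp (K * b)"
    by (intro mult_right_mono) auto
  then show ?thesis by (simp add: algebra_simps flip: exp_add)
qed

text \<open>\<open>r * Tk k g r\<close> is r^(-k) times the integral of s^k g(s) over [0, r], the
  solution of y' + k y / r = g that vanishes at 0. Rescaled to the fixed interval [0, 1] it makes
  sense at r = 0 and can be differentiated under the integral sign.\<close>

definition Tk :: "nat \<Rightarrow> (real \<Rightarrow> real) \<Rightarrow> real \<Rightarrow> real" where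
  "Tk k g r = integral {0..1} (\<lambda>t. t ^ k * g (r * t))"

lemma continuous_on_scaled:
  fixes g :: "real \<Rightarrow> real"
  assumes "continuous_on {0..} g"
  shows "continuous_on ({0..} \<times> {0..1}) (\<lambda>(r, t). t ^ k * g (r * t))"
  unfolding split_beta
  by (intro continuous_intros continuous_on_compose2[OF assms]) auto

lemma Tk_integrable:
  fixes g :: "real \<Rightarrow> real"
  assumes "continuous_on {0..} g" "r \<ge> 0"
  shows "(\<lambda>t. t ^ k * g (r * t)) integrable_on {0..1}"
  by (intro integrable_continuous_real continuous_intros continuous_on_compose2[OF assms(1)])
     (use assms in auto)

lemma continuous_on_Tk: "continuous_on {0..} g \<Longrightarrow> continuous_on {0..} (Tk k g)"
  using integral_continuous_on_param[of "{0..}" 0 1 "\<lambda>r t. t ^ k * g (r * t)"] continuous_on_scaled[of g k]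
  by (simp add: Tk_def[abs_def])

lemma Tk_0: "Tk k g 0 = g 0 / (real k + 1)"
proof -
  have "((\<lambda>t. t ^ k * g 0) has_integral (1 ^ Suc k / real (Suc k) * g 0 - 0 ^ Suc k / real (Suc k) * g 0)) {0..1::real}"
  proof (rule fundamental_theorem_of_calculus)
    fix t :: real
    have "((\<lambda>t. t ^ Suc k * (g 0 / real (Suc k))) has_real_derivative t ^ k * g 0) (at t within {0..1})"
      by (rule derivative_eq_intros refl)+ (simp_all del: of_nat_Suc add: field_simps)
    then show "((\<lambda>t. t ^ Suc k / real (Suc k) * g 0) has_vector_derivative t ^ k * g 0) (at t within {0..1})"
      by (simp del: of_nat_Suc add: has_real_derivative_iff_has_vector_derivative)
  qed simp
  then show ?thesis unfolding Tk_def mult_zero_left by (subst integral_unique) (assumption, simp add: add_ac)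
qed

lemma Tk_integral:
  assumes "continuous_on {0..} g" "r > 0"
  shows "r ^ Suc k * Tk k g r = integral {0..r} (\<lambda>s. s ^ k * g s)"
proof -
  have "(\<lambda>s. s ^ k * g s) integrable_on {0..r}"
    by (intro integrable_continuous_real continuous_intros continuous_on_subset[OF assms(1)]) auto
  then have "((\<lambda>s. s ^ k * g s) has_integral integral {0..r} (\<lambda>s. s ^ k * g s)) (cbox 0 r)"
    by (simp add: integrable_integral)
  from has_integral_affinity'[OF this assms(2), of 0]
  have "((\<lambda>t. (r * t) ^ k * g (r * t)) has_integral (integral {0..r} (\<lambda>s. s ^ k * g s) / r)) {0..1}"
    using assms by (simp add: field_simps)
  moreover have "integral {0..1} (\<lambda>t. (r * t) ^ k * g (r * t)) = r ^ k * Tk k g r"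
    unfolding Tk_def by (simp add: power_mult_distrib mult.assoc)
  ultimately have "integral {0..r} (\<lambda>s. s ^ k * g s) / r = r ^ k * Tk k g r"
    by (simp add: integral_unique)
  then show ?thesis using assms by (simp add: field_simps)
qed

text \<open>Differentiation under the integral sign; the inner factor t raises k by one, so no order
  of differentiability is lost at r = 0.\<close>

lemma Tk_deriv:
  assumes "continuous_on {0..} g'" "\<And>r. r \<ge> 0 \<Longrightarrow> (g has_real_derivative g' r) (at r within {0..})" "r \<ge> 0"
  shows "(Tk k g has_real_derivative Tk (Suc k) g' r) (at r within {0..})"
proof -
  have contg: "continuous_on {0..} g"
    by (rule DERIV_continuous_on[where D = g']) (use assms in auto)
  have "((\<lambda>x. integral (cbox 0 1) (\<lambda>t. t ^ k * g (x * t))) has_field_derivative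
          integral (cbox 0 1) (\<lambda>t. t ^ Suc k * g' (r * t))) (at r within {0..})"
  proof (rule leibniz_rule_field_derivative)
    fix x t :: real assume x: "x \<in> {0..}" "t \<in> cbox 0 1"
    have "((\<lambda>x. g (x * t)) has_real_derivative g' (x * t) * t) (at x within {0..})"
    proof -
      have d: "((\<lambda>x. x * t) has_real_derivative t) (at x within {0..})" by (auto intro!: derivative_eq_intros)
      have "(\<lambda>x. x * t) ` {0..} \<subseteq> {0..}" using x by auto
      with DERIV_image_chain[where f = g and g = "\<lambda>x. x * t" and x = x and s = "{0..}", OF DERIV_subset[OF assms(2)] d] x
      show ?thesis by (simp add: o_def)
    qed
    from DERIV_cmult[OF this, of "t ^ k"]
    show "((\<lambda>x. t ^ k * g (x * t)) has_real_derivative t ^ Suc k * g' (x * t)) (at x within {0..})"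
      by (simp add: mult_ac)
  qed (use contg assms Tk_integrable[OF contg] continuous_on_scaled[OF assms(1), of "Suc k"] in auto)
  then show ?thesis by (simp add: Tk_def[abs_def])
qed

text \<open>This is y' + k y / r = g with y / r replaced by \<open>Tk k g r\<close>, which stays
  meaningful at 0. There the difference quotient of \<open>r * Tk k g r\<close> is
  \<open>Tk k g r\<close> itself.\<close>

lemma rTk_deriv:
  assumes "continuous_on {0..} g" "r \<ge> 0"
  shows "((\<lambda>r. r * Tk k g r) has_real_derivative g r - real k * Tk k g r) (at r within {0..})"
proof (cases "r = 0")
  case True
  have "((\<lambda>r. r * Tk k g r) has_real_derivative Tk k g 0) (at 0 within {0..})"
    unfolding has_field_derivative_iff
  proof (rule Lim_transform_eventually)
    show "(Tk k g \<longlongrightarrow> Tk k g 0) (at 0 within {0..})"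
      using continuous_on_Tk[OF assms(1)] by (auto simp: continuous_on_def)
    show "\<forall>\<^sub>F y in at 0 within {0..}. Tk k g y = (y * Tk k g y - 0 * Tk k g 0) / (y - 0)"
      by (auto simp: eventually_at_filter)
  qed
  then show ?thesis using True by (simp add: Tk_0 field_simps)
next
  case False
  then have r: "r > 0" using assms by auto
  define I where "I = (\<lambda>r. integral {0..r} (\<lambda>s. s ^ k * g s))"
  have "(I has_real_derivative r ^ k * g r) (at r within {0..r+1})"
    unfolding I_def by (rule integral_has_real_derivative)
      (use r in \<open>auto intro!: continuous_intros continuous_on_subset[OF assms(1)]\<close>)
  then have dI: "(I has_real_derivative r ^ k * g r) (at r)"
    using r at_within_interior[of r "{0..r+1}"] by simp
  have eq: "Tk k g s = I s / s ^ Suc k" if "s > 0" for s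
    using Tk_integral[OF assms(1) that, of k] that by (simp add: I_def field_simps)
  have I: "I r = r * r ^ k * Tk k g r" using Tk_integral[OF assms(1) r, of k] by (simp add: I_def mult_ac)
  have "((\<lambda>s. I s / s ^ k) has_real_derivative g r - real k * Tk k g r) (at r)"
  proof (cases k)
    case 0 then show ?thesis using dI by simp
  next
    case (Suc m)
    show ?thesis
      by (rule derivative_eq_intros dI refl)+ (use r Suc I in \<open>auto simp: field_simps power2_eq_square\<close>)
  qed
  then have "((\<lambda>r. r * Tk k g r) has_real_derivative g r - real k * Tk k g r) (at r)"
    by (rule has_field_derivative_transform_within_open[where S = "{0<..}"]) (use r eq in \<open>auto simp: field_simps\<close>)
  then show ?thesis by (rule has_field_derivative_at_within)
qed

text \<open>The integrating factor s^k gives (s^k y)' = s^k g; continuity together with y 0 = 0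
  excludes the solutions r^(-k) of the homogeneous equation.\<close>

lemma eq_rTk:
  assumes y: "continuous_on {0..} y" "y 0 = 0" and g: "continuous_on {0..} g"
    and deriv: "\<And>s. s > 0 \<Longrightarrow> (y has_real_derivative g s - real k * y s / s) (at s)"
    and r: "r \<ge> 0"
  shows "y r = r * Tk k g r"
proof (cases "r = 0")
  case False
  then have r: "r > 0" using r by auto
  have "((\<lambda>s. s ^ k * g s) has_integral (r ^ k * y r - 0 ^ k * y 0)) {0..r}"
  proof (rule fundamental_theorem_of_calculus_interior)
    fix s assume s: "s \<in> {0<..<r}"
    have "((\<lambda>s. s ^ k * y s) has_real_derivative s ^ k * g s) (at s)"
    proof (cases k)
      case (Suc m)
      show ?thesis
        by (rule derivative_eq_intros deriv refl)+ (use s Suc in \<open>auto simp: field_simps\<close>)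
    qed (use deriv s in auto)
    then show "((\<lambda>s. s ^ k * y s) has_vector_derivative s ^ k * g s) (at s)"
      by (simp add: has_real_derivative_iff_has_vector_derivative)
  qed (use r in \<open>auto intro!: continuous_intros continuous_on_subset[OF y(1)]\<close>)
  then have "integral {0..r} (\<lambda>s. s ^ k * g s) = r ^ k * y r" using y(2) by (simp add: integral_unique)
  then show ?thesis using Tk_integral[OF g r, of k] r by simp
qed (use y in auto)

section \<open>Singular initial value problems\<close>

text \<open>A system with a regular singular point at 0: \<open>k i\<close> is the strength of the
  singular term of component i. The interval is half-open so that solutions of maximal lifetime can
  be treated, and the equation is imposed for r > 0 only, with continuity at 0.\<close>

definition sing_sol ::
    "('n::finite \<Rightarrow> nat) \<Rightarrow> (real \<Rightarrow> real^'n \<Rightarrow> real^'n) \<Rightarrow> real^'n \<Rightarrow> (real \<Rightarrow> real^'n) \<Rightarrow> real \<Rightarrow> bool" where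
  "sing_sol k P u0 u T \<longleftrightarrow> continuous_on {0..<T} u \<and> u 0 = u0 \<and>
     (\<forall>r i. 0 < r \<longrightarrow> r < T \<longrightarrow>
        ((\<lambda>s. u s $ i) has_real_derivative P r (u r) $ i - real (k i) * (u r $ i - u0 $ i) / r) (at r))"

lemma sing_sol_mono: "sing_sol k P u0 u T \<Longrightarrow> T' \<le> T \<Longrightarrow> sing_sol k P u0 u T'"
  unfolding sing_sol_def by (auto elim: continuous_on_subset)

text \<open>The singular terms have a favourable sign in the energy estimate for the difference of two
  solutions, after subtraction of the difference of the initial values.\<close>

lemma sing_sol_compare:
  assumes u: "sing_sol k P u0 u T" and v: "sing_sol k Q v0 v T" and K: "K \<ge> 0"
    and lip: "\<And>r. 0 < r \<Longrightarrow> r < T \<Longrightarrow> norm (P r (u r) - Q r (v r)) \<le> K * norm (u r - v r)"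
    and r: "0 \<le> r" "r < T"
  shows "norm (u r - v r) \<le> norm (u0 - v0) * (1 + exp (3/2 * K * r))"
proof -
  define e where "e = (\<lambda>s. u s - v s - (u0 - v0))"
  define d where "d = norm (u0 - v0)"
  \<comment> \<open>The Lipschitz bound brings in |u - v| \<le> |e| + d; adding the constant d^2
    makes the Gronwall inequality homogeneous.\<close>
  define Y where "Y = (\<lambda>s. (\<Sum>i\<in>UNIV. (e s $ i)\<^sup>2) + d\<^sup>2)"
  define F where "F = (\<lambda>s. P s (u s) - Q s (v s))"
  have sum_norm: "(\<Sum>i\<in>UNIV. (x $ i)\<^sup>2) = (norm x)\<^sup>2" for x :: "real^'a"
    unfolding power2_norm_eq_inner inner_vec_def by (simp add: power2_eq_square)
  have d0: "d \<ge> 0" by (simp add: d_def)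
  have conte: "continuous_on {0..r} e"
    using u v r unfolding e_def sing_sol_def
    by (intro continuous_intros) (auto elim: continuous_on_subset)
  define Y' where "Y' = (\<lambda>s. \<Sum>i\<in>UNIV. 2 * e s $ i * (F s $ i - real (k i) * e s $ i / s))"
  have "Y r \<le> Y 0 * exp (3 * K * (r - 0))"
  proof (rule gronwall[where y' = Y'])
    show "continuous_on {0..r} Y" unfolding Y_def by (intro continuous_intros conte)
    fix s assume s: "0 < s" "s < r"
    then have sT: "s < T" using r by simp
    have de: "((\<lambda>s. e s $ i) has_real_derivative F s $ i - real (k i) * e s $ i / s) (at s)" for i
    proof -
      have "((\<lambda>s. u s $ i - v s $ i - (u0 - v0) $ i) has_real_derivative
          (P s (u s) $ i - real (k i) * (u s $ i - u0 $ i) / s) -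
          (Q s (v s) $ i - real (k i) * (v s $ i - v0 $ i) / s) - 0) (at s)"
        using u v s sT unfolding sing_sol_def by (intro derivative_intros) auto
      then have "((\<lambda>s. e s $ i) has_real_derivative
          (P s (u s) $ i - real (k i) * (u s $ i - u0 $ i) / s) -
          (Q s (v s) $ i - real (k i) * (v s $ i - v0 $ i) / s) - 0) (at s)"
        by (simp add: e_def)
      then show ?thesis
        by (rule DERIV_cong) (simp add: e_def F_def diff_divide_distrib right_diff_distrib)
    qed
    show "(Y has_real_derivative Y' s) (at s)"
      unfolding Y_def Y'_def by (auto intro!: derivative_eq_intros sum.cong de)
    have "Y' s \<le> (\<Sum>i\<in>UNIV. 2 * e s $ i * F s $ i)"
      unfolding Y'_def
    proof (rule sum_mono)
      fix i
      have "2 * e s $ i * (F s $ i - real (k i) * e s $ i / s) =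
          2 * e s $ i * F s $ i - 2 * real (k i) * (e s $ i)\<^sup>2 / s"
        by (simp add: algebra_simps power2_eq_square)
      then show "2 * e s $ i * (F s $ i - real (k i) * e s $ i / s) \<le> 2 * e s $ i * F s $ i"
        using s by simp
    qed
    also have "\<dots> = 2 * (e s \<bullet> F s)" by (simp add: inner_vec_def sum_distrib_left mult_ac)
    also have "\<dots> \<le> 2 * (norm (e s) * norm (F s))" using norm_cauchy_schwarz by simp
    also have "\<dots> \<le> 2 * (norm (e s) * (K * (norm (e s) + d)))"
    proof -
      have "norm (u s - v s) \<le> norm (e s) + d"
        using norm_triangle_ineq[of "e s" "u0 - v0"] by (simp add: e_def d_def)
      then have "norm (F s) \<le> K * (norm (e s) + d)"
        using lip[OF s(1) sT] K unfolding F_def by (meson mult_left_mono order_trans)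
      then show ?thesis by (simp add: mult_left_mono)
    qed
    \<comment> \<open>By 2 |e| d \<le> |e|^2 + d^2, which is where the constant 3 comes
      from.\<close>
    also have "\<dots> \<le> 3 * K * Y s"
    proof -
      have "0 \<le> K * (norm (e s) - d)\<^sup>2" "0 \<le> K * d\<^sup>2" using K by simp_all
      then show ?thesis unfolding Y_def sum_norm by (simp add: power2_eq_square algebra_simps)
    qed
    finally show "Y' s \<le> 3 * K * Y s" .
  qed (use r in auto)
  moreover have "Y 0 = d\<^sup>2" using u v by (simp add: Y_def e_def sing_sol_def)
  ultimately have "(norm (e r))\<^sup>2 \<le> d\<^sup>2 * exp (3 * K * r)"
    unfolding Y_def sum_norm by simp (smt (verit) zero_le_power2)
  also have "\<dots> = (d * exp (3/2 * K * r))\<^sup>2" by (simp add: power_mult_distrib flip: exp_double)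
  finally have "norm (e r) \<le> d * exp (3/2 * K * r)" by (rule power2_le_imp_le) (use d0 in auto)
  moreover have "norm (u r - v r) \<le> norm (e r) + d"
    using norm_triangle_ineq[of "e r" "u0 - v0"] by (simp add: e_def d_def)
  ultimately show ?thesis by (simp add: d_def algebra_simps)
qed

text \<open>Integration gains the factor 1/\<kappa> relative to the weight exp(\<kappa> r); for
  large \<kappa> this makes the Picard map a contraction.\<close>

lemma rTk_exp_bound:
  assumes g: "continuous_on {0..} g" and le: "\<And>s. s \<ge> 0 \<Longrightarrow> \<bar>g s\<bar> \<le> D * exp (\<kappa> * s)"
    and \<kappa>: "\<kappa> > 0" and r: "r \<ge> 0"
  shows "\<bar>r * Tk k g r\<bar> \<le> D / \<kappa> * exp (\<kappa> * r)"
proof (cases "r = 0")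
  case True
  then show ?thesis using le[of 0] \<kappa> by simp
next
  case False
  then have r: "r > 0" using r by simp
  have D: "D \<ge> 0" using le[of 0] by simp
  have I: "((\<lambda>t. D * exp (\<kappa> * (r * t))) has_integral
      (D * exp (\<kappa> * (r * 1)) / (\<kappa> * r) - D * exp (\<kappa> * (r * 0)) / (\<kappa> * r))) {0..1}"
  proof (rule fundamental_theorem_of_calculus)
    fix t :: real
    have "((\<lambda>t. D * exp (\<kappa> * (r * t)) / (\<kappa> * r)) has_real_derivative D * exp (\<kappa> * (r * t))) (at t within {0..1})"
      by (rule derivative_eq_intros refl)+ (use \<kappa> r in auto)
    then show "((\<lambda>t. D * exp (\<kappa> * (r * t)) / (\<kappa> * r)) has_vector_derivative D * exp (\<kappa> * (r * t))) (at t within {0..1})"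
      by (simp add: has_real_derivative_iff_has_vector_derivative)
  qed simp
  have "norm (Tk k g r) \<le> integral {0..1} (\<lambda>t. D * exp (\<kappa> * (r * t)))"
    unfolding Tk_def
  proof (rule integral_norm_bound_integral)
    show "(\<lambda>t. D * exp (\<kappa> * (r * t))) integrable_on {0..1}" using I by (auto simp: integrable_on_def)
    fix t :: real assume t: "t \<in> {0..1}"
    have "\<bar>t ^ k * g (r * t)\<bar> \<le> 1 * \<bar>g (r * t)\<bar>"
      unfolding abs_mult using t by (intro mult_right_mono) (auto intro: power_le_one)
    also have "\<dots> \<le> D * exp (\<kappa> * (r * t))" using le[of "r * t"] t r by simp
    finally show "norm (t ^ k * g (r * t)) \<le> D * exp (\<kappa> * (r * t))" by simp
  qed (use Tk_integrable[OF g] r in auto)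
  also have "\<dots> = D * exp (\<kappa> * r) / (\<kappa> * r) - D / (\<kappa> * r)" using integral_unique[OF I] by simp
  also have "\<dots> \<le> D * exp (\<kappa> * r) / (\<kappa> * r)" using D r \<kappa> by simp
  finally have "r * \<bar>Tk k g r\<bar> \<le> r * (D * exp (\<kappa> * r) / (\<kappa> * r))" using r by (intro mult_left_mono) auto
  then show ?thesis using r \<kappa> by (simp add: abs_mult)
qed

lemma Tk_diff:
  assumes "continuous_on {0..} g" "continuous_on {0..} h" "r \<ge> 0"
  shows "Tk k (\<lambda>s. g s - h s) r = Tk k g r - Tk k h r"
  unfolding Tk_def
  using integral_diff[OF Tk_integrable[OF assms(1,3), of k] Tk_integrable[OF assms(2,3), of k]]
  by (simp add: algebra_simps)

text \<open>Banach's fixed point theorem for v = exp(-\<kappa> r) (u - u0) among bounded continuous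
  functions. The exponential weight gives a contraction on the whole half-line at once, so no
  continuation is involved for bounded, globally Lipschitz fields.\<close>

lemma sing_sol_picard:
  fixes P :: "real \<Rightarrow> real^'n \<Rightarrow> real^'n"
  assumes cont: "continuous_on UNIV (\<lambda>(r, u). P r u)"
    and bdd: "\<And>r u. norm (P r u) \<le> B"
    and lip: "\<And>r u v. norm (P r u - P r v) \<le> K * norm (u - v)" and K: "K \<ge> 0"
  shows "\<exists>u. \<forall>T. sing_sol k P u0 u T"
proof -
  define N where "N = real CARD('n)"
  \<comment> \<open>The norm is estimated by the sum over the N components; the contraction constant
    N K / \<kappa> is then at most 1/2.\<close>
  define \<kappa> where "\<kappa> = 2 * N * K + 1"
  have \<kappa>: "\<kappa> > 0" using K by (simp add: \<kappa>_def N_def add_nonneg_pos)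
  define G where "G = (\<lambda>(v :: real \<Rightarrow> real^'n) i s. P s (u0 + exp (\<kappa> * s) *\<^sub>R v s) $ i)"
  \<comment> \<open>\<open>max 0 r\<close> extends the map to negative r, because the bounded
    continuous functions are functions on all of the reals.\<close>
  define \<Phi> where "\<Phi> = (\<lambda>v r. exp (- \<kappa> * max 0 r) *\<^sub>R (\<chi> i. max 0 r * Tk (k i) (G v i) (max 0 r)))"
  have contP: "continuous_on S (\<lambda>x. P (f x) (g x))" if "continuous_on S f" "continuous_on S g" for S f g
    using continuous_on_compose2[OF cont continuous_on_Pair[OF that]] by simp
  have contG: "continuous_on S (G (apply_bcontfun v) i)" for S i and v :: "real \<Rightarrow>\<^sub>C (real^'n)"
    unfolding G_def by (intro continuous_intros contP) auto
  have norm_le: "norm (\<Phi> v r - \<Phi> w r) \<le> N * c"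
    if "\<And>i. \<bar>max 0 r * (Tk (k i) (G v i) (max 0 r) - Tk (k i) (G w i) (max 0 r))\<bar> \<le> c * exp (\<kappa> * max 0 r)" for v w r c
  proof -
    have "norm (\<Phi> v r - \<Phi> w r) \<le> (\<Sum>i\<in>UNIV. \<bar>(\<Phi> v r - \<Phi> w r) $ i\<bar>)" by (rule norm_le_l1_cart)
    also have "\<dots> \<le> (\<Sum>i\<in>(UNIV::'n set). c)"
    proof (rule sum_mono)
      fix i
      have "\<bar>(\<Phi> v r - \<Phi> w r) $ i\<bar> =
          exp (- \<kappa> * max 0 r) * \<bar>max 0 r * (Tk (k i) (G v i) (max 0 r) - Tk (k i) (G w i) (max 0 r))\<bar>"
        unfolding \<Phi>_def by (simp add: abs_mult flip: right_diff_distrib)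
      also have "\<dots> \<le> exp (- \<kappa> * max 0 r) * (c * exp (\<kappa> * max 0 r))"
        by (intro mult_left_mono that) auto
      also have "\<dots> = c" by (simp add: exp_minus)
      finally show "\<bar>(\<Phi> v r - \<Phi> w r) $ i\<bar> \<le> c" .
    qed
    finally show ?thesis by (simp add: N_def)
  qed
  have in_bcont: "\<Phi> (apply_bcontfun v) \<in> bcontfun" for v
  proof -
    have "continuous_on UNIV (\<Phi> (apply_bcontfun v))"
      unfolding \<Phi>_def
      by (intro continuous_intros continuous_on_compose2[OF continuous_on_Tk[OF contG[of _ v]]]) auto
    moreover have "norm (\<Phi> (apply_bcontfun v) r) \<le> N * (B / \<kappa>)" for r
    proof -
      have "norm (\<Phi> (apply_bcontfun v) r) \<le> (\<Sum>i\<in>UNIV. \<bar>\<Phi> (apply_bcontfun v) r $ i\<bar>)" by (rule norm_le_l1_cart)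
      also have "\<dots> \<le> (\<Sum>i\<in>(UNIV::'n set). B / \<kappa>)"
      proof (rule sum_mono)
        fix i
        have "\<bar>max 0 r * Tk (k i) (G v i) (max 0 r)\<bar> \<le> B / \<kappa> * exp (\<kappa> * max 0 r)"
        proof (rule rTk_exp_bound[OF contG _ \<kappa>])
          fix s :: real assume "s \<ge> 0"
          have "\<bar>G v i s\<bar> \<le> B"
            unfolding G_def using component_le_norm_cart bdd order_trans by blast
          also have "B = B * 1" by simp
          also have "\<dots> \<le> B * exp (\<kappa> * s)"
            using \<open>s \<ge> 0\<close> \<kappa> order_trans[OF norm_ge_zero bdd[of 0 0]] by (intro mult_left_mono) auto
          finally show "\<bar>G v i s\<bar> \<le> B * exp (\<kappa> * s)" .
        qed auto
        then have "exp (- \<kappa> * max 0 r) * \<bar>max 0 r * Tk (k i) (G v i) (max 0 r)\<bar> \<le> exp (- \<kappa> * max 0 r) * (B / \<kappa> * exp (\<kappa> * max 0 r))"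
          by (intro mult_left_mono) auto
        then show "\<bar>\<Phi> (apply_bcontfun v) r $ i\<bar> \<le> B / \<kappa>"
          unfolding \<Phi>_def by (simp add: abs_mult exp_minus field_simps)
      qed
      finally show ?thesis by (simp add: N_def)
    qed
    ultimately show ?thesis unfolding bcontfun_def bounded_iff by auto
  qed
  define \<Psi> where "\<Psi> = (\<lambda>v. Bcontfun (\<Phi> (apply_bcontfun v)))"
  have app\<Psi>: "apply_bcontfun (\<Psi> v) = \<Phi> (apply_bcontfun v)" for v
    unfolding \<Psi>_def using in_bcont by (rule Bcontfun_inverse)
  have "dist (\<Psi> v) (\<Psi> w) \<le> 1/2 * dist v w" for v w
  proof (rule dist_bound)
    fix r
    have "dist (apply_bcontfun (\<Psi> v) r) (apply_bcontfun (\<Psi> w) r) \<le> N * (K * dist v w / \<kappa>)"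
      unfolding app\<Psi> dist_norm[where 'a = "real^'n"]
    proof (rule norm_le)
      fix i
      have "\<bar>max 0 r * Tk (k i) (\<lambda>s. G v i s - G w i s) (max 0 r)\<bar> \<le> K * dist v w / \<kappa> * exp (\<kappa> * max 0 r)"
      proof (rule rTk_exp_bound[OF _ _ \<kappa>])
        fix s :: real
        have "\<bar>G v i s - G w i s\<bar> \<le> norm (P s (u0 + exp (\<kappa> * s) *\<^sub>R v s) - P s (u0 + exp (\<kappa> * s) *\<^sub>R w s))"
          unfolding G_def using component_le_norm_cart[of _ i] by (metis vector_minus_component)
        also have "\<dots> \<le> K * norm (exp (\<kappa> * s) *\<^sub>R v s - exp (\<kappa> * s) *\<^sub>R w s)"
          using lip[of s "u0 + exp (\<kappa> * s) *\<^sub>R v s" "u0 + exp (\<kappa> * s) *\<^sub>R w s"] by simp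
        also have "\<dots> = K * (exp (\<kappa> * s) * dist (v s) (w s))"
          by (simp add: dist_norm flip: scaleR_diff_right)
        also have "\<dots> \<le> K * (exp (\<kappa> * s) * dist v w)"
          using K dist_bounded[of v s w] by (intro mult_left_mono) auto
        finally show "\<bar>G v i s - G w i s\<bar> \<le> K * dist v w * exp (\<kappa> * s)" by (simp add: mult_ac)
      qed (auto intro!: continuous_intros contG)
      then show "\<bar>max 0 r * (Tk (k i) (G v i) (max 0 r) - Tk (k i) (G w i) (max 0 r))\<bar> \<le> K * dist v w / \<kappa> * exp (\<kappa> * max 0 r)"
        by (subst (asm) Tk_diff) (auto intro: contG)
    qed
    also have "\<dots> = (N * K / \<kappa>) * dist v w" by simp
    also have "\<dots> \<le> 1/2 * dist v w"
      using \<kappa> by (intro mult_right_mono) (auto simp: \<kappa>_def field_simps)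
    finally show "dist (apply_bcontfun (\<Psi> v) r) (apply_bcontfun (\<Psi> w) r) \<le> 1/2 * dist v w" .
  qed
  then obtain v where v: "\<Psi> v = v" using banach_fix_type[of "1/2" \<Psi>] by auto
  define u where "u = (\<lambda>r. u0 + exp (\<kappa> * r) *\<^sub>R v r)"
  have contu: "continuous_on S u" for S unfolding u_def by (intro continuous_intros) auto
  have contPu: "continuous_on S (\<lambda>s. P s (u s) $ i)" for S i by (intro continuous_intros contP contu)
  have u: "u r $ i = u0 $ i + r * Tk (k i) (\<lambda>s. P s (u s) $ i) r" if "r \<ge> 0" for r i
  proof -
    have "v r = \<Phi> v r" using app\<Psi>[of v] v by simp
    then show ?thesis using that unfolding u_def \<Phi>_def G_def by (simp add: exp_minus)
  qed
  have "sing_sol k P u0 u T" for T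
    unfolding sing_sol_def
  proof (intro conjI allI impI contu)
    show "u 0 = u0" using u[of 0] by (simp add: vec_eq_iff)
    fix r i assume r: "0 < r" "r < T"
    have "((\<lambda>r. u0 $ i + r * Tk (k i) (\<lambda>s. P s (u s) $ i) r) has_real_derivative
        0 + (P r (u r) $ i - real (k i) * Tk (k i) (\<lambda>s. P s (u s) $ i) r)) (at r within {0..})"
      using r by (intro derivative_intros rTk_deriv contPu) auto
    then have "((\<lambda>r. u0 $ i + r * Tk (k i) (\<lambda>s. P s (u s) $ i) r) has_real_derivative
        P r (u r) $ i - real (k i) * (u r $ i - u0 $ i) / r) (at r)"
      using r u[of r i] at_within_interior[of r "{0..}"] by simp
    then show "((\<lambda>s. u s $ i) has_real_derivative P r (u r) $ i - real (k i) * (u r $ i - u0 $ i) / r) (at r)"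
      by (rule has_field_derivative_transform_within_open[where S = "{0<..}"]) (use r u in auto)
  qed
  then show ?thesis by blast
qed

section \<open>Locally Lipschitz vector fields and their truncation\<close>

definition loc_lip :: "(real \<Rightarrow> real^'n \<Rightarrow> real) \<Rightarrow> bool" where
  "loc_lip g \<longleftrightarrow> continuous_on UNIV (\<lambda>(r, u). g r u) \<and>
     (\<forall>N. \<exists>K\<ge>0. \<forall>r\<in>{0..N}. \<forall>u\<in>cball 0 N. \<forall>v\<in>cball 0 N. \<bar>g r u - g r v\<bar> \<le> K * norm (u - v))"

lemma loc_lipI:
  assumes "continuous_on UNIV (\<lambda>(r, u). g r u)"
    and "\<And>N. \<exists>K. \<forall>r\<in>{0..N}. \<forall>u\<in>cball 0 N. \<forall>v\<in>cball 0 N. \<bar>g r u - g r v\<bar> \<le> K * norm (u - v)"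
  shows "loc_lip g"
  unfolding loc_lip_def
proof (intro conjI allI assms(1))
  fix N
  obtain K where K: "\<forall>r\<in>{0..N}. \<forall>u\<in>cball 0 N. \<forall>v\<in>cball 0 N. \<bar>g r u - g r v\<bar> \<le> K * norm (u - v)"
    using assms(2) by blast
  have "\<bar>g r u - g r v\<bar> \<le> \<bar>K\<bar> * norm (u - v)" if "r \<in> {0..N}" "u \<in> cball 0 N" "v \<in> cball 0 N" for r u v
  proof -
    have "K * norm (u - v) \<le> \<bar>K\<bar> * norm (u - v)" by (intro mult_right_mono) auto
    then show ?thesis using K that by (meson order_trans)
  qed
  then show "\<exists>K\<ge>0. \<forall>r\<in>{0..N}. \<forall>u\<in>cball 0 N. \<forall>v\<in>cball 0 N. \<bar>g r u - g r v\<bar> \<le> K * norm (u - v)"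
    by (intro exI[of _ "\<bar>K\<bar>"]) auto
qed

lemma loc_lip_bound:
  assumes "loc_lip g" shows "\<exists>B\<ge>0. \<forall>r\<in>{0..N}. \<forall>u\<in>cball 0 N. \<bar>g r u\<bar> \<le> B"
proof -
  have "compact ((\<lambda>(r, u). g r u) ` ({0..N} \<times> cball 0 N))"
    using assms unfolding loc_lip_def
    by (intro compact_continuous_image) (auto elim: continuous_on_subset intro: compact_Times)
  then obtain B where B: "\<forall>x\<in>(\<lambda>(r, u). g r u) ` ({0..N} \<times> cball 0 N). norm x \<le> B"
    using compact_imp_bounded bounded_iff by metis
  have "\<bar>g r u\<bar> \<le> \<bar>B\<bar>" if "r \<in> {0..N}" "u \<in> cball 0 N" for r u
    using bspec[OF B, of "g r u"] that by force
  then show ?thesis by (intro exI[of _ "\<bar>B\<bar>"]) auto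
qed

lemma loc_lip_indep: "continuous_on UNIV g \<Longrightarrow> loc_lip (\<lambda>r u. g r)"
  by (rule loc_lipI) (auto simp: split_beta intro!: continuous_on_compose2[of UNIV g] continuous_intros exI[of _ 0])

lemma loc_lip_const: "loc_lip (\<lambda>r u. c)"
  and loc_lip_time: "loc_lip (\<lambda>r u. r)"
  by (intro loc_lip_indep continuous_intros)+

lemma loc_lip_component: "loc_lip (\<lambda>r u. u $ i)"
proof (rule loc_lipI)
  show "continuous_on UNIV (\<lambda>(r, u :: real^'a). u $ i)"
    by (simp add: split_beta) (intro continuous_intros)
  show "\<exists>K. \<forall>r\<in>{0..N}. \<forall>u\<in>cball 0 N. \<forall>v\<in>cball 0 N. \<bar>u $ i - v $ i\<bar> \<le> K * norm (u - v)" for N :: real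
    using component_le_norm_cart[of _ i] by (intro exI[of _ 1]) (auto simp flip: vector_minus_component)
qed

lemma loc_lip_add:
  assumes "loc_lip g" "loc_lip h" shows "loc_lip (\<lambda>r u. g r u + h r u)"
proof (rule loc_lipI)
  show "continuous_on UNIV (\<lambda>(r, u). g r u + h r u)"
    using assms unfolding loc_lip_def split_beta by (intro continuous_intros) auto
  fix N
  obtain K where K: "\<And>r u v. r \<in> {0..N} \<Longrightarrow> u \<in> cball 0 N \<Longrightarrow> v \<in> cball 0 N \<Longrightarrow> \<bar>g r u - g r v\<bar> \<le> K * norm (u - v)"
    using assms unfolding loc_lip_def by metis
  obtain K' where K': "\<And>r u v. r \<in> {0..N} \<Longrightarrow> u \<in> cball 0 N \<Longrightarrow> v \<in> cball 0 N \<Longrightarrow> \<bar>h r u - h r v\<bar> \<le> K' * norm (u - v)"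
    using assms unfolding loc_lip_def by metis
  show "\<exists>K. \<forall>r\<in>{0..N}. \<forall>u\<in>cball 0 N. \<forall>v\<in>cball 0 N. \<bar>g r u + h r u - (g r v + h r v)\<bar> \<le> K * norm (u - v)"
  proof (intro exI[of _ "K + K'"] ballI)
    fix r and u v :: "real^'a" assume "r \<in> {0..N}" "u \<in> cball 0 N" "v \<in> cball 0 N"
    from K[OF this] K'[OF this]
    show "\<bar>g r u + h r u - (g r v + h r v)\<bar> \<le> (K + K') * norm (u - v)" unfolding distrib_right by linarith
  qed
qed

lemma loc_lip_mult:
  assumes g: "loc_lip g" and h: "loc_lip h" shows "loc_lip (\<lambda>r u. g r u * h r u)"
proof (rule loc_lipI)
  show "continuous_on UNIV (\<lambda>(r, u). g r u * h r u)"
    using assms unfolding loc_lip_def split_beta by (intro continuous_intros) auto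
  fix N
  obtain K where K: "K \<ge> 0" "\<And>r u v. r \<in> {0..N} \<Longrightarrow> u \<in> cball 0 N \<Longrightarrow> v \<in> cball 0 N \<Longrightarrow> \<bar>g r u - g r v\<bar> \<le> K * norm (u - v)"
    using assms unfolding loc_lip_def by metis
  obtain K' where K': "K' \<ge> 0" "\<And>r u v. r \<in> {0..N} \<Longrightarrow> u \<in> cball 0 N \<Longrightarrow> v \<in> cball 0 N \<Longrightarrow> \<bar>h r u - h r v\<bar> \<le> K' * norm (u - v)"
    using assms unfolding loc_lip_def by metis
  obtain B where B: "B \<ge> 0" "\<And>r u. r \<in> {0..N} \<Longrightarrow> u \<in> cball 0 N \<Longrightarrow> \<bar>g r u\<bar> \<le> B" using loc_lip_bound[OF g] by meson
  obtain B' where B': "B' \<ge> 0" "\<And>r u. r \<in> {0..N} \<Longrightarrow> u \<in> cball 0 N \<Longrightarrow> \<bar>h r u\<bar> \<le> B'" using loc_lip_bound[OF h] by meson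
  show "\<exists>K. \<forall>r\<in>{0..N}. \<forall>u\<in>cball 0 N. \<forall>v\<in>cball 0 N. \<bar>g r u * h r u - g r v * h r v\<bar> \<le> K * norm (u - v)"
  proof (intro exI[of _ "B * K' + B' * K"] ballI)
    fix r and u v :: "real^'a" assume *: "r \<in> {0..N}" "u \<in> cball 0 N" "v \<in> cball 0 N"
    have "g r u * h r u - g r v * h r v = g r u * (h r u - h r v) + h r v * (g r u - g r v)" by (simp add: algebra_simps)
    also have "\<bar>\<dots>\<bar> \<le> \<bar>g r u\<bar> * \<bar>h r u - h r v\<bar> + \<bar>h r v\<bar> * \<bar>g r u - g r v\<bar>"
      by (simp add: abs_triangle_ineq flip: abs_mult)
    also have "\<dots> \<le> B * (K' * norm (u - v)) + B' * (K * norm (u - v))"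
      using K(2)[OF *] K'(2)[OF *] B(2)[OF *(1,2)] B'(2)[OF *(1,3)] B(1) B'(1)
      by (intro add_mono mult_mono) auto
    finally show "\<bar>g r u * h r u - g r v * h r v\<bar> \<le> (B * K' + B' * K) * norm (u - v)" by (simp add: algebra_simps)
  qed
qed

lemma loc_lip_diff:
  assumes "loc_lip g" "loc_lip h" shows "loc_lip (\<lambda>r u. g r u - h r u)"
  using loc_lip_add[OF assms(1) loc_lip_mult[OF loc_lip_const[of "-1"] assms(2)]] by simp

text \<open>The two concrete fields below have components that are polynomial in r and the
  coordinates, so these rules cover them.\<close>

lemmas loc_lip_intros = loc_lip_const loc_lip_time loc_lip_component loc_lip_add loc_lip_diff loc_lip_mult

definition loc_lip_field :: "(real \<Rightarrow> real^'n \<Rightarrow> real^'n) \<Rightarrow> bool" where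
  "loc_lip_field P \<longleftrightarrow> (\<forall>i. loc_lip (\<lambda>r u. P r u $ i))"

lemma loc_lip_field_continuous:
  assumes "loc_lip_field P" shows "continuous_on UNIV (\<lambda>(r, u). P r u)"
proof -
  have "continuous_on UNIV (\<lambda>x. \<chi> i. P (fst x) (snd x) $ i)"
    using assms unfolding loc_lip_field_def loc_lip_def split_beta
    by (intro continuous_on_vec_lambda) auto
  then show ?thesis by (simp add: split_beta)
qed

lemma loc_lip_field_bounds:
  assumes P: "loc_lip_field P"
  obtains B K where "K \<ge> 0" "\<And>r u. r \<in> {0..N} \<Longrightarrow> u \<in> cball 0 N \<Longrightarrow> norm (P r u) \<le> B"
    "\<And>r u v. r \<in> {0..N} \<Longrightarrow> u \<in> cball 0 N \<Longrightarrow> v \<in> cball 0 N \<Longrightarrow> norm (P r u - P r v) \<le> K * norm (u - v)"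
proof -
  have "\<forall>i. \<exists>B\<ge>0. \<forall>r\<in>{0..N}. \<forall>u\<in>cball 0 N. \<bar>P r u $ i\<bar> \<le> B"
    using P loc_lip_bound unfolding loc_lip_field_def by blast
  then obtain B where B: "\<And>i r u. r \<in> {0..N} \<Longrightarrow> u \<in> cball 0 N \<Longrightarrow> \<bar>P r u $ i\<bar> \<le> B i" by metis
  have "\<forall>i. \<exists>K\<ge>0. \<forall>r\<in>{0..N}. \<forall>u\<in>cball 0 N. \<forall>v\<in>cball 0 N. \<bar>P r u $ i - P r v $ i\<bar> \<le> K * norm (u - v)"
    using P unfolding loc_lip_field_def loc_lip_def by blast
  then obtain K where K: "\<And>i. K i \<ge> 0"
    "\<And>i r u v. r \<in> {0..N} \<Longrightarrow> u \<in> cball 0 N \<Longrightarrow> v \<in> cball 0 N \<Longrightarrow> \<bar>P r u $ i - P r v $ i\<bar> \<le> K i * norm (u - v)" by metis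
  show ?thesis
  proof (rule that[of "\<Sum>i\<in>UNIV. K i" "\<Sum>i\<in>UNIV. B i"])
    fix r and u v :: "real^'a" assume *: "r \<in> {0..N}" "u \<in> cball 0 N" "v \<in> cball 0 N"
    show "norm (P r u) \<le> (\<Sum>i\<in>UNIV. B i)"
      by (rule order_trans[OF norm_le_l1_cart sum_mono]) (use B * in auto)
    show "norm (P r u - P r v) \<le> (\<Sum>i\<in>UNIV. K i) * norm (u - v)"
      unfolding sum_distrib_right
      by (rule order_trans[OF norm_le_l1_cart sum_mono]) (use K * in \<open>auto simp: vector_minus_component\<close>)
  qed (use K in \<open>auto intro: sum_nonneg\<close>)
qed

text \<open>Time is clamped to [0, N] and the state is projected onto the ball. The projection is
  1-Lipschitz, so the field becomes globally bounded and Lipschitz, while it is unchanged inside the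
  ball.\<close>

definition trunc_field :: "real \<Rightarrow> (real \<Rightarrow> real^'n \<Rightarrow> real^'n) \<Rightarrow> real \<Rightarrow> real^'n \<Rightarrow> real^'n" where
  "trunc_field N P r u = P (max 0 (min N r)) (closest_point (cball 0 N) u)"

lemma trunc_field_eq: "0 \<le> r \<Longrightarrow> r \<le> N \<Longrightarrow> norm u \<le> N \<Longrightarrow> trunc_field N P r u = P r u"
  unfolding trunc_field_def by (subst closest_point_self) auto

lemma trunc_field_lip:
  assumes P: "loc_lip_field P" and N: "N > 0"
  obtains K where "K \<ge> 0" "\<And>r u v. norm (trunc_field N P r u - trunc_field N P r v) \<le> K * norm (u - v)"
    "\<And>u0 k. \<exists>u. \<forall>T. sing_sol k (trunc_field N P) u0 u T"
proof -
  obtain B K where K: "K \<ge> 0" and B: "\<And>r u. r \<in> {0..N} \<Longrightarrow> u \<in> cball 0 N \<Longrightarrow> norm (P r u) \<le> B"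
    and L: "\<And>r u v. r \<in> {0..N} \<Longrightarrow> u \<in> cball 0 N \<Longrightarrow> v \<in> cball 0 N \<Longrightarrow> norm (P r u - P r v) \<le> K * norm (u - v)"
    using loc_lip_field_bounds[OF P] by metis
  have cp: "closest_point (cball 0 N) u \<in> cball 0 N" for u :: "real^'a"
    by (rule closest_point_in_set) (use N in auto)
  have cpl: "dist (closest_point (cball 0 N) u) (closest_point (cball 0 N) v) \<le> dist u v" for u v :: "real^'a"
    by (rule closest_point_lipschitz) (use N in auto)
  have lip: "norm (trunc_field N P r u - trunc_field N P r v) \<le> K * norm (u - v)" for r u v
  proof -
    have "norm (trunc_field N P r u - trunc_field N P r v) \<le> K * norm (closest_point (cball 0 N) u - closest_point (cball 0 N) v)"
      unfolding trunc_field_def using N by (intro L cp) auto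
    also have "\<dots> \<le> K * norm (u - v)" using cpl[of u v] K by (intro mult_left_mono) (auto simp: dist_norm)
    finally show ?thesis .
  qed
  have cont: "continuous_on UNIV (\<lambda>(r, u). trunc_field N P r u)"
    unfolding trunc_field_def split_beta
  proof (rule continuous_on_compose2[OF loc_lip_field_continuous[OF P], of UNIV "\<lambda>x. (max 0 (min N (fst x)), closest_point (cball 0 N) (snd x))", simplified])
    show "continuous_on UNIV (\<lambda>x. (max 0 (min N (fst x)), closest_point (cball 0 N) (snd x)))"
      using N by (intro continuous_intros continuous_on_compose2[OF continuous_on_closest_point[of "cball 0 N" UNIV]]) auto
  qed
  have "norm (trunc_field N P r u) \<le> B" for r u
    unfolding trunc_field_def using N by (intro B cp) auto
  then show ?thesis using that K lip sing_sol_picard[OF cont _ lip K] by blast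
qed

section \<open>Uniqueness, continuation and dependence on the initial value\<close>

lemma sing_sol_bounded_on:
  assumes u: "sing_sol k P u0 u T" and T': "T' < T"
  obtains B where "\<And>r. 0 \<le> r \<Longrightarrow> r \<le> T' \<Longrightarrow> norm (u r) \<le> B"
proof -
  have "compact (u ` {0..T'})" using u T' unfolding sing_sol_def
    by (intro compact_continuous_image) (auto elim: continuous_on_subset)
  then obtain B where "\<forall>x\<in>u ` {0..T'}. norm x \<le> B" using compact_imp_bounded bounded_iff by metis
  then show ?thesis by (intro that[of B]) auto
qed

text \<open>On a compact interval reaching beyond r both solutions lie in one ball, where the field
  has a Lipschitz constant; \<open>sing_sol_compare\<close> then applies with equal initial
  values.\<close>

lemma sing_sol_unique:
  assumes P: "loc_lip_field P" and u: "sing_sol k P u0 u T" and v: "sing_sol k P u0 v T'"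
    and r: "0 \<le> r" "r < T" "r < T'"
  shows "u r = v r"
proof -
  define S where "S = (r + min T T') / 2"
  have S: "r < S" "S < T" "S < T'" using r by (auto simp: S_def min_def field_simps)
  obtain B where B: "\<And>r. 0 \<le> r \<Longrightarrow> r \<le> S \<Longrightarrow> norm (u r) \<le> B" using sing_sol_bounded_on[OF u S(2)] by metis
  obtain B' where B': "\<And>r. 0 \<le> r \<Longrightarrow> r \<le> S \<Longrightarrow> norm (v r) \<le> B'" using sing_sol_bounded_on[OF v S(3)] by metis
  define N where "N = max S (max B B')"
  obtain K where K: "K \<ge> 0" "\<And>r u v. r \<in> {0..N} \<Longrightarrow> u \<in> cball 0 N \<Longrightarrow> v \<in> cball 0 N \<Longrightarrow> norm (P r u - P r v) \<le> K * norm (u - v)"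
    using loc_lip_field_bounds[OF P, of N] by metis
  have "norm (u r - v r) \<le> norm (u0 - u0) * (1 + exp (3/2 * K * r))"
  proof (rule sing_sol_compare[OF sing_sol_mono[OF u] sing_sol_mono[OF v]])
    fix s assume "0 < s" "s < S"
    then show "norm (P s (u s) - P s (v s)) \<le> K * norm (u s - v s)"
      using B[of s] B'[of s] by (intro K) (auto simp: N_def)
  qed (use K S r in auto)
  then show ?thesis by simp
qed

lemma sing_sol_cong:
  assumes "sing_sol k P u0 u T" "\<And>r. 0 \<le> r \<Longrightarrow> r < T \<Longrightarrow> v r = u r" "\<And>r. 0 < r \<Longrightarrow> r < T \<Longrightarrow> Q r (u r) = P r (u r)" "T > 0"
  shows "sing_sol k Q u0 v T"
  unfolding sing_sol_def
proof (intro conjI allI impI)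
  show "continuous_on {0..<T} v" using assms unfolding sing_sol_def by (metis atLeastLessThan_iff continuous_on_cong)
  show "v 0 = u0" using assms unfolding sing_sol_def by simp
  fix r i assume r: "0 < r" "r < T"
  have "((\<lambda>s. u s $ i) has_real_derivative P r (u r) $ i - real (k i) * (u r $ i - u0 $ i) / r) (at r)"
    using assms r unfolding sing_sol_def by simp
  then have "((\<lambda>s. v s $ i) has_real_derivative P r (u r) $ i - real (k i) * (u r $ i - u0 $ i) / r) (at r)"
    by (rule has_field_derivative_transform_within_open[where S = "{0<..<T}"]) (use r assms in auto)
  then show "((\<lambda>s. v s $ i) has_real_derivative Q r (v r) $ i - real (k i) * (v r $ i - u0 $ i) / r) (at r)"
    using assms(2,3)[of r] r by simp
qed

lemma sing_sol_local:
  assumes T: "T > 0" and loc: "\<And>r. 0 \<le> r \<Longrightarrow> r < T \<Longrightarrow> \<exists>T'>r. sing_sol k P u0 u T'"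
  shows "sing_sol k P u0 u T"
  unfolding sing_sol_def
proof (intro conjI allI impI)
  show "u 0 = u0" using loc[of 0] T unfolding sing_sol_def by auto
  show "continuous_on {0..<T} u"
    unfolding continuous_on_eq_continuous_within
  proof
    fix r assume r: "r \<in> {0..<T}"
    then obtain T' where T': "T' > r" "sing_sol k P u0 u T'" using loc[of r] by auto
    have "continuous (at r within {0..<T'}) u"
      using T' r unfolding sing_sol_def continuous_on_eq_continuous_within by auto
    moreover have "at r within {0..<T} = at r within {0..<T'}"
      by (rule at_within_nhd[of _ "{..<min T T'}"]) (use r T' in auto)
    ultimately show "continuous (at r within {0..<T}) u" by simp
  qed
  fix r i assume "0 < r" "r < T"
  then obtain T' where "T' > r" "sing_sol k P u0 u T'" using loc[of r] by auto
  then show "((\<lambda>s. u s $ i) has_real_derivative P r (u r) $ i - real (k i) * (u r $ i - u0 $ i) / r) (at r)"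
    using \<open>0 < r\<close> unfolding sing_sol_def by auto
qed

text \<open>By uniqueness the value at r may be taken from any of the solutions that live beyond
  r.\<close>

lemma sing_sol_glue:
  fixes P :: "real \<Rightarrow> real^'n \<Rightarrow> real^'n"
  assumes P: "loc_lip_field P" and D: "D \<subseteq> {0<..}" "\<And>T. T \<in> D \<Longrightarrow> \<exists>T'\<in>D. T < T'"
    and sol: "\<And>T. T \<in> D \<Longrightarrow> \<exists>u. sing_sol k P u0 u T"
  obtains u where "\<And>T. T \<in> D \<Longrightarrow> sing_sol k P u0 u T"
proof -
  obtain U where U: "\<And>T. T \<in> D \<Longrightarrow> sing_sol k P u0 (U T) T" using sol by metis
  define c where "c = (\<lambda>r. SOME T. T \<in> D \<and> r < T)"
  have c: "c r \<in> D \<and> r < c r" if "r < T" "T \<in> D" for r T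
    unfolding c_def by (rule someI[of _ T]) (use that in auto)
  define u where "u = (\<lambda>r. U (c r) r)"
  have "sing_sol k P u0 u T" if T: "T \<in> D" for T
  proof (rule sing_sol_cong[OF U[OF T]])
    fix r assume r: "0 \<le> r" "r < T"
    show "u r = U T r" unfolding u_def
      by (rule sing_sol_unique[OF P U U[OF T]]) (use c[OF r(2) T] r in auto)
  qed (use D T in auto)
  then show ?thesis using that by blast
qed

text \<open>The supremum of the existence times cannot be finite: the solution is bounded up to it
  by hypothesis, and a bounded solution extends further.\<close>

theorem sing_sol_global:
  fixes P :: "real \<Rightarrow> real^'n \<Rightarrow> real^'n"
  assumes P: "loc_lip_field P"
    and bdd: "\<And>T u. T > 0 \<Longrightarrow> sing_sol k P u0 u T \<Longrightarrow> bounded (u ` {0..<T})"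
  obtains u where "\<And>T. sing_sol k P u0 u T"
proof -
  define S where "S = {T. T > 0 \<and> (\<exists>u. sing_sol k P u0 u T)}"
  have down: "T' \<in> S" if "T \<in> S" "0 < T'" "T' \<le> T" for T T'
    using that sing_sol_mono unfolding S_def by blast
  \<comment> \<open>A solution bounded by N - 1 on [0, T) also solves the equation truncated at N.
    The global solution of the truncated equation agrees with it and stays below N for some time
    after T, so there it still solves the original equation. With T = 0 this is local
    existence.\<close>
  have extend: "\<exists>T'\<in>S. T < T'"
    if T: "T \<ge> 0" and N: "norm u0 < N" "T < N" and u: "T > 0 \<Longrightarrow> sing_sol k P u0 u T"
      "\<And>r. 0 \<le> r \<Longrightarrow> r < T \<Longrightarrow> norm (u r) \<le> N - 1" for T N u
  proof -
    have N0: "N > 0" using N norm_ge_zero[of u0] by linarith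
    obtain K v where K: "K \<ge> 0" "\<And>r u v. norm (trunc_field N P r u - trunc_field N P r v) \<le> K * norm (u - v)"
      and v: "\<And>T. sing_sol k (trunc_field N P) u0 v T"
      using trunc_field_lip[OF P N0] by metis
    have vu: "v r = u r" if r: "0 \<le> r" "r < T" for r
    proof -
      have "norm (v r - u r) \<le> norm (u0 - u0) * (1 + exp (3/2 * K * r))"
      proof (rule sing_sol_compare[OF v u(1)])
        fix s assume s: "0 < s" "s < T"
        then have "P s (u s) = trunc_field N P s (u s)"
          using u(2)[of s] N by (simp add: trunc_field_eq)
        then show "norm (trunc_field N P s (v s) - P s (u s)) \<le> K * norm (v s - u s)" using K by simp
      qed (use r K in auto)
      then show ?thesis by simp
    qed
    have contv: "continuous_on {0..} v"
      unfolding continuous_on_eq_continuous_within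
    proof
      fix r :: real assume r: "r \<in> {0..}"
      have "continuous (at r within {0..<r+1}) v"
        using v[of "r+1"] r unfolding sing_sol_def continuous_on_eq_continuous_within by auto
      moreover have "at r within {0..} = at r within {0..<r+1}"
        by (rule at_within_nhd[of _ "{..<r+1}"]) (use r in auto)
      ultimately show "continuous (at r within {0..}) v" by simp
    qed
    have "norm (v T) < N"
    proof (cases "T = 0")
      case True
      then show ?thesis using v[of 1] N unfolding sing_sol_def by simp
    next
      case False
      have "norm (v T) \<le> N - 1"
      proof (rule tendsto_upperbound)
        show "((\<lambda>r. norm (v r)) \<longlongrightarrow> norm (v T)) (at T within {0..<T})"
          using contv T by (intro tendsto_norm) (auto simp: continuous_on_def intro: tendsto_within_subset[where S = "{0..}"])
        show "\<forall>\<^sub>F r in at T within {0..<T}. norm (v r) \<le> N - 1"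
          using u(2) vu by (auto simp: eventually_at_filter)
        show "at T within {0..<T} \<noteq> bot"
          using False T by (simp add: trivial_limit_within islimpt_Ico)
      qed
      then show ?thesis by simp
    qed
    have "((\<lambda>r. norm (v r)) \<longlongrightarrow> norm (v T)) (at T within {0..})"
      using contv T by (intro tendsto_norm) (auto simp: continuous_on_def)
    from order_tendstoD(2)[OF this \<open>norm (v T) < N\<close>]
    obtain d where d: "d > 0" "\<And>r. r \<ge> 0 \<Longrightarrow> r \<noteq> T \<Longrightarrow> dist r T < d \<Longrightarrow> norm (v r) < N"
      unfolding eventually_at by auto
    define T' where "T' = min N (T + d)"
    have T': "T < T'" using d N by (simp add: T'_def)
    have vN: "norm (v r) \<le> N" if "0 \<le> r" "r < T'" for r
    proof (cases "r < T")
      case True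
      then show ?thesis using vu u(2)[of r] that by simp
    next
      case False
      then show ?thesis using d(2)[of r] \<open>norm (v T) < N\<close> that by (cases "r = T") (auto simp: dist_real_def T'_def)
    qed
    have "sing_sol k P u0 v T'"
    proof (rule sing_sol_cong[OF v])
      fix r assume "0 < r" "r < T'"
      then show "P r (v r) = trunc_field N P r (v r)" using vN[of r] by (simp add: trunc_field_eq T'_def)
    qed (use T T' in auto)
    then have "T' \<in> S" using T' T by (auto simp: S_def)
    then show ?thesis using T' by blast
  qed
  have "T \<in> S" if T: "T > 0" for T
  proof (rule ccontr)
    assume "T \<notin> S"
    then have bdS: "bdd_above S" using down T by (intro bdd_aboveI[of _ T]) (meson linear)
    have "\<exists>T'\<in>S. 0 < T'"
      by (rule extend[where N = "norm u0 + 1" and u = "\<lambda>_. 0"]) (auto intro: add_nonneg_pos)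
    then have neS: "S \<noteq> {}" by blast
    define M where "M = Sup S"
    obtain T0 where "T0 \<in> S" using neS by blast
    then have M0: "M > 0" using cSup_upper[OF _ bdS] unfolding M_def S_def by fastforce
    have inS: "T \<in> S" if "0 < T" "T < M" for T
      using that less_cSup_iff[OF neS bdS] down unfolding M_def by (meson less_imp_le)
    have D0: "{0<..<M} \<subseteq> {0<..}" by auto
    have ex: "\<exists>u. sing_sol k P u0 u T" if "T \<in> {0<..<M}" for T using that inS unfolding S_def by auto
    have up: "\<exists>T'\<in>{0<..<M}. T < T'" if "T \<in> {0<..<M}" for T using that dense[of T M] by auto
    obtain u where u: "\<And>T. T \<in> {0<..<M} \<Longrightarrow> sing_sol k P u0 u T"
      using sing_sol_glue[OF P D0 up ex] by blast
    have uM: "sing_sol k P u0 u M"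
    proof (rule sing_sol_local[OF M0])
      fix r assume r: "0 \<le> r" "r < M"
      then obtain T' where "r < T'" "T' < M" using dense by blast
      then show "\<exists>T'>r. sing_sol k P u0 u T'" using u[of T'] r by auto
    qed
    obtain B where B: "\<forall>x\<in>u ` {0..<M}. norm x \<le> B"
      using bdd[OF M0 uM] unfolding bounded_iff by blast
    define N where "N = max (B + 1) (max (M + 1) (norm u0 + 1))"
    have N: "B + 1 \<le> N" "M + 1 \<le> N" "norm u0 + 1 \<le> N" by (simp_all add: N_def)
    have "\<exists>T'\<in>S. M < T'"
    proof (rule extend[where N = N and u = u])
      fix r assume "0 \<le> r" "r < M"
      then have "norm (u r) \<le> B" using B by simp
      then show "norm (u r) \<le> N - 1" using N by simp
    qed (use M0 uM N in auto)
    then show False using cSup_upper[OF _ bdS] unfolding M_def by force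
  qed
  then have ex: "\<exists>u. sing_sol k P u0 u T" if "T \<in> {0<..}" for T using that unfolding S_def by auto
  have up: "\<exists>T'\<in>{0<..}. T < T'" if "T \<in> {0<..}" for T :: real
    by (intro bexI[of _ "T + 1"]) (use that in auto)
  obtain u where u: "\<And>T. T \<in> {0<..} \<Longrightarrow> sing_sol k P u0 u T"
    using sing_sol_glue[OF P order_refl up ex] by blast
  have "sing_sol k P u0 u T" for T
    by (rule sing_sol_mono[OF u[of "max T 1"]]) auto
  then show ?thesis by (rule that)
qed

text \<open>A bootstrap: while the two solutions are at distance at most 1 they stay in one ball
  with a common Lipschitz constant, and the comparison estimate improves the distance to d * C < 1.
  Hence distance 1 is never reached up to time R.\<close>

theorem sing_sol_dependence:
  fixes P :: "real \<Rightarrow> real^'n \<Rightarrow> real^'n"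
  assumes P: "loc_lip_field P" and u: "\<And>T. sing_sol k P u0 u T" and R: "R \<ge> 0" and eps: "e > 0"
  obtains d where "d > 0"
    "\<And>v0 v. norm (v0 - u0) < d \<Longrightarrow> (\<And>T. sing_sol k P v0 v T) \<Longrightarrow> norm (v R - u R) < e"
proof -
  obtain B where B: "\<And>r. 0 \<le> r \<Longrightarrow> r \<le> R \<Longrightarrow> norm (u r) \<le> B" using sing_sol_bounded_on[OF u, of R "R+1"] by auto
  define N where "N = max R (B + 1)"
  obtain K where K: "K \<ge> 0" "\<And>r u v. r \<in> {0..N} \<Longrightarrow> u \<in> cball 0 N \<Longrightarrow> v \<in> cball 0 N \<Longrightarrow> norm (P r u - P r v) \<le> K * norm (u - v)"
    using loc_lip_field_bounds[OF P, of N] by metis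
  define C where "C = 1 + exp (3/2 * K * R)"
  have C: "C > 0" by (simp add: C_def add_pos_pos)
  \<comment> \<open>C is the growth factor of \<open>sing_sol_compare\<close> up to time R, so d * C
    is at most half of 1 and half of e.\<close>
  define d where "d = min 1 e / (2 * C)"
  show ?thesis
  proof (rule that[of d])
    show d0: "d > 0" using eps C by (simp add: d_def)
    fix v0 v assume v0: "norm (v0 - u0) < d" and v: "\<And>T. sing_sol k P v0 v T"
    have close: "norm (v r - u r) \<le> d * C"
      if r: "0 \<le> r" "r < T" "T \<le> R" and le: "\<And>s. 0 \<le> s \<Longrightarrow> s < T \<Longrightarrow> norm (v s - u s) \<le> 1" for r T
    proof -
      have "norm (v r - u r) \<le> norm (v0 - u0) * (1 + exp (3/2 * K * r))"
      proof (rule sing_sol_compare[OF v u])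
        fix s assume s: "0 < s" "s < T"
        then have "norm (v s) \<le> N"
          using B[of s] le[of s] norm_triangle_ineq2[of "v s" "u s"] r by (simp add: N_def)
        then show "norm (P s (v s) - P s (u s)) \<le> K * norm (v s - u s)"
          using B[of s] s r by (intro K) (auto simp: N_def)
      qed (use K r in auto)
      also have "\<dots> \<le> d * C"
        unfolding C_def using r v0 K(1) d0 by (intro mult_mono) (auto intro!: mult_left_mono)
      finally show ?thesis .
    qed
    have dC: "d * C < 1" "d * C < e" using C eps by (auto simp: d_def min_def field_simps)
    define g where "g = (\<lambda>r. norm (v r - u r))"
    have contg: "continuous_on {0..R} g" unfolding g_def
      using v[of "R+1"] u[of "R+1"] unfolding sing_sol_def by (intro continuous_intros) (auto elim: continuous_on_subset)
    have lim: "g t \<le> d * C" if t: "0 < t" "t \<le> R" and le: "\<And>s. 0 \<le> s \<Longrightarrow> s < t \<Longrightarrow> g s \<le> 1" for t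
    proof (rule tendsto_upperbound)
      show "(g \<longlongrightarrow> g t) (at t within {0..<t})"
        using contg t by (auto simp: continuous_on_def intro: tendsto_within_subset[where S = "{0..R}"])
      show "\<forall>\<^sub>F r in at t within {0..<t}. g r \<le> d * C"
        using close[of _ t] le t by (auto simp: eventually_at_filter g_def)
      show "at t within {0..<t} \<noteq> bot" using t by (simp add: trivial_limit_within islimpt_Ico)
    qed
    have g0: "g 0 < d" using v[of 1] u[of 1] v0 unfolding sing_sol_def by (simp add: g_def)
    have C1: "1 \<le> C" by (simp add: C_def)
    then have dle: "d \<le> d * C" using d0 by simp
    \<comment> \<open>The times at which the bootstrap assumption has failed. Its infimum would be
      positive and still belong to Z, which contradicts \<open>lim\<close>.\<close>
    define Z where "Z = {r \<in> {0..R}. g r \<in> {1..}}"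
    have "Z = {}"
    proof (rule ccontr)
      assume ne: "Z \<noteq> {}"
      have "closed Z" unfolding Z_def
        by (intro continuous_closed_preimage[OF contg, unfolded vimage_def Int_def mem_Collect_eq]) auto
      moreover have bd: "bdd_below Z" by (auto simp: Z_def intro: bdd_belowI[of _ 0])
      ultimately have tZ: "Inf Z \<in> Z" using ne by (intro closed_contains_Inf) auto
      define t where "t = Inf Z"
      have t: "0 \<le> t" "t \<le> R" "g t \<ge> 1" using tZ by (auto simp: Z_def t_def)
      have "t > 0" using t g0 dle dC by (cases "t = 0") auto
      have "g s \<le> 1" if "0 \<le> s" "s < t" for s
        using that t cInf_lower[OF _ bd, of s] by (force simp: t_def Z_def)
      then show False using lim[of t] t \<open>t > 0\<close> dC by auto
    qed
    then have "g s \<le> 1" if "0 \<le> s" "s \<le> R" for s using that by (force simp: Z_def)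
    then have "g R \<le> d * C" using lim[of R] g0 dle R by (cases "R = 0") auto
    then show "norm (v R - u R) < e" using dC by (simp add: g_def)
  qed
qed

section \<open>Smoothness on the half-line\<close>

text \<open>Being n times continuously differentiable up to 0, one-sidedly. Asking for some
  derivative function in place of \<open>hderiv\<close> lets the closure properties go through by
  induction; the link to \<open>hderiv\<close> is made once, in \<open>Ck_smooth\<close>.\<close>

primrec Ck :: "nat \<Rightarrow> (real \<Rightarrow> real) \<Rightarrow> bool" where
  "Ck 0 g = continuous_on {0..} g"
| "Ck (Suc n) g = (\<exists>g'. (\<forall>r\<ge>0. (g has_real_derivative g' r) (at r within {0..})) \<and> Ck n g')"

lemma Ck_SucI:
  "(\<And>r. r \<ge> 0 \<Longrightarrow> (g has_real_derivative g' r) (at r within {0..})) \<Longrightarrow> Ck n g' \<Longrightarrow> Ck (Suc n) g"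
  by auto

lemma Ck_Suc_imp: "Ck (Suc n) g \<Longrightarrow> Ck n g"
proof (induction n arbitrary: g)
  case 0
  then obtain g' where "\<And>r. r \<ge> 0 \<Longrightarrow> (g has_real_derivative g' r) (at r within {0..})" by auto
  then show ?case by (auto intro!: DERIV_continuous_on[where D = g'])
next
  case (Suc n)
  then obtain g' where "\<And>r. r \<ge> 0 \<Longrightarrow> (g has_real_derivative g' r) (at r within {0..})" "Ck (Suc n) g'"
    unfolding Ck.simps(2)[of "Suc n"] by blast
  then show ?case using Suc.IH by (auto intro!: Ck_SucI simp del: Ck.simps)
qed

lemma Ck_continuous: "Ck n g \<Longrightarrow> continuous_on {0..} g"
  by (induction n) (auto dest: Ck_Suc_imp simp del: Ck.simps(2))

lemma Ck_cong: "Ck n g \<Longrightarrow> (\<And>r. r \<ge> 0 \<Longrightarrow> h r = g r) \<Longrightarrow> Ck n h"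
proof (cases n)
  case 0
  assume "Ck n g" "\<And>r. r \<ge> 0 \<Longrightarrow> h r = g r"
  then show ?thesis using 0 by (metis Ck.simps(1) atLeast_iff continuous_on_cong)
next
  case (Suc m)
  assume g: "Ck n g" and eq: "\<And>r. r \<ge> 0 \<Longrightarrow> h r = g r"
  then obtain g' where g': "\<And>r. r \<ge> 0 \<Longrightarrow> (g has_real_derivative g' r) (at r within {0..})" "Ck m g'"
    using Suc by auto
  have "(h has_real_derivative g' r) (at r within {0..})" if "r \<ge> 0" for r
    by (rule has_field_derivative_transform_within[OF g'(1)[OF that], of 1]) (use that eq in auto)
  then show ?thesis using g'(2) Suc by (auto intro!: Ck_SucI simp del: Ck.simps)
qed

lemma Ck_const: "Ck n (\<lambda>r. c)"
  by (induction n arbitrary: c) (auto intro!: exI[of _ "\<lambda>r. 0"])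

lemma Ck_id: "Ck n (\<lambda>r. r)"
  by (cases n) (auto intro!: exI[of _ "\<lambda>r. 1"] Ck_const)

lemma Ck_add: "Ck n g \<Longrightarrow> Ck n h \<Longrightarrow> Ck n (\<lambda>r. g r + h r)"
proof (induction n arbitrary: g h)
  case (Suc n)
  then obtain g' h' where "\<And>r. r \<ge> 0 \<Longrightarrow> (g has_real_derivative g' r) (at r within {0..})" "Ck n g'"
    "\<And>r. r \<ge> 0 \<Longrightarrow> (h has_real_derivative h' r) (at r within {0..})" "Ck n h'" by auto
  then show ?case
    by (intro Ck_SucI[where g' = "\<lambda>r. g' r + h' r"] Suc.IH) (auto intro!: derivative_intros)
qed (auto intro: continuous_on_add)

lemma Ck_mult: "Ck n g \<Longrightarrow> Ck n h \<Longrightarrow> Ck n (\<lambda>r. g r * h r)"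
proof (induction n arbitrary: g h)
  case (Suc n)
  then obtain g' h' where "\<And>r. r \<ge> 0 \<Longrightarrow> (g has_real_derivative g' r) (at r within {0..})" "Ck n g'"
    "\<And>r. r \<ge> 0 \<Longrightarrow> (h has_real_derivative h' r) (at r within {0..})" "Ck n h'" by auto
  then show ?case using Suc.prems[THEN Ck_Suc_imp]
    by (intro Ck_SucI[where g' = "\<lambda>r. g' r * h r + g r * h' r"] Suc.IH Ck_add)
       (auto intro!: derivative_eq_intros simp: algebra_simps)
qed (auto intro: continuous_on_mult)

lemma Ck_minus: "Ck n g \<Longrightarrow> Ck n (\<lambda>r. - g r)"
  using Ck_mult[OF Ck_const[of n "-1"], of g] by simp

lemma Ck_diff: "Ck n g \<Longrightarrow> Ck n h \<Longrightarrow> Ck n (\<lambda>r. g r - h r)"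
  using Ck_add[OF _ Ck_minus[of n h], of g] by simp

lemma Ck_inverse: "Ck n g \<Longrightarrow> (\<And>r. r \<ge> 0 \<Longrightarrow> g r \<noteq> 0) \<Longrightarrow> Ck n (\<lambda>r. inverse (g r))"
proof (induction n)
  case (Suc n)
  then obtain g' where g': "\<And>r. r \<ge> 0 \<Longrightarrow> (g has_real_derivative g' r) (at r within {0..})" "Ck n g'" by auto
  have "Ck n (\<lambda>r. inverse (g r))" using Suc Ck_Suc_imp by blast
  then show ?case using g' Suc.prems(2)
    by (intro Ck_SucI[where g' = "\<lambda>r. - (inverse (g r) * g' r * inverse (g r))"] Ck_minus Ck_mult)
       (auto intro!: DERIV_inverse')
qed (auto intro!: continuous_intros)

lemmas Ck_intros = Ck_const Ck_id Ck_add Ck_mult Ck_minus Ck_diff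

lemma Ck_exp: "Ck n g \<Longrightarrow> Ck n (\<lambda>r. exp (g r))"
proof (induction n)
  case (Suc n)
  then obtain g' where "\<And>r. r \<ge> 0 \<Longrightarrow> (g has_real_derivative g' r) (at r within {0..})" "Ck n g'" by auto
  then show ?case using Suc Ck_Suc_imp
    by (intro Ck_SucI[where g' = "\<lambda>r. exp (g r) * g' r"] Ck_mult) (auto intro!: derivative_eq_intros)
qed (auto intro: continuous_on_exp)

text \<open>The induction must range over all k, because the derivative of \<open>Tk k g\<close> is
  \<open>Tk (Suc k) g'\<close>.\<close>

lemma Ck_Tk: "Ck n g \<Longrightarrow> Ck n (Tk k g)"
proof (induction n arbitrary: g k)
  case (Suc n)
  then obtain g' where "\<And>r. r \<ge> 0 \<Longrightarrow> (g has_real_derivative g' r) (at r within {0..})" "Ck n g'" by auto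
  then show ?case using Suc.IH
    by (intro Ck_SucI[where g' = "Tk (Suc k) g'"] Tk_deriv) (auto dest: Ck_continuous)
qed (auto intro: continuous_on_Tk)

section \<open>One-sided derivatives on the half-line\<close>

lemma at_halfline_nontrivial:
  assumes "r \<ge> 0" shows "at r within {0..} \<noteq> (bot :: real filter)"
proof -
  have "{r<..<r + 1} \<subseteq> {0..}" using assms by auto
  then have "r islimpt {0..}" using islimpt_subset[OF islimpt_greaterThanLessThan1[of r "r + 1"]] by simp
  then show ?thesis by (simp add: trivial_limit_within)
qed

lemma at_within_halfline: "r > 0 \<Longrightarrow> at r within {0..} = at (r :: real)"
  using at_within_interior[of r "{0..}"] by simp

lemma hderiv_eq:
  assumes "(g has_real_derivative d) (at r within {0..})" "r \<ge> 0" shows "hderiv g r = d"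
  unfolding hderiv_def
  using vector_derivative_within[OF at_halfline_nontrivial[OF assms(2)]] assms(1)
  by (simp add: has_real_derivative_iff_has_vector_derivative)

lemma hderiv_eq_pos: "(g has_real_derivative d) (at r) \<Longrightarrow> r > 0 \<Longrightarrow> hderiv g r = d"
  using hderiv_eq has_field_derivative_at_within less_imp_le by blast

lemma has_real_derivative_hderiv:
  assumes "g differentiable_on {0..}" "r \<ge> 0"
  shows "(g has_real_derivative hderiv g r) (at r within {0..})"
proof -
  have "g differentiable (at r within {0..})" using assms by (auto simp: differentiable_on_def)
  then show ?thesis unfolding hderiv_def
    by (simp add: vector_derivative_works has_real_derivative_iff_has_vector_derivative)
qed

lemma Ck_smooth:
  assumes "\<And>n. Ck n g" shows "smooth_halfline g"
proof -
  have "(\<forall>m. Ck m g) \<Longrightarrow> (hderiv ^^ n) g differentiable_on {0..}" for n and g :: "real \<Rightarrow> real"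
  proof (induction n arbitrary: g)
    case 0
    then obtain g' where "\<And>r. r \<ge> 0 \<Longrightarrow> (g has_real_derivative g' r) (at r within {0..})"
      using Ck.simps(2)[of 0] by metis
    then show ?case by (auto simp: differentiable_on_def real_differentiable_def)
  next
    case (Suc n)
    have "Ck m (hderiv g)" for m
    proof -
      obtain g' where g': "\<And>r. r \<ge> 0 \<Longrightarrow> (g has_real_derivative g' r) (at r within {0..})" "Ck m g'"
        using Suc.prems Ck.simps(2)[of m] by metis
      show ?thesis by (rule Ck_cong[OF g'(2)]) (use hderiv_eq g'(1) in auto)
    qed
    then show ?case unfolding funpow_Suc_right o_def using Suc.IH by blast
  qed
  then show ?thesis using assms unfolding smooth_halfline_def by blast
qed

lemma smooth_halfline_derivs:
  assumes "smooth_halfline g"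
  shows "r \<ge> 0 \<Longrightarrow> (g has_real_derivative hderiv g r) (at r within {0..})"
    and "r \<ge> 0 \<Longrightarrow> (hderiv g has_real_derivative hderiv (hderiv g) r) (at r within {0..})"
    and "continuous_on {0..} (hderiv (hderiv g))"
proof -
  have d: "(hderiv ^^ n) g differentiable_on {0..}" for n using assms unfolding smooth_halfline_def by blast
  show "r \<ge> 0 \<Longrightarrow> (g has_real_derivative hderiv g r) (at r within {0..})"
    using has_real_derivative_hderiv[OF d[of 0]] by simp
  show "r \<ge> 0 \<Longrightarrow> (hderiv g has_real_derivative hderiv (hderiv g) r) (at r within {0..})"
    using has_real_derivative_hderiv[OF d[of 1]] by simp
  show "continuous_on {0..} (hderiv (hderiv g))"
    using differentiable_imp_continuous_on[OF d[of 2]] by (simp add: numeral_2_eq_2)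
qed

section \<open>Regularity of singular solutions up to r = 0\<close>

lemma sing_sol_continuous:
  assumes "\<And>T. sing_sol k P u0 u T" shows "continuous_on {0..} u"
  unfolding continuous_on_eq_continuous_within
proof
  fix r :: real assume r: "r \<in> {0..}"
  have "continuous (at r within {0..<r+1}) u"
    using assms[of "r+1"] r unfolding sing_sol_def continuous_on_eq_continuous_within by auto
  moreover have "at r within {0..} = at r within {0..<r+1}"
    by (rule at_within_nhd[of _ "{..<r+1}"]) (use r in auto)
  ultimately show "continuous (at r within {0..}) u" by simp
qed

text \<open>The integral form of the equation is meaningful at r = 0; derivatives at 0 and
  smoothness up to 0 are read off from it.\<close>

lemma sing_sol_eq_rTk:
  assumes u: "\<And>T. sing_sol k P u0 u T" and cont: "continuous_on {0..} (\<lambda>r. P r (u r) $ i)" and r: "r \<ge> 0"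
  shows "u r $ i = u0 $ i + r * Tk (k i) (\<lambda>r. P r (u r) $ i) r"
proof -
  have "u r $ i - u0 $ i = r * Tk (k i) (\<lambda>r. P r (u r) $ i) r"
  proof (rule eq_rTk[OF _ _ cont _ r])
    show "continuous_on {0..} (\<lambda>r. u r $ i - u0 $ i)"
      by (intro continuous_intros sing_sol_continuous[OF u])
    show "u 0 $ i - u0 $ i = 0" using u[of 1] unfolding sing_sol_def by simp
    fix s :: real assume "s > 0"
    then have "((\<lambda>r. u r $ i - u0 $ i) has_real_derivative
        (P s (u s) $ i - real (k i) * (u s $ i - u0 $ i) / s) - 0) (at s)"
      using u[of "s + 1"] unfolding sing_sol_def by (intro derivative_intros) auto
    then show "((\<lambda>r. u r $ i - u0 $ i) has_real_derivative
        P s (u s) $ i - real (k i) * (u s $ i - u0 $ i) / s) (at s)" by simp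
  qed
  then show ?thesis by simp
qed

lemma sing_sol_field_continuous:
  assumes "\<And>T. sing_sol k P u0 u T" "loc_lip_field P" shows "continuous_on {0..} (\<lambda>r. P r (u r) $ i)"
  by (intro continuous_intros continuous_on_compose2[OF loc_lip_field_continuous[OF assms(2)],
        of "{0..}" "\<lambda>r. (r, u r)", simplified] sing_sol_continuous[OF assms(1)])

lemma sing_sol_deriv:
  assumes u: "\<And>T. sing_sol k P u0 u T" and cont: "continuous_on {0..} (\<lambda>r. P r (u r) $ i)" and r: "r \<ge> 0"
  shows "((\<lambda>r. u r $ i) has_real_derivative P r (u r) $ i - real (k i) * Tk (k i) (\<lambda>r. P r (u r) $ i) r) (at r within {0..})"
proof -
  have "((\<lambda>r. u0 $ i + r * Tk (k i) (\<lambda>r. P r (u r) $ i) r) has_real_derivative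
      0 + (P r (u r) $ i - real (k i) * Tk (k i) (\<lambda>r. P r (u r) $ i) r)) (at r within {0..})"
    by (intro derivative_intros rTk_deriv cont r)
  then have "((\<lambda>r. u0 $ i + r * Tk (k i) (\<lambda>r. P r (u r) $ i) r) has_real_derivative
      P r (u r) $ i - real (k i) * Tk (k i) (\<lambda>r. P r (u r) $ i) r) (at r within {0..})" by simp
  then show ?thesis
    by (rule has_field_derivative_transform_within[where d = 1])
       (use r sing_sol_eq_rTk[OF u cont] in auto)
qed

text \<open>At 0 the average \<open>Tk k g\<close> equals g / (k + 1), so the singular term takes
  away the fraction k / (k + 1) of the field.\<close>

lemma sing_sol_deriv_0:
  assumes u: "\<And>T. sing_sol k P u0 u T" and P: "loc_lip_field P"
  shows "((\<lambda>r. u r $ i) has_real_derivative P 0 u0 $ i / (real (k i) + 1)) (at 0 within {0..})"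
proof -
  have "u 0 = u0" using u[of 1] unfolding sing_sol_def by simp
  then have "P 0 (u 0) $ i - real (k i) * Tk (k i) (\<lambda>r. P r (u r) $ i) 0 = P 0 u0 $ i / (real (k i) + 1)"
    unfolding Tk_0 by (simp add: field_simps)
  then show ?thesis using sing_sol_deriv[OF u sing_sol_field_continuous[OF u P], of 0 i] by simp
qed

text \<open>If all components are C^n, then so are the field along the solution and its averages
  \<open>Tk\<close>; these make up the derivatives, so the components are C^(n+1).\<close>

lemma sing_sol_smooth:
  assumes u: "\<And>T. sing_sol k P u0 u T"
    and P: "\<And>n i. (\<And>j. Ck n (\<lambda>r. u r $ j)) \<Longrightarrow> Ck n (\<lambda>r. P r (u r) $ i)"
  shows "Ck n (\<lambda>r. u r $ i)"
proof (induction n arbitrary: i)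
  case 0
  then show ?case by (auto intro!: continuous_intros sing_sol_continuous[OF u])
next
  case (Suc n)
  have Pn: "Ck n (\<lambda>r. P r (u r) $ i)" using P Suc by blast
  show ?case
    by (rule Ck_SucI[OF sing_sol_deriv[OF u Ck_continuous[OF Pn]]]) (assumption | intro Ck_intros Ck_Tk Pn)+
qed

section \<open>The soliton equations as a polynomial system\<close>

text \<open>Used with y = a''/a' or b''/b' and z = ln a' or ln b'. Damping at least 3/2 against
  forcing of order 1/X^2 keeps y below the barrier B. As X' \<ge> 1/4, the term 1/X^2 is dominated
  by the derivative of -4/X, so the variation of z is finite and controlled by the state at
  s.\<close>

lemma decay_tail:
  fixes y z h p X X' :: "real \<Rightarrow> real"
  assumes y: "\<And>t. t \<ge> s \<Longrightarrow> (y has_real_derivative h t - p t * y t) (at t)"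
    and z: "\<And>t. t \<ge> s \<Longrightarrow> (z has_real_derivative y t) (at t)"
    and X: "\<And>t. t \<ge> s \<Longrightarrow> (X has_real_derivative X' t) (at t)"
    and p: "\<And>t. t \<ge> s \<Longrightarrow> p t \<ge> 3/2" and X4: "\<And>t. t \<ge> s \<Longrightarrow> X t \<ge> 4"
    and X': "\<And>t. t \<ge> s \<Longrightarrow> 1/4 \<le> X' t" "\<And>t. t \<ge> s \<Longrightarrow> X' t \<le> 1"
    and h: "\<And>t. t \<ge> s \<Longrightarrow> \<bar>h t\<bar> \<le> K / (X t)\<^sup>2" and r: "r \<ge> s"
  shows "\<bar>y r\<bar> \<le> \<bar>y s\<bar> * exp (s - r) + (K + 1) / (X r)\<^sup>2"
    and "\<bar>z r - z s\<bar> \<le> \<bar>y s\<bar> + 4 * (K + 1) / X s"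
proof -
  have "0 \<le> K / (X s)\<^sup>2" using h[of s] by linarith
  then have K: "K \<ge> 0" using X4[of s] by (simp add: zero_le_divide_iff)
  \<comment> \<open>The surplus 1 in K + 1 provides strictness: at contact, 3/2 B - K/X^2 exceeds
    the possible loss |y s| exp(s - t) + (K + 1)/(2 X^2) of B by at least 1/X^2. The halving of the
    second term uses X \<ge> 4.\<close>
  define B where "B = (\<lambda>t. \<bar>y s\<bar> * exp (s - t) + (K + 1) / (X t)\<^sup>2)"
  define B' where "B' = (\<lambda>t. - \<bar>y s\<bar> * exp (s - t) - 2 * (K + 1) * X' t / (X t)^3)"
  have dB: "(B has_real_derivative B' t) (at t)" if "t \<ge> s" for t
    unfolding B_def B'_def using X4[OF that]
    by (auto intro!: derivative_eq_intros X that simp: field_simps power2_eq_square power3_eq_cube)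
  \<comment> \<open>Stated for a generic solution so that it applies both to y and to -y.\<close>
  have upper: "y1 t < B t"
    if y1: "\<And>t. t \<ge> s \<Longrightarrow> (y1 has_real_derivative h1 t - p t * y1 t) (at t)" "y1 s \<le> \<bar>y s\<bar>"
      "\<And>t. t \<ge> s \<Longrightarrow> \<bar>h1 t\<bar> \<le> K / (X t)\<^sup>2" and t: "t \<ge> s" for y1 h1 t
  proof -
    have "B t - y1 t > 0"
    proof (rule stays_pos[where g = "\<lambda>t. B t - y1 t" and g' = "\<lambda>t. B' t - (h1 t - p t * y1 t)", OF t])
      have "(K + 1) / (X s)\<^sup>2 > 0" using K X4[of s] by simp
      then show "0 < B s - y1 s" using y1(2) unfolding B_def by simp
      fix t assume t: "s < t" "B t - y1 t = 0"
      have x: "X t \<ge> 4" "X' t \<le> 1" using X4 X' t by auto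
      have e: "\<bar>y s\<bar> * exp (s - t) \<ge> 0" by simp
      have "2 * (K + 1) * X' t / (X t)^3 \<le> 2 * (K + 1) * 1 / (4 * (X t)\<^sup>2)"
        using x K X'(1)[of t] t by (intro frac_le mult_left_mono) (auto simp: power3_eq_cube power2_eq_square)
      also have "\<dots> = (K + 1) / (2 * (X t)\<^sup>2)" using x by (simp add: field_simps)
      finally have b': "B' t \<ge> - (\<bar>y s\<bar> * exp (s - t)) - (K + 1) / (2 * (X t)\<^sup>2)" unfolding B'_def by simp
      have "B t \<ge> 0" using e K unfolding B_def by simp
      then have "3/2 * B t \<le> p t * B t" using p[of t] t by (intro mult_right_mono) auto
      then have "3/2 * B t \<le> p t * y1 t" using t by simp
      moreover have "h1 t \<le> K / (X t)\<^sup>2" using y1(3)[of t] t by auto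
      moreover have "(K + 1) / (2 * (X t)\<^sup>2) = (K / (X t)\<^sup>2 + 1 / (X t)\<^sup>2) / 2" using x by (simp add: field_simps)
      moreover have "B t = \<bar>y s\<bar> * exp (s - t) + (K / (X t)\<^sup>2 + 1 / (X t)\<^sup>2)" unfolding B_def by (simp add: add_divide_distrib)
      moreover have "1 / (X t)\<^sup>2 > 0" using x by simp
      ultimately show "0 < B' t - (h1 t - p t * y1 t)" using b' e by argo
    qed (auto intro!: derivative_intros dB y1)
    then show ?thesis by simp
  qed
  have yB: "\<bar>y t\<bar> \<le> B t" if "t \<ge> s" for t
    using upper[of y h t] upper[of "\<lambda>t. - y t" "\<lambda>t. - h t" t] y h that
    by (fastforce intro!: derivative_eq_intros)
  show "\<bar>y r\<bar> \<le> \<bar>y s\<bar> * exp (s - r) + (K + 1) / (X r)\<^sup>2" using yB[OF r] unfolding B_def .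
  \<comment> \<open>Minus the derivative of \<open>\<Phi>\<close> dominates B, so z +
    \<open>\<Phi>\<close> and -z + \<open>\<Phi>\<close> both decrease.\<close>
  define \<Phi> where "\<Phi> = (\<lambda>t. \<bar>y s\<bar> * exp (s - t) + 4 * (K + 1) / X t)"
  have d\<Phi>: "(\<Phi> has_real_derivative - \<bar>y s\<bar> * exp (s - t) - 4 * (K + 1) * X' t / (X t)\<^sup>2) (at t)" if "t \<ge> s" for t
    unfolding \<Phi>_def using X4[OF that]
    by (auto intro!: derivative_eq_intros X that simp: field_simps power2_eq_square)
  have le: "B t \<le> \<bar>y s\<bar> * exp (s - t) + 4 * (K + 1) * X' t / (X t)\<^sup>2" if "t \<ge> s" for t
  proof -
    have "(K + 1) * 1 / (X t)\<^sup>2 \<le> (K + 1) * (4 * X' t) / (X t)\<^sup>2"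
      using X'(1)[OF that] K by (intro divide_right_mono mult_left_mono) auto
    then show ?thesis unfolding B_def by (simp add: mult_ac)
  qed
  have "z r + \<Phi> r \<le> z s + \<Phi> s"
    by (rule deriv_nonpos_ge[OF r DERIV_add[OF z d\<Phi>]]) (use yB le in \<open>force\<close>)+
  moreover have "- z r + \<Phi> r \<le> - z s + \<Phi> s"
    by (rule deriv_nonpos_ge[OF r DERIV_add[OF DERIV_minus[OF z] d\<Phi>]]) (use yB le in \<open>force\<close>)+
  moreover have "\<Phi> r \<ge> 0" using X4[OF r] K by (simp add: \<Phi>_def)
  ultimately show "\<bar>z r - z s\<bar> \<le> \<bar>y s\<bar> + 4 * (K + 1) / X s"
    unfolding \<Phi>_def by simp
qed

text \<open>While D \<ge> m it falls at rate at least \<open>\<eta>\<close>, so it drops below m in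
  finite time; at the level m its derivative is negative, so it cannot return.\<close>

lemma eventually_below:
  fixes D D' :: "real \<Rightarrow> real"
  assumes D: "\<And>t. t \<ge> s \<Longrightarrow> (D has_real_derivative D' t) (at t)" and \<eta>: "\<eta> > 0"
    and neg: "\<And>t. t \<ge> s \<Longrightarrow> D t \<ge> m \<Longrightarrow> D' t \<le> - \<eta>"
  shows "eventually (\<lambda>r. D r < m) at_top"
proof -
  obtain t where t: "t \<ge> s" "D t < m"
  proof (rule ccontr)
    assume "\<not> thesis"
    then have ge: "D t \<ge> m" if "t \<ge> s" for t using that \<open>\<And>t. s \<le> t \<Longrightarrow> D t < m \<Longrightarrow> thesis\<close> by force
    define r where "r = s + (D s - m) / \<eta> + 1"
    have r: "r \<ge> s" using ge[of s] \<eta> by (simp add: r_def add_nonneg_nonneg)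
    have "D r + \<eta> * r \<le> D s + \<eta> * s"
    proof (rule deriv_nonpos_ge[OF r, where g' = "\<lambda>t. D' t + \<eta>"])
      fix t assume t: "s \<le> t" "t \<le> r"
      show "((\<lambda>t. D t + \<eta> * t) has_real_derivative D' t + \<eta>) (at t)"
        using t by (auto intro!: derivative_eq_intros D)
      show "D' t + \<eta> \<le> 0" using neg[of t] ge[of t] t by simp
    qed
    moreover have "\<eta> * r = \<eta> * s + (D s - m) + \<eta>" using \<eta> by (simp add: r_def field_simps)
    ultimately show False using ge[OF r] \<eta> by simp
  qed
  have "D r < m" if "r \<ge> t" for r
  proof -
    have "m - D r > 0"
    proof (rule stays_pos[where g = "\<lambda>t. m - D t" and g' = "\<lambda>t. - D' t", OF that])
      fix u assume "t \<le> u" "u \<le> r"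
      then show "((\<lambda>t. m - D t) has_real_derivative - D' u) (at u)"
        using t by (auto intro!: derivative_eq_intros D)
    next
      fix u assume "t < u" "m - D u = 0"
      then show "0 < - D' u" using neg[of u] t \<eta> by simp
    qed (use t in auto)
    then show ?thesis by simp
  qed
  then show ?thesis by (auto simp: eventually_at_top_linorder)
qed

text \<open>Cauchy's criterion at infinity; the limit is produced along the natural numbers and then
  transferred to the reals.\<close>

lemma tendsto_at_top_if_tails:
  fixes f :: "real \<Rightarrow> real"
  assumes "\<And>e. e > 0 \<Longrightarrow> \<exists>s. \<forall>r\<ge>s. \<bar>f r - f s\<bar> \<le> e"
  shows "\<exists>l. (f \<longlongrightarrow> l) at_top"
proof -
  have "Cauchy (\<lambda>n. f (real n))"
  proof (rule CauchyI)
    fix e :: real assume "e > 0"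
    then obtain s where s: "\<And>r. r \<ge> s \<Longrightarrow> \<bar>f r - f s\<bar> \<le> e / 3" using assms[of "e/3"] by auto
    obtain N where N: "s \<le> real N" using real_arch_simple by blast
    have "norm (f (real m) - f (real n)) < e" if "m \<ge> N" "n \<ge> N" for m n
      using s[of "real m"] s[of "real n"] that N \<open>e > 0\<close> unfolding real_norm_def by linarith
    then show "\<exists>M. \<forall>m\<ge>M. \<forall>n\<ge>M. norm (f (real m) - f (real n)) < e" by blast
  qed
  then obtain l where l: "(\<lambda>n. f (real n)) \<longlonglongrightarrow> l" using real_Cauchy_convergent convergent_def by blast
  have "(f \<longlongrightarrow> l) at_top"
  proof (rule tendstoI)
    fix e :: real assume e: "e > 0"
    then obtain s where s: "\<And>r. r \<ge> s \<Longrightarrow> \<bar>f r - f s\<bar> \<le> e / 3" using assms[of "e/3"] by auto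
    obtain N where N: "s \<le> real N" using real_arch_simple by blast
    have "\<bar>l - f s\<bar> \<le> e / 3"
    proof (rule tendsto_upperbound)
      show "(\<lambda>n. \<bar>f (real n) - f s\<bar>) \<longlonglongrightarrow> \<bar>l - f s\<bar>" by (intro tendsto_intros l)
      show "\<forall>\<^sub>F n in sequentially. \<bar>f (real n) - f s\<bar> \<le> e / 3"
        using eventually_ge_at_top[of N] by eventually_elim (use s N in force)
    qed auto
    show "\<forall>\<^sub>F r in at_top. dist (f r) l < e"
      using eventually_ge_at_top[of s]
      proof eventually_elim
        case (elim r)
        then show ?case using s[of r] e \<open>\<bar>l - f s\<bar> \<le> e / 3\<close> unfolding dist_real_def by linarith
      qed
  qed
  then show ?thesis by blast
qed

text \<open>With \<open>L = a'/a\<close>, \<open>M = b'/b\<close>, \<open>W = 1/b\<close>, \<open>q = -f'\<close> and \<open>X\<close> the drift mean curvature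
  \<open>a'/a + 2b'/b - f'\<close>, the soliton equations become a polynomial system. The function \<open>U\<close> is
  \<open>C - 2f\<close>, where \<open>C\<close> is determined by Hamilton's identity \<open>R + |\<nabla>f|\<^sup>2 + 2f = const\<close>.\<close>

locale phase =
  fixes L M X W q U :: "real \<Rightarrow> real" and I :: "real set"
  assumes I_pos: "r \<in> I \<Longrightarrow> 0 < r" and I_down: "r \<in> I \<Longrightarrow> 0 < s \<Longrightarrow> s \<le> r \<Longrightarrow> s \<in> I"
    and dL: "r \<in> I \<Longrightarrow> (L has_real_derivative 1 - X r * L r) (at r)"
    and dM: "r \<in> I \<Longrightarrow> (M has_real_derivative 1 + (W r)\<^sup>2 - X r * M r) (at r)"
    and dX: "r \<in> I \<Longrightarrow> (X has_real_derivative 1 - (L r)\<^sup>2 - 2 * (M r)\<^sup>2) (at r)"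
    and dW: "r \<in> I \<Longrightarrow> (W has_real_derivative - (M r * W r)) (at r)"
    and dq: "r \<in> I \<Longrightarrow> (q has_real_derivative U r - X r * q r) (at r)"
    and dU: "r \<in> I \<Longrightarrow> (U has_real_derivative 2 * q r) (at r)"
    and X_eq: "r \<in> I \<Longrightarrow> X r = L r + 2 * M r + q r"
    and X_sq: "r \<in> I \<Longrightarrow> (X r)\<^sup>2 = 2 + 2 * (W r)\<^sup>2 + (L r)\<^sup>2 + 2 * (M r)\<^sup>2 + U r"
    and init: "\<forall>\<^sub>F r in at_right 0. L r > 0 \<and> M r > 0 \<and> W r > 0 \<and> q r > 0 \<and> U r - X r * q r > 0 \<and> U r > 0"
begin

lemma L_pos: assumes "r \<in> I" shows "L r > 0"
proof (rule first_zero_pos[where g = L and a = 0 and g' = "\<lambda>r. 1 - X r * L r"])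
  show "\<forall>\<^sub>F r in at_right 0. L r > 0" using init by eventually_elim simp
next
  fix s assume "0 < s" "s \<le> r"
  then show "(L has_real_derivative 1 - X s * L s) (at s)" using dL I_down[OF assms] by blast
qed (use I_pos[OF assms] in auto)

lemma M_pos: assumes "r \<in> I" shows "M r > 0"
proof (rule first_zero_pos[where g = M and a = 0 and g' = "\<lambda>r. 1 + (W r)\<^sup>2 - X r * M r"])
  show "\<forall>\<^sub>F r in at_right 0. M r > 0" using init by eventually_elim simp
next
  fix s assume "0 < s" "s \<le> r"
  then show "(M has_real_derivative 1 + (W s)\<^sup>2 - X s * M s) (at s)" using dM I_down[OF assms] by blast
qed (use I_pos[OF assms] in \<open>auto simp: add_pos_nonneg\<close>)

text \<open>The derivative of W vanishes together with W, so a first zero offers no sign to exploit.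
  Instead it is impossible outright: with M \<le> K on a compact interval, W^2 exp(2 K t) does not
  decrease.\<close>

lemma W_pos: assumes r: "r \<in> I" shows "W r > 0"
proof (rule first_zero_pos[where g = W and a = 0 and g' = "\<lambda>r. - (M r * W r)"])
  show ev: "\<forall>\<^sub>F r in at_right 0. W r > 0" using init by eventually_elim simp
  fix s assume s: "0 < s" "s \<le> r" "W s = 0" and pos: "\<And>t. 0 < t \<Longrightarrow> t < s \<Longrightarrow> W t > 0"
  define t where "t = s / 2"
  have t: "0 < t" "t < s" "W t > 0" using s pos by (auto simp: t_def)
  have inI: "u \<in> I" if "t \<le> u" "u \<le> s" for u using I_down[OF r, of u] that s t by auto
  have "continuous_on {t..s} M"
    by (rule DERIV_atLeastAtMost_imp_continuous_on) (use inI dM in blast)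
  then obtain K where K: "\<And>u. t \<le> u \<Longrightarrow> u \<le> s \<Longrightarrow> M u \<le> K"
    using continuous_attains_sup[of "{t..s}" M] t by (metis atLeastAtMost_iff atLeastatMost_empty_iff compact_Icc less_eq_real_def not_le)
  have "(W t)\<^sup>2 * exp (2 * K * t) \<le> (W s)\<^sup>2 * exp (2 * K * s)"
  proof (rule deriv_nonneg_le[where g = "\<lambda>u. (W u)\<^sup>2 * exp (2 * K * u)" and g' = "\<lambda>u. 2 * (K - M u) * (W u)\<^sup>2 * exp (2 * K * u)"])
    fix u assume u: "t \<le> u" "u \<le> s"
    show "((\<lambda>u. (W u)\<^sup>2 * exp (2 * K * u)) has_real_derivative 2 * (K - M u) * (W u)\<^sup>2 * exp (2 * K * u)) (at u)"
      by (auto intro!: derivative_eq_intros dW inI u simp: power2_eq_square algebra_simps)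
    show "0 \<le> 2 * (K - M u) * (W u)\<^sup>2 * exp (2 * K * u)" using K u by simp
  qed (use t in auto)
  then have False using t s by (simp add: power2_eq_square mult_le_0_iff zero_less_mult_iff not_le)
  then show "0 < - (M s * W s)" ..
next
  fix s assume "0 < s" "s \<le> r"
  then show "(W has_real_derivative - (M s * W s)) (at s)" using dW I_down[OF r] by blast
qed (use I_pos[OF r] in auto)

text \<open>The derivative q' = U - X q satisfies q'' = (1 + L^2 + 2 M^2) q - X q'. As long as q' >
  0 the function q stays positive, so at a first zero of q' its derivative would be
  positive.\<close>

lemma dq_pos: assumes r: "r \<in> I" shows "U r - X r * q r > 0"
  and q_pos: "q r > 0" and U_pos: "U r > 0"
proof -
  \<comment> \<open>Up to a first zero of q' the function q is increasing from positive values near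
    0.\<close>
  have q_pos': "q s > 0" if s: "s \<in> I" and pos: "\<And>t. 0 < t \<Longrightarrow> t < s \<Longrightarrow> U t - X t * q t > 0" for s
  proof -
    obtain d where d: "d > 0" "\<And>t. 0 < t \<Longrightarrow> t < d \<Longrightarrow> q t > 0"
      using init unfolding eventually_at_right_field by auto
    define t where "t = min d s / 2"
    have t: "0 < t" "t < d" "t < s" using d I_pos[OF s] by (auto simp: t_def min_def)
    have inI: "u \<in> I" if "t \<le> u" "u \<le> s" for u using I_down[OF s, of u] that t by auto
    have "q t < q s"
    proof (rule DERIV_pos_imp_increasing_open[OF t(3)])
      show "continuous_on {t..s} q"
        by (rule DERIV_atLeastAtMost_imp_continuous_on) (use inI dq in blast)
      show "\<exists>y. (q has_real_derivative y) (at u) \<and> 0 < y" if "t < u" "u < s" for u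
        using dq[OF inI[of u]] pos[of u] that t by (intro exI[of _ "U u - X u * q u"]) auto
    qed
    then show ?thesis using d(2)[of t] t by simp
  qed
  have main: "U s - X s * q s > 0" if s: "s \<in> I" for s
  proof (rule first_zero_pos[where g = "\<lambda>r. U r - X r * q r" and a = 0 and
        g' = "\<lambda>r. 2 * q r - ((1 - (L r)\<^sup>2 - 2 * (M r)\<^sup>2) * q r + X r * (U r - X r * q r))"])
    show "\<forall>\<^sub>F r in at_right 0. U r - X r * q r > 0" using init by eventually_elim simp
    fix t assume t: "0 < t" "t \<le> s" "U t - X t * q t = 0" "\<And>u. 0 < u \<Longrightarrow> u < t \<Longrightarrow> U u - X u * q u > 0"
    then have "q t > 0" using q_pos'[of t] I_down[OF s, of t] by blast
    moreover have "2 * q t - ((1 - (L t)\<^sup>2 - 2 * (M t)\<^sup>2) * q t + X t * (U t - X t * q t)) = (1 + (L t)\<^sup>2 + 2 * (M t)\<^sup>2) * q t"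
      using t by (simp add: algebra_simps)
    moreover have "1 + (L t)\<^sup>2 + 2 * (M t)\<^sup>2 > 0" by (simp add: add_pos_nonneg)
    ultimately show "0 < 2 * q t - ((1 - (L t)\<^sup>2 - 2 * (M t)\<^sup>2) * q t + X t * (U t - X t * q t))" by simp
  next
    fix t assume "0 < t" "t \<le> s"
    then have "t \<in> I" using I_down[OF s] by blast
    then show "((\<lambda>r. U r - X r * q r) has_real_derivative
        2 * q t - ((1 - (L t)\<^sup>2 - 2 * (M t)\<^sup>2) * q t + X t * (U t - X t * q t))) (at t)"
      by (auto intro!: derivative_eq_intros dU dX dq)
  qed (use I_pos[OF s] in auto)
  show "U r - X r * q r > 0" by (rule main[OF r])
  have qp: "q s > 0" if "s \<in> I" for s using q_pos'[OF that] main I_down[OF that] by force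
  then show "q r > 0" using r by blast
  show "U r > 0"
  proof (rule first_zero_pos[where g = U and a = 0 and g' = "\<lambda>r. 2 * q r"])
    show "\<forall>\<^sub>F r in at_right 0. U r > 0" using init by eventually_elim simp
  next
      fix s assume "0 < s" "s \<le> r"
    then have "s \<in> I" using I_down[OF r] by blast
    then show "(U has_real_derivative 2 * q s) (at s)" "0 < 2 * q s" using dU qp by auto
  qed (use I_pos[OF r] in auto)
qed

lemma X_pos: "r \<in> I \<Longrightarrow> X r > 0"
  using X_eq L_pos M_pos q_pos by (simp add: add_pos_pos)

lemma X_gt_q: "r \<in> I \<Longrightarrow> X r > q r" and X_gt_L: "r \<in> I \<Longrightarrow> X r > L r"
  using X_eq[of r] L_pos[of r] M_pos[of r] q_pos[of r] by auto

lemma X_ge: assumes "r \<in> I" "k \<ge> 0" "k\<^sup>2 \<le> U r + 2" shows "X r \<ge> k"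
proof (rule power2_le_imp_le)
  have "0 \<le> 2 * (W r)\<^sup>2 + (L r)\<^sup>2 + 2 * (M r)\<^sup>2" by simp
  then show "k\<^sup>2 \<le> (X r)\<^sup>2" using X_sq[OF assms(1)] assms by linarith
qed (use X_pos assms in \<open>auto intro: less_imp_le\<close>)

text \<open>Monotonicity and growth over a time span r - s in terms of the state at s. On a bounded
  interval these bounds exclude blow-up.\<close>

context
  fixes s r assumes s: "0 < s" "s \<le> r" and r: "r \<in> I"
begin

private lemma inI: "s \<le> t \<Longrightarrow> t \<le> r \<Longrightarrow> t \<in> I"
  using I_down[OF r, of t] s by auto

lemma W_antimono: "W r \<le> W s"
  by (rule deriv_nonpos_ge[OF s(2) dW[OF inI]]) (use M_pos W_pos inI in \<open>auto simp: less_imp_le\<close>)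

lemma q_mono: "q s \<le> q r"
  by (rule deriv_nonneg_le[OF s(2) dq[OF inI]]) (use dq_pos inI in \<open>auto simp: less_imp_le\<close>)

lemma U_mono: "U s \<le> U r"
  by (rule deriv_nonneg_le[OF s(2) dU[OF inI]]) (use q_pos inI in \<open>auto simp: less_imp_le\<close>)

lemma X_upper: "X r \<le> X s + (r - s)"
proof -
  have "X r - r \<le> X s - s"
    by (rule deriv_nonpos_ge[OF s(2) DERIV_diff[OF dX[OF inI] DERIV_ident]])
      (auto intro: order_trans[of _ 0])
  then show ?thesis by simp
qed

lemma L_upper: "L r \<le> L s + (r - s)"
proof -
  have "L r - r \<le> L s - s"
    by (rule deriv_nonpos_ge[OF s(2) DERIV_diff[OF dL[OF inI] DERIV_ident]])
       (use L_pos X_pos inI in \<open>auto simp: less_imp_le\<close>)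
  then show ?thesis by simp
qed

lemma M_upper: "M r \<le> M s + (1 + (W s)\<^sup>2) * (r - s)"
proof -
  have "M r - (1 + (W s)\<^sup>2) * r \<le> M s - (1 + (W s)\<^sup>2) * s"
  proof (rule deriv_nonpos_ge[OF s(2) DERIV_diff[OF dM[OF inI]]])
    fix t assume t: "s \<le> t" "t \<le> r"
    show "((*) (1 + (W s)\<^sup>2) has_real_derivative 1 + (W s)\<^sup>2) (at t)" by (auto intro!: derivative_eq_intros)
    have "W t \<le> W s"
      by (rule deriv_nonpos_ge[OF t(1) dW]) (use t inI M_pos W_pos in \<open>auto simp: less_imp_le\<close>)
    then have "(W t)\<^sup>2 \<le> (W s)\<^sup>2" using W_pos[OF inI[OF t]] by (intro power_mono) auto
    then show "1 + (W t)\<^sup>2 - X t * M t - (1 + (W s)\<^sup>2) \<le> 0"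
      using X_pos[OF inI[OF t]] M_pos[OF inI[OF t]] mult_pos_pos[of "X t" "M t"] by linarith
  qed auto
  then show ?thesis by (simp add: algebra_simps)
qed

lemma U_upper: "U r \<le> U s + 2 * q r * (r - s)"
proof -
  have "U r - 2 * q r * r \<le> U s - 2 * q r * s"
  proof (rule deriv_nonpos_ge[OF s(2) DERIV_diff[OF dU[OF inI]]])
    fix t assume t: "s \<le> t" "t \<le> r"
    show "((*) (2 * q r) has_real_derivative 2 * q r) (at t)" by (auto intro!: derivative_eq_intros)
    have "q t \<le> q r"
      by (rule deriv_nonneg_le[OF t(2) dq]) (use t inI dq_pos in \<open>auto simp: less_imp_le\<close>)
    then show "2 * q t - 2 * q r \<le> 0" by simp
  qed auto
  then show ?thesis by (simp add: algebra_simps)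
qed

end

end

text \<open>A global trajectory together with a and the constant C = U(0). The last three
  assumptions are common to both boundary conditions and each starts an argument at r = 0: the
  barriers L < 1 + 1/r and b b' > r/5, and the statement on interior maxima of b'.\<close>

locale expander = phase L M X W q U "{0<..}" for L M X W q U +
  fixes a :: "real \<Rightarrow> real" and C :: real
  assumes a_pos: "r > 0 \<Longrightarrow> a r > 0" and da: "r > 0 \<Longrightarrow> (a has_real_derivative L r * a r) (at r)"
    and C_pos: "C > 0"
    and init_q: "(q \<longlongrightarrow> 0) (at_right 0)" and init_U: "(U \<longlongrightarrow> C) (at_right 0)"
    and init_L: "\<forall>\<^sub>F r in at_right 0. L r < 1 + 1 / r"
    and init_N: "\<forall>\<^sub>F r in at_right 0. r / 5 < M r / (W r)\<^sup>2"
    and init_slope: "t > 1 \<Longrightarrow> \<forall>\<^sub>F r in at_right 0. M r / W r < t"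
begin

lemmas derivs = dL[unfolded greaterThan_iff] dM[unfolded greaterThan_iff] dX[unfolded greaterThan_iff]
  dW[unfolded greaterThan_iff] dq[unfolded greaterThan_iff] dU[unfolded greaterThan_iff] da
lemmas pos = L_pos[unfolded greaterThan_iff] M_pos[unfolded greaterThan_iff] W_pos[unfolded greaterThan_iff]
  q_pos[unfolded greaterThan_iff] U_pos[unfolded greaterThan_iff] X_pos[unfolded greaterThan_iff] a_pos
lemmas mono_facts = W_antimono[unfolded greaterThan_iff] q_mono[unfolded greaterThan_iff] U_mono[unfolded greaterThan_iff]

definition "ln_a' r = ln (L r * a r)"
definition "ln_b' r = ln (M r / W r)"
text \<open>\<open>E\<close> is a''/a' and \<open>G\<close> is b''/b'.\<close>

definition "E r = 1 / L r - X r + L r"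
definition "G r = (1 + (W r)\<^sup>2) / M r - X r + M r"

lemma d_ln_a': "r > 0 \<Longrightarrow> (ln_a' has_real_derivative E r) (at r)"
  unfolding ln_a'_def[abs_def] E_def using pos[of r]
  by (auto intro!: derivative_eq_intros derivs simp: field_simps)

lemma d_ln_b': "r > 0 \<Longrightarrow> (ln_b' has_real_derivative G r) (at r)"
  unfolding ln_b'_def[abs_def] G_def using pos[of r]
  by (auto intro!: derivative_eq_intros derivs simp: field_simps power2_eq_square)

text \<open>The equation closes up: E is damped with coefficient 1/L - L, which is at least 3/2 once
  L \<le> 1/2, and forced by 2 M^2. The equation of G below has the same structure.\<close>

lemma dE: "r > 0 \<Longrightarrow> (E has_real_derivative 2 * (M r)\<^sup>2 - (1 / L r - L r) * E r) (at r)"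
  unfolding E_def[abs_def] using pos[of r]
  by (auto intro!: derivative_eq_intros derivs simp: field_simps power2_eq_square)

lemma dG: "r > 0 \<Longrightarrow> (G has_real_derivative ((M r)\<^sup>2 + (L r)\<^sup>2 - (W r)\<^sup>2) - ((1 + (W r)\<^sup>2) / M r - M r) * G r) (at r)"
  unfolding G_def[abs_def] using pos[of r]
  by (auto intro!: derivative_eq_intros derivs simp: field_simps power2_eq_square)

text \<open>An open, forward invariant set of states which every solution enters and from which the total
  variation of the remaining part of \<open>ln a'\<close> and \<open>ln b'\<close> is controlled by the state itself.\<close>

definition "trap s \<longleftrightarrow> U s > 16 \<and> L s < 1/2 \<and> M s < 1/2 \<and> W s < 1/2 \<and>
  1 < X s * L s \<and> X s * L s < 2 \<and> 1 < X s * M s \<and> X s * M s < 3"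

lemma X_gt_4: assumes "r > 0" "U r > 16" shows "X r > 4"
proof (rule power2_less_imp_less)
  have "(X r)\<^sup>2 = 2 + 2 * (W r)\<^sup>2 + (L r)\<^sup>2 + 2 * (M r)\<^sup>2 + U r" "(4::real)\<^sup>2 = 16" using X_sq[of r] assms by simp_all
  then show "4\<^sup>2 < (X r)\<^sup>2"
    using zero_le_power2[of "W r"] zero_le_power2[of "L r"] zero_le_power2[of "M r"] assms(2) by linarith
qed (use pos assms in \<open>auto intro: less_imp_le\<close>)

lemma dXP:
  assumes "r > 0"
  shows "((\<lambda>r. X r * L r) has_real_derivative (1 - (L r)\<^sup>2 - 2 * (M r)\<^sup>2) * L r + X r * (1 - X r * L r)) (at r)"
    and "((\<lambda>r. X r * M r) has_real_derivative (1 - (L r)\<^sup>2 - 2 * (M r)\<^sup>2) * M r + X r * (1 + (W r)\<^sup>2 - X r * M r)) (at r)"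
  using assms by (auto intro!: derivative_eq_intros derivs)

lemma dX_bounds:
  assumes "0 < r" "L r < 1/2" "M r < 1/2"
  shows "1/4 \<le> 1 - (L r)\<^sup>2 - 2 * (M r)\<^sup>2" "1 - (L r)\<^sup>2 - 2 * (M r)\<^sup>2 \<le> 1"
proof -
  have "(L r)\<^sup>2 \<le> (1/2)\<^sup>2" "(M r)\<^sup>2 \<le> (1/2)\<^sup>2" using assms pos[of r] by (auto intro!: power_mono)
  then show "1/4 \<le> 1 - (L r)\<^sup>2 - 2 * (M r)\<^sup>2" by (simp add: power2_eq_square)
qed (use zero_le_power2[of "L r"] zero_le_power2[of "M r"] in linarith)

text \<open>Every face of the region is crossed inwards only. U increases, so X > 4, and W
  decreases. On L = 1/2 or M = 1/2 the factor X > 4 makes the derivative negative. Then X' lies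
  between 1/4 and 1, which decides the sign on the faces of X L and X M; the upper value 3 for X M
  leaves room for 1 + W^2.\<close>

lemma trap_persists:
  assumes s: "s > 0" "s \<le> r" and trap: "trap s" shows "trap r"
proof -
  have r: "r > 0" using s by simp
  have U: "U t > 16" if "t \<ge> s" for t using trap mono_facts(3)[of s t] s that unfolding trap_def by auto
  have X: "X t > 4" if "t \<ge> s" for t using X_gt_4[of t] U[OF that] s that by auto
  have W: "W t < 1/2" if "t \<ge> s" for t using trap mono_facts(1)[of s t] s that unfolding trap_def by auto
  have W2: "(W t)\<^sup>2 < 1/4" if "t \<ge> s" for t
    using power_strict_mono[of "W t" "1/2" 2] W[OF that] pos(3)[of t] s that by (simp add: power2_eq_square)
  have L: "L t < 1/2" if "t \<ge> s" for t
  proof -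
    have "1/2 - L t > 0"
    proof (rule stays_pos[where s = s and r = t and g = "\<lambda>t. 1/2 - L t" and g' = "\<lambda>t. - (1 - X t * L t)"])
      fix u assume "s < u" "u \<le> t" "1/2 - L u = 0"
      then have Lu: "X u > 4" "L u = 1/2" using X[of u] by auto
      have "X u * L u = X u / 2" unfolding Lu(2) by simp
      with Lu(1) have "X u * L u > 2" by linarith
      then show "0 < - (1 - X u * L u)" by simp
    qed (use s that trap in \<open>auto intro!: derivative_eq_intros derivs simp: trap_def\<close>)
    then show ?thesis by simp
  qed
  have M: "M t < 1/2" if "t \<ge> s" for t
  proof -
    have "1/2 - M t > 0"
    proof (rule stays_pos[where s = s and r = t and g = "\<lambda>t. 1/2 - M t" and g' = "\<lambda>t. - (1 + (W t)\<^sup>2 - X t * M t)"])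
      fix u assume "s < u" "u \<le> t" "1/2 - M u = 0"
      then have Mu: "X u > 4" "M u = 1/2" "(W u)\<^sup>2 < 1/4" using X[of u] W2[of u] by auto
      have "X u * M u = X u / 2" unfolding Mu(2) by simp
      with Mu show "0 < - (1 + (W u)\<^sup>2 - X u * M u)" by linarith
    qed (use s that trap in \<open>auto intro!: derivative_eq_intros derivs simp: trap_def\<close>)
    then show ?thesis by simp
  qed
  note X' = dX_bounds[OF less_le_trans[OF s(1)] L M]
  have XL1: "X r * L r - 1 > 0"
  proof (rule stays_pos[where s = s and r = r and g = "\<lambda>t. X t * L t - 1"])
    fix u assume u: "s \<le> u" "u \<le> r"
    then show "((\<lambda>t. X t * L t - 1) has_real_derivative (1 - (L u)\<^sup>2 - 2 * (M u)\<^sup>2) * L u + X u * (1 - X u * L u)) (at u)"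
      using s by (auto intro!: derivative_eq_intros derivs)
  next
    fix u assume u: "s < u" "u \<le> r" "X u * L u - 1 = 0"
    then show "0 < (1 - (L u)\<^sup>2 - 2 * (M u)\<^sup>2) * L u + X u * (1 - X u * L u)"
      using X'[of u] pos(1)[of u] s by (simp add: mult_pos_pos)
  qed (use s trap in \<open>auto simp: trap_def\<close>)
  have XL2: "2 - X r * L r > 0"
  proof (rule stays_pos[where s = s and r = r and g = "\<lambda>t. 2 - X t * L t"])
    fix u assume u: "s \<le> u" "u \<le> r"
    then show "((\<lambda>t. 2 - X t * L t) has_real_derivative - ((1 - (L u)\<^sup>2 - 2 * (M u)\<^sup>2) * L u + X u * (1 - X u * L u))) (at u)"
      using s by (auto intro!: derivative_eq_intros derivs)
  next
    fix u assume u: "s < u" "u \<le> r" "2 - X u * L u = 0"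
    have "(1 - (L u)\<^sup>2 - 2 * (M u)\<^sup>2) * L u \<le> 1 * L u"
      using X'[of u] pos(1)[of u] u s by (intro mult_right_mono) auto
    moreover have "X u * (1 - X u * L u) = - X u" using u by simp
    ultimately show "0 < - ((1 - (L u)\<^sup>2 - 2 * (M u)\<^sup>2) * L u + X u * (1 - X u * L u))"
      using X[of u] L[of u] u by linarith
  qed (use s trap in \<open>auto simp: trap_def\<close>)
  have XM1: "X r * M r - 1 > 0"
  proof (rule stays_pos[where s = s and r = r and g = "\<lambda>t. X t * M t - 1"])
    fix u assume u: "s \<le> u" "u \<le> r"
    then show "((\<lambda>t. X t * M t - 1) has_real_derivative (1 - (L u)\<^sup>2 - 2 * (M u)\<^sup>2) * M u + X u * (1 + (W u)\<^sup>2 - X u * M u)) (at u)"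
      using s by (auto intro!: derivative_eq_intros derivs)
  next
    fix u assume u: "s < u" "u \<le> r" "X u * M u - 1 = 0"
    have "(1 - (L u)\<^sup>2 - 2 * (M u)\<^sup>2) * M u > 0" using X'[of u] pos(2)[of u] u s by (intro mult_pos_pos) auto
    moreover have "X u * (1 + (W u)\<^sup>2 - X u * M u) = X u * (W u)\<^sup>2" using u by simp
    moreover have "X u * (W u)\<^sup>2 \<ge> 0" using X[of u] u by simp
    ultimately show "0 < (1 - (L u)\<^sup>2 - 2 * (M u)\<^sup>2) * M u + X u * (1 + (W u)\<^sup>2 - X u * M u)" by linarith
  qed (use s trap in \<open>auto simp: trap_def\<close>)
  have XM2: "3 - X r * M r > 0"
  proof (rule stays_pos[where s = s and r = r and g = "\<lambda>t. 3 - X t * M t"])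
    fix u assume u: "s \<le> u" "u \<le> r"
    then show "((\<lambda>t. 3 - X t * M t) has_real_derivative - ((1 - (L u)\<^sup>2 - 2 * (M u)\<^sup>2) * M u + X u * (1 + (W u)\<^sup>2 - X u * M u))) (at u)"
      using s by (auto intro!: derivative_eq_intros derivs)
  next
    fix u assume u: "s < u" "u \<le> r" "3 - X u * M u = 0"
    have "(1 - (L u)\<^sup>2 - 2 * (M u)\<^sup>2) * M u \<le> 1 * M u"
      using X'[of u] pos(2)[of u] u s by (intro mult_right_mono) auto
    moreover have "X u * (1 + (W u)\<^sup>2 - X u * M u) \<le> X u * (- 1)"
      using u W2[of u] X[of u] by (intro mult_left_mono) auto
    ultimately show "0 < - ((1 - (L u)\<^sup>2 - 2 * (M u)\<^sup>2) * M u + X u * (1 + (W u)\<^sup>2 - X u * M u))"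
      using X[of u] M[of u] u by linarith
  qed (use s trap in \<open>auto simp: trap_def\<close>)
  show ?thesis using U[OF s(2)] L[OF s(2)] M[OF s(2)] W[OF s(2)] XL1 XL2 XM1 XM2 by (simp add: trap_def)
qed

text \<open>(X W)' = (X' - X M) W with X' \<le> 1 < X M. This makes W^2 of order 1/X^2, as the
  forcing term of G requires.\<close>

lemma XW_antimono:
  assumes s: "0 < s" "s \<le> r" and trap: "trap s" shows "X r * W r \<le> X s * W s"
proof (rule deriv_nonpos_ge[OF s(2), where g = "\<lambda>r. X r * W r"])
  fix t assume t: "s \<le> t" "t \<le> r"
  then show "((\<lambda>r. X r * W r) has_real_derivative ((1 - (L t)\<^sup>2 - 2 * (M t)\<^sup>2) - X t * M t) * W t) (at t)"
    using s by (auto intro!: derivative_eq_intros derivs simp: algebra_simps)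
  have "trap t" using trap_persists[OF s(1) t(1) trap] .
  then have "(1 - (L t)\<^sup>2 - 2 * (M t)\<^sup>2) - X t * M t \<le> 0"
    using dX_bounds(2)[of t] t s unfolding trap_def by auto
  then show "((1 - (L t)\<^sup>2 - 2 * (M t)\<^sup>2) - X t * M t) * W t \<le> 0"
    using pos(3)[of t] t s by (intro mult_nonpos_nonneg) auto
qed

text \<open>In the trap M^2 \<le> 9/X^2 and L^2 \<le> 4/X^2, so \<open>decay_tail\<close> applies to
  E with K = 18 and to G with K = 13 + (X W)^2; thus 76 is 4 * 19.\<close>

definition "tail_a s = \<bar>E s\<bar> + 76 / X s"
definition "tail_b s = \<bar>G s\<bar> + 4 * (14 + (X s * W s)\<^sup>2) / X s"

lemma trap_tails:
  assumes s: "0 < s" "s \<le> r" and trap: "trap s"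
  shows "\<bar>ln_a' r - ln_a' s\<bar> \<le> tail_a s" "\<bar>ln_b' r - ln_b' s\<bar> \<le> tail_b s"
    and "\<bar>E r\<bar> \<le> \<bar>E s\<bar> * exp (s - r) + 19 / (X r)\<^sup>2"
    and "\<bar>G r\<bar> \<le> \<bar>G s\<bar> * exp (s - r) + (14 + (X s * W s)\<^sup>2) / (X r)\<^sup>2"
proof -
  have tr: "trap t" if "t \<ge> s" for t using trap_persists[OF s(1) that trap] .
  have p: "t > 0" if "t \<ge> s" for t using s that by simp
  have X4: "X t \<ge> 4" if "t \<ge> s" for t using X_gt_4[OF p[OF that]] tr[OF that] unfolding trap_def by auto
  have X': "1/4 \<le> 1 - (L t)\<^sup>2 - 2 * (M t)\<^sup>2" "1 - (L t)\<^sup>2 - 2 * (M t)\<^sup>2 \<le> 1" if "t \<ge> s" for t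
    using dX_bounds[OF p[OF that]] tr[OF that] unfolding trap_def by auto
  \<comment> \<open>Turns the bounds on X L, X M and X W into bounds of order 1/X^2 for the
    squares.\<close>
  have sq: "P\<^sup>2 \<le> c\<^sup>2 / (X t)\<^sup>2" if t: "t \<ge> s" and "0 \<le> P" "X t * P \<le> c" for P c t
  proof -
    have "(X t * P)\<^sup>2 \<le> c\<^sup>2" using that X4[OF t] by (intro power_mono) auto
    then show ?thesis using X4[OF t] by (simp add: field_simps power_mult_distrib)
  qed
  have M2: "(M t)\<^sup>2 \<le> 3\<^sup>2 / (X t)\<^sup>2" if "t \<ge> s" for t
    by (rule sq[OF that]) (use tr[OF that] pos(2)[OF p[OF that]] in \<open>auto simp: trap_def\<close>)
  have L2: "(L t)\<^sup>2 \<le> 2\<^sup>2 / (X t)\<^sup>2" if "t \<ge> s" for t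
    by (rule sq[OF that]) (use tr[OF that] pos(1)[OF p[OF that]] in \<open>auto simp: trap_def\<close>)
  have W2: "(W t)\<^sup>2 \<le> (X s * W s)\<^sup>2 / (X t)\<^sup>2" if "t \<ge> s" for t
    by (rule sq[OF that]) (use XW_antimono[OF s(1) that trap] pos(3)[OF p[OF that]] in auto)
  have inv: "1 / P \<ge> 2" if "0 < P" "P < 1/2" for P :: real using that by (simp add: field_simps)
  have pE: "3/2 \<le> 1 / L t - L t" if "t \<ge> s" for t
    using inv[of "L t"] pos(1)[OF p[OF that]] tr[OF that] unfolding trap_def by auto
  have pG: "3/2 \<le> (1 + (W t)\<^sup>2) / M t - M t" if "t \<ge> s" for t
  proof -
    have "1 / M t \<le> (1 + (W t)\<^sup>2) / M t" using pos(2)[OF p[OF that]] by (intro divide_right_mono) auto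
    moreover have "M t < 1/2" using tr[OF that] unfolding trap_def by blast
    moreover have "1 / M t \<ge> 2" using inv[of "M t"] pos(2)[OF p[OF that]] calculation(2) by blast
    ultimately show ?thesis by linarith
  qed
  have hE: "\<bar>2 * (M t)\<^sup>2\<bar> \<le> 18 / (X t)\<^sup>2" if "t \<ge> s" for t using M2[OF that] by (simp add: power2_eq_square)
  have hG: "\<bar>(M t)\<^sup>2 + (L t)\<^sup>2 - (W t)\<^sup>2\<bar> \<le> (13 + (X s * W s)\<^sup>2) / (X t)\<^sup>2" if "t \<ge> s" for t
  proof -
    have "\<bar>(M t)\<^sup>2 + (L t)\<^sup>2 - (W t)\<^sup>2\<bar> \<le> (M t)\<^sup>2 + (L t)\<^sup>2 + (W t)\<^sup>2"
      using zero_le_power2[of "M t"] zero_le_power2[of "L t"] zero_le_power2[of "W t"] by linarith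
    then show ?thesis using M2[OF that] L2[OF that] W2[OF that] by (simp add: add_divide_distrib)
  qed
  note tE = decay_tail[OF dE[OF p] d_ln_a'[OF p] derivs(3)[OF p] pE X4 X' hE s(2)]
  note tG = decay_tail[OF dG[OF p] d_ln_b'[OF p] derivs(3)[OF p] pG X4 X' hG s(2)]
  show "\<bar>ln_a' r - ln_a' s\<bar> \<le> tail_a s" using tE(2) by (simp add: tail_a_def)
  show "\<bar>ln_b' r - ln_b' s\<bar> \<le> tail_b s" using tG(2) by (simp add: tail_b_def add_ac)
  show "\<bar>E r\<bar> \<le> \<bar>E s\<bar> * exp (s - r) + 19 / (X r)\<^sup>2" using tE(1) by simp
  show "\<bar>G r\<bar> \<le> \<bar>G s\<bar> * exp (s - r) + (14 + (X s * W s)\<^sup>2) / (X r)\<^sup>2" using tG(1) by (simp add: add_ac)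
qed

section \<open>Entry of every trajectory into the trap\<close>

lemma filterlim_U: "filterlim U at_top at_top"
proof (rule filterlim_at_top_mono)
  \<comment> \<open>U' = 2 q and q increases, so U grows at least linearly.\<close>
  show "filterlim (\<lambda>r. U 1 + 2 * q 1 * (r - 1)) at_top at_top"
    using pos(4)[of 1] by real_asymp
  show "\<forall>\<^sub>F r in at_top. U 1 + 2 * q 1 * (r - 1) \<le> U r"
    using eventually_ge_at_top[of 1]
  proof eventually_elim
    case (elim r)
    have "U 1 - 2 * q 1 * 1 \<le> U r - 2 * q 1 * r"
    proof (rule deriv_nonneg_le[OF elim, where g = "\<lambda>r. U r - 2 * q 1 * r" and g' = "\<lambda>r. 2 * q r - 2 * q 1"])
      fix t assume t: "1 \<le> t" "t \<le> r"
      show "((\<lambda>r. U r - 2 * q 1 * r) has_real_derivative 2 * q t - 2 * q 1) (at t)"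
        using t by (auto intro!: derivative_eq_intros derivs)
      show "0 \<le> 2 * q t - 2 * q 1" using mono_facts(2)[of 1 t] t by simp
    qed
    then show ?case by (simp add: algebra_simps)
  qed
qed

lemma filterlim_X: "filterlim X at_top at_top"
proof (rule filterlim_at_top_mono)
  show "filterlim (\<lambda>r. sqrt (U r)) at_top at_top"
    by (rule filterlim_compose[OF sqrt_at_top filterlim_U])
  show "\<forall>\<^sub>F r in at_top. sqrt (U r) \<le> X r"
    using eventually_gt_at_top[of 0] by eventually_elim (rule X_ge, use pos(5) in \<open>auto simp: less_imp_le\<close>)
qed

text \<open>P stands for L or M and z for ln a or ln b. As X grows at most linearly,
  \<open>\<mu> / (r + k)\<close> is a barrier below P, and its integral diverges
  logarithmically.\<close>

lemma integral_diverges: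
  assumes P: "\<And>t. t \<ge> 1 \<Longrightarrow> (P has_real_derivative P' t) (at t)" "\<And>t. t \<ge> 1 \<Longrightarrow> P' t \<ge> 1 - X t * P t"
    "\<And>t. t \<ge> 1 \<Longrightarrow> P t > 0" and z: "\<And>t. t \<ge> 1 \<Longrightarrow> (z has_real_derivative P t) (at t)"
  shows "filterlim z at_top at_top"
proof -
  define k where "k = X 1"
  \<comment> \<open>The bound 1/2 gives X P \<le> \<mu> < 1 at contact, so P is increasing there
    while the barrier decreases.\<close>
  define \<mu> where "\<mu> = min (1/2) (P 1)"
  have k: "k > 0" using pos(6)[of 1] by (simp add: k_def)
  have \<mu>: "0 < \<mu>" "\<mu> \<le> 1/2" "\<mu> \<le> P 1" using P(3)[of 1] by (auto simp: \<mu>_def)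
  have low: "P r > \<mu> / (r + k)" if r: "r \<ge> 1" for r
  proof -
    have "P r - \<mu> / (r + k) > 0"
    proof (rule stays_pos[OF r, where g = "\<lambda>r. P r - \<mu> / (r + k)" and g' = "\<lambda>r. P' r + \<mu> / (r + k)\<^sup>2"])
      fix t assume t: "1 \<le> t" "t \<le> r"
      show "((\<lambda>r. P r - \<mu> / (r + k)) has_real_derivative P' t + \<mu> / (t + k)\<^sup>2) (at t)"
        using t k by (auto intro!: derivative_eq_intros P simp: power2_eq_square field_simps)
    next
      have "\<mu> / (1 + k) < \<mu> / 1" using \<mu> k by (intro divide_strict_left_mono) auto
      then show "0 < P 1 - \<mu> / (1 + k)" using \<mu> by simp
    next
      fix t assume t: "1 < t" "t \<le> r" "P t - \<mu> / (t + k) = 0"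
      have "X t \<le> t + k" using X_upper[of 1 t] t unfolding k_def by simp
      then have "X t * P t \<le> (t + k) * P t" using P(3)[of t] t by (intro mult_right_mono) auto
      also have "\<dots> = \<mu>" using t k by (simp add: field_simps)
      finally have "P' t > 0" using P(2)[of t] t \<mu> by simp
      then show "0 < P' t + \<mu> / (t + k)\<^sup>2" using \<mu> by (simp add: add_pos_nonneg)
    qed
    then show ?thesis by simp
  qed
  show ?thesis
  proof (rule filterlim_at_top_mono)
    show "filterlim (\<lambda>r. z 1 - \<mu> * ln (1 + k) + \<mu> * ln (r + k)) at_top at_top"
      using \<mu>(1) by real_asymp
    show "\<forall>\<^sub>F r in at_top. z 1 - \<mu> * ln (1 + k) + \<mu> * ln (r + k) \<le> z r"
      using eventually_ge_at_top[of 1]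
    proof eventually_elim
      case (elim r)
      have "z 1 - \<mu> * ln (1 + k) \<le> z r - \<mu> * ln (r + k)"
      proof (rule deriv_nonneg_le[OF elim, where g = "\<lambda>r. z r - \<mu> * ln (r + k)" and g' = "\<lambda>r. P r - \<mu> / (r + k)"])
        fix t assume t: "1 \<le> t" "t \<le> r"
        show "((\<lambda>r. z r - \<mu> * ln (r + k)) has_real_derivative P t - \<mu> / (t + k)) (at t)"
          using t k by (auto intro!: derivative_eq_intros z)
        show "0 \<le> P t - \<mu> / (t + k)" using low[of t] t by simp
      qed
      then show ?case by simp
    qed
  qed
qed

text \<open>While X P \<le> 1, P' is nonnegative and X P grows at rate at least P/4. As the integral
  of P diverges, X P cannot stay below 1; on the level 1 it still increases, so it remains
  above.\<close>

lemma eventually_above_1: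
  assumes P: "\<And>t. t \<ge> 1 \<Longrightarrow> (P has_real_derivative P' t) (at t)" "\<And>t. t \<ge> 1 \<Longrightarrow> P' t \<ge> 1 - X t * P t"
    "\<And>t. t \<ge> 1 \<Longrightarrow> P t > 0" and z: "\<And>t. t \<ge> 1 \<Longrightarrow> (z has_real_derivative P t) (at t)"
    and s: "s \<ge> 1" "\<And>t. t \<ge> s \<Longrightarrow> L t < 1/2" "\<And>t. t \<ge> s \<Longrightarrow> M t < 1/2"
  shows "\<forall>\<^sub>F r in at_top. X r * P r > 1"
proof -
  have d: "((\<lambda>r. X r * P r) has_real_derivative (1 - (L t)\<^sup>2 - 2 * (M t)\<^sup>2) * P t + X t * P' t) (at t)" if "t \<ge> s" for t
    using that s by (auto intro!: derivative_eq_intros derivs P)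
  have low: "(1 - (L t)\<^sup>2 - 2 * (M t)\<^sup>2) * P t + X t * P' t \<ge> P t / 4" if "t \<ge> s" "X t * P t \<le> 1" for t
  proof -
    have "P' t \<ge> 0" using P(2)[of t] that s by simp
    then have "X t * P' t \<ge> 0" using pos(6)[of t] that s by simp
    moreover have "(1 - (L t)\<^sup>2 - 2 * (M t)\<^sup>2) * P t \<ge> 1/4 * P t"
      using dX_bounds(1)[of t] s(2,3)[of t] P(3)[of t] that s by (intro mult_right_mono) auto
    ultimately show ?thesis by simp
  qed
  obtain t where t: "t \<ge> s" "X t * P t > 1"
  proof (rule ccontr)
    assume "\<not> thesis"
    then have le: "X t * P t \<le> 1" if "t \<ge> s" for t
      using that \<open>\<And>t. s \<le> t \<Longrightarrow> 1 < X t * P t \<Longrightarrow> thesis\<close> by force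
    have "filterlim z at_top at_top" using integral_diverges[OF P z] .
    then have "\<forall>\<^sub>F r in at_top. z r > 4 + z s" by (simp add: filterlim_at_top_dense)
    then have "\<forall>\<^sub>F r in at_top. z r > 4 + z s \<and> r \<ge> s" using eventually_ge_at_top[of s] by eventually_elim simp
    then obtain r where r: "z r > 4 + z s" "r \<ge> s" unfolding eventually_at_top_linorder by auto
    have "X s * P s - z s / 4 \<le> X r * P r - z r / 4"
    proof (rule deriv_nonneg_le[OF r(2), where g = "\<lambda>r. X r * P r - z r / 4"
          and g' = "\<lambda>t. (1 - (L t)\<^sup>2 - 2 * (M t)\<^sup>2) * P t + X t * P' t - P t / 4"])
      fix t assume t: "s \<le> t" "t \<le> r"
      have "((\<lambda>r. z r / 4) has_real_derivative P t / 4) (at t)"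
        using z[of t] t s by (intro DERIV_cdivide) auto
      then show "((\<lambda>r. X r * P r - z r / 4) has_real_derivative (1 - (L t)\<^sup>2 - 2 * (M t)\<^sup>2) * P t + X t * P' t - P t / 4) (at t)"
        by (intro derivative_intros d t)
      show "0 \<le> (1 - (L t)\<^sup>2 - 2 * (M t)\<^sup>2) * P t + X t * P' t - P t / 4" using low[of t] le[of t] t by simp
    qed
    moreover have "X s * P s > 0" using pos(6)[of s] P(3)[of s] s by simp
    ultimately show False using r le[of r] by simp
  qed
  have "X r * P r > 1" if "r \<ge> t" for r
  proof -
    have "X r * P r - 1 > 0"
    proof (rule stays_pos[OF that, where g = "\<lambda>r. X r * P r - 1"])
      fix u assume "t \<le> u" "u \<le> r"
      then show "((\<lambda>r. X r * P r - 1) has_real_derivative (1 - (L u)\<^sup>2 - 2 * (M u)\<^sup>2) * P u + X u * P' u) (at u)"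
        using t by (auto intro!: derivative_eq_intros d[THEN DERIV_cong])
    next
      fix u assume "t < u" "X u * P u - 1 = 0"
      then show "0 < (1 - (L u)\<^sup>2 - 2 * (M u)\<^sup>2) * P u + X u * P' u"
        using low[of u] P(3)[of u] t s by simp
    qed (use t in auto)
    then show ?thesis by simp
  qed
  then show ?thesis by (auto simp: eventually_at_top_linorder)
qed

lemma d_neg_ln_W: "r > 0 \<Longrightarrow> ((\<lambda>r. - ln (W r)) has_real_derivative M r) (at r)"
  using pos(3)[of r] by (auto intro!: derivative_eq_intros derivs)

lemma d_ln_a: "r > 0 \<Longrightarrow> ((\<lambda>r. ln (a r)) has_real_derivative L r) (at r)"
  using pos(7)[of r] by (auto intro!: derivative_eq_intros derivs)

lemma eventually_W: "\<forall>\<^sub>F r in at_top. W r < 1/2"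
proof -
  have "filterlim (\<lambda>r. - ln (W r)) at_top at_top"
    by (rule integral_diverges[OF derivs(2) _ _ d_neg_ln_W]) (use pos in auto)
  then have "\<forall>\<^sub>F r in at_top. - ln (1/2) < - ln (W r)" unfolding filterlim_at_top_dense by blast
  then show ?thesis using eventually_gt_at_top[of 0]
  proof eventually_elim
    case (elim r)
    then show ?case using pos(3)[of r] ln_less_cancel_iff[of "W r" "1/2"] by linarith
  qed
qed

text \<open>The conditions are reached in an order in which each uses the earlier ones: X and U
  large, W small, then L and M small, then the upper and the lower bounds for X L and X M.\<close>

lemma eventually_trap: "\<forall>\<^sub>F r in at_top. trap r"
proof -
  \<comment> \<open>With X > k, M \<ge> 1/2 gives X M \<ge> 4 + W(1)^2 and so M' \<le> -1; k \<ge> 8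
    leaves a margin for the upper bounds on the products.\<close>
  define k where "k = 2 * (2 + (W 1)\<^sup>2) + 4"
  have "\<forall>\<^sub>F r in at_top. X r > k \<and> U r > 16 \<and> W r < 1/2 \<and> r > 1"
    using filterlim_X filterlim_U eventually_W eventually_gt_at_top[of 1]
    by (simp add: filterlim_at_top_dense eventually_conj_iff)
  then obtain s where s: "\<And>r. r \<ge> s \<Longrightarrow> X r > k \<and> U r > 16 \<and> W r < 1/2 \<and> r > 1"
    unfolding eventually_at_top_linorder by auto
  have k: "k \<ge> 8" by (simp add: k_def)
  have s1: "s > 1" using s[of s] by simp
  have evL: "\<forall>\<^sub>F r in at_top. L r < 1/2"
  proof (rule eventually_below[where s = s and \<eta> = 1])
    fix t assume t: "t \<ge> s" "1/2 \<le> L t"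
    have "4 * (1/2) \<le> X t * L t" using s[of t] t k by (intro mult_mono) auto
    then show "1 - X t * L t \<le> - 1" by simp
  qed (use s1 derivs in auto)
  have evM: "\<forall>\<^sub>F r in at_top. M r < 1/2"
  proof (rule eventually_below[where s = s and \<eta> = 1])
    fix t assume t: "t \<ge> s" "1/2 \<le> M t"
    have "k * (1/2) \<le> X t * M t" using s[of t] t k by (intro mult_mono) auto
    moreover have "(W t)\<^sup>2 \<le> (W 1)\<^sup>2" using mono_facts(1)[of 1 t] pos(3)[of t] t s1 by (intro power_mono) auto
    ultimately show "1 + (W t)\<^sup>2 - X t * M t \<le> - 1" by (simp add: k_def)
  qed (use s1 derivs in auto)
  have "\<forall>\<^sub>F r in at_top. L r < 1/2 \<and> M r < 1/2 \<and> r > s" using evL evM eventually_gt_at_top[of s] by eventually_elim simp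
  then obtain s' where s': "\<And>r. r \<ge> s' \<Longrightarrow> L r < 1/2 \<and> M r < 1/2 \<and> r > s"
    unfolding eventually_at_top_linorder by auto
  have ss: "s' > s" "s' > 1" using s'[of s'] s1 by auto
  have g0: "t > 0" if "t \<ge> s'" for t using that ss by simp
  have X8: "X t > 8" if "t \<ge> s'" for t using s[of t] that ss k by simp
  have W2: "(W t)\<^sup>2 < 1/4" if "t \<ge> s'" for t
    using power_strict_mono[of "W t" "1/2" 2] s[of t] pos(3)[OF g0[OF that]] ss that by (simp add: power2_eq_square)
  have evXL2: "\<forall>\<^sub>F r in at_top. X r * L r < 2"
  proof (rule eventually_below[where s = s' and \<eta> = 1, OF dXP(1)])
    fix t assume t: "t \<ge> s'" "2 \<le> X t * L t"
    have "(1 - (L t)\<^sup>2 - 2 * (M t)\<^sup>2) * L t \<le> 1 * L t"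
      using dX_bounds(2)[OF g0[OF t(1)]] s'[OF t(1)] pos(1)[OF g0[OF t(1)]] by (intro mult_right_mono) auto
    moreover have "X t * (1 - X t * L t) \<le> X t * (- 1)" using t X8[OF t(1)] by (intro mult_left_mono) auto
    ultimately show "(1 - (L t)\<^sup>2 - 2 * (M t)\<^sup>2) * L t + X t * (1 - X t * L t) \<le> - 1"
      using X8[OF t(1)] s'[OF t(1)] by linarith
  qed (use g0 in auto)
  have evXM2: "\<forall>\<^sub>F r in at_top. X r * M r < 3"
  proof (rule eventually_below[where s = s' and \<eta> = 1, OF dXP(2)])
    fix t assume t: "t \<ge> s'" "3 \<le> X t * M t"
    have "(1 - (L t)\<^sup>2 - 2 * (M t)\<^sup>2) * M t \<le> 1 * M t"
      using dX_bounds(2)[OF g0[OF t(1)]] s'[OF t(1)] pos(2)[OF g0[OF t(1)]] by (intro mult_right_mono) auto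
    moreover have "X t * (1 + (W t)\<^sup>2 - X t * M t) \<le> X t * (- 1)"
      using t X8[OF t(1)] W2[OF t(1)] by (intro mult_left_mono) auto
    ultimately show "(1 - (L t)\<^sup>2 - 2 * (M t)\<^sup>2) * M t + X t * (1 + (W t)\<^sup>2 - X t * M t) \<le> - 1"
      using X8[OF t(1)] s'[OF t(1)] by linarith
  qed (use g0 in auto)
  have evXL1: "\<forall>\<^sub>F r in at_top. X r * L r > 1"
    by (rule eventually_above_1[OF derivs(1) _ _ d_ln_a, where s = s']) (use pos ss s' in auto)
  have evXM1: "\<forall>\<^sub>F r in at_top. X r * M r > 1"
    by (rule eventually_above_1[OF derivs(2) _ _ d_neg_ln_W, where s = s']) (use pos ss s' in auto)
  show ?thesis using eventually_ge_at_top[of s'] evXL1 evXL2 evXM1 evXM2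
  proof eventually_elim
    case (elim r)
    then show ?case using s[of r] s'[of r] ss by (simp add: trap_def)
  qed
qed

text \<open>From one trapped time on, E and G decay up to O(1/X^2) and X W does not increase, so the
  tail bounds tend to 0. The constants 33 and 132 in \<open>g\<close> are chosen to dominate the
  bounds for E and for G simultaneously.\<close>

lemma ex_small_tail:
  assumes "e > 0"
  obtains s where "s > 0" "trap s" "tail_a s < e" "tail_b s < e"
proof -
  have "\<forall>\<^sub>F r in at_top. trap r \<and> r > 0" using eventually_trap eventually_gt_at_top[of 0] by eventually_elim simp
  then obtain s where s: "trap s" "s > 0" unfolding eventually_at_top_linorder by auto
  define \<kappa> where "\<kappa> = (X s * W s)\<^sup>2"
  define g where "g = (\<lambda>r. (\<bar>E s\<bar> + \<bar>G s\<bar>) * exp (s - r) + (33 + \<kappa>) / (X r)\<^sup>2 + (132 + 4 * \<kappa>) / X r)"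
  have "((\<lambda>r. c * exp (s - r)) \<longlongrightarrow> 0) at_top" for c :: real by real_asymp
  then have "((\<lambda>r. (\<bar>E s\<bar> + \<bar>G s\<bar>) * exp (s - r)) \<longlongrightarrow> 0) at_top" .
  moreover have "((\<lambda>r. (33 + \<kappa>) / (X r)\<^sup>2) \<longlongrightarrow> 0) at_top"
    by (intro tendsto_divide_0[OF tendsto_const] filterlim_at_top_imp_at_infinity filterlim_pow_at_top filterlim_X) auto
  moreover have "((\<lambda>r. (132 + 4 * \<kappa>) / X r) \<longlongrightarrow> 0) at_top"
    by (intro tendsto_divide_0[OF tendsto_const] filterlim_at_top_imp_at_infinity filterlim_X)
  ultimately have "(g \<longlongrightarrow> 0 + 0 + 0) at_top" unfolding g_def by (intro tendsto_add)
  then have "\<forall>\<^sub>F r in at_top. g r < e" using order_tendstoD(2)[of g 0 at_top e] assms by simp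
  then have "\<forall>\<^sub>F r in at_top. g r < e \<and> r \<ge> s" using eventually_ge_at_top[of s] by eventually_elim simp
  then obtain r where r: "g r < e" "r \<ge> s" unfolding eventually_at_top_linorder by auto
  have r0: "r > 0" using r s by simp
  have \<kappa>: "\<kappa> \<ge> 0" by (simp add: \<kappa>_def)
  have "(X r * W r)\<^sup>2 \<le> \<kappa>" unfolding \<kappa>_def using XW_antimono[OF s(2) r(2) s(1)] pos[OF r0]
    by (intro power_mono) auto
  then have "4 * (14 + (X r * W r)\<^sup>2) / X r \<le> (132 + 4 * \<kappa>) / X r" "76 / X r \<le> (132 + 4 * \<kappa>) / X r"
    using pos(6)[OF r0] \<kappa> by (auto intro!: divide_right_mono)
  moreover have "\<bar>E r\<bar> \<le> (\<bar>E s\<bar> + \<bar>G s\<bar>) * exp (s - r) + (33 + \<kappa>) / (X r)\<^sup>2"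
    by (rule order_trans[OF trap_tails(3)[OF s(2) r(2) s(1)]])
       (use \<kappa> in \<open>auto intro!: add_mono mult_right_mono divide_right_mono\<close>)
  moreover have "\<bar>G r\<bar> \<le> (\<bar>E s\<bar> + \<bar>G s\<bar>) * exp (s - r) + (33 + \<kappa>) / (X r)\<^sup>2"
    by (rule order_trans[OF trap_tails(4)[OF s(2) r(2) s(1)]])
       (use \<kappa> in \<open>auto intro!: add_mono mult_right_mono divide_right_mono simp: \<kappa>_def\<close>)
  ultimately have "tail_a r < e" "tail_b r < e" using r unfolding tail_a_def tail_b_def g_def by linarith+
  then show ?thesis using that[of r] r0 trap_persists[OF s(2) r(2) s(1)] by simp
qed

section \<open>Existence of the asymptotic slopes\<close>

lemma ln_slopes_converge: "\<exists>l. (ln_a' \<longlongrightarrow> l) at_top" "\<exists>l. (ln_b' \<longlongrightarrow> l) at_top"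
proof -
  have "\<exists>s. \<forall>r\<ge>s. \<bar>ln_a' r - ln_a' s\<bar> \<le> e \<and> \<bar>ln_b' r - ln_b' s\<bar> \<le> e" if e: "e > 0" for e
  proof -
    obtain s where s: "s > 0" "trap s" "tail_a s < e" "tail_b s < e" using ex_small_tail[OF e] .
    then show ?thesis using trap_tails(1,2)[OF s(1) _ s(2)] by (intro exI[of _ s]) (meson less_imp_le order_trans)
  qed
  note * = this
  show "\<exists>l. (ln_a' \<longlongrightarrow> l) at_top" by (rule tendsto_at_top_if_tails) (use * in blast)
  show "\<exists>l. (ln_b' \<longlongrightarrow> l) at_top" by (rule tendsto_at_top_if_tails) (use * in blast)
qed

lemma ln_slope_tail:
  assumes "(ln_a' \<longlongrightarrow> l) at_top" "(ln_b' \<longlongrightarrow> l') at_top" "s > 0" "trap s"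
  shows "\<bar>l - ln_a' s\<bar> \<le> tail_a s" "\<bar>l' - ln_b' s\<bar> \<le> tail_b s"
proof -
  have ev: "\<forall>\<^sub>F r in at_top. r \<ge> s" by (rule eventually_ge_at_top)
  show "\<bar>l - ln_a' s\<bar> \<le> tail_a s"
  proof (rule tendsto_upperbound)
    show "((\<lambda>r. \<bar>ln_a' r - ln_a' s\<bar>) \<longlongrightarrow> \<bar>l - ln_a' s\<bar>) at_top" by (intro tendsto_intros assms)
    show "\<forall>\<^sub>F r in at_top. \<bar>ln_a' r - ln_a' s\<bar> \<le> tail_a s" using ev by eventually_elim (use trap_tails assms in auto)
  qed auto
  show "\<bar>l' - ln_b' s\<bar> \<le> tail_b s"
  proof (rule tendsto_upperbound)
    show "((\<lambda>r. \<bar>ln_b' r - ln_b' s\<bar>) \<longlongrightarrow> \<bar>l' - ln_b' s\<bar>) at_top" by (intro tendsto_intros assms)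
    show "\<forall>\<^sub>F r in at_top. \<bar>ln_b' r - ln_b' s\<bar> \<le> tail_b s" using ev by eventually_elim (use trap_tails assms in auto)
  qed auto
qed

text \<open>Exponentials of limits make positivity immediate and match the continuity proof, which
  works with the logarithms.\<close>

definition "slope_a = exp (Lim at_top ln_a')"
definition "slope_b = exp (Lim at_top ln_b')"

lemma ln_slopes: "(ln_a' \<longlongrightarrow> ln slope_a) at_top" "(ln_b' \<longlongrightarrow> ln slope_b) at_top"
  unfolding slope_a_def slope_b_def ln_exp using ln_slopes_converge
  by (metis tendsto_Lim trivial_limit_at_top_linorder)+

lemma slopes_pos: "slope_a > 0" "slope_b > 0" by (simp_all add: slope_a_def slope_b_def)

lemma slopes: "((\<lambda>r. L r * a r) \<longlongrightarrow> slope_a) at_top" "((\<lambda>r. M r / W r) \<longlongrightarrow> slope_b) at_top"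
proof -
  have "((\<lambda>r. exp (ln_a' r)) \<longlongrightarrow> slope_a) at_top"
    using tendsto_exp[OF ln_slopes(1)] slopes_pos by simp
  then show "((\<lambda>r. L r * a r) \<longlongrightarrow> slope_a) at_top"
  proof (rule Lim_transform_eventually)
    show "\<forall>\<^sub>F r in at_top. exp (ln_a' r) = L r * a r"
      using eventually_gt_at_top[of 0]
    proof eventually_elim
      case (elim r)
      then show ?case using pos(1,7)[of r] by (simp add: ln_a'_def)
    qed
  qed
  have "((\<lambda>r. exp (ln_b' r)) \<longlongrightarrow> slope_b) at_top"
    using tendsto_exp[OF ln_slopes(2)] slopes_pos by simp
  then show "((\<lambda>r. M r / W r) \<longlongrightarrow> slope_b) at_top"
  proof (rule Lim_transform_eventually)
    show "\<forall>\<^sub>F r in at_top. exp (ln_b' r) = M r / W r"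
      using eventually_gt_at_top[of 0]
    proof eventually_elim
      case (elim r)
      then show ?case using pos(2,3)[of r] by (simp add: ln_b'_def)
    qed
  qed
qed

text \<open>At an interior maximum of \<open>b'\<close> with value above 1 one has \<open>G = 0\<close> and \<open>G' = M\<^sup>2 + L\<^sup>2 - W\<^sup>2 > 0\<close>.\<close>

lemma slope_b_ge:
  assumes r1: "r1 > 0" "M r1 / W r1 > 1" shows "slope_b \<ge> M r1 / W r1"
proof -
  define \<beta> where "\<beta> = (\<lambda>r. M r / W r)"
  have d\<beta>: "(\<beta> has_real_derivative \<beta> t * G t) (at t)" if "t > 0" for t
    unfolding \<beta>_def G_def using pos[OF that] that
    by (auto intro!: derivative_eq_intros derivs simp: field_simps power2_eq_square)
  have mono: "\<beta> r1 \<le> \<beta> r2" if r2: "r2 \<ge> r1" for r2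
  proof (rule ccontr)
    assume "\<not> \<beta> r1 \<le> \<beta> r2"
    then have lt: "\<beta> r2 < \<beta> r1" "r1 < r2" using r2 by (auto simp: less_le)
    \<comment> \<open>\<open>init_slope\<close> with t = b'(r1) > 1 supplies a left end point with a
      smaller value, so the maximum over [r0, r2] is interior.\<close>
    obtain d where d: "d > 0" "\<And>t. 0 < t \<Longrightarrow> t < d \<Longrightarrow> \<beta> t < \<beta> r1"
      using init_slope[OF r1(2)] unfolding eventually_at_right_field \<beta>_def by auto
    define r0 where "r0 = min d r1 / 2"
    have r0: "0 < r0" "r0 < r1" "\<beta> r0 < \<beta> r1" using d r1 by (auto simp: r0_def min_def)
    have "continuous_on {r0..r2} \<beta>"
      by (rule DERIV_atLeastAtMost_imp_continuous_on) (use d\<beta> r0 in \<open>meson less_le_trans\<close>)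
    then obtain m where m: "m \<in> {r0..r2}" "\<And>t. t \<in> {r0..r2} \<Longrightarrow> \<beta> t \<le> \<beta> m"
      using continuous_attains_sup[of "{r0..r2}" \<beta>] r0 lt by auto
    have ge: "\<beta> m \<ge> \<beta> r1" using m(2)[of r1] r0 lt by auto
    have "m \<noteq> r0" "m \<noteq> r2" using ge r0(3) lt(1) by auto
    then have m': "r0 < m" "m < r2" "m > 0" using m(1) r0(1) by auto
    have "\<beta> m * G m = 0"
    proof (rule DERIV_local_max[OF d\<beta>[OF m'(3)], of "min (m - r0) (r2 - m)"])
      show "\<forall>y. \<bar>m - y\<bar> < min (m - r0) (r2 - m) \<longrightarrow> \<beta> y \<le> \<beta> m"
      proof (intro allI impI)
        fix y assume "\<bar>m - y\<bar> < min (m - r0) (r2 - m)"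
        then have "r0 \<le> y" "y \<le> r2" by linarith+
        then show "\<beta> y \<le> \<beta> m" using m(2)[of y] by simp
      qed
    qed (use m' in auto)
    then have G0: "G m = 0" using ge r1 by (auto simp: \<beta>_def)
    have "\<beta> m > 1" using ge r1 by (simp add: \<beta>_def)
    then have "M m > W m" using pos[OF m'(3)] by (simp add: \<beta>_def field_simps)
    then have "(M m)\<^sup>2 > (W m)\<^sup>2" using pos[OF m'(3)] by (intro power_strict_mono) auto
    then have "(M m)\<^sup>2 + (L m)\<^sup>2 - (W m)\<^sup>2 > 0" using zero_le_power2[of "L m"] by linarith
    moreover have "(G has_real_derivative (M m)\<^sup>2 + (L m)\<^sup>2 - (W m)\<^sup>2) (at m)" using dG[OF m'(3)] G0 by simp
    ultimately obtain h where h: "h > 0" "\<And>t. 0 < t \<Longrightarrow> t < h \<Longrightarrow> G m < G (m + t)"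
      using DERIV_pos_inc_right by blast
    define t where "t = min h (r2 - m) / 2"
    have t: "0 < t" "t < h" "m + t < r2" using h m' by (auto simp: t_def min_def field_simps)
    have "\<beta> m < \<beta> (m + t)"
    proof (rule DERIV_pos_imp_increasing_open[where f = "\<beta>" and a = m and b = "m + t"])
      fix u assume u: "m < u" "u < m + t"
      have "G u > 0" using h(2)[of "u - m"] u t G0 by simp
      then have "\<beta> u * G u > 0" using pos[of u] u m' unfolding \<beta>_def by simp
      then show "\<exists>y. (\<beta> has_real_derivative y) (at u) \<and> 0 < y" using d\<beta>[of u] u m' by auto
    next
      show "continuous_on {m..m + t} \<beta>"
        by (rule DERIV_atLeastAtMost_imp_continuous_on) (use d\<beta> m' in \<open>meson less_le_trans\<close>)
    qed (use t in auto)
    then show False using m(2)[of "m + t"] t m' by auto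
  qed
  show ?thesis
  proof (rule tendsto_lowerbound[OF slopes(2)])
    show "\<forall>\<^sub>F r in at_top. M r1 / W r1 \<le> M r / W r"
      using eventually_ge_at_top[of r1] by eventually_elim (use mono in \<open>simp add: \<beta>_def\<close>)
  qed auto
qed

section \<open>A priori bounds for the asymptotic slopes\<close>

lemma X_eq': "r > 0 \<Longrightarrow> X r = L r + 2 * M r + q r"
  using X_eq[of r] by simp

text \<open>1 + 1/r is a strict supersolution of y' = 1 - y^2, and X > L makes L a
  subsolution.\<close>

lemma L_lt: assumes "r > 0" shows "L r < 1 + 1 / r"
proof -
  have "1 + 1 / r - L r > 0"
  proof (rule first_zero_pos[OF assms, where g = "\<lambda>r. 1 + 1 / r - L r" and g' = "\<lambda>r. - 1 / r\<^sup>2 - (1 - X r * L r)"])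
    fix s assume s: "0 < s" "s \<le> r"
    then show "((\<lambda>r. 1 + 1 / r - L r) has_real_derivative - 1 / s\<^sup>2 - (1 - X s * L s)) (at s)"
      by (auto intro!: derivative_eq_intros derivs simp: power2_eq_square)
    assume "1 + 1 / s - L s = 0"
    then have L: "L s = 1 + 1 / s" by simp
    have "(1 + 1 / s) * (1 + 1 / s) \<le> X s * L s"
      using X_gt_L[of s] pos(6)[of s] s unfolding L by (intro mult_mono) auto
    moreover have "(1 + 1 / s) * (1 + 1 / s) = 1 + 2 / s + 1 / s\<^sup>2" by (simp add: algebra_simps add_divide_distrib power2_eq_square)
    moreover have "2 / s > 0" using s by simp
    ultimately have "1 - X s * L s < - (1 / s\<^sup>2)" by linarith
    then show "0 < - 1 / s\<^sup>2 - (1 - X s * L s)" by simp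
  next
    show "\<forall>\<^sub>F s in at_right 0. 0 < 1 + 1 / s - L s" using init_L by eventually_elim simp
  qed
  then show ?thesis by simp
qed

lemma W_le_limit: "(W \<longlongrightarrow> w) (at_right 0) \<Longrightarrow> r > 0 \<Longrightarrow> W r \<le> w"
  by (rule deriv_nonpos_le_limit[where g = W and a = 0 and g' = "\<lambda>t. - (M t * W t)"])
     (use derivs pos in \<open>auto simp: less_imp_le\<close>)

lemma U_ge: "r > 0 \<Longrightarrow> U r \<ge> C"
  by (rule deriv_nonneg_ge_limit[where g = U and a = 0 and g' = "\<lambda>t. 2 * q t"])
     (use derivs pos init_U in \<open>auto simp: less_imp_le\<close>)

text \<open>(q + U)' = U - X q + 2 q \<le> 2 (q + U), and q + U starts from C. Small C therefore
  keeps q small for a time of order ln (1/C).\<close>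

lemma qU_le: assumes "r > 0" shows "q r + U r \<le> C * exp (2 * r)"
proof -
  have "(q r + U r) * exp (- 2 * r) \<le> C"
  proof (rule deriv_nonpos_le_limit[where g = "\<lambda>r. (q r + U r) * exp (- 2 * r)" and a = 0, OF assms])
    fix t assume t: "0 < t" "t \<le> r"
    then show "((\<lambda>r. (q r + U r) * exp (- 2 * r)) has_real_derivative - (U t + X t * q t) * exp (- 2 * t)) (at t)"
      by (auto intro!: derivative_eq_intros derivs simp: algebra_simps)
    have "U t + X t * q t > 0" using pos[of t] t by (simp add: add_pos_pos)
    then show "- (U t + X t * q t) * exp (- 2 * t) \<le> 0" by (intro mult_nonpos_nonneg) auto
  next
    have "((\<lambda>r. (q r + U r) * exp (- 2 * r)) \<longlongrightarrow> (0 + C) * exp (- 2 * 0)) (at_right 0)"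
      by (intro tendsto_intros init_q init_U)
    then show "((\<lambda>r. (q r + U r) * exp (- 2 * r)) \<longlongrightarrow> C) (at_right 0)" by simp
  qed
  then have "(q r + U r) * exp (- 2 * r) * exp (2 * r) \<le> C * exp (2 * r)" by (intro mult_right_mono) auto
  then show ?thesis by (simp add: mult.assoc flip: exp_add)
qed

text \<open>This is b b', half the derivative of b^2. Its damping is L + q, free of the term 2 M
  contained in X.\<close>

definition "bb' r = M r / (W r)\<^sup>2"

lemma d_bb': "r > 0 \<Longrightarrow> (bb' has_real_derivative 1 / (W r)\<^sup>2 + 1 - (L r + q r) * bb' r) (at r)"
  unfolding bb'_def[abs_def] using pos[of r] X_eq'[of r]
  by (auto intro!: derivative_eq_intros derivs simp: field_simps power2_eq_square)

lemma d_b2: "r > 0 \<Longrightarrow> ((\<lambda>r. 1 / (W r)\<^sup>2) has_real_derivative 2 * bb' r) (at r)"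
  unfolding bb'_def using pos[of r]
  by (auto intro!: derivative_eq_intros derivs simp: field_simps power2_eq_square)

lemma d_b: "r > 0 \<Longrightarrow> ((\<lambda>r. 1 / W r) has_real_derivative M r / W r) (at r)"
  using pos[of r] by (auto intro!: derivative_eq_intros derivs simp: field_simps power2_eq_square)

lemma bb'_pos: "r > 0 \<Longrightarrow> bb' r > 0" unfolding bb'_def using pos[of r] by simp

text \<open>With L < 1 + 1/r and q \<le> 1, the damping term at contact of b b' with r/5 is at most
  (2 r + 1)/5 \<le> 3/5, below the forcing 1. Hence b b' > r/5 on (0, 1], and integration yields the
  bound.\<close>

lemma b2_ge_fifth:
  assumes q1: "\<And>s. 0 < s \<Longrightarrow> s \<le> 1 \<Longrightarrow> q s \<le> 1" shows "1 / (W 1)\<^sup>2 \<ge> 1 / 5"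
proof -
  have N: "bb' r > r / 5" if "0 < r" "r \<le> 1" for r
  proof -
    have "bb' r - r / 5 > 0"
    proof (rule first_zero_pos[where a = 0 and r = r and g = "\<lambda>r. bb' r - r / 5" and g' = "\<lambda>r. 1 / (W r)\<^sup>2 + 1 - (L r + q r) * bb' r - 1/5"])
      fix s assume s: "0 < s" "s \<le> r"
      then show "((\<lambda>r. bb' r - r / 5) has_real_derivative 1 / (W s)\<^sup>2 + 1 - (L s + q s) * bb' s - 1/5) (at s)"
        by (auto intro!: derivative_eq_intros d_bb')
      assume "bb' s - s / 5 = 0"
      then have eq: "bb' s = s / 5" by simp
      have "(L s + q s) * (s / 5) \<le> (2 + 1 / s) * (s / 5)"
        using L_lt[of s] q1[of s] s that by (intro mult_right_mono) auto
      also have "\<dots> = (2 * s + 1) / 5" using s by (simp add: field_simps)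
      also have "\<dots> \<le> 3 / 5" using s that by simp
      finally have "(L s + q s) * bb' s \<le> 3/5" unfolding eq .
      moreover have "1 / (W s)\<^sup>2 > 0" using pos(3)[of s] s by simp
      ultimately show "0 < 1 / (W s)\<^sup>2 + 1 - (L s + q s) * bb' s - 1/5" by linarith
    next
      show "\<forall>\<^sub>F s in at_right 0. 0 < bb' s - s / 5" using init_N by eventually_elim (simp add: bb'_def)
    qed (use that in auto)
    then show ?thesis by simp
  qed
  show ?thesis
  proof (rule ccontr)
    assume neg: "\<not> ?thesis"
    \<comment> \<open>In this locale b^2 has a sign but no prescribed limit at 0: a deficit
      \<open>\<delta>\<close> at r = 1 would make b^2 negative at min 1
      \<open>\<delta>\<close>.\<close>
    define \<delta> where "\<delta> = 1 / 5 - 1 / (W 1)\<^sup>2"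
    have \<delta>: "\<delta> > 0" using neg by (simp add: \<delta>_def)
    define s where "s = min 1 \<delta>"
    have s: "0 < s" "s \<le> 1" "s \<le> \<delta>" using \<delta> by (auto simp: s_def)
    have "1 / (W s)\<^sup>2 - s\<^sup>2 / 5 \<le> 1 / (W 1)\<^sup>2 - 1\<^sup>2 / 5"
    proof (rule deriv_nonneg_le[OF s(2), where g = "\<lambda>r. 1 / (W r)\<^sup>2 - r\<^sup>2 / 5" and g' = "\<lambda>r. 2 * bb' r - 2 * r / 5"])
      fix t assume t: "s \<le> t" "t \<le> 1"
      show "((\<lambda>r. 1 / (W r)\<^sup>2 - r\<^sup>2 / 5) has_real_derivative 2 * bb' t - 2 * t / 5) (at t)"
        using s t by (intro DERIV_diff d_b2) (auto intro!: derivative_eq_intros)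
      show "0 \<le> 2 * bb' t - 2 * t / 5" using N[of t] s t by simp
    qed
    moreover have "1 / (W s)\<^sup>2 > 0" using pos(3)[of s] s by simp
    moreover have "s\<^sup>2 \<le> s" using s by (simp add: power2_eq_square mult_left_le)
    ultimately show False using s(1,3) unfolding \<delta>_def one_power2 by linarith
  qed
qed

text \<open>Up to R one has q \<le> 1. Then M exceeds 1/4 on [3, R], so b grows at least linearly
  and b' = M b does too. R > 43 makes (R - 3)/40 > 1, and so \<open>slope_b_ge\<close> carries the
  value b'(R) to infinity.\<close>

lemma slope_b_large:
  assumes R: "R > 43" and C: "C * exp (2 * R) \<le> 1" shows "slope_b \<ge> (R - 3) / 40"
proof -
  have q1: "q s \<le> 1" if "0 < s" "s \<le> R" for s
  proof -
    have "C * exp (2 * s) \<le> C * exp (2 * R)" using C_pos that by simp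
    then show ?thesis using qU_le[of s] pos(5)[of s] that C by linarith
  qed
  have b1: "1 / (W 1)\<^sup>2 \<ge> 1 / 5" by (rule b2_ge_fifth) (use q1 R in auto)
  have W3: "W 3 \<le> 5/2"
  proof (rule power2_le_imp_le)
    have "(W 1)\<^sup>2 \<le> 5" using b1 pos(3)[of 1] by (simp add: field_simps)
    moreover have "(W 3)\<^sup>2 \<le> (W 1)\<^sup>2" using mono_facts(1)[of 1 3] pos(3)[of 3] by (intro power_mono) auto
    ultimately show "(W 3)\<^sup>2 \<le> (5/2)\<^sup>2" by (simp add: power2_eq_square)
  qed simp
  \<comment> \<open>As long as M \<le> 1/4: L < 2, 2 M \<le> 1/2 and q \<le> 1 give X < 7/2. Then M'
    > 1/8, which takes M past 1/4 between r = 1 and r = 3.\<close>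
  have X7: "X t * M t < 7/8" if "1 < t" "t \<le> R" "M t \<le> 1/4" for t
  proof -
    have "1 / t < 1" using that by simp
    then have "X t < 7/2" using X_eq'[of t] L_lt[of t] q1[of t] that by linarith
    then have "X t * M t < 7/2 * M t" using pos(2)[of t] that by (intro mult_strict_right_mono) auto
    then show ?thesis using that by simp
  qed
  have M3: "M 3 > 1/4"
  proof -
    have "M 3 - (3 - 1) / 8 > 0"
    proof (rule stays_pos[where s = 1 and r = 3 and g = "\<lambda>r. M r - (r - 1) / 8" and g' = "\<lambda>r. 1 + (W r)\<^sup>2 - X r * M r - 1/8"])
      fix t :: real assume "1 \<le> t" "t \<le> 3"
      then show "((\<lambda>r. M r - (r - 1) / 8) has_real_derivative 1 + (W t)\<^sup>2 - X t * M t - 1/8) (at t)"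
        by (auto intro!: derivative_eq_intros derivs)
    next
      fix t :: real assume t: "1 < t" "t \<le> 3" "M t - (t - 1) / 8 = 0"
      then have "X t * M t < 7/8" using X7[of t] R by simp
      then show "0 < 1 + (W t)\<^sup>2 - X t * M t - 1/8" using zero_le_power2[of "W t"] by linarith
    qed (use pos(2)[of 1] in auto)
    then show ?thesis by simp
  qed
  have M: "M r > 1/4" if "3 \<le> r" "r \<le> R" for r
  proof -
    have "M r - 1/4 > 0"
    proof (rule stays_pos[where s = 3 and r = r and g = "\<lambda>r. M r - 1/4" and g' = "\<lambda>r. 1 + (W r)\<^sup>2 - X r * M r"])
      fix t :: real assume "3 \<le> t" "t \<le> r"
      then show "((\<lambda>r. M r - 1/4) has_real_derivative 1 + (W t)\<^sup>2 - X t * M t) (at t)"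
        by (auto intro!: derivative_eq_intros derivs)
    next
      fix t :: real assume t: "3 < t" "t \<le> r" "M t - 1/4 = 0"
      then have "X t * M t < 7/8" using X7[of t] that by simp
      then show "0 < 1 + (W t)\<^sup>2 - X t * M t" using zero_le_power2[of "W t"] by linarith
    qed (use that M3 in auto)
    then show ?thesis by simp
  qed
  have b3: "1 / W t \<ge> 2/5" if "t \<ge> 3" for t
    using W3 mono_facts(1)[of 3 t] pos(3)[of t] that by (simp add: field_simps)
  \<comment> \<open>On [3, R] one has b' = M b \<ge> 1/4 * 2/5 = 1/10.\<close>
  have "1 / W 3 - 3 / 10 \<le> 1 / W R - R / 10"
  proof (rule deriv_nonneg_le[where g = "\<lambda>r. 1 / W r - r / 10" and g' = "\<lambda>r. M r / W r - 1/10"])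
    fix t assume t: "3 \<le> t" "t \<le> R"
    show "((\<lambda>r. 1 / W r - r / 10) has_real_derivative M t / W t - 1/10) (at t)"
      using t by (intro DERIV_diff d_b) (auto intro!: derivative_eq_intros)
    have "1/4 * (2/5) \<le> M t * (1 / W t)" using M[OF t] b3[OF t(1)] by (intro mult_mono) auto
    then show "0 \<le> M t / W t - 1/10" by simp
  qed (use R in auto)
  then have "1 / W R \<ge> R / 10 - 3/10" using b3[of 3] by simp
  then have "1/4 * (R / 10 - 3 / 10) \<le> M R * (1 / W R)" using M[of R] R by (intro mult_mono) auto
  then have *: "(R - 3) / 40 \<le> M R / W R" by (simp add: field_simps)
  moreover have "(R - 3) / 40 > 1" using R by simp
  ultimately have "M R / W R > 1" by linarith
  then show ?thesis using slope_b_ge[of R] R * by linarith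
qed

text \<open>At a contact U = q^2 the difference has derivative 2 q + 2 q^2 (X - q), which is
  positive because X > q.\<close>

lemma q2_less_U: assumes "r > 0" shows "(q r)\<^sup>2 < U r"
proof -
  have "U r - (q r)\<^sup>2 > 0"
  proof (rule first_zero_pos[where g = "\<lambda>r. U r - (q r)\<^sup>2" and g' = "\<lambda>r. 2 * q r - 2 * q r * (U r - X r * q r)", OF assms])
    fix s assume s: "0 < s" "s \<le> r"
    then show "((\<lambda>r. U r - (q r)\<^sup>2) has_real_derivative 2 * q s - 2 * q s * (U s - X s * q s)) (at s)"
      by (auto intro!: derivative_eq_intros derivs)
    assume "U s - (q s)\<^sup>2 = 0"
    then have "2 * q s - 2 * q s * (U s - X s * q s) = 2 * q s + 2 * (q s)\<^sup>2 * (X s - q s)"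
      by (simp add: power2_eq_square algebra_simps)
    moreover have "2 * (q s)\<^sup>2 * (X s - q s) \<ge> 0" using X_gt_q[of s] s by simp
    moreover have "q s > 0" using pos(4)[of s] s by simp
    ultimately show "0 < 2 * q s - 2 * q s * (U s - X s * q s)" by linarith
  next
    have "((\<lambda>r. U r - (q r)\<^sup>2) \<longlongrightarrow> C - 0\<^sup>2) (at_right 0)" by (intro tendsto_intros init_U init_q)
    then show "\<forall>\<^sub>F s in at_right 0. 0 < U s - (q s)\<^sup>2" by (rule order_tendstoD(1)) (use C_pos in simp)
  qed
  then show ?thesis by simp
qed

text \<open>\<open>U\<close> solves \<open>U'' + X U' = 2 U\<close>, the equation satisfied by \<open>a\<^sup>2\<close> up to quadratic errors;
  comparing the two gives a bound for the slope of \<open>a\<close> that does not involve \<open>b\<close>.\<close>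

lemma slope_a_le_large_C:
  assumes C: "C \<ge> 16" shows "slope_a \<le> exp (9/4) * a 1"
proof -
  define R where "R = (\<lambda>r. sqrt (U r))"
  have R4: "R r \<ge> 4" if "r > 0" for r
    unfolding R_def using U_ge[OF that] C by (intro real_le_rsqrt) simp
  have R2: "(R r)\<^sup>2 = U r" if "r > 0" for r unfolding R_def using pos(5)[OF that] by simp
  have dR: "(R has_real_derivative q r / R r) (at r)" if "r > 0" for r
    unfolding R_def using pos(5)[OF that] that by (auto intro!: derivative_eq_intros derivs simp: field_simps)
  have qR: "q r \<le> R r" if "r > 0" for r
    by (rule power2_le_imp_le) (use q2_less_U[OF that] R2[OF that] R4[OF that] in auto)
  have XR: "X r \<ge> R r" if "r > 0" for r
    by (rule X_ge) (use that R4[OF that] R2[OF that] in auto)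
  \<comment> \<open>V is the logarithmic derivative of a^2 / U.\<close>
  define V where "V = (\<lambda>r. 2 * L r - 2 * q r / (R r)\<^sup>2)"
  \<comment> \<open>B/2 is minus the derivative of 2 exp(1 - r) + 1/R. Its integral from 1 on is at
    most 2 + 1/4, which is the exponent 9/4.\<close>
  define B where "B = (\<lambda>r. 4 * exp (1 - r) + 2 * q r / (R r)^3)"
  have dV: "(V has_real_derivative 4 * (q r)\<^sup>2 / (R r)^4 - X r * V r) (at r)" if "r > 0" for r
  proof -
    have eq: "(\<lambda>r. 2 * q r / (R r)\<^sup>2) = (\<lambda>r. 2 * q r / (R r * R r))" by (simp add: power2_eq_square)
    have *: "U r / (R r * R r) = 1" using R2[OF that] pos(5)[OF that] by (simp add: power2_eq_square)
    have "((\<lambda>r. 2 * q r / (R r * R r)) has_real_derivative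
      (2 * (U r - X r * q r) * (R r * R r) - 2 * q r * (q r / R r * R r + q r / R r * R r)) / ((R r * R r) * (R r * R r))) (at r)"
      using R4[OF that] that by (auto intro!: derivative_eq_intros derivs dR)
    then have "((\<lambda>r. 2 * q r / (R r)\<^sup>2) has_real_derivative
        2 * (U r / (R r * R r)) - 2 * X r * q r / (R r)\<^sup>2 - 4 * (q r)\<^sup>2 / (R r)^4) (at r)"
      unfolding eq by (rule DERIV_cong) (use R4[OF that] in \<open>simp add: field_simps power2_eq_square power4_eq_xxxx\<close>)
    then have "((\<lambda>r. 2 * L r - 2 * q r / (R r)\<^sup>2) has_real_derivative
        2 * (1 - X r * L r) - (2 - 2 * X r * q r / (R r)\<^sup>2 - 4 * (q r)\<^sup>2 / (R r)^4)) (at r)"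
      unfolding * using that by (intro DERIV_diff DERIV_cmult derivs) auto
    then show ?thesis unfolding V_def by (rule DERIV_cong) (simp add: algebra_simps)
  qed
  have dB: "(B has_real_derivative - 4 * exp (1 - r) + 2 * (U r - X r * q r) / (R r)^3 - 6 * (q r)\<^sup>2 / (R r)^5) (at r)" if "r > 0" for r
  proof -
    have d1: "((\<lambda>r. 2 * q r / (R r)^3) has_real_derivative 2 * (U r - X r * q r) / (R r)^3 - 6 * (q r)\<^sup>2 / (R r)^5) (at r)"
      using R4[OF that] that
      by (auto intro!: derivative_eq_intros derivs dR simp: field_simps eval_nat_numeral)
    have d2: "((\<lambda>r. 4 * exp (1 - r)) has_real_derivative - 4 * exp (1 - r)) (at r)"
      by (auto intro!: derivative_eq_intros)
    show ?thesis unfolding B_def by (rule DERIV_cong[OF DERIV_add[OF d2 d1]]) simp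
  qed
  have VB: "V r < B r" if r: "r \<ge> 1" for r
  proof -
    have "B r - V r > 0"
    proof (rule stays_pos[OF r, where g = "\<lambda>r. B r - V r" and g' = "\<lambda>r. (- 4 * exp (1 - r) + 2 * (U r - X r * q r) / (R r)^3 - 6 * (q r)\<^sup>2 / (R r)^5) - (4 * (q r)\<^sup>2 / (R r)^4 - X r * V r)"])
      show "0 < B 1 - V 1"
      proof -
        have "V 1 < 4" "B 1 > 4" using L_lt[of 1] pos(4)[of 1] R4[of 1]
          unfolding V_def B_def by (auto intro!: add_strict_mono intro: less_le_trans[of _ 4] simp: diff_less_eq add_pos_pos)
        then show ?thesis by simp
      qed
      fix t assume t: "1 < t" "t \<le> r" "B t - V t = 0"
      then have t0: "t > 0" by simp
      note facts = R4[OF t0] qR[OF t0] XR[OF t0] pos(4)[OF t0]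
      \<comment> \<open>All terms at contact are measured in z = q/U: the losses are at most 3/8 z
        and z, the gain from X V is at least 2 z, and its exponential part 16 exp(1 - t) outweighs 4
        exp(1 - t).\<close>
      define z where "z = q t / (R t)\<^sup>2"
      have z: "z > 0" using facts by (simp add: z_def)
      have i1: "2 * (U t - X t * q t) / (R t)^3 \<ge> 0" using dq_pos[of t] t0 facts by simp
      have i2: "6 * (q t)\<^sup>2 / (R t)^5 \<le> 3/8 * z"
      proof -
        have "6 * (q t)\<^sup>2 / (R t)^5 = 6 * z * (q t / R t) * (1 / (R t)\<^sup>2)"
          unfolding z_def using facts by (simp add: field_simps eval_nat_numeral)
        also have "\<dots> \<le> 6 * z * 1 * (1 / 4\<^sup>2)"
          using facts z by (intro mult_mono mult_left_mono frac_le power_mono) (auto simp: field_simps)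
        finally show ?thesis by simp
      qed
      have i3: "4 * (q t)\<^sup>2 / (R t)^4 \<le> z"
      proof -
        have "4 * (q t)\<^sup>2 / (R t)^4 = z * (q t / R t) * (4 / R t)"
          unfolding z_def using facts by (simp add: field_simps eval_nat_numeral)
        also have "\<dots> \<le> z * 1 * 1"
          using facts z by (intro mult_mono mult_left_mono) (auto simp: field_simps)
        finally show ?thesis by simp
      qed
      have i4: "X t * V t \<ge> 16 * exp (1 - t) + 2 * z"
      proof -
        have "2 * q t / (R t)^3 * R t = 2 * z" unfolding z_def using facts by (simp add: field_simps eval_nat_numeral)
        moreover have "4 * exp (1 - t) * R t \<ge> 4 * exp (1 - t) * 4" using facts by (intro mult_left_mono) auto
        ultimately have "B t * R t \<ge> 16 * exp (1 - t) + 2 * z" unfolding B_def by (simp add: distrib_right)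
        moreover have "B t \<ge> 0" unfolding B_def using facts by simp
        then have "B t * R t \<le> B t * X t" using facts by (intro mult_left_mono) auto
        ultimately show ?thesis using t by (simp add: mult.commute)
      qed
      have "exp (1 - t) > 0" by simp
      then show "0 < (- 4 * exp (1 - t) + 2 * (U t - X t * q t) / (R t)^3 - 6 * (q t)\<^sup>2 / (R t)^5) - (4 * (q t)\<^sup>2 / (R t)^4 - X t * V t)"
        using i1 i2 i3 i4 z by linarith
    next
      fix t assume "1 \<le> t" "t \<le> r"
      then have "t > 0" by simp
      from DERIV_diff[OF dB[OF this] dV[OF this]]
      show "((\<lambda>r. B r - V r) has_real_derivative (- 4 * exp (1 - t) + 2 * (U t - X t * q t) / (R t)^3 - 6 * (q t)\<^sup>2 / (R t)^5) - (4 * (q t)\<^sup>2 / (R t)^4 - X t * V t)) (at t)" .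
    qed
    then show ?thesis by simp
  qed
  have aR: "a r / R r \<le> exp (9/4) * (a 1 / R 1)" if r: "r \<ge> 1" for r
  proof -
    have "ln (a r) - ln (R r) + 2 * exp (1 - r) + 1 / R r \<le> ln (a 1) - ln (R 1) + 2 * exp (1 - 1) + 1 / R 1"
    proof (rule deriv_nonpos_ge[OF r, where g = "\<lambda>r. ln (a r) - ln (R r) + 2 * exp (1 - r) + 1 / R r" and g' = "\<lambda>r. (V r - B r) / 2"])
      fix t assume t: "1 \<le> t" "t \<le> r"
      have "((\<lambda>r. ln (a r) - ln (R r) + 2 * exp (1 - r) + 1 / R r) has_real_derivative
          L t - q t / R t / R t + 2 * (exp (1 - t) * (0 - 1)) + - (q t / R t) / (R t * R t)) (at t)"
        using t R4[of t] by (intro derivative_intros d_ln_a) (auto intro!: derivative_eq_intros dR)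
      then show "((\<lambda>r. ln (a r) - ln (R r) + 2 * exp (1 - r) + 1 / R r) has_real_derivative (V t - B t) / 2) (at t)"
        by (rule DERIV_cong) (use R4[of t] t in \<open>simp add: V_def B_def field_simps eval_nat_numeral\<close>)
      show "(V t - B t) / 2 \<le> 0" using VB[OF t(1)] by simp
    qed
    moreover have "1 / R 1 \<le> 1 / 4" using R4[of 1] by (simp add: field_simps)
    moreover have "1 / R r > 0" using R4[of r] r by simp
    moreover have "exp (1 - r) > 0" by simp
    moreover have "exp (1 - 1) = (1 :: real)" by simp
    ultimately have "ln (a r) - ln (R r) \<le> ln (a 1) - ln (R 1) + 9/4" by linarith
    then have "ln (a r / R r) \<le> ln (exp (9/4) * (a 1 / R 1))"
      using pos(7)[of r] pos(7)[of 1] R4[of r] R4[of 1] r by (simp add: ln_div ln_mult)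
    then show ?thesis using pos(7)[of r] pos(7)[of 1] R4[of r] R4[of 1] r
      by (subst (asm) ln_le_cancel_iff) auto
  qed
  show ?thesis
  proof (rule tendsto_upperbound[OF slopes(1)])
    show "\<forall>\<^sub>F r in at_top. L r * a r \<le> exp (9/4) * a 1"
      using eventually_trap eventually_ge_at_top[of 1]
    proof eventually_elim
      case (elim r)
      then have r: "r > 0" by simp
      \<comment> \<open>In the trap X L < 2, so a' = (L R) (a/R) is bounded by means of a / sqrt U,
        and R(1) \<ge> 4 cancels the factor 2.\<close>
      have "L r * R r \<le> L r * X r" using XR[OF r] pos(1)[OF r] by (intro mult_left_mono) auto
      also have "\<dots> \<le> 2" using elim by (simp add: trap_def mult.commute)
      finally have "L r * R r \<le> 2" .
      then have "L r * R r * (a r / R r) \<le> 2 * (exp (9/4) * (a 1 / R 1))"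
        using aR[OF elim(2)] pos[OF r] R4[OF r] by (intro mult_mono) auto
      also have "\<dots> \<le> 2 * (exp (9/4) * (a 1 / 4))"
        using R4[of 1] pos(7)[of 1] by (intro mult_left_mono divide_left_mono) auto
      also have "\<dots> \<le> exp (9/4) * a 1" using pos(7)[of 1] by simp
      finally show ?case using R4[OF r] by simp
    qed
  qed auto
qed

text \<open>L - M solves y' = -X y - W^2 with X \<ge> 1, so it stays below 2 exp(1 - r), and after r
  = 1 the ratio a/b grows by the factor exp 2 at most. In the trap X L < 2 < 2 X M, so L \<le> 2 M
  and a' \<le> 2 (a/b) b'.\<close>

lemma slope_a_le_slope_b: "slope_a \<le> 2 * exp 2 * (a 1 * W 1) * slope_b"
proof -
  have D: "L r - M r < 2 * exp (1 - r)" if r: "r \<ge> 1" for r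
  proof -
    have "2 * exp (1 - r) - (L r - M r) > 0"
    proof (rule stays_pos[OF r, where g = "\<lambda>r. 2 * exp (1 - r) - (L r - M r)" and g' = "\<lambda>r. - 2 * exp (1 - r) + X r * (L r - M r) + (W r)\<^sup>2"])
      fix t assume t: "1 \<le> t" "t \<le> r"
      show "((\<lambda>r. 2 * exp (1 - r) - (L r - M r)) has_real_derivative - 2 * exp (1 - t) + X t * (L t - M t) + (W t)\<^sup>2) (at t)"
        using t by (auto intro!: derivative_eq_intros derivs simp: algebra_simps)
    next
      show "0 < 2 * exp (1 - 1) - (L 1 - M 1)" using L_lt[of 1] pos(2)[of 1] by simp
    next
      fix t assume t: "1 < t" "t \<le> r" "2 * exp (1 - t) - (L t - M t) = 0"
      have X1: "X t \<ge> 1" by (rule X_ge) (use t pos(5)[of t] in auto)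
      have "1 * (2 * exp (1 - t)) \<le> X t * (2 * exp (1 - t))" using X1 by (intro mult_right_mono) auto
      moreover have "(W t)\<^sup>2 > 0" using pos(3)[of t] t by simp
      moreover have LM: "L t - M t = 2 * exp (1 - t)" using t by simp
      ultimately show "0 < - 2 * exp (1 - t) + X t * (L t - M t) + (W t)\<^sup>2" unfolding LM by linarith
    qed
    then show ?thesis by simp
  qed
  have aW: "a r * W r \<le> exp 2 * (a 1 * W 1)" if r: "r \<ge> 1" for r
  proof -
    have "ln (a r) - (- ln (W r)) + 2 * exp (1 - r) \<le> ln (a 1) - (- ln (W 1)) + 2 * exp (1 - 1)"
    proof (rule deriv_nonpos_ge[OF r, where g = "\<lambda>r. ln (a r) - (- ln (W r)) + 2 * exp (1 - r)" and g' = "\<lambda>r. L r - M r - 2 * exp (1 - r)"])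
      fix t assume t: "1 \<le> t" "t \<le> r"
      have "((\<lambda>r. ln (a r) - (- ln (W r)) + 2 * exp (1 - r)) has_real_derivative L t - M t + 2 * (exp (1 - t) * (0 - 1))) (at t)"
        using t by (intro DERIV_add DERIV_diff d_ln_a d_neg_ln_W) (auto intro!: derivative_eq_intros)
      then show "((\<lambda>r. ln (a r) - (- ln (W r)) + 2 * exp (1 - r)) has_real_derivative L t - M t - 2 * exp (1 - t)) (at t)"
        by simp
      show "L t - M t - 2 * exp (1 - t) \<le> 0" using D[OF t(1)] by simp
    qed
    moreover have "exp (1 - r) > 0" "exp (1 - 1) = (1 :: real)" by simp_all
    ultimately have "ln (a r) + ln (W r) \<le> ln (a 1) + ln (W 1) + 2" by linarith
    then have "ln (a r * W r) \<le> ln (exp 2 * (a 1 * W 1))"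
      using pos(3,7)[of r] pos(3,7)[of 1] r by (simp add: ln_mult)
    then show ?thesis using pos(3,7)[of r] pos(3,7)[of 1] r by (subst (asm) ln_le_cancel_iff) auto
  qed
  show ?thesis
  proof (rule tendsto_le[OF _ tendsto_mult_left[OF slopes(2)] slopes(1)])
    show "\<forall>\<^sub>F r in at_top. L r * a r \<le> 2 * exp 2 * (a 1 * W 1) * (M r / W r)"
      using eventually_trap eventually_ge_at_top[of 1]
    proof eventually_elim
      case (elim r)
      then have r: "r > 0" by simp
      have "X r * L r \<le> X r * (2 * M r)" using elim by (simp add: trap_def)
      then have "L r \<le> 2 * M r" using pos(6)[OF r] by simp
      then have "L r * (a r * W r) \<le> 2 * M r * (exp 2 * (a 1 * W 1))"
        using aW[OF elim(2)] pos[OF r] by (intro mult_mono[of _ _ "a r * W r"]) auto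
      then show ?case using pos(3)[OF r] by (simp add: field_simps)
    qed
  qed auto
qed

end

text \<open>The behaviour at the S^1 orbit: L and b vanish, b' is 1, and q ~ (C/3) r. The last
  assumption says that b starts out concave when C > 2.\<close>

locale expander_S1 = expander L M X W q U a C for L M X W q U a C +
  assumes init_L0: "(L \<longlongrightarrow> 0) (at_right 0)" and init_b0: "((\<lambda>r. 1 / W r) \<longlongrightarrow> 0) (at_right 0)"
    and init_b'1: "((\<lambda>r. M r / W r) \<longlongrightarrow> 1) (at_right 0)"
    and init_q_gt: "\<forall>\<^sub>F r in at_right 0. q r > C / 6 * r"
    and init_G: "C > 2 \<Longrightarrow> \<forall>\<^sub>F r in at_right 0. (1 + (W r)\<^sup>2) / M r - X r + M r < 0"
begin

lemma d_slope: "r > 0 \<Longrightarrow> ((\<lambda>r. M r / W r) has_real_derivative M r / W r * G r) (at r)"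
  unfolding G_def using pos[of r]
  by (auto intro!: derivative_eq_intros derivs simp: field_simps power2_eq_square)

text \<open>While \<open>b\<close> is concave, \<open>L\<close> is small and \<open>q\<close> is large, as for the Bryant soliton of scale
  \<open>C powr (- 1/2)\<close>; this in turn prevents \<open>b''\<close> from vanishing.\<close>

context
  fixes r \<sigma> :: real
  assumes r: "r > 0" and C_eq: "C = 3 * \<sigma>\<^sup>2" and \<sigma>: "\<sigma> \<ge> 20480"
    and concave: "\<And>s. 0 < s \<Longrightarrow> s \<le> r \<Longrightarrow> G s \<le> 0"
begin

lemma slope_antimono: "0 < s \<Longrightarrow> s \<le> t \<Longrightarrow> t \<le> r \<Longrightarrow> M t / W t \<le> M s / W s"
proof -
  assume s: "0 < s" "s \<le> t" "t \<le> r"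
  show ?thesis
  proof (rule deriv_nonpos_ge[OF s(2), where g = "\<lambda>r. M r / W r" and g' = "\<lambda>r. M r / W r * G r"])
    fix u assume u: "s \<le> u" "u \<le> t"
    show "((\<lambda>r. M r / W r) has_real_derivative M u / W u * G u) (at u)" using d_slope u s by simp
    show "M u / W u * G u \<le> 0" using concave[of u] pos[of u] u s by (intro mult_nonneg_nonpos) auto
  qed
qed

lemma slope_le_1: assumes "0 < s" "s \<le> r" shows "M s / W s \<le> 1"
proof (rule deriv_nonpos_le_limit[where a = 0 and g = "\<lambda>r. M r / W r" and g' = "\<lambda>r. M r / W r * G r", OF assms(1)])
  fix u assume u: "0 < u" "u \<le> s"
  show "((\<lambda>r. M r / W r) has_real_derivative M u / W u * G u) (at u)" using d_slope u by simp
  show "M u / W u * G u \<le> 0" using concave[of u] pos[of u] u assms by (intro mult_nonneg_nonpos) auto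
qed (rule init_b'1)

lemma b_le: assumes "0 < s" "s \<le> r" shows "1 / W s \<le> s"
proof -
  have "1 / W s - s \<le> 0"
  proof (rule deriv_nonpos_le_limit[where a = 0 and g = "\<lambda>r. 1 / W r - r" and g' = "\<lambda>r. M r / W r - 1", OF assms(1)])
    fix u assume u: "0 < u" "u \<le> s"
    show "((\<lambda>r. 1 / W r - r) has_real_derivative M u / W u - 1) (at u)"
      using u by (intro DERIV_diff d_b) auto
    show "M u / W u - 1 \<le> 0" using slope_le_1[of u] u assms by simp
  next
    have "((\<lambda>r. 1 / W r - r) \<longlongrightarrow> 0 - 0) (at_right 0)" by (intro tendsto_intros init_b0)
    then show "((\<lambda>r. 1 / W r - r) \<longlongrightarrow> 0) (at_right 0)" by simp
  qed
  then show ?thesis by simp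
qed

text \<open>The function b - r b' vanishes at 0 and has derivative -r b'' \<ge> 0. It follows that M
  \<le> 1/r, as if b were linear.\<close>

lemma b_ge: assumes "0 < s" "s \<le> r" shows "s * (M s / W s) \<le> 1 / W s"
proof -
  have "0 \<le> 1 / W s - s * (M s / W s)"
  proof (rule deriv_nonneg_ge_limit[where a = 0 and g = "\<lambda>r. 1 / W r - r * (M r / W r)" and g' = "\<lambda>r. M r / W r - (1 * (M r / W r) + M r / W r * G r * r)", OF assms(1)])
    fix u assume u: "0 < u" "u \<le> s"
    show "((\<lambda>r. 1 / W r - r * (M r / W r)) has_real_derivative M u / W u - (1 * (M u / W u) + M u / W u * G u * u)) (at u)"
      using u by (intro DERIV_diff d_b DERIV_mult DERIV_ident d_slope) auto
    have "M u / W u * u * G u \<le> 0" using concave[of u] pos[of u] u assms by (intro mult_nonneg_nonpos) auto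
    then show "0 \<le> M u / W u - (1 * (M u / W u) + M u / W u * G u * u)" by (simp add: mult_ac)
  next
    have "((\<lambda>r. 1 / W r - r * (M r / W r)) \<longlongrightarrow> 0 - 0 * 1) (at_right 0)" by (intro tendsto_intros init_b0 init_b'1)
    then show "((\<lambda>r. 1 / W r - r * (M r / W r)) \<longlongrightarrow> 0) (at_right 0)" by simp
  qed
  then show ?thesis by simp
qed

lemma M_le: assumes "0 < s" "s \<le> r" shows "M s \<le> 1 / s"
  using b_ge[OF assms] pos(3)[of s] assms by (simp add: field_simps)

lemma X_ge_sigma: assumes "s > 0" shows "X s \<ge> \<sigma>"
proof (rule X_ge)
  show "\<sigma>\<^sup>2 \<le> U s + 2" using U_ge[OF assms] zero_le_power2[of \<sigma>] unfolding C_eq by linarith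
qed (use assms \<sigma> in auto)

lemma L_less: assumes "s > 0" shows "L s < 2 / \<sigma>"
proof -
  have "2 / \<sigma> - L s > 0"
  proof (rule first_zero_pos[OF assms, where g = "\<lambda>s. 2 / \<sigma> - L s" and g' = "\<lambda>s. - (1 - X s * L s)"])
    fix t assume t: "0 < t" "t \<le> s"
    then show "((\<lambda>s. 2 / \<sigma> - L s) has_real_derivative - (1 - X t * L t)) (at t)"
      by (auto intro!: derivative_eq_intros derivs)
    assume "2 / \<sigma> - L t = 0"
    then have Lt: "L t = 2 / \<sigma>" by simp
    have "\<sigma> * (2 / \<sigma>) \<le> X t * L t" unfolding Lt using X_ge_sigma[of t] t \<sigma> by (intro mult_right_mono) auto
    moreover have "\<sigma> * (2 / \<sigma>) = 2" using \<sigma> by simp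
    ultimately show "0 < - (1 - X t * L t)" by linarith
  next
    show "\<forall>\<^sub>F s in at_right 0. 0 < 2 / \<sigma> - L s"
      using order_tendstoD(2)[OF init_L0, of "2 / \<sigma>"] \<sigma> by simp
  qed
  then show ?thesis by simp
qed

text \<open>The subsolution \<open>\<psi>\<close> interpolates between slope \<sigma>^2/2 at 0 and
  the value \<sigma> at infinity. At contact X q \<le> (2/\<sigma> + 2/s + \<psi>) \<psi> \<le> 2 +
  2 \<sigma>^2, against U \<ge> 3 \<sigma>^2 and \<psi>' \<le> \<sigma>^2/2.\<close>

lemma q_greater: assumes "0 < s" "s \<le> r" shows "q s > \<sigma>\<^sup>2 * s / (2 + \<sigma> * s)"
proof -
  define \<psi> where "\<psi> = (\<lambda>s. \<sigma>\<^sup>2 * s / (2 + \<sigma> * s))"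
  have den: "2 + \<sigma> * t > 2" if "t > 0" for t using \<sigma> that by simp
  have "q s - \<psi> s > 0"
  proof (rule first_zero_pos[OF assms(1), where g = "\<lambda>s. q s - \<psi> s" and g' = "\<lambda>s. U s - X s * q s - 2 * \<sigma>\<^sup>2 / (2 + \<sigma> * s)\<^sup>2"])
    fix t assume t: "0 < t" "t \<le> s"
    have "(\<psi> has_real_derivative 2 * \<sigma>\<^sup>2 / (2 + \<sigma> * t)\<^sup>2) (at t)"
      unfolding \<psi>_def using den[OF t(1)]
      by (auto intro!: derivative_eq_intros simp: power2_eq_square field_simps)
    then show "((\<lambda>s. q s - \<psi> s) has_real_derivative U t - X t * q t - 2 * \<sigma>\<^sup>2 / (2 + \<sigma> * t)\<^sup>2) (at t)"
      using t by (intro DERIV_diff derivs)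
    assume "q t - \<psi> t = 0"
    then have qt: "q t = \<psi> t" by simp
    have \<psi>0: "\<psi> t > 0" using qt pos(4)[OF t(1)] by simp
    have "\<sigma>\<^sup>2 * t \<le> \<sigma> * (2 + \<sigma> * t)" using \<sigma> by (simp add: power2_eq_square algebra_simps)
    moreover have "0 < 2 + \<sigma> * t" using den[OF t(1)] by linarith
    ultimately have \<psi>1: "\<psi> t \<le> \<sigma>" unfolding \<psi>_def by (subst pos_divide_le_eq)
    have \<psi>2: "\<psi> t \<le> \<sigma>\<^sup>2 * t / 2" unfolding \<psi>_def using t \<sigma> by (intro divide_left_mono mult_pos_pos add_pos_pos) auto
    have "X t * q t \<le> (2 / \<sigma> + 2 * (1 / t) + \<psi> t) * \<psi> t"
      unfolding qt using X_eq'[OF t(1)] L_less[OF t(1)] M_le[of t] t assms \<psi>0 qt by (intro mult_right_mono) auto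
    also have "\<dots> = 2 / \<sigma> * \<psi> t + 2 * \<psi> t / t + \<psi> t * \<psi> t" by (simp add: algebra_simps)
    also have "\<dots> \<le> 2 / \<sigma> * \<sigma> + \<sigma>\<^sup>2 + \<sigma> * \<sigma>"
      using \<psi>0 \<psi>1 \<psi>2 t \<sigma> by (intro add_mono mult_mono mult_left_mono) (auto simp: field_simps)
    also have "\<dots> = 2 + 2 * \<sigma>\<^sup>2" using \<sigma> by (simp add: power2_eq_square)
    finally have Xq: "X t * q t \<le> 2 + 2 * \<sigma>\<^sup>2" .
    have "2\<^sup>2 \<le> (2 + \<sigma> * t)\<^sup>2" using den[OF t(1)] by (intro power_mono) auto
    then have "2 * \<sigma>\<^sup>2 / (2 + \<sigma> * t)\<^sup>2 \<le> 2 * \<sigma>\<^sup>2 / 2\<^sup>2" by (intro divide_left_mono) auto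
    then have h: "2 * \<sigma>\<^sup>2 / (2 + \<sigma> * t)\<^sup>2 \<le> \<sigma>\<^sup>2 / 2" by simp
    have "\<sigma>\<^sup>2 \<ge> 20480\<^sup>2" using \<sigma> by (intro power_mono) auto
    then have big: "\<sigma>\<^sup>2 > 4" by simp
    show "0 < U t - X t * q t - 2 * \<sigma>\<^sup>2 / (2 + \<sigma> * t)\<^sup>2"
      using U_ge[OF t(1)] Xq h big unfolding C_eq by linarith
  next
    have "\<forall>\<^sub>F s in at_right 0. (s::real) > 0" by (simp add: eventually_at_right_less)
    then show "\<forall>\<^sub>F s in at_right 0. 0 < q s - \<psi> s" using init_q_gt
    proof eventually_elim
      case (elim s)
      have "\<psi> s \<le> \<sigma>\<^sup>2 * s / 2" unfolding \<psi>_def using elim \<sigma> by (intro divide_left_mono mult_pos_pos add_pos_pos) auto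
      then show ?case using elim unfolding C_eq by simp
    qed
  qed
  then show ?thesis by (simp add: \<psi>_def)
qed

text \<open>Up to 2/\<sigma>, concavity gives b b' \<le> r. Beyond it q \<ge> \<sigma>/2, and at the
  level 5/\<sigma> the damping term 5/2 exceeds the forcing b^2 + 1 \<le> 2. At r = 1 finally b'^2
  \<le> b b' by \<open>b_ge\<close>.\<close>

lemma slope_1_less: assumes "1 \<le> r" shows "(M 1 / W 1)\<^sup>2 < 5 / \<sigma>"
proof -
  have s0: "2 / \<sigma> \<le> 1" "2 / \<sigma> > 0" using \<sigma> by auto
  have bbeq: "bb' s = 1 / W s * (M s / W s)" for s by (simp add: bb'_def power2_eq_square)
  have "5 / \<sigma> - bb' 1 > 0"
  proof (rule stays_pos[OF s0(1), where g = "\<lambda>s. 5 / \<sigma> - bb' s" and g' = "\<lambda>s. - (1 / (W s)\<^sup>2 + 1 - (L s + q s) * bb' s)"])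
    have "bb' (2 / \<sigma>) \<le> 2 / \<sigma> * 1"
      unfolding bbeq using b_le[of "2/\<sigma>"] slope_le_1[of "2/\<sigma>"] s0 assms pos[of "2/\<sigma>"] by (intro mult_mono) auto
    then have "bb' (2 / \<sigma>) \<le> 2 / \<sigma>" by simp
    moreover have "2 / \<sigma> < 5 / \<sigma>" using \<sigma> by (intro divide_strict_right_mono) auto
    ultimately show "0 < 5 / \<sigma> - bb' (2 / \<sigma>)" by simp
    fix t assume t: "2 / \<sigma> < t" "t \<le> 1" "5 / \<sigma> - bb' t = 0"
    have t0: "t > 0" "t \<le> r" using t(1,2) s0(2) assms by linarith+
    have "\<sigma> / 2 \<le> \<sigma>\<^sup>2 * t / (2 + \<sigma> * t)"
    proof -
      have "\<sigma> * t > 2" using t \<sigma> by (simp add: field_simps)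
      then have "\<sigma> * 2 + \<sigma> * (\<sigma> * t) \<le> 2 * (\<sigma> * (\<sigma> * t))" using \<sigma> by simp
      then show ?thesis using \<open>\<sigma> * t > 2\<close> by (simp add: field_simps power2_eq_square)
    qed
    then have "L t + q t \<ge> \<sigma> / 2" using q_greater[OF t0] pos(1)[OF t0(1)] by linarith
    then have "\<sigma> / 2 * (5 / \<sigma>) \<le> (L t + q t) * bb' t" using t \<sigma> bb'_pos[OF t0(1)] by (intro mult_mono) auto
    then have "(L t + q t) * bb' t \<ge> 5/2" using \<sigma> by simp
    moreover have "1 / (W t)\<^sup>2 \<le> 1"
    proof -
      have "1 / W t \<le> 1" using b_le[OF t0] t(2) by linarith
      then have "(1 / W t)\<^sup>2 \<le> 1\<^sup>2" using pos(3)[OF t0(1)] by (intro power_mono) (auto intro: less_imp_le)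
      then show ?thesis by (simp add: power_divide)
    qed
    ultimately show "0 < - (1 / (W t)\<^sup>2 + 1 - (L t + q t) * bb' t)" by linarith
  next
    fix t assume "2 / \<sigma> \<le> t" "t \<le> 1"
    then have "t > 0" using s0 by linarith
    then show "((\<lambda>s. 5 / \<sigma> - bb' s) has_real_derivative - (1 / (W t)\<^sup>2 + 1 - (L t + q t) * bb' t)) (at t)"
      using DERIV_diff[OF DERIV_const d_bb', of t] by fastforce
  qed
  moreover have "M 1 / W 1 * (M 1 / W 1) \<le> bb' 1"
    unfolding bbeq using b_ge[of 1] assms pos[of 1] by (intro mult_right_mono) auto
  ultimately show ?thesis by (simp add: power2_eq_square)
qed

text \<open>Origin of 20480 = 5 * 64^2: it makes the slope b'(1) at most 1/64.\<close>

lemma sigma_bound: "5 / \<sigma> \<le> 1 / 4096" using \<sigma> by (simp add: field_simps)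

text \<open>The conclusion makes G' negative at a zero of G, so b'' cannot reach 0 from below. In
  terms of b it reads b'^2 + (b L)^2 < 1.\<close>

lemma G_zero_imp: assumes G0: "G r = 0" shows "(M r)\<^sup>2 + (L r)\<^sup>2 < (W r)\<^sup>2"
proof -
  define \<beta> where "\<beta> = M r / W r"
  define b where "b = 1 / W r"
  have W: "W r > 0" using pos r by simp
  have b0: "b > 0" and \<beta>0: "\<beta> > 0" unfolding b_def \<beta>_def using pos[OF r] by auto
  have Mb: "M r = \<beta> * W r" "b * W r = 1" using W by (auto simp: \<beta>_def b_def)
  have L\<sigma>: "L r < 2 / \<sigma>" "L r > 0" using L_less[OF r] pos(1)[OF r] by auto
  have L1: "L r < 1 / 8" using L\<sigma> sigma_bound by linarith
  have key: "\<beta>\<^sup>2 + (b * L r)\<^sup>2 < 1"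
  proof (cases "r \<le> 1")
    case True
    show ?thesis
    proof (rule ccontr)
      assume "\<not> ?thesis"
      then have ge: "1 \<le> \<beta>\<^sup>2 + (b * L r)\<^sup>2" by simp
      have br: "b \<le> r" using b_le[OF r order_refl] by (simp add: b_def)
      have "b * L r \<le> 1 * (1/2)" using br True L1 b0 L\<sigma> by (intro mult_mono) auto
      then have "(b * L r)\<^sup>2 \<le> (1/2)\<^sup>2" using b0 L\<sigma> by (intro power_mono) auto
      then have "\<beta>\<^sup>2 \<ge> (1/2)\<^sup>2" using ge by (simp add: power2_eq_square)
      then have \<beta>2: "\<beta> \<ge> 1/2" using \<beta>0 by (rule power2_le_imp_le[OF _ less_imp_le])
      \<comment> \<open>Multiplied by b^2, b'' = 0 becomes b^2 + 1 - (L + q) b b' - b'^2 = 0.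
        Together with the negated claim this yields q \<le> 5/2 r, against q > \<sigma> r /
        2.\<close>
      have "1 + (W r)\<^sup>2 - X r * M r + (M r)\<^sup>2 = 0"
        using G0 pos(2)[OF r] unfolding G_def by (simp add: field_simps power2_eq_square)
      then have "b\<^sup>2 * (1 + (W r)\<^sup>2 - (L r + 2 * M r + q r) * M r + (M r)\<^sup>2) = 0"
        unfolding X_eq'[OF r] by simp
      moreover have "b\<^sup>2 * (1 + (W r)\<^sup>2 - (L r + 2 * M r + q r) * M r + (M r)\<^sup>2) =
          b\<^sup>2 + (b * W r)\<^sup>2 - (L r + q r) * b * \<beta> * (b * W r) - \<beta>\<^sup>2 * (b * W r)\<^sup>2"
        unfolding Mb(1) by (simp add: power2_eq_square algebra_simps)
      ultimately have "b\<^sup>2 + 1 - (L r + q r) * b * \<beta> - \<beta>\<^sup>2 = 0" unfolding Mb(2) by simp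
      then have "(L r + q r) * b * \<beta> \<le> b\<^sup>2 + (b * L r)\<^sup>2" using ge by linarith
      then have "b * ((L r + q r) * \<beta>) \<le> b * (b * (1 + (L r)\<^sup>2))" by (simp add: power2_eq_square algebra_simps)
      then have le: "(L r + q r) * \<beta> \<le> b * (1 + (L r)\<^sup>2)" using b0 by simp
      have "(L r)\<^sup>2 \<le> (1/2)\<^sup>2" using L1 L\<sigma> by (intro power_mono) auto
      then have "b * (1 + (L r)\<^sup>2) \<le> r * (5/4)" using br b0 by (intro mult_mono) (auto simp: power2_eq_square)
      moreover have "(L r + q r) * (1/2) \<le> (L r + q r) * \<beta>" using \<beta>2 L\<sigma> pos(4)[OF r] by (intro mult_left_mono) auto
      ultimately have "(L r + q r) * (1/2) \<le> r * (5/4)" using le by (meson order_trans)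
      then have q: "q r \<le> 5/2 * r" using L\<sigma>(2) by simp
      have "\<sigma> * r \<le> \<sigma> * 1" "\<sigma> * r > 0" using \<sigma> True r by (auto intro!: mult_left_mono)
      then have den: "2 + \<sigma> * r \<le> 2 * \<sigma>" "2 + \<sigma> * r > 0" using \<sigma> by linarith+
      have "\<sigma>\<^sup>2 * r / (2 * \<sigma>) \<le> \<sigma>\<^sup>2 * r / (2 + \<sigma> * r)" using den \<sigma> r by (intro divide_left_mono) auto
      moreover have "\<sigma>\<^sup>2 * r / (2 * \<sigma>) = \<sigma> * r / 2" using \<sigma> by (simp add: power2_eq_square)
      ultimately have "\<sigma> * r / 2 < q r" using q_greater[OF r order_refl] by linarith
      moreover have "\<sigma> * r \<ge> 20480 * r" using \<sigma> r by (intro mult_right_mono) auto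
      ultimately show False using q r by linarith
    qed
  next
    case False
    \<comment> \<open>Beyond r = 1 the slope is at most 1/64, so b \<le> 1 + r/64, and r L < 16 by a
      barrier. Hence b L \<le> L + 16/64, which stays below 1/2.\<close>
    have s1: "(M 1 / W 1)\<^sup>2 < 5 / \<sigma>" using slope_1_less False by simp
    have "(1/64 :: real)\<^sup>2 = 1 / 4096" by (simp add: power2_eq_square)
    then have "(M 1 / W 1)\<^sup>2 \<le> (1/64)\<^sup>2" using s1 sigma_bound by linarith
    then have \<beta>1: "M 1 / W 1 \<le> 1 / 64" by (rule power2_le_imp_le) simp
    have \<beta>s: "M s / W s \<le> 1 / 64" if "1 \<le> s" "s \<le> r" for s
      using order_trans[OF slope_antimono[of 1 s] \<beta>1] that by simp
    have "1 / W r - 1 / 64 * r \<le> 1 / W 1 - 1 / 64 * 1"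
    proof (rule deriv_nonpos_ge[where s = 1 and r = r and g = "\<lambda>r. 1 / W r - 1 / 64 * r" and g' = "\<lambda>r. M r / W r - 1 / 64"])
      fix t assume t: "1 \<le> t" "t \<le> r"
      show "((\<lambda>r. 1 / W r - 1 / 64 * r) has_real_derivative M t / W t - 1 / 64) (at t)"
        using t by (intro DERIV_diff d_b) (auto intro!: derivative_eq_intros)
      show "M t / W t - 1 / 64 \<le> 0" using \<beta>s[OF t] by simp
    qed (use False in auto)
    moreover have "1 / W 1 \<le> 1" using b_le[of 1] False by simp
    ultimately have br: "b \<le> 1 + r / 64" by (simp add: b_def)
    have L2: "(L s)\<^sup>2 \<le> 1/4" if "s > 0" for s
    proof -
      have "L s \<le> 1/2" using L_less[OF that] sigma_bound by linarith
      then have "(L s)\<^sup>2 \<le> (1/2)\<^sup>2" using pos(1)[OF that] by (intro power_mono) auto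
      then show ?thesis by (simp add: power2_eq_square)
    qed
    \<comment> \<open>Up to r = 2 the bound X \<ge> \<sigma> suffices; afterwards M \<le> 1/2 and L
      \<le> 1/2 give X' \<ge> 1/4.\<close>
    have X8: "X s \<ge> s / 8" if s: "1 \<le> s" "s \<le> r" for s
    proof (cases "s \<le> 2")
      case True
      then show ?thesis using X_ge_sigma[of s] \<sigma> s by simp
    next
      case False
      have "X 2 - 2 / 4 \<le> X s - s / 4"
      proof (rule deriv_nonneg_le[where s = 2 and r = s and g = "\<lambda>s. X s - s / 4" and g' = "\<lambda>s. (1 - (L s)\<^sup>2 - 2 * (M s)\<^sup>2) - 1/4"])
        fix t assume t: "2 \<le> t" "t \<le> s"
        show "((\<lambda>s. X s - s / 4) has_real_derivative (1 - (L t)\<^sup>2 - 2 * (M t)\<^sup>2) - 1/4) (at t)"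
          using t by (intro DERIV_diff derivs) (auto intro!: derivative_eq_intros)
        have "1 / t \<le> 1 / 2" using t by (simp add: field_simps)
        then have "M t \<le> 1/2" using M_le[of t] t s by linarith
        then have "(M t)\<^sup>2 \<le> (1/2)\<^sup>2" using pos(2)[of t] t by (intro power_mono) auto
        then show "0 \<le> (1 - (L t)\<^sup>2 - 2 * (M t)\<^sup>2) - 1/4" using L2[of t] t by (simp add: power2_eq_square)
      qed (use False in auto)
      then show ?thesis using X_ge_sigma[of 2] \<sigma> s by simp
    qed
    \<comment> \<open>As L is tiny, a contact L = 16/t can occur only for t > 4; there X L \<ge> 2 >
      1 + 16/t^2.\<close>
    have "16 / r - L r > 0"
    proof (rule stays_pos[where s = 1 and r = r and g = "\<lambda>r. 16 / r - L r" and g' = "\<lambda>r. - 16 / r\<^sup>2 - (1 - X r * L r)"])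
      fix t assume t: "1 < t" "t \<le> r" "16 / t - L t = 0"
      then have Lt: "L t = 16 / t" by simp
      have "t > 4"
      proof (rule ccontr)
        assume "\<not> t > 4"
        then have "16 / t \<ge> 4" using t by (simp add: field_simps)
        then show False using L_less[of t] sigma_bound Lt t by simp
      qed
      have "t / 8 * (16 / t) \<le> X t * L t" using X8[of t] t pos(1)[of t] unfolding Lt by (intro mult_right_mono) auto
      then have "X t * L t \<ge> 2" using t by simp
      moreover have "16 / t\<^sup>2 < 1" using \<open>t > 4\<close> power_strict_mono[of 4 t 2] by simp
      ultimately show "0 < - 16 / t\<^sup>2 - (1 - X t * L t)" by simp
    next
      fix t assume "1 \<le> t" "t \<le> r"
      then show "((\<lambda>r. 16 / r - L r) has_real_derivative - 16 / t\<^sup>2 - (1 - X t * L t)) (at t)"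
        by (auto intro!: derivative_eq_intros derivs simp: power2_eq_square)
    next
      show "0 < 16 / 1 - L 1" using L_less[of 1] sigma_bound by simp
    qed (use False in auto)
    then have "r * L r < 16" using r by (simp add: field_simps)
    moreover have "b * L r \<le> (1 + r / 64) * L r" using br L\<sigma> by (intro mult_right_mono) auto
    moreover have "(1 + r / 64) * L r = L r + r * L r / 64" by (simp add: algebra_simps)
    ultimately have "b * L r \<le> 1/2" using L1 by linarith
    then have "(b * L r)\<^sup>2 \<le> (1/2)\<^sup>2" using b0 L\<sigma> by (intro power_mono) auto
    moreover have "\<beta>\<^sup>2 \<le> (1/64)\<^sup>2" using \<beta>s[of r] False \<beta>0 by (intro power_mono) (auto simp: \<beta>_def)
    ultimately show ?thesis by (simp add: power2_eq_square)
  qed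
  have "(W r)\<^sup>2 * (\<beta>\<^sup>2 + (b * L r)\<^sup>2) < (W r)\<^sup>2 * 1" using key W by (intro mult_strict_left_mono) auto
  moreover have "(W r)\<^sup>2 * (\<beta>\<^sup>2 + (b * L r)\<^sup>2) = (M r)\<^sup>2 + (b * W r)\<^sup>2 * (L r)\<^sup>2"
    unfolding Mb(1) by (simp add: power2_eq_square algebra_simps)
  ultimately show ?thesis unfolding Mb(2) by simp
qed

end

text \<open>By \<open>G_zero_imp\<close> the negative function G never reaches 0, so b is concave
  throughout and the limit of b' is at most b'(1).\<close>

lemma slope_b_small:
  assumes C_eq: "C = 3 * \<sigma>\<^sup>2" and \<sigma>: "\<sigma> \<ge> 20480" shows "slope_b\<^sup>2 \<le> 5 / \<sigma>"
proof -
  have Gneg: "G r < 0" if r: "r > 0" for r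
  proof -
    have "- G r > 0"
    proof (rule first_zero_pos[OF r, where g = "\<lambda>r. - G r" and g' = "\<lambda>r. - (((M r)\<^sup>2 + (L r)\<^sup>2 - (W r)\<^sup>2) - ((1 + (W r)\<^sup>2) / M r - M r) * G r)"])
      fix s assume s: "0 < s" "s \<le> r" "- G s = 0" and before: "\<And>t. 0 < t \<Longrightarrow> t < s \<Longrightarrow> - G t > 0"
      have "G t \<le> 0" if "0 < t" "t \<le> s" for t using before[of t] s that by (cases "t = s") auto
      from G_zero_imp[OF s(1) C_eq \<sigma> this] s(3)
      show "0 < - (((M s)\<^sup>2 + (L s)\<^sup>2 - (W s)\<^sup>2) - ((1 + (W s)\<^sup>2) / M s - M s) * G s)" by simp
    next
      have "20480\<^sup>2 \<le> \<sigma>\<^sup>2" using \<sigma> by (intro power_mono) auto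
      then have "C > 2" unfolding C_eq by simp
      from init_G[OF this] show "\<forall>\<^sub>F s in at_right 0. 0 < - G s" by eventually_elim (simp add: G_def)
    next
      fix s assume "0 < s" "s \<le> r"
      then show "((\<lambda>r. - G r) has_real_derivative - (((M s)\<^sup>2 + (L s)\<^sup>2 - (W s)\<^sup>2) - ((1 + (W s)\<^sup>2) / M s - M s) * G s)) (at s)"
        by (intro DERIV_minus dG)
    qed
    then show ?thesis by simp
  qed
  then have G: "G s \<le> 0" if "0 < s" for s using that less_imp_le by blast
  have "slope_b \<le> M 1 / W 1"
  proof (rule tendsto_upperbound[OF slopes(2)])
    show "\<forall>\<^sub>F r in at_top. M r / W r \<le> M 1 / W 1"
      using eventually_ge_at_top[of 1]
    proof eventually_elim
      case (elim r)
      then show ?case using slope_antimono[OF _ C_eq \<sigma> G, of r 1 r] by simp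
    qed
  qed auto
  then have "slope_b\<^sup>2 \<le> (M 1 / W 1)\<^sup>2" using slopes_pos by (intro power_mono) auto
  then show ?thesis using slope_1_less[OF zero_less_one C_eq \<sigma> G] by simp
qed

end

text \<open>The behaviour at the S^2 orbit, with \<open>w0\<close> the reciprocal of b(0): there a
  vanishes with slope 1, and b' vanishes.\<close>

locale expander_S2 = expander L M X W q U a C for L M X W q U a C +
  fixes w0 :: real
  assumes w0: "w0 > 0" and init_W: "(W \<longlongrightarrow> w0) (at_right 0)"
    and init_a: "(a \<longlongrightarrow> 0) (at_right 0)" and init_a': "((\<lambda>r. L r * a r) \<longlongrightarrow> 1) (at_right 0)"
    and init_M0: "(M \<longlongrightarrow> 0) (at_right 0)" and init_M_gt: "\<forall>\<^sub>F r in at_right 0. M r > r / 4"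
begin

text \<open>This is -f, because U = C - 2 f.\<close>

definition "F r = (U r - C) / 2"
definition "\<kappa> r = (W r / w0)\<^sup>2 * exp (- F r)"

lemma dF: "r > 0 \<Longrightarrow> (F has_real_derivative q r) (at r)"
  unfolding F_def[abs_def] by (auto intro!: derivative_eq_intros derivs)

lemma F_lim: "(F \<longlongrightarrow> 0) (at_right 0)"
proof -
  have "(F \<longlongrightarrow> (C - C) / 2) (at_right 0)" unfolding F_def[abs_def] by (intro tendsto_intros init_U) auto
  then show ?thesis by simp
qed

lemma F_nonneg: "r > 0 \<Longrightarrow> F r \<ge> 0" unfolding F_def using U_ge[of r] by simp

lemma F_mono: "0 < s \<Longrightarrow> s \<le> r \<Longrightarrow> F s \<le> F r" unfolding F_def using mono_facts(3)[of s r] by simp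

lemma d\<kappa>: "r > 0 \<Longrightarrow> (\<kappa> has_real_derivative - (2 * M r + q r) * \<kappa> r) (at r)"
  unfolding \<kappa>_def[abs_def] using w0
  by (auto intro!: derivative_eq_intros derivs dF simp: field_simps power2_eq_square)

lemma \<kappa>_pos: "r > 0 \<Longrightarrow> \<kappa> r > 0" unfolding \<kappa>_def using pos[of r] w0 by simp

lemma \<kappa>_lim: "(\<kappa> \<longlongrightarrow> 1) (at_right 0)"
proof -
  have "(\<kappa> \<longlongrightarrow> (w0 / w0)\<^sup>2 * exp (- 0)) (at_right 0)"
    unfolding \<kappa>_def[abs_def] using w0 by (intro tendsto_intros init_W F_lim) auto
  then show ?thesis using w0 by simp
qed

lemma \<kappa>_nonincreasing: "r > 0 \<Longrightarrow> - (2 * M r + q r) * \<kappa> r \<le> 0"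
  using pos[of r] \<kappa>_pos[of r] by (intro mult_nonpos_nonneg) auto

lemma \<kappa>_le_1: "r > 0 \<Longrightarrow> \<kappa> r \<le> 1"
  by (rule deriv_nonpos_le_limit[where a = 0 and g = \<kappa> and g' = "\<lambda>r. - (2 * M r + q r) * \<kappa> r"])
     (use d\<kappa> \<kappa>_nonincreasing \<kappa>_lim in auto)

lemma \<kappa>_antimono: "0 < s \<Longrightarrow> s \<le> r \<Longrightarrow> \<kappa> r \<le> \<kappa> s"
  by (rule deriv_nonpos_ge[where g = \<kappa> and g' = "\<lambda>r. - (2 * M r + q r) * \<kappa> r"])
     (use d\<kappa> \<kappa>_nonincreasing in auto)

lemma da': "r > 0 \<Longrightarrow> ((\<lambda>r. L r * a r) has_real_derivative a r - (2 * M r + q r) * (L r * a r)) (at r)"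
  by (rule DERIV_cong[OF DERIV_mult[OF derivs(1) da]]) (auto simp: X_eq' algebra_simps)

text \<open>\<open>\<kappa>\<close> is the solution of the homogeneous equation for \<open>a'\<close> with the initial value of \<open>a'\<close>.\<close>

lemma a'_ge_\<kappa>: assumes "r > 0" shows "\<kappa> r \<le> L r * a r"
proof -
  have "1 \<le> L r * a r / \<kappa> r"
  proof (rule deriv_nonneg_ge_limit[where a = 0 and g = "\<lambda>r. L r * a r / \<kappa> r" and g' = "\<lambda>r. a r / \<kappa> r", OF assms])
    fix t assume t: "0 < t" "t \<le> r"
    show "((\<lambda>r. L r * a r / \<kappa> r) has_real_derivative a t / \<kappa> t) (at t)"
      by (rule DERIV_cong[OF DERIV_divide[OF da' d\<kappa>]]) (use t \<kappa>_pos[of t] in \<open>auto simp: field_simps\<close>)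
    show "0 \<le> a t / \<kappa> t" using \<kappa>_pos[of t] pos(7)[of t] t by simp
  next
    have "((\<lambda>r. L r * a r / \<kappa> r) \<longlongrightarrow> 1 / 1) (at_right 0)" by (intro tendsto_intros init_a' \<kappa>_lim) auto
    then show "((\<lambda>r. L r * a r / \<kappa> r) \<longlongrightarrow> 1) (at_right 0)" by simp
  qed
  then show ?thesis using \<kappa>_pos[OF assms] by (simp add: field_simps)
qed

text \<open>With D = a' - \<kappa> \<ge> 0 one has (a + D)' \<le> (a + D) + \<kappa>. The forcing is
  bounded by 1 up to \<open>\<delta>\<close> and by its value at \<open>\<delta>\<close>
  afterwards.\<close>

lemma a1_le: assumes \<delta>: "0 < \<delta>" "\<delta> \<le> 1" shows "a 1 \<le> exp 1 * (\<delta> + \<kappa> \<delta>)"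
proof -
  define D where "D = (\<lambda>r. L r * a r - \<kappa> r)"
  define h where "h = (\<lambda>r. (a r + D r) * exp (- r))"
  have D0: "D r \<ge> 0" if "r > 0" for r using a'_ge_\<kappa>[OF that] by (simp add: D_def)
  have dh: "(h has_real_derivative (\<kappa> r - (2 * M r + q r) * D r) * exp (- r)) (at r)" if "r > 0" for r
  proof -
    have dD: "(D has_real_derivative a r - (2 * M r + q r) * D r) (at r)"
      unfolding D_def by (rule DERIV_cong[OF DERIV_diff[OF da' d\<kappa>]]) (use that in \<open>auto simp: algebra_simps\<close>)
    show ?thesis unfolding h_def
      by (rule derivative_eq_intros da dD refl that)+ (simp add: D_def algebra_simps)
  qed
  have dh_le: "(\<kappa> r - (2 * M r + q r) * D r) * exp (- r) \<le> \<kappa> r" if "r > 0" for r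
  proof -
    have "(2 * M r + q r) * D r \<ge> 0" using pos[OF that] D0[OF that] by (intro mult_nonneg_nonneg) auto
    then have "(\<kappa> r - (2 * M r + q r) * D r) * exp (- r) \<le> \<kappa> r * exp (- r)" by (intro mult_right_mono) auto
    also have "\<dots> \<le> \<kappa> r * 1" using \<kappa>_pos[OF that] that by (intro mult_left_mono) auto
    finally show ?thesis by simp
  qed
  have "h \<delta> - \<delta> \<le> 0"
  proof (rule deriv_nonpos_le_limit[where a = 0 and g = "\<lambda>r. h r - r", OF \<delta>(1)])
    fix t assume t: "0 < t" "t \<le> \<delta>"
    show "((\<lambda>r. h r - r) has_real_derivative (\<kappa> t - (2 * M t + q t) * D t) * exp (- t) - 1) (at t)"
      by (intro DERIV_diff dh DERIV_ident t)
    show "(\<kappa> t - (2 * M t + q t) * D t) * exp (- t) - 1 \<le> 0" using dh_le[OF t(1)] \<kappa>_le_1[OF t(1)] by simp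
  next
    have "((\<lambda>r. h r - r) \<longlongrightarrow> (0 + (1 - 1)) * exp (- 0) - 0) (at_right 0)"
      unfolding h_def D_def by (intro tendsto_intros init_a init_a' \<kappa>_lim)
    then show "((\<lambda>r. h r - r) \<longlongrightarrow> 0) (at_right 0)" by simp
  qed
  moreover have "h 1 - \<kappa> \<delta> * 1 \<le> h \<delta> - \<kappa> \<delta> * \<delta>"
  proof (rule deriv_nonpos_ge[OF \<delta>(2), where g = "\<lambda>r. h r - \<kappa> \<delta> * r"])
    fix t assume t: "\<delta> \<le> t" "t \<le> 1"
    then have t0: "t > 0" using \<delta> by simp
    show "((\<lambda>r. h r - \<kappa> \<delta> * r) has_real_derivative (\<kappa> t - (2 * M t + q t) * D t) * exp (- t) - \<kappa> \<delta>) (at t)"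
      by (intro DERIV_diff dh t0) (auto intro!: derivative_eq_intros)
    show "(\<kappa> t - (2 * M t + q t) * D t) * exp (- t) - \<kappa> \<delta> \<le> 0" using dh_le[OF t0] \<kappa>_antimono[OF \<delta>(1) t(1)] by simp
  qed
  moreover have "\<kappa> \<delta> * \<delta> \<ge> 0" using \<kappa>_pos[OF \<delta>(1)] \<delta> by simp
  ultimately have "h 1 \<le> \<delta> + \<kappa> \<delta>" by linarith
  then have "exp 1 * ((a 1 + D 1) * exp (- 1)) \<le> exp 1 * (\<delta> + \<kappa> \<delta>)" unfolding h_def by (intro mult_left_mono) auto
  moreover have "exp 1 * ((a 1 + D 1) * exp (- 1)) = a 1 + D 1" by (simp add: exp_minus)
  ultimately show ?thesis using D0[of 1] by simp
qed

text \<open>On (0, 1] the factor r^2 thus outweighs the damping by L in the integrating factors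
  below.\<close>

lemma two_over_minus_L: "0 < r \<Longrightarrow> r \<le> 1 \<Longrightarrow> 2 / r - L r \<ge> 0"
proof -
  assume r: "0 < r" "r \<le> 1"
  have "1 \<le> 1 / r" using r by simp
  moreover have "2 / r = 1 / r + 1 / r" by simp
  ultimately show ?thesis using L_lt[OF r(1)] by linarith
qed

text \<open>exp F absorbs the damping by q and r^2 that by L, so the derivative of b b' exp(F) r^2
  is at least r^2.\<close>

lemma bb'_ge: assumes r: "0 < r" "r \<le> 1" shows "r / 3 \<le> bb' r * exp (F r)"
proof -
  have "0 \<le> bb' r * exp (F r) * r\<^sup>2 - r ^ 3 / 3"
  proof (rule deriv_nonneg_ge_limit[where a = 0 and g = "\<lambda>r. bb' r * exp (F r) * r\<^sup>2 - r ^ 3 / 3", OF r(1)])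
    fix t assume t: "0 < t" "t \<le> r"
    show "((\<lambda>r. bb' r * exp (F r) * r\<^sup>2 - r ^ 3 / 3) has_real_derivative
        exp (F t) * t\<^sup>2 * (1 / (W t)\<^sup>2 + 1 + (2 / t - L t) * bb' t) - t\<^sup>2) (at t)"
      by (rule derivative_eq_intros d_bb' dF refl t)+ (use t in \<open>auto simp: field_simps power2_eq_square\<close>)
    have "1 * t\<^sup>2 * (0 + 1 + 0) \<le> exp (F t) * t\<^sup>2 * (1 / (W t)\<^sup>2 + 1 + (2 / t - L t) * bb' t)"
      using two_over_minus_L[of t] t r bb'_pos[of t] F_nonneg[of t]
      by (intro mult_mono add_mono mult_nonneg_nonneg) auto
    then show "0 \<le> exp (F t) * t\<^sup>2 * (1 / (W t)\<^sup>2 + 1 + (2 / t - L t) * bb' t) - t\<^sup>2" by simp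
  next
    have "((\<lambda>r. bb' r * exp (F r) * r\<^sup>2 - r ^ 3 / 3) \<longlongrightarrow> 0 / w0\<^sup>2 * exp 0 * 0\<^sup>2 - 0 ^ 3 / 3) (at_right 0)"
      unfolding bb'_def using w0 by (intro tendsto_intros init_M0 init_W F_lim) auto
    then show "((\<lambda>r. bb' r * exp (F r) * r\<^sup>2 - r ^ 3 / 3) \<longlongrightarrow> 0) (at_right 0)" by simp
  qed
  then have "r / 3 * r\<^sup>2 \<le> bb' r * exp (F r) * r\<^sup>2" by (simp add: power2_eq_square power3_eq_cube)
  then show ?thesis using r by simp
qed

lemma b2_ge: assumes r: "0 < r" "r \<le> 1" and t: "F r \<le> t" shows "1 / w0\<^sup>2 + exp (- t) * r\<^sup>2 / 3 \<le> 1 / (W r)\<^sup>2"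
proof -
  have "1 / w0\<^sup>2 \<le> 1 / (W r)\<^sup>2 - exp (- t) * r\<^sup>2 / 3"
  proof (rule deriv_nonneg_ge_limit[where a = 0 and g = "\<lambda>r. 1 / (W r)\<^sup>2 - exp (- t) * r\<^sup>2 / 3" and g' = "\<lambda>r. 2 * bb' r - exp (- t) * (2 * r) / 3", OF r(1)])
    fix s assume s: "0 < s" "s \<le> r"
    show "((\<lambda>r. 1 / (W r)\<^sup>2 - exp (- t) * r\<^sup>2 / 3) has_real_derivative 2 * bb' s - exp (- t) * (2 * s) / 3) (at s)"
      by (intro DERIV_diff d_b2 s) (auto intro!: derivative_eq_intros)
    have "s / 3 \<le> bb' s * exp (F s)" using bb'_ge[of s] s r by simp
    also have "\<dots> \<le> bb' s * exp t" using bb'_pos[OF s(1)] F_mono[OF s] t by (intro mult_left_mono) auto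
    finally have "exp (- t) * (s / 3) \<le> exp (- t) * (bb' s * exp t)" by (intro mult_left_mono) auto
    also have "\<dots> = bb' s" by (simp add: exp_minus)
    finally have "exp (- t) * (s / 3) \<le> bb' s" .
    moreover have "exp (- t) * (2 * s) / 3 = 2 * (exp (- t) * (s / 3))" by simp
    ultimately show "0 \<le> 2 * bb' s - exp (- t) * (2 * s) / 3" by linarith
  next
    have "((\<lambda>r. 1 / (W r)\<^sup>2 - exp (- t) * r\<^sup>2 / 3) \<longlongrightarrow> 1 / w0\<^sup>2 - exp (- t) * 0\<^sup>2 / 3) (at_right 0)"
      using w0 by (intro tendsto_intros init_W) auto
    then show "((\<lambda>r. 1 / (W r)\<^sup>2 - exp (- t) * r\<^sup>2 / 3) \<longlongrightarrow> 1 / w0\<^sup>2) (at_right 0)" by simp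
  qed
  then show ?thesis by simp
qed

text \<open>The integrating factor exp(F) r^2 b^2 absorbs q, L and 2 M, the three parts of X; the
  derivative that remains is at least C r^2 b(0)^2.\<close>

lemma q_ge: assumes r: "0 < r" "r \<le> 1" shows "C / 3 * r * \<kappa> r \<le> q r"
proof -
  have "0 \<le> q r * exp (F r) * r\<^sup>2 * (1 / (W r)\<^sup>2) - C * r ^ 3 / (3 * w0\<^sup>2)"
  proof (rule deriv_nonneg_ge_limit[where a = 0 and g = "\<lambda>r. q r * exp (F r) * r\<^sup>2 * (1 / (W r)\<^sup>2) - C * r ^ 3 / (3 * w0\<^sup>2)", OF r(1)])
    fix t assume t: "0 < t" "t \<le> r"
    show "((\<lambda>r. q r * exp (F r) * r\<^sup>2 * (1 / (W r)\<^sup>2) - C * r ^ 3 / (3 * w0\<^sup>2)) has_real_derivative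
        exp (F t) * t\<^sup>2 * (1 / (W t)\<^sup>2) * (U t + (2 / t - L t) * q t) - C * t\<^sup>2 / w0\<^sup>2) (at t)"
    proof -
      have d1: "((\<lambda>r. q r * exp (F r) * r\<^sup>2) has_real_derivative
          (U t - X t * q t) * exp (F t) * t\<^sup>2 + q t * (exp (F t) * q t) * t\<^sup>2 + q t * exp (F t) * (2 * t)) (at t)"
        by (auto intro!: derivative_eq_intros derivs dF t simp: algebra_simps)
      have d2: "((\<lambda>r. C * r ^ 3 / (3 * w0\<^sup>2)) has_real_derivative C * t\<^sup>2 / w0\<^sup>2) (at t)"
        using w0 by (auto intro!: derivative_eq_intros simp: field_simps eval_nat_numeral)
      show ?thesis
        by (rule DERIV_cong[OF DERIV_diff[OF DERIV_mult[OF d1 d_b2[OF t(1)]] d2]])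
           (use t w0 pos(3)[OF t(1)] X_eq'[OF t(1)] in \<open>simp add: bb'_def field_simps power2_eq_square\<close>)
    qed
    have "1 / w0\<^sup>2 \<le> 1 / (W t)\<^sup>2"
      using W_le_limit[OF init_W t(1)] pos(3)[OF t(1)] by (intro divide_left_mono power_mono) (auto simp: w0)
    then have "1 * t\<^sup>2 * (1 / w0\<^sup>2) * (C + 0) \<le> exp (F t) * t\<^sup>2 * (1 / (W t)\<^sup>2) * (U t + (2 / t - L t) * q t)"
      using two_over_minus_L[of t] t r pos(4)[of t] F_nonneg[of t] U_ge[of t] C_pos
      by (intro mult_mono add_mono mult_nonneg_nonneg) auto
    then show "0 \<le> exp (F t) * t\<^sup>2 * (1 / (W t)\<^sup>2) * (U t + (2 / t - L t) * q t) - C * t\<^sup>2 / w0\<^sup>2" by (simp add: mult_ac)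
  next
    have "((\<lambda>r. q r * exp (F r) * r\<^sup>2 * (1 / (W r)\<^sup>2) - C * r ^ 3 / (3 * w0\<^sup>2)) \<longlongrightarrow> 0 * exp 0 * 0\<^sup>2 * (1 / w0\<^sup>2) - C * 0 ^ 3 / (3 * w0\<^sup>2)) (at_right 0)"
      using w0 by (intro tendsto_intros init_q init_W F_lim) auto
    then show "((\<lambda>r. q r * exp (F r) * r\<^sup>2 * (1 / (W r)\<^sup>2) - C * r ^ 3 / (3 * w0\<^sup>2)) \<longlongrightarrow> 0) (at_right 0)" by simp
  qed
  then have le: "C * r ^ 3 / (3 * w0\<^sup>2) \<le> q r * exp (F r) * r\<^sup>2 * (1 / (W r)\<^sup>2)" by simp
  have nn: "(W r)\<^sup>2 * exp (- F r) / r\<^sup>2 \<ge> 0" by simp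
  have "C * r ^ 3 / (3 * w0\<^sup>2) * ((W r)\<^sup>2 * exp (- F r) / r\<^sup>2) = C / 3 * r * \<kappa> r"
    unfolding \<kappa>_def using r w0 by (simp add: field_simps power2_eq_square power3_eq_cube)
  note e1 = this
  have e2: "q r * exp (F r) * r\<^sup>2 * (1 / (W r)\<^sup>2) * ((W r)\<^sup>2 * exp (- F r) / r\<^sup>2) = q r"
    using r pos(3)[OF r(1)] by (simp add: exp_minus)
  show ?thesis using mult_right_mono[OF le nn] unfolding e1 e2 .
qed

text \<open>If \<open>\<kappa>\<close> exceeded 1/\<tau> at \<delta> = 1/\<tau>, then f and b would
  have changed little: F < \<tau> and b^2 < \<tau> b(0)^2 there. The growth of b^2 then bounds
  \<open>w0\<close>, and q \<ge> C r / (3 \<tau>), integrated to F, bounds C. So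
  \<open>\<kappa>\<close> is small, and \<open>a1_le\<close> gives a(1) \<le> e (2/\<tau>).\<close>

lemma a1_small:
  assumes \<tau>: "\<tau> \<ge> 1" and large: "C \<ge> 6 * \<tau> ^ 4 * exp \<tau> \<or> w0\<^sup>2 \<ge> 3 * \<tau> ^ 3 * exp \<tau>"
  shows "a 1 \<le> 6 / \<tau>"
proof -
  define \<delta> where "\<delta> = 1 / \<tau>"
  have \<delta>: "0 < \<delta>" "\<delta> \<le> 1" using \<tau> by (auto simp: \<delta>_def)
  have "\<kappa> \<delta> \<le> 1 / \<tau>"
  proof (rule ccontr)
    assume "\<not> ?thesis"
    then have \<kappa>: "\<kappa> \<delta> > 1 / \<tau>" by simp
    have W: "0 < W \<delta>" "W \<delta> \<le> w0" using pos(3)[OF \<delta>(1)] W_le_limit[OF init_W \<delta>(1)] by auto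
    have "(W \<delta> / w0)\<^sup>2 \<le> 1\<^sup>2" using W w0 by (intro power_mono) auto
    then have "\<kappa> \<delta> \<le> 1 * exp (- F \<delta>)" unfolding \<kappa>_def by (intro mult_right_mono) auto
    then have "exp (- F \<delta>) > 1 / \<tau>" using \<kappa> by simp
    moreover have "\<tau> \<le> exp \<tau>" using exp_ge_add_one_self[of \<tau>] by linarith
    then have "exp (- \<tau>) \<le> 1 / \<tau>" using \<tau> by (simp add: exp_minus inverse_eq_divide frac_le)
    ultimately have "exp (- \<tau>) < exp (- F \<delta>)" by linarith
    then have F: "F \<delta> < \<tau>" by simp
    have "\<kappa> \<delta> \<le> (W \<delta> / w0)\<^sup>2 * 1" unfolding \<kappa>_def using F_nonneg[OF \<delta>(1)] by (intro mult_left_mono) auto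
    then have "(W \<delta> / w0)\<^sup>2 > 1 / \<tau>" using \<kappa> by simp
    then have S: "w0\<^sup>2 / (W \<delta>)\<^sup>2 < \<tau>" using W w0 \<tau> by (simp add: field_simps power_divide)
    have "w0\<^sup>2 * (1 / w0\<^sup>2 + exp (- \<tau>) * \<delta>\<^sup>2 / 3) \<le> w0\<^sup>2 * (1 / (W \<delta>)\<^sup>2)"
      using b2_ge[OF \<delta>, of \<tau>] F by (intro mult_left_mono) auto
    moreover have "w0\<^sup>2 * (1 / w0\<^sup>2 + exp (- \<tau>) * \<delta>\<^sup>2 / 3) = 1 + w0\<^sup>2 * (exp (- \<tau>) * \<delta>\<^sup>2 / 3)"
      using w0 by (simp add: distrib_left)
    ultimately have "w0\<^sup>2 * (exp (- \<tau>) * \<delta>\<^sup>2 / 3) < \<tau>" using S by simp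
    then have w: "w0\<^sup>2 < 3 * \<tau> ^ 3 * exp \<tau>"
      using \<tau> unfolding \<delta>_def by (simp add: exp_minus field_simps power2_eq_square power3_eq_cube)
    have "0 \<le> F \<delta> - C / (3 * \<tau>) * \<delta>\<^sup>2 / 2"
    proof (rule deriv_nonneg_ge_limit[where a = 0 and g = "\<lambda>r. F r - C / (3 * \<tau>) * r\<^sup>2 / 2" and g' = "\<lambda>r. q r - C / (3 * \<tau>) * (2 * r) / 2", OF \<delta>(1)])
      fix s assume s: "0 < s" "s \<le> \<delta>"
      show "((\<lambda>r. F r - C / (3 * \<tau>) * r\<^sup>2 / 2) has_real_derivative q s - C / (3 * \<tau>) * (2 * s) / 2) (at s)"
      proof (intro DERIV_diff dF s)
        have "((\<lambda>r. c * r\<^sup>2 / 2) has_real_derivative c * (2 * s) / 2) (at s)" for c :: real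
          by (auto intro!: derivative_eq_intros)
        then show "((\<lambda>r. C / (3 * \<tau>) * r\<^sup>2 / 2) has_real_derivative C / (3 * \<tau>) * (2 * s) / 2) (at s)" .
      qed
      have "1 / \<tau> \<le> \<kappa> s" using \<kappa> \<kappa>_antimono[OF s] by simp
      then have "C / 3 * s * (1 / \<tau>) \<le> C / 3 * s * \<kappa> s" using C_pos s by (intro mult_left_mono) auto
      also have "\<dots> \<le> q s" using q_ge[of s] s \<delta> by simp
      finally show "0 \<le> q s - C / (3 * \<tau>) * (2 * s) / 2" by simp
    next
      have "((\<lambda>r. F r - C / (3 * \<tau>) * r\<^sup>2 / 2) \<longlongrightarrow> 0 - C / (3 * \<tau>) * 0\<^sup>2 / 2) (at_right 0)"
        by (intro tendsto_intros F_lim) (use \<tau> in auto)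
      then show "((\<lambda>r. F r - C / (3 * \<tau>) * r\<^sup>2 / 2) \<longlongrightarrow> 0) (at_right 0)" by simp
    qed
    then have "C / (3 * \<tau>) * \<delta>\<^sup>2 / 2 < \<tau>" using F by simp
    then have "C < 6 * \<tau> ^ 4"
      using \<tau> unfolding \<delta>_def by (simp add: field_simps power2_eq_square power4_eq_xxxx)
    also have "\<dots> \<le> 6 * \<tau> ^ 4 * exp \<tau>" using \<tau> by simp
    finally show False using w large by simp
  qed
  then have "\<delta> + \<kappa> \<delta> \<le> 2 / \<tau>" by (simp add: \<delta>_def)
  then have "exp 1 * (\<delta> + \<kappa> \<delta>) \<le> 3 * (2 / \<tau>)" using exp_le \<kappa>_pos[OF \<delta>(1)] \<delta> by (intro mult_mono) auto
  then show ?thesis using a1_le[OF \<delta>] by simp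
qed

lemma exp_2_le: "exp 2 \<le> (9 :: real)"
proof -
  have "exp 2 = exp 1 * exp (1 :: real)" by (simp flip: exp_add)
  also have "\<dots> \<le> 3 * 3" using exp_le by (intro mult_mono) auto
  finally show ?thesis by simp
qed

text \<open>For C \<ge> 16 the comparison with U suffices. Otherwise f is bounded on (0, 1], which
  keeps b(1) away from 0: U(1) \<le> 144 gives F(1) \<le> 72 and then W(1) \<le> exp 37, and 40 is 1
  + 2 + 37.\<close>

lemma slope_a_le: "slope_a \<le> exp 40 * a 1 * (1 + slope_b)"
proof (cases "C \<ge> 16")
  case True
  have "slope_a \<le> exp (9/4) * a 1" by (rule slope_a_le_large_C[OF True])
  also have "\<dots> \<le> exp 40 * a 1 * (1 + slope_b)"
    using slopes_pos pos(7)[of 1] by (simp add: mult_mono[of "exp (9/4) * a 1" "exp 40 * a 1" 1, simplified])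
  finally show ?thesis .
next
  case False
  have "U 1 \<le> C * exp 2" using qU_le[of 1] pos(4)[of 1] by simp
  also have "\<dots> \<le> 16 * 9" using False exp_2_le C_pos by (intro mult_mono) auto
  finally have "F 1 \<le> 72" using C_pos by (simp add: F_def)
  then have "1 / w0\<^sup>2 + exp (- 72) * 1\<^sup>2 / 3 \<le> 1 / (W 1)\<^sup>2" by (intro b2_ge) auto
  moreover have "1 / w0\<^sup>2 > 0" using w0 by simp
  ultimately have "exp (- 72) / 3 \<le> 1 / (W 1)\<^sup>2" unfolding one_power2 mult_1_right by linarith
  then have "(W 1)\<^sup>2 \<le> 3 * exp 72" using pos(3)[of 1] by (simp add: exp_minus field_simps)
  also have "\<dots> \<le> exp 2 * exp 72" using exp_ge_add_one_self[of 2] by (intro mult_right_mono) auto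
  also have "\<dots> = (exp 37)\<^sup>2" by (simp flip: exp_add exp_double)
  finally have W1: "W 1 \<le> exp 37" by (rule power2_le_imp_le) simp
  have "slope_a \<le> 2 * exp 2 * (a 1 * W 1) * slope_b" by (rule slope_a_le_slope_b)
  also have "\<dots> \<le> exp 1 * exp 2 * (a 1 * exp 37) * (1 + slope_b)"
    using W1 pos(3,7)[of 1] slopes_pos exp_ge_add_one_self[of 1] by (intro mult_mono) auto
  also have "\<dots> = (exp 1 * exp 2 * exp 37) * a 1 * (1 + slope_b)" by simp
  also have "exp 1 * exp 2 * exp 37 = exp (40::real)" by (simp flip: exp_add)
  finally show ?thesis .
qed

text \<open>On (0, 1] one has M \<le> 2 r and q \<le> 9 \<Lambda>. At contact of M with \<mu> r this
  gives X M \<le> \<mu> (6 + 9 \<Lambda>) = 1 - 2 \<mu>, so M' > \<mu>; this dictates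
  \<open>\<mu>\<close>. Hence b'(1) \<ge> \<mu> b(0) > 1, and \<open>slope_b_ge\<close>
  applies.\<close>

lemma slope_b_large_b0:
  assumes w1: "w0 \<le> 1" and C: "C \<le> \<Lambda>" and \<mu>: "\<mu> = 1 / (8 + 9 * \<Lambda>)" "\<mu> / w0 > 1"
  shows "slope_b \<ge> \<mu> / w0"
proof -
  have \<Lambda>: "\<Lambda> > 0" using C C_pos by simp
  have \<mu>0: "0 < \<mu>" "\<mu> < 1/4" "\<mu> * (8 + 9 * \<Lambda>) = 1" using \<Lambda> unfolding \<mu>(1) by auto
  have M2: "M r \<le> 2 * r" if r: "0 < r" for r
  proof -
    have "M r - 2 * r \<le> 0"
    proof (rule deriv_nonpos_le_limit[where a = 0 and g = "\<lambda>r. M r - 2 * r" and g' = "\<lambda>r. 1 + (W r)\<^sup>2 - X r * M r - 2", OF r])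
      fix t assume t: "0 < t" "t \<le> r"
      then show "((\<lambda>r. M r - 2 * r) has_real_derivative 1 + (W t)\<^sup>2 - X t * M t - 2) (at t)"
        by (auto intro!: derivative_eq_intros derivs)
      have "(W t)\<^sup>2 \<le> 1\<^sup>2" using W_le_limit[OF init_W t(1)] w1 pos(3)[OF t(1)] by (intro power_mono) auto
      moreover have "X t * M t \<ge> 0" using pos[OF t(1)] by simp
      ultimately show "1 + (W t)\<^sup>2 - X t * M t - 2 \<le> 0" by simp
    next
      have "((\<lambda>r. M r - 2 * r) \<longlongrightarrow> 0 - 2 * 0) (at_right 0)" by (intro tendsto_intros init_M0)
      then show "((\<lambda>r. M r - 2 * r) \<longlongrightarrow> 0) (at_right 0)" by simp
    qed
    then show ?thesis by simp
  qed
  have "M 1 - \<mu> * 1 > 0"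
  proof (rule first_zero_pos[where a = 0 and r = 1 and g = "\<lambda>r. M r - \<mu> * r" and g' = "\<lambda>r. 1 + (W r)\<^sup>2 - X r * M r - \<mu>"])
    fix t :: real assume t: "0 < t" "t \<le> 1"
    then show "((\<lambda>r. M r - \<mu> * r) has_real_derivative 1 + (W t)\<^sup>2 - X t * M t - \<mu>) (at t)"
      by (auto intro!: derivative_eq_intros derivs)
    assume "M t - \<mu> * t = 0"
    then have Mt: "M t = \<mu> * t" by simp
    have "C * exp (2 * t) \<le> \<Lambda> * 9"
    proof (rule mult_mono[OF C])
      show "exp (2 * t) \<le> 9" by (rule order_trans[OF _ exp_2_le]) (use t in simp)
    qed (use \<Lambda> in auto)
    then have q9: "q t \<le> 9 * \<Lambda>" using qU_le[OF t(1)] pos(5)[OF t(1)] by simp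
    have "X t * M t \<le> (1 + 1 / t + 2 * (2 * t) + 9 * \<Lambda>) * (\<mu> * t)"
      unfolding Mt using X_eq'[OF t(1)] L_lt[OF t(1)] M2[OF t(1)] q9 \<mu>0 t by (intro mult_right_mono) auto
    also have "\<dots> = \<mu> * (1 + t * (1 + 9 * \<Lambda>) + 4 * (t * t))" using t by (simp add: field_simps)
    also have "\<dots> \<le> \<mu> * (1 + 1 * (1 + 9 * \<Lambda>) + 4 * (1 * 1))"
      using t \<mu>0 \<Lambda> by (intro mult_left_mono add_mono mult_mono) auto
    also have "\<dots> = 1 - 2 * \<mu>" using \<mu>0(3) by (simp add: algebra_simps)
    finally have "X t * M t \<le> 1 - 2 * \<mu>" .
    then show "0 < 1 + (W t)\<^sup>2 - X t * M t - \<mu>" using \<mu>0 zero_le_power2[of "W t"] by linarith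
  next
    have "\<forall>\<^sub>F s in at_right 0. (s::real) > 0" by (simp add: eventually_at_right_less)
    then show "\<forall>\<^sub>F s in at_right 0. 0 < M s - \<mu> * s" using init_M_gt
    proof eventually_elim
      case (elim s)
      have "\<mu> * s \<le> 1/4 * s" using elim \<mu>0 by (intro mult_right_mono) auto
      then show ?case using elim(2) by linarith
    qed
  qed simp
  then have "\<mu> / w0 \<le> M 1 / W 1"
    using W_le_limit[OF init_W, of 1] pos(3)[of 1] \<mu>0 by (intro frac_le) auto
  then show ?thesis using slope_b_ge[of 1] \<mu>(2) by linarith
qed

end

section \<open>Absence of blow-up, and the passage between the system and the soliton
  equations\<close>

context phase
begin

text \<open>X' \<le> 1 and q < X bound q, and hence U; L and M grow at most linearly and W
  decreases.\<close>

lemma bounds: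
  assumes I: "I \<subseteq> {..<T}" and s: "s \<in> I"
  obtains B where "\<And>r. r \<in> I \<Longrightarrow> s \<le> r \<Longrightarrow> \<bar>L r\<bar> \<le> B \<and> \<bar>M r\<bar> \<le> B \<and> \<bar>W r\<bar> \<le> B \<and> \<bar>q r\<bar> \<le> B \<and> \<bar>U r\<bar> \<le> B"
proof -
  define D where "D = T - s"
  define Bq where "Bq = X s + D"
  define B where "B = (L s + D) + (M s + (1 + (W s)\<^sup>2) * D) + W s + Bq + (U s + 2 * Bq * D)"
  have s0: "0 < s" using I_pos s by blast
  have D: "D > 0" using I s by (auto simp: D_def)
  note ps = L_pos[OF s] M_pos[OF s] W_pos[OF s] X_pos[OF s] U_pos[OF s]
  have Bq: "Bq > 0" using ps D by (simp add: Bq_def)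
  have parts: "0 \<le> L s + D" "0 \<le> M s + (1 + (W s)\<^sup>2) * D" "0 \<le> W s" "0 \<le> Bq" "0 \<le> U s + 2 * Bq * D"
    using ps D Bq by auto
  show ?thesis
  proof (rule that[of B])
    fix r assume r: "r \<in> I" "s \<le> r"
    have rD: "0 \<le> r - s" "r - s \<le> D" using I r by (auto simp: D_def)
    have "L r \<le> L s + D" using L_upper[OF s0 r(2,1)] rD by simp
    moreover have "M r \<le> M s + (1 + (W s)\<^sup>2) * D"
      using M_upper[OF s0 r(2,1)] rD mult_left_mono[of "r - s" D "1 + (W s)\<^sup>2"] by (smt (verit) zero_le_power2)
    moreover have "W r \<le> W s" by (rule W_antimono[OF s0 r(2,1)])
    moreover have q: "q r \<le> Bq" using X_upper[OF s0 r(2,1)] X_gt_q[OF r(1)] rD by (simp add: Bq_def)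
    moreover have "2 * q r * (r - s) \<le> 2 * Bq * D" using q rD q_pos[OF r(1)] Bq by (intro mult_mono) auto
    then have "U r \<le> U s + 2 * Bq * D" using U_upper[OF s0 r(2,1)] by simp
    ultimately show "\<bar>L r\<bar> \<le> B \<and> \<bar>M r\<bar> \<le> B \<and> \<bar>W r\<bar> \<le> B \<and> \<bar>q r\<bar> \<le> B \<and> \<bar>U r\<bar> \<le> B"
      using L_pos[OF r(1)] M_pos[OF r(1)] W_pos[OF r(1)] q_pos[OF r(1)] U_pos[OF r(1)] parts
      unfolding B_def by linarith
  qed
qed

end

text \<open>The equations of a and b rest on X = L + 2 M + q; the equation of f is where the
  identity \<open>X_sq\<close> enters.\<close>

lemma soliton_of_phase:
  assumes "phase L M X W q U {0<..}"
    and smooth: "smooth_halfline a" "smooth_halfline b" "smooth_halfline f"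
    and a: "\<And>r. r > 0 \<Longrightarrow> a r > 0" "\<And>r. r > 0 \<Longrightarrow> (a has_real_derivative L r * a r) (at r)"
    and b: "\<And>r. r > 0 \<Longrightarrow> b r = 1 / W r"
    and f: "\<And>r. r > 0 \<Longrightarrow> (f has_real_derivative - q r) (at r)"
  shows "soliton a b f"
proof -
  interpret phase L M X W q U "{0<..}" by fact
  have deriv2: "hderiv (hderiv g) r = d2"
    if "r > 0" "\<And>s. s > 0 \<Longrightarrow> hderiv g s = g' s" "(g' has_real_derivative d2) (at r)" for g g' r d2
    by (rule hderiv_eq_pos, rule has_field_derivative_transform_within_open[where S = "{0<..}", OF that(3)])
       (use that in auto)
  have ha: "hderiv a r = L r * a r" if "r > 0" for r using hderiv_eq_pos[OF a(2)] that by blast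
  have hf: "hderiv f r = - q r" if "r > 0" for r using hderiv_eq_pos[OF f] that by blast
  have db: "(b has_real_derivative M r / W r) (at r)" if "r > 0" for r
  proof -
    have "((\<lambda>r. 1 / W r) has_real_derivative M r / W r) (at r)"
      using that W_pos[of r] by (auto intro!: derivative_eq_intros dW)
    then show ?thesis
      by (rule has_field_derivative_transform_within_open[where S = "{0<..}"]) (use that b in auto)
  qed
  have hb: "hderiv b r = M r / W r" if "r > 0" for r using hderiv_eq_pos[OF db] that by blast
  have haa: "hderiv (hderiv a) r = (1 - X r * L r) * a r + L r * (L r * a r)" if "r > 0" for r
    by (rule deriv2[OF that ha]) (use that in \<open>auto intro!: derivative_eq_intros dL a(2)\<close>)
  have hbb: "hderiv (hderiv b) r = (1 + (W r)\<^sup>2 - X r * M r + (M r)\<^sup>2) / W r" if "r > 0" for r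
    by (rule deriv2[OF that hb])
       (use that W_pos[of r] in \<open>auto intro!: derivative_eq_intros dM dW simp: field_simps power2_eq_square\<close>)
  have hff: "hderiv (hderiv f) r = - (U r - X r * q r)" if "r > 0" for r
    by (rule deriv2[OF that hf]) (use that in \<open>auto intro!: derivative_eq_intros dq\<close>)
  show ?thesis
    unfolding soliton_def
  proof (intro conjI allI impI smooth)
    fix r :: real assume r: "0 < r"
    have W: "W r > 0" and ar: "a r > 0" and Xe: "X r = L r + 2 * M r + q r" using W_pos a(1) X_eq r by auto
    show "a r > 0" by fact
    show "b r > 0" using b r W by simp
    have Ur: "U r = (X r)\<^sup>2 - 2 - 2 * (W r)\<^sup>2 - (L r)\<^sup>2 - 2 * (M r)\<^sup>2" using X_sq[of r] r by simp
    have r1: "((1 - X r * L r) * a r + L r * (L r * a r)) / a r = 1 - X r * L r + (L r)\<^sup>2"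
      using ar by (simp add: field_simps power2_eq_square)
    have r2: "(1 + (W r)\<^sup>2 - X r * M r + (M r)\<^sup>2) / W r / (1 / W r) = 1 + (W r)\<^sup>2 - X r * M r + (M r)\<^sup>2"
      using W by simp
    show "hderiv (hderiv f) r = hderiv (hderiv a) r / a r + 2 * (hderiv (hderiv b) r / b r) - 1"
      unfolding hff[OF r] haa[OF r] hbb[OF r] b[OF r] r1 r2 Ur
      using Xe by (simp add: power2_eq_square algebra_simps)
    show "hderiv (hderiv a) r = - 2 * (hderiv a r * hderiv b r / b r) + hderiv a r * hderiv f r + a r"
      unfolding haa[OF r] ha[OF r] hb[OF r] hf[OF r] b[OF r] Xe using W by (simp add: algebra_simps)
    show "hderiv (hderiv b) r = (1 - (hderiv b r)\<^sup>2) / b r - hderiv a r * hderiv b r / a r + hderiv b r * hderiv f r + b r"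
      unfolding hbb[OF r] ha[OF r] hb[OF r] hf[OF r] b[OF r] Xe using W ar
      by (simp add: field_simps power2_eq_square)
  qed
qed

text \<open>The last claim is Hamilton's identity.\<close>

lemma soliton_system:
  assumes "soliton a b f"
  defines "L \<equiv> \<lambda>r. hderiv a r / a r" and "M \<equiv> \<lambda>r. hderiv b r / b r" and "q \<equiv> \<lambda>r. - hderiv f r"
  defines "X \<equiv> \<lambda>r. L r + 2 * M r + q r"
  shows "\<And>r. r > 0 \<Longrightarrow> (L has_real_derivative 1 - X r * L r) (at r)"
    and "\<And>r. r > 0 \<Longrightarrow> (M has_real_derivative 1 + (1 / b r)\<^sup>2 - X r * M r) (at r)"
    and "\<And>r. r > 0 \<Longrightarrow> ((\<lambda>r. 1 / b r) has_real_derivative - (M r * (1 / b r))) (at r)"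
    and "\<exists>C. \<forall>r>0. hderiv (hderiv f) r = X r * q r - (C - 2 * f r)"
proof -
  have sm: "smooth_halfline a" "smooth_halfline b" "smooth_halfline f" using assms(1) unfolding soliton_def by auto
  have eq: "a r > 0" "b r > 0"
    "hderiv (hderiv f) r = hderiv (hderiv a) r / a r + 2 * (hderiv (hderiv b) r / b r) - 1"
    "hderiv (hderiv a) r = - 2 * (hderiv a r * hderiv b r / b r) + hderiv a r * hderiv f r + a r"
    "hderiv (hderiv b) r = (1 - (hderiv b r)\<^sup>2) / b r - hderiv a r * hderiv b r / a r + hderiv b r * hderiv f r + b r"
    if "r > 0" for r using assms(1) that unfolding soliton_def by auto
  have d1: "(g has_real_derivative hderiv g r) (at r)" "(hderiv g has_real_derivative hderiv (hderiv g) r) (at r)"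
    if "smooth_halfline g" "r > 0" for g r
    using smooth_halfline_derivs(1,2)[OF that(1), of r] that(2) by (simp_all add: at_within_halfline)
  show dL: "(L has_real_derivative 1 - X r * L r) (at r)" if "r > 0" for r
  proof -
    have "((\<lambda>r. hderiv a r / a r) has_real_derivative (hderiv (hderiv a) r * a r - hderiv a r * hderiv a r) / (a r * a r)) (at r)"
      using eq[OF that] by (intro DERIV_divide d1 sm that) auto
    then show ?thesis unfolding L_def
      by (rule DERIV_cong) (use eq(1,2)[OF that] in \<open>simp add: eq(4)[OF that] X_def L_def M_def q_def field_simps\<close>)
  qed
  show dM: "(M has_real_derivative 1 + (1 / b r)\<^sup>2 - X r * M r) (at r)" if "r > 0" for r
  proof -
    have "((\<lambda>r. hderiv b r / b r) has_real_derivative (hderiv (hderiv b) r * b r - hderiv b r * hderiv b r) / (b r * b r)) (at r)"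
      using eq[OF that] by (intro DERIV_divide d1 sm that) auto
    then show ?thesis unfolding M_def
      by (rule DERIV_cong) (use eq(1,2)[OF that] in \<open>simp add: eq(5)[OF that] X_def L_def M_def q_def field_simps power2_eq_square\<close>)
  qed
  show dW: "((\<lambda>r. 1 / b r) has_real_derivative - (M r * (1 / b r))) (at r)" if "r > 0" for r
    using eq(2)[OF that] by (auto intro!: derivative_eq_intros d1 sm that simp: M_def)
  \<comment> \<open>The soliton equations combine to V = X q - f''. In the derivative of V + 2 f all
    terms cancel, so V is C - 2 f for a constant C.\<close>
  define V where "V = (\<lambda>r. (X r)\<^sup>2 - 2 - 2 * (1 / b r)\<^sup>2 - (L r)\<^sup>2 - 2 * (M r)\<^sup>2)"
  have hff: "hderiv (hderiv f) r = X r * q r - V r" if "r > 0" for r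
  proof -
    have A: "hderiv (hderiv a) r / a r = 1 - X r * L r + (L r)\<^sup>2"
      unfolding eq(4)[OF that] using eq(1,2)[OF that] by (simp add: X_def L_def M_def q_def field_simps power2_eq_square)
    have B: "hderiv (hderiv b) r / b r = 1 + (1 / b r)\<^sup>2 - X r * M r + (M r)\<^sup>2"
      unfolding eq(5)[OF that] using eq(1,2)[OF that] by (simp add: X_def L_def M_def q_def field_simps power2_eq_square)
    have "hderiv (hderiv f) r = X r * (- L r - 2 * M r) + 2 + 2 * (1 / b r)\<^sup>2 + (L r)\<^sup>2 + 2 * (M r)\<^sup>2"
      unfolding eq(3)[OF that] A B by (simp add: algebra_simps)
    also have "\<dots> = X r * q r - V r" unfolding V_def by (simp add: X_def power2_eq_square algebra_simps)
    finally show ?thesis .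
  qed
  have dq: "(q has_real_derivative V r - X r * q r) (at r)" if "r > 0" for r
    unfolding q_def by (rule DERIV_cong[OF DERIV_minus[OF d1(2)]]) (use sm that hff in \<open>auto simp: q_def\<close>)
  have dX: "(X has_real_derivative 1 - (L r)\<^sup>2 - 2 * (M r)\<^sup>2) (at r)" if "r > 0" for r
    unfolding X_def
    by (rule DERIV_cong[OF DERIV_add[OF DERIV_add[OF dL DERIV_cmult[OF dM]] dq]])
       (use that in \<open>auto simp: V_def X_def power2_eq_square algebra_simps\<close>)
  have dV: "((\<lambda>r. V r + 2 * f r) has_real_derivative 0) (at r)" if "r > 0" for r
  proof -
    have "((\<lambda>r. V r + 2 * f r) has_real_derivative
        2 * X r * (1 - (L r)\<^sup>2 - 2 * (M r)\<^sup>2) - 4 * (1 / b r) * (- (M r * (1 / b r)))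
          - 2 * L r * (1 - X r * L r) - 4 * M r * (1 + (1 / b r)\<^sup>2 - X r * M r) + 2 * hderiv f r) (at r)"
      unfolding V_def by (auto intro!: derivative_eq_intros dX dW[THEN DERIV_cong] dL dM d1 sm that)
    then show ?thesis by (rule DERIV_cong) (simp add: X_def q_def power2_eq_square algebra_simps)
  qed
  have const: "V r + 2 * f r = V 1 + 2 * f 1" if "r > 0" for r
  proof (rule DERIV_zero_connected_constant[where S = "{0<..}" and K = "{}"])
    show "continuous_on {0<..} (\<lambda>r. V r + 2 * f r)"
      by (intro continuous_at_imp_continuous_on) (use dV DERIV_isCont in auto)
  qed (use dV that in auto)
  show "\<exists>C. \<forall>r>0. hderiv (hderiv f) r = X r * q r - (C - 2 * f r)"
  proof (intro exI allI impI)
    fix r :: real assume "r > 0"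
    from hff[OF this] const[OF this]
    show "hderiv (hderiv f) r = X r * q r - ((V 1 + 2 * f 1) - 2 * f r)" by simp
  qed
qed

section \<open>Continuous dependence of the asymptotic slopes\<close>

text \<open>A local 3-epsilon argument in which the time s may depend on the point:
  \<open>G s\<close> persists nearby, and the error bound \<open>t s\<close>, being continuous,
  stays small there.\<close>

lemma continuous_on_limit_of_tails:
  fixes g :: "real \<Rightarrow> 'p :: metric_space \<Rightarrow> real"
  assumes g: "\<And>s. s > 0 \<Longrightarrow> continuous_on \<Theta> (g s)" and t: "\<And>s. s > 0 \<Longrightarrow> continuous_on \<Theta> (t s)"
    and G: "\<And>s \<theta>. s > 0 \<Longrightarrow> \<theta> \<in> \<Theta> \<Longrightarrow> G s \<theta> \<Longrightarrow> eventually (\<lambda>\<theta>'. G s \<theta>') (at \<theta> within \<Theta>)"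
    and tail: "\<And>s \<theta>. s > 0 \<Longrightarrow> \<theta> \<in> \<Theta> \<Longrightarrow> G s \<theta> \<Longrightarrow> \<bar>l \<theta> - g s \<theta>\<bar> \<le> t s \<theta>"
    and small: "\<And>\<theta> e. \<theta> \<in> \<Theta> \<Longrightarrow> e > 0 \<Longrightarrow> \<exists>s>0. G s \<theta> \<and> t s \<theta> < e"
  shows "continuous_on \<Theta> l"
  unfolding continuous_on_def
proof
  fix \<theta> assume \<theta>: "\<theta> \<in> \<Theta>"
  show "(l \<longlongrightarrow> l \<theta>) (at \<theta> within \<Theta>)"
  proof (rule tendstoI)
    fix e :: real assume "e > 0"
    then obtain s where s: "s > 0" "G s \<theta>" "t s \<theta> < e / 4" using small[OF \<theta>, of "e/4"] by auto
    have lim: "(g s \<longlongrightarrow> g s \<theta>) (at \<theta> within \<Theta>)" "(t s \<longlongrightarrow> t s \<theta>) (at \<theta> within \<Theta>)"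
      using g[OF s(1)] t[OF s(1)] \<theta> by (auto simp: continuous_on_def)
    have "\<forall>\<^sub>F \<theta>' in at \<theta> within \<Theta>. dist (g s \<theta>') (g s \<theta>) < e / 4"
      by (rule tendstoD[OF lim(1)]) (use \<open>e > 0\<close> in simp)
    moreover have "\<forall>\<^sub>F \<theta>' in at \<theta> within \<Theta>. t s \<theta>' < e / 4" by (rule order_tendstoD(2)[OF lim(2) s(3)])
    moreover have "\<forall>\<^sub>F \<theta>' in at \<theta> within \<Theta>. G s \<theta>'" by (rule G[OF s(1) \<theta> s(2)])
    moreover have "\<forall>\<^sub>F \<theta>' in at \<theta> within \<Theta>. \<theta>' \<in> \<Theta>" by (auto simp: eventually_at_filter)
    ultimately show "\<forall>\<^sub>F \<theta>' in at \<theta> within \<Theta>. dist (l \<theta>') (l \<theta>) < e"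
    proof eventually_elim
      case (elim \<theta>')
      then show ?case
        using tail[OF s(1) \<theta> s(2)] tail[OF s(1) \<open>\<theta>' \<in> \<Theta>\<close> \<open>G s \<theta>'\<close>] s \<open>e > 0\<close> unfolding dist_real_def by linarith
    qed
  qed
qed

text \<open>Applied to the logarithms of the slopes. The trap is given by strict inequalities
  between continuous functions of the parameter, and \<open>tail_a\<close> and \<open>tail_b\<close>
  are continuous expressions in the state at time s.\<close>

lemma slopes_continuous:
  fixes L M X W q U a :: "'p :: metric_space \<Rightarrow> real \<Rightarrow> real"
  assumes ex: "\<And>\<theta>. \<theta> \<in> \<Theta> \<Longrightarrow> expander (L \<theta>) (M \<theta>) (X \<theta>) (W \<theta>) (q \<theta>) (U \<theta>) (a \<theta>) (C \<theta>)"
    and cont: "\<And>s. s > 0 \<Longrightarrow> continuous_on \<Theta> (\<lambda>\<theta>. L \<theta> s)" "\<And>s. s > 0 \<Longrightarrow> continuous_on \<Theta> (\<lambda>\<theta>. M \<theta> s)"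
      "\<And>s. s > 0 \<Longrightarrow> continuous_on \<Theta> (\<lambda>\<theta>. X \<theta> s)" "\<And>s. s > 0 \<Longrightarrow> continuous_on \<Theta> (\<lambda>\<theta>. W \<theta> s)"
      "\<And>s. s > 0 \<Longrightarrow> continuous_on \<Theta> (\<lambda>\<theta>. U \<theta> s)" "\<And>s. s > 0 \<Longrightarrow> continuous_on \<Theta> (\<lambda>\<theta>. a \<theta> s)"
  shows "continuous_on \<Theta> (\<lambda>\<theta>. expander.slope_a (L \<theta>) (a \<theta>))"
    and "continuous_on \<Theta> (\<lambda>\<theta>. expander.slope_b (M \<theta>) (W \<theta>))"
proof -
  define T where "T = (\<lambda>s \<theta>. expander.trap (L \<theta>) (M \<theta>) (X \<theta>) (W \<theta>) (U \<theta>) s)"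
  define la where "la = (\<lambda>s \<theta>. expander.ln_a' (L \<theta>) (a \<theta>) s)"
  define lb where "lb = (\<lambda>s \<theta>. expander.ln_b' (M \<theta>) (W \<theta>) s)"
  define ta where "ta = (\<lambda>s \<theta>. expander.tail_a (L \<theta>) (X \<theta>) s)"
  define tb where "tb = (\<lambda>s \<theta>. expander.tail_b (M \<theta>) (X \<theta>) (W \<theta>) s)"
  have pos: "L \<theta> s > 0" "M \<theta> s > 0" "W \<theta> s > 0" "X \<theta> s > 0" "a \<theta> s > 0" if "\<theta> \<in> \<Theta>" "s > 0" for \<theta> s
  proof -
    interpret expander "L \<theta>" "M \<theta>" "X \<theta>" "W \<theta>" "q \<theta>" "U \<theta>" "a \<theta>" "C \<theta>" by (rule ex[OF that(1)])
    show "L \<theta> s > 0" "M \<theta> s > 0" "W \<theta> s > 0" "X \<theta> s > 0" "a \<theta> s > 0" using pos that(2) by auto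
  qed
  have defs: "T s \<theta> \<longleftrightarrow> U \<theta> s > 16 \<and> L \<theta> s < 1/2 \<and> M \<theta> s < 1/2 \<and> W \<theta> s < 1/2 \<and>
      1 < X \<theta> s * L \<theta> s \<and> X \<theta> s * L \<theta> s < 2 \<and> 1 < X \<theta> s * M \<theta> s \<and> X \<theta> s * M \<theta> s < 3"
    "la s \<theta> = ln (L \<theta> s * a \<theta> s)" "lb s \<theta> = ln (M \<theta> s / W \<theta> s)"
    "ta s \<theta> = \<bar>1 / L \<theta> s - X \<theta> s + L \<theta> s\<bar> + 76 / X \<theta> s"
    "tb s \<theta> = \<bar>(1 + (W \<theta> s)\<^sup>2) / M \<theta> s - X \<theta> s + M \<theta> s\<bar> + 4 * (14 + (X \<theta> s * W \<theta> s)\<^sup>2) / X \<theta> s"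
    if "\<theta> \<in> \<Theta>" for s \<theta>
  proof -
    interpret expander "L \<theta>" "M \<theta>" "X \<theta>" "W \<theta>" "q \<theta>" "U \<theta>" "a \<theta>" "C \<theta>" by (rule ex[OF that])
    show "T s \<theta> \<longleftrightarrow> U \<theta> s > 16 \<and> L \<theta> s < 1/2 \<and> M \<theta> s < 1/2 \<and> W \<theta> s < 1/2 \<and>
      1 < X \<theta> s * L \<theta> s \<and> X \<theta> s * L \<theta> s < 2 \<and> 1 < X \<theta> s * M \<theta> s \<and> X \<theta> s * M \<theta> s < 3"
      "la s \<theta> = ln (L \<theta> s * a \<theta> s)" "lb s \<theta> = ln (M \<theta> s / W \<theta> s)"
      "ta s \<theta> = \<bar>1 / L \<theta> s - X \<theta> s + L \<theta> s\<bar> + 76 / X \<theta> s"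
      "tb s \<theta> = \<bar>(1 + (W \<theta> s)\<^sup>2) / M \<theta> s - X \<theta> s + M \<theta> s\<bar> + 4 * (14 + (X \<theta> s * W \<theta> s)\<^sup>2) / X \<theta> s"
      by (simp_all add: T_def la_def lb_def ta_def tb_def trap_def ln_a'_def ln_b'_def tail_a_def tail_b_def E_def G_def)
  qed
  have evT: "eventually (T s) (at \<theta> within \<Theta>)" if s: "s > 0" and \<theta>: "\<theta> \<in> \<Theta>" and T: "T s \<theta>" for s \<theta>
  proof -
    have lim: "((\<lambda>\<theta>. L \<theta> s) \<longlongrightarrow> L \<theta> s) (at \<theta> within \<Theta>)" "((\<lambda>\<theta>. M \<theta> s) \<longlongrightarrow> M \<theta> s) (at \<theta> within \<Theta>)"
      "((\<lambda>\<theta>. X \<theta> s) \<longlongrightarrow> X \<theta> s) (at \<theta> within \<Theta>)" "((\<lambda>\<theta>. W \<theta> s) \<longlongrightarrow> W \<theta> s) (at \<theta> within \<Theta>)"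
      "((\<lambda>\<theta>. U \<theta> s) \<longlongrightarrow> U \<theta> s) (at \<theta> within \<Theta>)"
      using cont s \<theta> by (auto simp: continuous_on_def)
    note lim2 = tendsto_mult[OF lim(3,1)] tendsto_mult[OF lim(3,2)]
    have in\<Theta>: "\<forall>\<^sub>F \<theta>' in at \<theta> within \<Theta>. \<theta>' \<in> \<Theta>" by (auto simp: eventually_at_filter)
    have "U \<theta> s > 16" "L \<theta> s < 1/2" "M \<theta> s < 1/2" "W \<theta> s < 1/2"
      "1 < X \<theta> s * L \<theta> s" "X \<theta> s * L \<theta> s < 2" "1 < X \<theta> s * M \<theta> s" "X \<theta> s * M \<theta> s < 3"
      using T unfolding defs(1)[OF \<theta>] by auto
    note ev = order_tendstoD(1)[OF lim(5) this(1)] order_tendstoD(2)[OF lim(1) this(2)]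
      order_tendstoD(2)[OF lim(2) this(3)] order_tendstoD(2)[OF lim(4) this(4)]
      order_tendstoD(1)[OF lim2(1) this(5)] order_tendstoD(2)[OF lim2(1) this(6)]
      order_tendstoD(1)[OF lim2(2) this(7)] order_tendstoD(2)[OF lim2(2) this(8)]
    show ?thesis using ev in\<Theta> by eventually_elim (simp add: defs(1))
  qed
  have small: "\<exists>s>0. T s \<theta> \<and> ta s \<theta> < e \<and> tb s \<theta> < e" if "\<theta> \<in> \<Theta>" and e: "e > 0" for \<theta> e
  proof -
    interpret expander "L \<theta>" "M \<theta>" "X \<theta>" "W \<theta>" "q \<theta>" "U \<theta>" "a \<theta>" "C \<theta>" by (rule ex[OF that(1)])
    show ?thesis using ex_small_tail[OF e] unfolding T_def ta_def tb_def by metis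
  qed
  have tails: "\<bar>ln (expander.slope_a (L \<theta>) (a \<theta>)) - la s \<theta>\<bar> \<le> ta s \<theta>"
    "\<bar>ln (expander.slope_b (M \<theta>) (W \<theta>)) - lb s \<theta>\<bar> \<le> tb s \<theta>" if "s > 0" "\<theta> \<in> \<Theta>" "T s \<theta>" for s \<theta>
  proof -
    interpret expander "L \<theta>" "M \<theta>" "X \<theta>" "W \<theta>" "q \<theta>" "U \<theta>" "a \<theta>" "C \<theta>" by (rule ex[OF that(2)])
    show "\<bar>ln slope_a - la s \<theta>\<bar> \<le> ta s \<theta>" "\<bar>ln slope_b - lb s \<theta>\<bar> \<le> tb s \<theta>"
      using ln_slope_tail[OF ln_slopes that(1)] that(3) by (simp_all add: T_def la_def lb_def ta_def tb_def)
  qed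
  have cla: "continuous_on \<Theta> (la s)" and clb: "continuous_on \<Theta> (lb s)" and cta: "continuous_on \<Theta> (ta s)"
    and ctb: "continuous_on \<Theta> (tb s)" if s: "s > 0" for s
  proof -
    have "continuous_on \<Theta> (\<lambda>\<theta>. ln (L \<theta> s * a \<theta> s))" using pos s
      by (intro continuous_intros cont s) (metis less_irrefl mult_pos_pos)
    then show "continuous_on \<Theta> (la s)" by (rule continuous_on_cong[THEN iffD1, rotated 2]) (auto simp: defs)
    have "continuous_on \<Theta> (\<lambda>\<theta>. ln (M \<theta> s / W \<theta> s))" using pos s
      by (intro continuous_intros cont s) (metis less_irrefl, metis less_irrefl divide_pos_pos)
    then show "continuous_on \<Theta> (lb s)" by (rule continuous_on_cong[THEN iffD1, rotated 2]) (auto simp: defs)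
    have "continuous_on \<Theta> (\<lambda>\<theta>. \<bar>1 / L \<theta> s - X \<theta> s + L \<theta> s\<bar> + 76 / X \<theta> s)" using pos s
      by (intro continuous_intros cont s) (metis less_irrefl)+
    then show "continuous_on \<Theta> (ta s)" by (rule continuous_on_cong[THEN iffD1, rotated 2]) (auto simp: defs)
    have "continuous_on \<Theta> (\<lambda>\<theta>. \<bar>(1 + (W \<theta> s)\<^sup>2) / M \<theta> s - X \<theta> s + M \<theta> s\<bar> + 4 * (14 + (X \<theta> s * W \<theta> s)\<^sup>2) / X \<theta> s)" using pos s
      by (intro continuous_intros cont s) (metis less_irrefl)+
    then show "continuous_on \<Theta> (tb s)" by (rule continuous_on_cong[THEN iffD1, rotated 2]) (auto simp: defs)
  qed
  have "continuous_on \<Theta> (\<lambda>\<theta>. ln (expander.slope_a (L \<theta>) (a \<theta>)))"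
    by (rule continuous_on_limit_of_tails[where G = T, OF cla cta evT tails(1)]) (use small in blast)+
  then have "continuous_on \<Theta> (\<lambda>\<theta>. exp (ln (expander.slope_a (L \<theta>) (a \<theta>))))" by (rule continuous_on_exp)
  then show "continuous_on \<Theta> (\<lambda>\<theta>. expander.slope_a (L \<theta>) (a \<theta>))"
    by (rule continuous_on_cong[THEN iffD1, rotated 2]) (use expander.slopes_pos[OF ex] in auto)
  have "continuous_on \<Theta> (\<lambda>\<theta>. ln (expander.slope_b (M \<theta>) (W \<theta>)))"
    by (rule continuous_on_limit_of_tails[where G = T, OF clb ctb evT tails(2)]) (use small in blast)+
  then have "continuous_on \<Theta> (\<lambda>\<theta>. exp (ln (expander.slope_b (M \<theta>) (W \<theta>))))" by (rule continuous_on_exp)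
  then show "continuous_on \<Theta> (\<lambda>\<theta>. expander.slope_b (M \<theta>) (W \<theta>))"
    by (rule continuous_on_cong[THEN iffD1, rotated 2]) (use expander.slopes_pos[OF ex] in auto)
qed

section \<open>Coordinates for the concrete systems, and limits at r = 0\<close>

datatype idx = I1 | I2 | I3 | I4 | I5 | I6

instance idx :: finite
proof
  have "(UNIV :: idx set) \<subseteq> {I1, I2, I3, I4, I5, I6}" by (auto intro: idx.exhaust)
  then show "finite (UNIV :: idx set)" by (rule finite_subset) simp
qed

definition vec6 :: "real \<Rightarrow> real \<Rightarrow> real \<Rightarrow> real \<Rightarrow> real \<Rightarrow> real \<Rightarrow> real^idx" where
  "vec6 x1 x2 x3 x4 x5 x6 = (\<chi> i. case i of I1 \<Rightarrow> x1 | I2 \<Rightarrow> x2 | I3 \<Rightarrow> x3 | I4 \<Rightarrow> x4 | I5 \<Rightarrow> x5 | I6 \<Rightarrow> x6)"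

lemma vec6_nth [simp]:
  "vec6 x1 x2 x3 x4 x5 x6 $ I1 = x1" "vec6 x1 x2 x3 x4 x5 x6 $ I2 = x2" "vec6 x1 x2 x3 x4 x5 x6 $ I3 = x3"
  "vec6 x1 x2 x3 x4 x5 x6 $ I4 = x4" "vec6 x1 x2 x3 x4 x5 x6 $ I5 = x5" "vec6 x1 x2 x3 x4 x5 x6 $ I6 = x6"
  by (simp_all add: vec6_def)

lemma sing_solI:
  assumes u0: "u 0 = u0" and lim: "\<And>i. ((\<lambda>r. u r $ i) \<longlongrightarrow> u0 $ i) (at_right 0)"
    and deriv: "\<And>r i. r > 0 \<Longrightarrow> ((\<lambda>s. u s $ i) has_real_derivative P r (u r) $ i - real (k i) * (u r $ i - u0 $ i) / r) (at r)"
  shows "sing_sol k P u0 u T"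
  unfolding sing_sol_def
proof (intro conjI allI impI u0 deriv)
  show "continuous_on {0..<T} u"
    unfolding continuous_on_def
  proof
    fix r assume r: "r \<in> {0..<T}"
    show "(u \<longlongrightarrow> u r) (at r within {0..<T})"
    proof (rule vec_tendstoI)
      fix i
      show "((\<lambda>r. u r $ i) \<longlongrightarrow> u r $ i) (at r within {0..<T})"
      proof (cases "r = 0")
        case True
        have "at (0 :: real) within {0..<T} \<le> at_right 0"
          unfolding at_within_def by (intro inf_mono) auto
        then show ?thesis using filterlim_mono[OF lim[of i] order_refl] True u0 by auto
      next
        case False
        then have "isCont (\<lambda>r. u r $ i) r" using deriv[of r i] r DERIV_isCont by fastforce
        then show ?thesis unfolding isCont_def by (rule tendsto_within_subset) auto
      qed
    qed
  qed
qed

lemma sing_sol_lim_0: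
  assumes "sing_sol k P u0 u T" "T > 0" shows "((\<lambda>r. u r $ i) \<longlongrightarrow> u0 $ i) (at_right 0)"
proof -
  have "(u \<longlongrightarrow> u 0) (at 0 within {0..<T})" using assms unfolding sing_sol_def continuous_on_def by auto
  moreover have "at (0 :: real) within {0..<T} = at 0 within {0..}"
    by (rule at_within_nhd[of _ "{..<T}"]) (use assms in auto)
  ultimately have "(u \<longlongrightarrow> u0) (at 0 within {0..})" using assms unfolding sing_sol_def by simp
  then have "(u \<longlongrightarrow> u0) (at_right 0)" by (rule tendsto_within_subset) auto
  then show ?thesis by (rule tendsto_vec_nth)
qed

lemma right_derivative_quotient:
  assumes "(g has_real_derivative d) (at 0 within {0..})"
  shows "((\<lambda>r. (g r - g 0) / r) \<longlongrightarrow> d) (at_right 0)"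
proof -
  have "{0<..} \<subseteq> {0::real..}" by auto
  from tendsto_within_subset[OF assms[unfolded has_field_derivative_iff] this] show ?thesis by simp
qed

lemma smooth_limits:
  assumes "smooth_halfline g"
  shows "(g \<longlongrightarrow> g 0) (at_right 0)" "(hderiv g \<longlongrightarrow> hderiv g 0) (at_right 0)"
    "(hderiv (hderiv g) \<longlongrightarrow> hderiv (hderiv g) 0) (at_right 0)"
    "((\<lambda>r. (g r - g 0) / r) \<longlongrightarrow> hderiv g 0) (at_right 0)"
    "((\<lambda>r. (hderiv g r - hderiv g 0) / r) \<longlongrightarrow> hderiv (hderiv g) 0) (at_right 0)"
proof -
  note d = smooth_halfline_derivs[OF assms]
  have c: "(h \<longlongrightarrow> h 0) (at_right 0)" if "continuous_on {0..} h" for h :: "real \<Rightarrow> real"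
    using that by (auto simp: continuous_on_def intro: tendsto_within_subset[where S = "{0..}"])
  show "(g \<longlongrightarrow> g 0) (at_right 0)" "(hderiv g \<longlongrightarrow> hderiv g 0) (at_right 0)"
    "(hderiv (hderiv g) \<longlongrightarrow> hderiv (hderiv g) 0) (at_right 0)"
    by (rule c, rule DERIV_continuous_on, rule d(1), simp) (rule c, rule DERIV_continuous_on, rule d(2), simp, rule c[OF d(3)])
  show "((\<lambda>r. (g r - g 0) / r) \<longlongrightarrow> hderiv g 0) (at_right 0)"
    "((\<lambda>r. (hderiv g r - hderiv g 0) / r) \<longlongrightarrow> hderiv (hderiv g) 0) (at_right 0)"
    by (rule right_derivative_quotient, rule d, simp)+
qed

lemma eventually_pos_right: "\<forall>\<^sub>F r in at_right 0. (r::real) > 0"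
  by (simp add: eventually_at_right_less)

text \<open>By l'Hopital (g - r)/r^2 tends to g''(0)/2 = 0, and (g' - 1)/r tends to g''(0) = 0; both
  differences are expressed through these quotients.\<close>

lemma second_order_limits:
  assumes g: "smooth_halfline g" "g 0 = 0" "hderiv g 0 = 1" "hderiv (hderiv g) 0 = 0" "\<And>r. r > 0 \<Longrightarrow> g r > 0"
  shows "((\<lambda>r. hderiv g r / g r - 1 / r) \<longlongrightarrow> 0) (at_right 0)"
    "((\<lambda>r. 1 / g r - 1 / r) \<longlongrightarrow> 0) (at_right 0)"
proof -
  note lim = smooth_limits[OF g(1), unfolded g(2-4)]
  have q: "((\<lambda>r. (g r - r) / r\<^sup>2) \<longlongrightarrow> 0) (at_right 0)"
  proof (rule lhopital_right_0[where f' = "\<lambda>r. hderiv g r - 1" and g' = "\<lambda>r. 2 * r"])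
    show "((\<lambda>r. g r - r) \<longlongrightarrow> 0) (at_right 0)"
      using tendsto_diff[OF lim(1) tendsto_ident_at[of 0 "{0<..}"]] by simp
    show "((\<lambda>r::real. r\<^sup>2) \<longlongrightarrow> 0) (at_right 0)"
      using tendsto_power[OF tendsto_ident_at[of "0::real" "{0<..}"], of 2] by simp
    show "\<forall>\<^sub>F r in at_right 0. (r::real)\<^sup>2 \<noteq> 0" "\<forall>\<^sub>F r in at_right 0. 2 * (r::real) \<noteq> 0"
      using eventually_pos_right by (eventually_elim, simp)+
    show "\<forall>\<^sub>F r in at_right 0. ((\<lambda>r. g r - r) has_real_derivative hderiv g r - 1) (at r)"
      using eventually_pos_right
    proof eventually_elim
      case (elim r)
      then show ?case using smooth_halfline_derivs(1)[OF g(1), of r]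
        by (intro DERIV_diff DERIV_ident) (simp_all add: at_within_halfline)
    qed
    show "\<forall>\<^sub>F r in at_right 0. ((\<lambda>r::real. r\<^sup>2) has_real_derivative 2 * r) (at r)"
      by (auto intro!: always_eventually derivative_eq_intros)
    show "((\<lambda>r. (hderiv g r - 1) / (2 * r)) \<longlongrightarrow> 0) (at_right 0)"
      using tendsto_mult_left[OF lim(5), of "1/2"] by (simp add: field_simps)
  qed
  have gr: "((\<lambda>r. g r / r) \<longlongrightarrow> 1) (at_right 0)" using lim(4) by simp
  have "((\<lambda>r. ((hderiv g r - 1) / r - (g r - r) / r\<^sup>2) / (g r / r)) \<longlongrightarrow> (0 - 0) / 1) (at_right 0)"
    by (intro tendsto_intros lim(5) q gr) simp
  then have "((\<lambda>r. ((hderiv g r - 1) / r - (g r - r) / r\<^sup>2) / (g r / r)) \<longlongrightarrow> 0) (at_right 0)" by simp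
  then show "((\<lambda>r. hderiv g r / g r - 1 / r) \<longlongrightarrow> 0) (at_right 0)"
  proof (rule Lim_transform_eventually)
    show "\<forall>\<^sub>F r in at_right 0. ((hderiv g r - 1) / r - (g r - r) / r\<^sup>2) / (g r / r) = hderiv g r / g r - 1 / r"
      using eventually_pos_right
    proof eventually_elim
      case (elim r)
      then show ?case using g(5)[of r] by (simp add: field_simps power2_eq_square)
    qed
  qed
  have "((\<lambda>r. - ((g r - r) / r\<^sup>2) / (g r / r)) \<longlongrightarrow> - 0 / 1) (at_right 0)"
    by (intro tendsto_intros q gr) simp
  then have "((\<lambda>r. - ((g r - r) / r\<^sup>2) / (g r / r)) \<longlongrightarrow> 0) (at_right 0)" by simp
  then show "((\<lambda>r. 1 / g r - 1 / r) \<longlongrightarrow> 0) (at_right 0)"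
  proof (rule Lim_transform_eventually)
    show "\<forall>\<^sub>F r in at_right 0. - ((g r - r) / r\<^sup>2) / (g r / r) = 1 / g r - 1 / r"
      using eventually_pos_right
    proof eventually_elim
      case (elim r)
      then show ?case using g(5)[of r] by (simp add: field_simps power2_eq_square)
    qed
  qed
qed

text \<open>Propagates Hamilton's identity from r = 0: its defect, multiplied by a suitable power of
  r, satisfies such an equation with a coefficient that is regular at 0.\<close>

lemma linear_ode_zero:
  fixes Y x :: "real \<Rightarrow> real"
  assumes r: "r > 0" and Y: "continuous_on {0..r} Y" "Y 0 = 0" and x: "continuous_on {0..r} x"
    and deriv: "\<And>s. 0 < s \<Longrightarrow> s < r \<Longrightarrow> (Y has_real_derivative - 2 * x s * Y s) (at s)"
  shows "Y r = 0"
proof -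
  have "compact (x ` {0..r})" by (intro compact_continuous_image x) simp
  then obtain B where B: "\<forall>y\<in>x ` {0..r}. norm y \<le> B" using compact_imp_bounded bounded_iff by metis
  have "(Y r)\<^sup>2 \<le> (Y 0)\<^sup>2 * exp (4 * B * (r - 0))"
  proof (rule gronwall[where y = "\<lambda>s. (Y s)\<^sup>2" and y' = "\<lambda>s. - 4 * x s * (Y s)\<^sup>2"])
    fix s assume s: "0 < s" "s < r"
    show "((\<lambda>s. (Y s)\<^sup>2) has_real_derivative - 4 * x s * (Y s)\<^sup>2) (at s)"
      by (auto intro!: derivative_eq_intros deriv s simp: power2_eq_square)
    have "- 4 * x s \<le> 4 * B" using bspec[OF B, of "x s"] s by auto
    then show "- 4 * x s * (Y s)\<^sup>2 \<le> 4 * B * (Y s)\<^sup>2" by (intro mult_right_mono) auto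
  qed (use r Y in \<open>auto intro!: continuous_intros\<close>)
  then show ?thesis using Y by simp
qed

section \<open>The case of S^1 x R^3\<close>

text \<open>The regular variables \<open>L/r\<close>, \<open>q/r\<close>, \<open>(U - C)/r\<close>, \<open>m - 2v\<close>, \<open>m - v\<close> and \<open>ln a\<close> for \<open>a(0) = 1\<close>,
  where \<open>M = 1/r + m\<close> and \<open>W = 1/r + v\<close>. The combinations of \<open>m\<close> and \<open>v\<close> diagonalise the singular part.\<close>

definition "mS1 u = 2 * u $ I5 - u $ I4"
definition "vS1 u = u $ I5 - u $ I4"
definition "xS1 r u = 2 * mS1 u + r * (u $ I1 + u $ I2)"

definition fieldS1 :: "real \<Rightarrow> real^idx \<Rightarrow> real^idx" where
  "fieldS1 r u = vec6 (0 - xS1 r u * u $ I1) (u $ I3 - xS1 r u * u $ I2) (2 * u $ I2)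
     (1 - (u $ I1 + u $ I2) + vS1 u * vS1 u - xS1 r u * mS1 u + 2 * mS1 u * vS1 u)
     (1 - (u $ I1 + u $ I2) + vS1 u * vS1 u - xS1 r u * mS1 u + mS1 u * vS1 u) (r * u $ I1)"

text \<open>X is 2/r + x, and division by r adds 1: hence 3 for L/r and q/r, and 1 for (U - C)/r.
  The singular part of (m, v)' has rows (-4, 2) and (-1, -1), with eigenvalues -2 on m - 2v and -3
  on m - v.\<close>

definition kS1 :: "idx \<Rightarrow> nat" where
  "kS1 i = (case i of I1 \<Rightarrow> 3 | I2 \<Rightarrow> 3 | I3 \<Rightarrow> 1 | I4 \<Rightarrow> 2 | I5 \<Rightarrow> 3 | I6 \<Rightarrow> 0)"

definition initS1 :: "real \<Rightarrow> real^idx" where "initS1 c = vec6 (1/3) c 0 0 0 0"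

lemma loc_lip_fieldS1: "loc_lip_field fieldS1"
  unfolding loc_lip_field_def
proof
  fix i show "loc_lip (\<lambda>r u. fieldS1 r u $ i)"
    by (cases i; simp only: fieldS1_def vec6_nth xS1_def mS1_def vS1_def; intro loc_lip_intros)
qed

text \<open>The solution is assumed on initial pieces of I only, so that the locale serves both
  before and after global existence is known.\<close>

locale systemS1 =
  fixes u :: "real \<Rightarrow> real^idx" and c :: real and I :: "real set"
  assumes c: "c > 0" and I_pos: "r \<in> I \<Longrightarrow> 0 < r" and I_down: "r \<in> I \<Longrightarrow> 0 < s \<Longrightarrow> s \<le> r \<Longrightarrow> s \<in> I"
    and I_ne: "I \<noteq> {}" and sol: "r \<in> I \<Longrightarrow> \<exists>T>r. sing_sol kS1 fieldS1 (initS1 c) u T"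
begin

definition "m r = mS1 (u r)"
definition "v r = vS1 (u r)"
definition "x r = xS1 r (u r)"
definition "L r = r * u r $ I1"
definition "q r = r * u r $ I2"
definition "U r = 3 * c + r * u r $ I3"
definition "M r = 1 / r + m r"
definition "W r = 1 / r + v r"
definition "X r = 2 / r + x r"
definition "a r = exp (u r $ I6)"

lemma x_eq: "x r = 2 * m r + r * (u r $ I1 + u r $ I2)"
  by (simp add: x_def xS1_def m_def)

lemma d_comp:
  assumes "r \<in> I"
  shows "((\<lambda>s. u s $ I1) has_real_derivative - (x r * u r $ I1) - 3 * (u r $ I1 - 1/3) / r) (at r)"
    "((\<lambda>s. u s $ I2) has_real_derivative u r $ I3 - x r * u r $ I2 - 3 * (u r $ I2 - c) / r) (at r)"
    "((\<lambda>s. u s $ I3) has_real_derivative 2 * u r $ I2 - u r $ I3 / r) (at r)"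
    "((\<lambda>s. u s $ I6) has_real_derivative r * u r $ I1) (at r)"
    "(m has_real_derivative 1 - (u r $ I1 + u r $ I2) + (v r)\<^sup>2 - x r * m r + (2 * v r - 4 * m r) / r) (at r)"
    "(v has_real_derivative - (m r * v r) - (m r + v r) / r) (at r)"
proof -
  obtain T where "T > r" "sing_sol kS1 fieldS1 (initS1 c) u T" using sol[OF assms] by blast
  then have d: "((\<lambda>s. u s $ i) has_real_derivative fieldS1 r (u r) $ i - real (kS1 i) * (u r $ i - initS1 c $ i) / r) (at r)" for i
    using I_pos[OF assms] unfolding sing_sol_def by blast
  show "((\<lambda>s. u s $ I1) has_real_derivative - (x r * u r $ I1) - 3 * (u r $ I1 - 1/3) / r) (at r)"
    "((\<lambda>s. u s $ I2) has_real_derivative u r $ I3 - x r * u r $ I2 - 3 * (u r $ I2 - c) / r) (at r)"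
    "((\<lambda>s. u s $ I3) has_real_derivative 2 * u r $ I2 - u r $ I3 / r) (at r)"
    "((\<lambda>s. u s $ I6) has_real_derivative r * u r $ I1) (at r)"
    using d[of I1] d[of I2] d[of I3] d[of I6] by (simp_all add: fieldS1_def kS1_def initS1_def x_def)
  note d4 = d[of I4, unfolded fieldS1_def kS1_def initS1_def vec6_nth idx.case]
  note d5 = d[of I5, unfolded fieldS1_def kS1_def initS1_def vec6_nth idx.case]
  show "(m has_real_derivative 1 - (u r $ I1 + u r $ I2) + (v r)\<^sup>2 - x r * m r + (2 * v r - 4 * m r) / r) (at r)"
    unfolding m_def[abs_def] mS1_def
    by (rule DERIV_cong[OF DERIV_diff[OF DERIV_cmult[OF d5] d4]])
       (simp add: v_def x_def mS1_def vS1_def power2_eq_square diff_divide_distrib algebra_simps)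
  show "(v has_real_derivative - (m r * v r) - (m r + v r) / r) (at r)"
    unfolding v_def[abs_def] vS1_def
    by (rule DERIV_cong[OF DERIV_diff[OF d5 d4]])
       (simp add: m_def x_def mS1_def vS1_def power2_eq_square add_divide_distrib diff_divide_distrib algebra_simps)
qed

lemma ev_I: "\<forall>\<^sub>F r in at_right 0. r \<in> I"
proof -
  obtain r where r: "r \<in> I" using I_ne by blast
  have "\<forall>\<^sub>F s in at_right 0. s \<in> {0<..<r}" by (rule eventually_at_right_real) (use I_pos[OF r] in auto)
  then show ?thesis by eventually_elim (use I_down[OF r] in auto)
qed

lemma lim_comp: "((\<lambda>r. u r $ i) \<longlongrightarrow> initS1 c $ i) (at_right 0)"
proof -
  obtain r where r: "r \<in> I" using I_ne by blast
  then obtain T where "T > r" "sing_sol kS1 fieldS1 (initS1 c) u T" using sol by blast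
  then show ?thesis using sing_sol_lim_0 I_pos[OF r] by force
qed

lemma lims: "((\<lambda>r. u r $ I1) \<longlongrightarrow> 1/3) (at_right 0)" "((\<lambda>r. u r $ I2) \<longlongrightarrow> c) (at_right 0)"
    "((\<lambda>r. u r $ I3) \<longlongrightarrow> 0) (at_right 0)" "((\<lambda>r. u r $ I6) \<longlongrightarrow> 0) (at_right 0)"
    "(m \<longlongrightarrow> 0) (at_right 0)" "(v \<longlongrightarrow> 0) (at_right 0)" "(x \<longlongrightarrow> 0) (at_right 0)"
proof -
  note l = lim_comp[of I1] lim_comp[of I2] lim_comp[of I3] lim_comp[of I4] lim_comp[of I5] lim_comp[of I6]
  note l' = l[unfolded initS1_def vec6_nth]
  show "((\<lambda>r. u r $ I1) \<longlongrightarrow> 1/3) (at_right 0)" "((\<lambda>r. u r $ I2) \<longlongrightarrow> c) (at_right 0)"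
    "((\<lambda>r. u r $ I3) \<longlongrightarrow> 0) (at_right 0)" "((\<lambda>r. u r $ I6) \<longlongrightarrow> 0) (at_right 0)" using l' by auto
  have "(m \<longlongrightarrow> 2 * 0 - 0) (at_right 0)" unfolding m_def[abs_def] mS1_def by (intro tendsto_intros l')
  then show m0: "(m \<longlongrightarrow> 0) (at_right 0)" by simp
  have "(v \<longlongrightarrow> 0 - 0) (at_right 0)" unfolding v_def[abs_def] vS1_def by (intro tendsto_intros l')
  then show "(v \<longlongrightarrow> 0) (at_right 0)" by simp
  have "(x \<longlongrightarrow> 2 * 0 + 0 * (1/3 + c)) (at_right 0)" unfolding x_eq[abs_def] by (intro tendsto_intros l' m0)
  then show "(x \<longlongrightarrow> 0) (at_right 0)" by simp
qed

lemma X_eq: "r \<in> I \<Longrightarrow> X r = L r + 2 * M r + q r"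
  unfolding X_def L_def M_def q_def x_eq by (simp add: algebra_simps)

lemma dL: "r \<in> I \<Longrightarrow> (L has_real_derivative 1 - X r * L r) (at r)"
  unfolding L_def[abs_def] X_def using I_pos[of r]
  by (auto intro!: derivative_eq_intros d_comp simp: field_simps)

lemma dq: "r \<in> I \<Longrightarrow> (q has_real_derivative U r - X r * q r) (at r)"
  unfolding q_def[abs_def] U_def X_def using I_pos[of r]
  by (auto intro!: derivative_eq_intros d_comp simp: field_simps)

lemma dU: "r \<in> I \<Longrightarrow> (U has_real_derivative 2 * q r) (at r)"
  unfolding q_def U_def[abs_def] using I_pos[of r]
  by (auto intro!: derivative_eq_intros d_comp simp: field_simps)

lemma dM: assumes r: "r \<in> I" shows "(M has_real_derivative 1 + (W r)\<^sup>2 - X r * M r) (at r)"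
proof -
  have d: "(M has_real_derivative - 1 / r\<^sup>2 + (1 - (u r $ I1 + u r $ I2) + (v r)\<^sup>2 - x r * m r + (2 * v r - 4 * m r) / r)) (at r)"
    unfolding M_def[abs_def]
    by (intro DERIV_add d_comp r) (use I_pos[OF r] in \<open>auto intro!: derivative_eq_intros simp: power2_eq_square\<close>)
  have xr: "x r / r = 2 * m r / r + (u r $ I1 + u r $ I2)"
    unfolding x_eq using I_pos[OF r] by (simp add: field_simps)
  have "1 + (W r)\<^sup>2 - X r * M r = 1 + (1 / r)\<^sup>2 + 2 * v r / r + (v r)\<^sup>2 - 2 * (1 / r)\<^sup>2 - x r / r - 2 * m r / r - x r * m r"
    unfolding W_def X_def M_def by (simp add: power2_eq_square algebra_simps)
  then have "1 + (W r)\<^sup>2 - X r * M r = - 1 / r\<^sup>2 + (1 - (u r $ I1 + u r $ I2) + (v r)\<^sup>2 - x r * m r + (2 * v r - 4 * m r) / r)"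
    unfolding xr by (simp add: power_divide diff_divide_distrib)
  then show ?thesis by (rule DERIV_cong[OF d sym])
qed

lemma dW: "r \<in> I \<Longrightarrow> (W has_real_derivative - (M r * W r)) (at r)"
  unfolding W_def[abs_def] M_def using I_pos[of r]
  by (auto intro!: derivative_eq_intros d_comp simp: field_simps power2_eq_square)

lemma da: "r \<in> I \<Longrightarrow> (a has_real_derivative L r * a r) (at r)"
  unfolding a_def[abs_def] L_def by (auto intro!: derivative_eq_intros d_comp)

text \<open>The failure of Hamilton's identity, which for the concrete system has to be proved. It
  solves Q' = -2 X Q.\<close>

definition "defect r = 2 + 2 * (W r)\<^sup>2 + (L r)\<^sup>2 + 2 * (M r)\<^sup>2 - (X r)\<^sup>2 + U r"

lemma dX': assumes r: "r \<in> I" shows "(X has_real_derivative 1 - (L r)\<^sup>2 - 2 * (M r)\<^sup>2 + defect r) (at r)"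
proof -
  have d0: "((\<lambda>r. L r + 2 * M r + q r) has_real_derivative
      1 - X r * L r + 2 * (1 + (W r)\<^sup>2 - X r * M r) + (U r - X r * q r)) (at r)"
    by (intro DERIV_add DERIV_cmult dL dM dq r)
  have "1 - X r * L r + 2 * (1 + (W r)\<^sup>2 - X r * M r) + (U r - X r * q r) = 3 + 2 * (W r)\<^sup>2 + U r - X r * (L r + 2 * M r + q r)"
    by (simp add: algebra_simps)
  also have "3 + 2 * (W r)\<^sup>2 + U r - X r * (L r + 2 * M r + q r) = 1 - (L r)\<^sup>2 - 2 * (M r)\<^sup>2 + defect r"
    unfolding X_eq[OF r, symmetric] defect_def by (simp add: power2_eq_square)
  finally have d: "((\<lambda>r. L r + 2 * M r + q r) has_real_derivative 1 - (L r)\<^sup>2 - 2 * (M r)\<^sup>2 + defect r) (at r)"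
    by (rule DERIV_cong[OF d0])
  show ?thesis
    by (rule has_field_derivative_transform_within_open[OF d, of "{0<..}"])
       (use I_pos[OF r] in \<open>auto simp: X_def L_def M_def q_def x_eq algebra_simps\<close>)
qed

text \<open>As X = 2/r + x, the factor r^4 cancels the singular part of Q' = -2 X Q.
  \<open>Y\<close> is r^4 times the defect, written in variables that are continuous at 0, so that
  \<open>Y 0 = 0\<close> is visible.\<close>

lemma defect_zero: assumes r: "r \<in> I" shows "defect r = 0"
proof -
  define Y where "Y = (\<lambda>r. 2 * r ^ 4 + 2 * r\<^sup>2 * (1 + r * v r)\<^sup>2 + r ^ 4 * (L r)\<^sup>2 + 2 * r\<^sup>2 * (1 + r * m r)\<^sup>2 - r\<^sup>2 * (2 + r * x r)\<^sup>2 + r ^ 4 * U r)"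
  have YQ: "Y s = s ^ 4 * defect s" if "s > 0" for s
    unfolding Y_def defect_def W_def M_def X_def using that by (simp add: field_simps eval_nat_numeral)
  obtain T where T: "T > r" "sing_sol kS1 fieldS1 (initS1 c) u T" using sol[OF r] by blast
  then have cu: "continuous_on {0..r} u" unfolding sing_sol_def by (auto elim: continuous_on_subset)
  have r0: "r > 0" using I_pos[OF r] .
  have "Y r = 0"
  proof (rule linear_ode_zero[OF r0, where x = x])
    show "continuous_on {0..r} Y" "continuous_on {0..r} x"
      unfolding Y_def L_def U_def m_def v_def x_def mS1_def vS1_def xS1_def by (intro continuous_intros cu)+
    show "Y 0 = 0" by (simp add: Y_def)
    fix s assume s: "0 < s" "s < r"
    then have sI: "s \<in> I" using I_down[OF r] by auto
    have dQ: "(defect has_real_derivative - 2 * X s * defect s) (at s)"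
    proof -
      have "(defect has_real_derivative 4 * W s * (- (M s * W s)) + 2 * L s * (1 - X s * L s) + 4 * M s * (1 + (W s)\<^sup>2 - X s * M s)
          - 2 * X s * (1 - (L s)\<^sup>2 - 2 * (M s)\<^sup>2 + defect s) + 2 * q s) (at s)"
        unfolding defect_def[abs_def]
        by (auto intro!: derivative_eq_intros dW dL dM dX' dU sI simp: defect_def)
      moreover have "q s = X s - L s - 2 * M s" using X_eq[OF sI] by simp
      ultimately show ?thesis by (auto elim!: DERIV_cong simp: power2_eq_square algebra_simps)
    qed
    have "((\<lambda>s. s ^ 4 * defect s) has_real_derivative - 2 * x s * (s ^ 4 * defect s)) (at s)"
      by (rule derivative_eq_intros dQ refl)+ (use s in \<open>simp add: X_def field_simps eval_nat_numeral\<close>)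
    then have "(Y has_real_derivative - 2 * x s * (s ^ 4 * defect s)) (at s)"
      by (rule has_field_derivative_transform_within_open[where S = "{0<..}"]) (use s YQ in auto)
    then show "(Y has_real_derivative - 2 * x s * Y s) (at s)" using YQ[OF s(1)] by simp
  qed
  then show ?thesis using YQ[OF r0] r0 by simp
qed

sublocale phase L M X W q U I
proof
  fix r assume r: "r \<in> I"
  show "0 < r" by (rule I_pos[OF r])
  show "s \<in> I" if "0 < s" "s \<le> r" for s by (rule I_down[OF r that])
  show "(L has_real_derivative 1 - X r * L r) (at r)" by (rule dL[OF r])
  show "(M has_real_derivative 1 + (W r)\<^sup>2 - X r * M r) (at r)" by (rule dM[OF r])
  show "(W has_real_derivative - (M r * W r)) (at r)" by (rule dW[OF r])
  show "(q has_real_derivative U r - X r * q r) (at r)" by (rule dq[OF r])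
  show "(U has_real_derivative 2 * q r) (at r)" by (rule dU[OF r])
  show "X r = L r + 2 * M r + q r" by (rule X_eq[OF r])
  show "(X has_real_derivative 1 - (L r)\<^sup>2 - 2 * (M r)\<^sup>2) (at r)" using dX'[OF r] defect_zero[OF r] by simp
  show "(X r)\<^sup>2 = 2 + 2 * (W r)\<^sup>2 + (L r)\<^sup>2 + 2 * (M r)\<^sup>2 + U r" using defect_zero[OF r] unfolding defect_def by simp
next
  have gt: "\<forall>\<^sub>F r in at_right 0. g r > 0" if "(g \<longlongrightarrow> l) (at_right 0)" "l > 0" for g :: "real \<Rightarrow> real" and l
    using that by (rule order_tendstoD(1))
  have id0: "((\<lambda>r::real. r) \<longlongrightarrow> 0) (at_right 0)" by (rule tendsto_ident_at)
  \<comment> \<open>The third limit is that of U - X q: as X ~ 2/r and q ~ c r, it equals 3 c - 2 c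
    > 0.\<close>
  have "((\<lambda>r. 1 + r * m r) \<longlongrightarrow> 1 + 0 * 0) (at_right 0)" "((\<lambda>r. 1 + r * v r) \<longlongrightarrow> 1 + 0 * 0) (at_right 0)"
    "((\<lambda>r. 3 * c + r * u r $ I3 - 2 * u r $ I2 - x r * r * u r $ I2) \<longlongrightarrow> 3 * c + 0 * 0 - 2 * c - 0 * 0 * c) (at_right 0)"
    "(U \<longlongrightarrow> 3 * c + 0 * 0) (at_right 0)"
    unfolding U_def[abs_def] by (intro tendsto_intros lims id0)+
  then have "\<forall>\<^sub>F r in at_right 0. 1 + r * m r > 0" "\<forall>\<^sub>F r in at_right 0. 1 + r * v r > 0"
    "\<forall>\<^sub>F r in at_right 0. 3 * c + r * u r $ I3 - 2 * u r $ I2 - x r * r * u r $ I2 > 0"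
    "\<forall>\<^sub>F r in at_right 0. U r > 0"
    using c by (auto dest: gt)
  moreover have "\<forall>\<^sub>F r in at_right 0. u r $ I1 > 0" "\<forall>\<^sub>F r in at_right 0. u r $ I2 > 0"
    using gt[OF lims(1)] gt[OF lims(2) c] by auto
  ultimately show "\<forall>\<^sub>F r in at_right 0. L r > 0 \<and> M r > 0 \<and> W r > 0 \<and> q r > 0 \<and> U r - X r * q r > 0 \<and> U r > 0"
    using eventually_pos_right
  proof eventually_elim
    case (elim r)
    have "M r = (1 + r * m r) / r" "W r = (1 + r * v r) / r" using elim by (simp_all add: M_def W_def field_simps)
    moreover have "U r - X r * q r = 3 * c + r * u r $ I3 - 2 * u r $ I2 - x r * r * u r $ I2"
      using elim by (simp add: U_def X_def q_def field_simps)
    ultimately show ?case using elim by (simp add: L_def q_def)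
  qed
qed

end

lemma sing_sol_bounded_from_tail:
  fixes u :: "real \<Rightarrow> real^'n"
  assumes u: "sing_sol k P u0 u T" and s: "s < T"
    and tail: "\<And>r i. s \<le> r \<Longrightarrow> r < T \<Longrightarrow> \<bar>u r $ i\<bar> \<le> K"
  shows "bounded (u ` {0..<T})"
proof -
  obtain B where B: "\<And>r. 0 \<le> r \<Longrightarrow> r \<le> s \<Longrightarrow> norm (u r) \<le> B" using sing_sol_bounded_on[OF u s] by metis
  have "norm (u r) \<le> max B (real CARD('n) * K)" if r: "r \<in> {0..<T}" for r
  proof (cases "r \<le> s")
    case False
    have "norm (u r) \<le> (\<Sum>i\<in>UNIV. \<bar>u r $ i\<bar>)" by (rule norm_le_l1_cart)
    also have "\<dots> \<le> (\<Sum>i\<in>(UNIV :: 'n set). K)" by (intro sum_mono tail) (use False r in auto)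
    finally show ?thesis by simp
  qed (use B[of r] r in auto)
  then show ?thesis unfolding bounded_iff by blast
qed

lemma sing_sol_continuous_in_init:
  fixes P :: "real \<Rightarrow> real^'n \<Rightarrow> real^'n" and u0 :: "'p :: metric_space \<Rightarrow> real^'n"
  assumes P: "loc_lip_field P" and u0: "continuous_on \<Theta> u0"
    and u: "\<And>\<theta> T. \<theta> \<in> \<Theta> \<Longrightarrow> sing_sol k P (u0 \<theta>) (u \<theta>) T" and R: "R \<ge> 0"
  shows "continuous_on \<Theta> (\<lambda>\<theta>. u \<theta> R)"
  unfolding continuous_on_iff
proof (intro ballI allI impI)
  fix \<theta> and e :: real assume \<theta>: "\<theta> \<in> \<Theta>" and e: "e > 0"
  obtain d where d: "d > 0"
    "\<And>v0 v. norm (v0 - u0 \<theta>) < d \<Longrightarrow> (\<And>T. sing_sol k P v0 v T) \<Longrightarrow> norm (v R - u \<theta> R) < e"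
    using sing_sol_dependence[OF P u[OF \<theta>] R e] by metis
  obtain d' where d': "d' > 0" "\<And>\<theta>'. \<theta>' \<in> \<Theta> \<Longrightarrow> dist \<theta>' \<theta> < d' \<Longrightarrow> dist (u0 \<theta>') (u0 \<theta>) < d"
    using u0 \<theta> d(1) unfolding continuous_on_iff by metis
  show "\<exists>d>0. \<forall>\<theta>'\<in>\<Theta>. dist \<theta>' \<theta> < d \<longrightarrow> dist (u \<theta>' R) (u \<theta> R) < e"
  proof (intro exI[of _ d'] conjI ballI impI d'(1))
    fix \<theta>' assume "\<theta>' \<in> \<Theta>" "dist \<theta>' \<theta> < d'"
    then have "norm (u0 \<theta>' - u0 \<theta>) < d" using d'(2) by (simp add: dist_norm)
    from d(2)[OF this u[OF \<open>\<theta>' \<in> \<Theta>\<close>]] show "dist (u \<theta>' R) (u \<theta> R) < e" by (simp add: dist_norm)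
  qed
qed

lemma continuous_on_vec6:
  assumes "continuous_on S f1" "continuous_on S f2" "continuous_on S f3" "continuous_on S f4" "continuous_on S f5" "continuous_on S f6"
  shows "continuous_on S (\<lambda>x. vec6 (f1 x) (f2 x) (f3 x) (f4 x) (f5 x) (f6 x))"
  unfolding vec6_def
proof (rule continuous_on_vec_lambda)
  fix i show "continuous_on S (\<lambda>x. case i of I1 \<Rightarrow> f1 x | I2 \<Rightarrow> f2 x | I3 \<Rightarrow> f3 x | I4 \<Rightarrow> f4 x | I5 \<Rightarrow> f5 x | I6 \<Rightarrow> f6 x)"
    by (cases i) (use assms in auto)
qed

text \<open>Away from r = 0 the regular variables are controlled by L, M, W, q and U, which
  \<open>bounds\<close> keeps finite on (0, T); the last component is ln a, whose derivative is
  L.\<close>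

lemma ex_systemS1:
  assumes c: "c > 0" shows "\<exists>u. \<forall>T. sing_sol kS1 fieldS1 (initS1 c) u T"
proof -
  have "bounded (u ` {0..<T})" if T: "T > 0" and u: "sing_sol kS1 fieldS1 (initS1 c) u T" for T u
  proof -
    interpret systemS1 u c "{0<..<T}"
      by unfold_locales (use c T u in \<open>auto intro: dense\<close>)
    define s where "s = T / 2"
    have s: "0 < s" "s < T" "s \<in> {0<..<T}" using T by (auto simp: s_def)
    have sub: "{0<..<T} \<subseteq> {..<T}" by auto
    obtain B where B: "\<And>r. r \<in> {0<..<T} \<Longrightarrow> s \<le> r \<Longrightarrow> \<bar>L r\<bar> \<le> B \<and> \<bar>M r\<bar> \<le> B \<and> \<bar>W r\<bar> \<le> B \<and> \<bar>q r\<bar> \<le> B \<and> \<bar>U r\<bar> \<le> B"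
      using bounds[OF sub s(3)] by blast
    have B0: "B \<ge> 0" using B[OF s(3)] by fastforce
    define K where "K = (B + 3 * c) / s + 3 * (B + 1 / s) + \<bar>u s $ I6\<bar> + B * T"
    have nn: "0 \<le> (B + 3 * c) / s" "0 \<le> B + 1 / s" "0 \<le> B * T" using B0 c s T by auto
    have "\<bar>u r $ i\<bar> \<le> K" if r: "s \<le> r" "r < T" for r i
    proof -
      have r0: "r > 0" "r \<in> {0<..<T}" using r s by auto
      note b = B[OF r0(2) r(1)]
      have div: "\<bar>z / r\<bar> \<le> (B + 3 * c) / s" if "\<bar>z\<bar> \<le> B + 3 * c" for z
      proof -
        have "\<bar>z\<bar> / r \<le> (B + 3 * c) / s" using that r r0 s by (intro frac_le) auto
        then show ?thesis using r0 by simp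
      qed
      have "u r $ I1 = L r / r" "u r $ I2 = q r / r" "u r $ I3 = (U r - 3 * c) / r"
        using r0 by (simp_all add: L_def q_def U_def)
      moreover have "\<bar>U r - 3 * c\<bar> \<le> B + 3 * c" "\<bar>L r\<bar> \<le> B + 3 * c" "\<bar>q r\<bar> \<le> B + 3 * c" using b c by linarith+
      ultimately have i123: "\<bar>u r $ I1\<bar> \<le> (B + 3 * c) / s" "\<bar>u r $ I2\<bar> \<le> (B + 3 * c) / s" "\<bar>u r $ I3\<bar> \<le> (B + 3 * c) / s"
        using div[of "L r"] div[of "q r"] div[of "U r - 3 * c"] by auto
      have "0 \<le> 1 / r" "1 / r \<le> 1 / s" using r r0 s by (auto intro: divide_left_mono)
      then have mv: "\<bar>m r\<bar> \<le> B + 1 / s" "\<bar>v r\<bar> \<le> B + 1 / s" using b unfolding M_def W_def by linarith+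
      have arith: "\<bar>y - 2 * z\<bar> \<le> 3 * k" "\<bar>y - z\<bar> \<le> 3 * k" if "\<bar>y\<bar> \<le> k" "\<bar>z\<bar> \<le> k" for y z k :: real
        using that by linarith+
      have "u r $ I4 = m r - 2 * v r" "u r $ I5 = m r - v r"
        by (simp_all add: m_def v_def mS1_def vS1_def)
      then have i45: "\<bar>u r $ I4\<bar> \<le> 3 * (B + 1 / s)" "\<bar>u r $ I5\<bar> \<le> 3 * (B + 1 / s)"
        using arith[OF mv] by simp_all
      have inI: "t \<in> {0<..<T}" if "s \<le> t" "t \<le> r" for t using that s r by auto
      have "u s $ I6 \<le> u r $ I6"
        by (rule deriv_nonneg_le[OF r(1), where g = "\<lambda>r. u r $ I6" and g' = L])
           (use inI d_comp(4) L_pos in \<open>auto simp: L_def less_imp_le\<close>)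
      moreover have "u r $ I6 - B * r \<le> u s $ I6 - B * s"
      proof (rule deriv_nonpos_ge[OF r(1), where g = "\<lambda>r. u r $ I6 - B * r" and g' = "\<lambda>r. L r - B"])
        fix t assume t: "s \<le> t" "t \<le> r"
        show "((\<lambda>r. u r $ I6 - B * r) has_real_derivative L t - B) (at t)"
          using d_comp(4)[OF inI[OF t]] unfolding L_def by (auto intro!: derivative_eq_intros)
        show "L t - B \<le> 0" using B[OF inI[OF t] t(1)] by auto
      qed
      moreover have "B * r \<le> B * T" "0 \<le> B * s" using B0 r s by (auto intro: mult_left_mono)
      ultimately have i6: "\<bar>u r $ I6\<bar> \<le> \<bar>u s $ I6\<bar> + B * T" by linarith
      have "\<bar>u r $ i\<bar> \<le> k1 + 3 * k2 + \<bar>u s $ I6\<bar> + k3"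
        if "\<bar>u r $ I1\<bar> \<le> k1" "\<bar>u r $ I2\<bar> \<le> k1" "\<bar>u r $ I3\<bar> \<le> k1" "\<bar>u r $ I4\<bar> \<le> 3 * k2" "\<bar>u r $ I5\<bar> \<le> 3 * k2"
          "\<bar>u r $ I6\<bar> \<le> \<bar>u s $ I6\<bar> + k3" "0 \<le> k1" "0 \<le> k2" "0 \<le> k3" for k1 k2 k3
        by (cases i; hypsubst; insert that; linarith)
      from this[OF i123 i45 i6 nn] show ?thesis unfolding K_def .
    qed
    then show ?thesis by (rule sing_sol_bounded_from_tail[OF u s(2)])
  qed
  then show ?thesis using sing_sol_global[OF loc_lip_fieldS1, of kS1 "initS1 c"] by metis
qed

section \<open>Global solutions and the solitons they define\<close>

locale systemS1_global =
  fixes u :: "real \<Rightarrow> real^idx" and c :: real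
  assumes c_pos: "c > 0" and global: "\<And>T. sing_sol kS1 fieldS1 (initS1 c) u T"
begin

sublocale systemS1 u c "{0<..}"
proof
  show "\<exists>T>r. sing_sol kS1 fieldS1 (initS1 c) u T" for r using global gt_ex by blast
qed (use c_pos in auto)

lemma lim_rm: "((\<lambda>r. 1 + r * m r) \<longlongrightarrow> 1) (at_right 0)" and lim_rv: "((\<lambda>r. 1 + r * v r) \<longlongrightarrow> 1) (at_right 0)"
proof -
  have "((\<lambda>r. 1 + r * m r) \<longlongrightarrow> 1 + 0 * 0) (at_right 0)" "((\<lambda>r. 1 + r * v r) \<longlongrightarrow> 1 + 0 * 0) (at_right 0)"
    by (intro tendsto_intros lims)+
  then show "((\<lambda>r. 1 + r * m r) \<longlongrightarrow> 1) (at_right 0)" "((\<lambda>r. 1 + r * v r) \<longlongrightarrow> 1) (at_right 0)" by simp_all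
qed

lemma MW_eq: "r > 0 \<Longrightarrow> M r = (1 + r * m r) / r" "r > 0 \<Longrightarrow> W r = (1 + r * v r) / r"
  by (simp_all add: M_def W_def field_simps)

lemma rv_pos: "r \<ge> 0 \<Longrightarrow> 1 + r * v r > 0"
  using W_pos[of r] MW_eq(2)[of r] by (cases "r = 0") (auto simp: zero_less_divide_iff)

lemma lim_L: "(L \<longlongrightarrow> 0) (at_right 0)" and lim_q: "(q \<longlongrightarrow> 0) (at_right 0)" and lim_U: "(U \<longlongrightarrow> 3 * c) (at_right 0)"
proof -
  have "(L \<longlongrightarrow> 0 * (1/3)) (at_right 0)" "(q \<longlongrightarrow> 0 * c) (at_right 0)" "(U \<longlongrightarrow> 3 * c + 0 * 0) (at_right 0)"
    unfolding L_def[abs_def] q_def[abs_def] U_def[abs_def] by (intro tendsto_intros lims)+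
  then show "(L \<longlongrightarrow> 0) (at_right 0)" "(q \<longlongrightarrow> 0) (at_right 0)" "(U \<longlongrightarrow> 3 * c) (at_right 0)" by simp_all
qed

lemma lim_slope: "((\<lambda>r. M r / W r) \<longlongrightarrow> 1) (at_right 0)"
proof -
  have "((\<lambda>r. (1 + r * m r) / (1 + r * v r)) \<longlongrightarrow> 1 / 1) (at_right 0)" by (intro tendsto_intros lim_rm lim_rv) simp
  then have "((\<lambda>r. (1 + r * m r) / (1 + r * v r)) \<longlongrightarrow> 1) (at_right 0)" by simp
  then show ?thesis
  proof (rule Lim_transform_eventually)
    show "\<forall>\<^sub>F r in at_right 0. (1 + r * m r) / (1 + r * v r) = M r / W r"
      using eventually_pos_right by eventually_elim (simp add: MW_eq)
  qed
qed

text \<open>The expression is b''/b. It contains -2 (m - v)/r, so the derivative (2/3 - c)/4 of m -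
  v at 0 enters. The limit is negative exactly for c > 2/3, that is for C = 3 c > 2.\<close>

lemma lim_concavity:
  "((\<lambda>r. 1 + (W r)\<^sup>2 - X r * M r + (M r)\<^sup>2) \<longlongrightarrow> 1/3 - c / 2) (at_right 0)"
proof -
  have z: "((\<lambda>r. u r $ I5 / r) \<longlongrightarrow> (2/3 - c) / 4) (at_right 0)"
  proof -
    have "u 0 = initS1 c" using global[of 1] unfolding sing_sol_def by simp
    then show ?thesis
      using right_derivative_quotient[OF sing_sol_deriv_0[OF global loc_lip_fieldS1, of I5]]
      by (simp add: initS1_def fieldS1_def kS1_def vS1_def mS1_def xS1_def)
  qed
  have "((\<lambda>r. 1 - 2 * (u r $ I5 / r) - (u r $ I1 + u r $ I2) + (v r)\<^sup>2 - x r * m r + (m r)\<^sup>2) \<longlongrightarrow>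
      1 - 2 * ((2/3 - c) / 4) - (1/3 + c) + 0\<^sup>2 - 0 * 0 + 0\<^sup>2) (at_right 0)"
    by (intro tendsto_intros lims z)
  moreover have "1 - 2 * ((2/3 - c) / 4) - (1/3 + c) + 0\<^sup>2 - 0 * 0 + 0\<^sup>2 = 1/3 - c / 2" by (simp add: field_simps)
  ultimately have "((\<lambda>r. 1 - 2 * (u r $ I5 / r) - (u r $ I1 + u r $ I2) + (v r)\<^sup>2 - x r * m r + (m r)\<^sup>2) \<longlongrightarrow> 1/3 - c / 2) (at_right 0)"
    by (simp only:)
  then show ?thesis
  proof (rule Lim_transform_eventually)
    show "\<forall>\<^sub>F r in at_right 0. 1 - 2 * (u r $ I5 / r) - (u r $ I1 + u r $ I2) + (v r)\<^sup>2 - x r * m r + (m r)\<^sup>2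
        = 1 + (W r)\<^sup>2 - X r * M r + (M r)\<^sup>2"
      using eventually_pos_right
    proof eventually_elim
      case (elim r)
      have z: "u r $ I5 = m r - v r" by (simp add: m_def v_def mS1_def vS1_def)
      have "x r / r = 2 * m r / r + (u r $ I1 + u r $ I2)" unfolding x_eq using elim by (simp add: field_simps)
      moreover have "1 + (W r)\<^sup>2 - X r * M r + (M r)\<^sup>2 = 1 + 2 * v r / r + (v r)\<^sup>2 - x r / r - x r * m r + (m r)\<^sup>2"
        unfolding W_def X_def M_def using elim by (simp add: field_simps power2_eq_square)
      ultimately show ?case unfolding z by (simp add: diff_divide_distrib)
    qed
  qed
qed

sublocale expander_S1 L M X W q U a "3 * c"
proof
  fix r :: real assume "r > 0"
  then show "a r > 0" "(a has_real_derivative L r * a r) (at r)" using da by (auto simp: a_def)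
next
  show "3 * c > 0" using c_pos by simp
  show "(q \<longlongrightarrow> 0) (at_right 0)" "(U \<longlongrightarrow> 3 * c) (at_right 0)" "(L \<longlongrightarrow> 0) (at_right 0)"
    by (rule lim_q, rule lim_U, rule lim_L)
  show "((\<lambda>r. M r / W r) \<longlongrightarrow> 1) (at_right 0)" by (rule lim_slope)
  show "\<forall>\<^sub>F r in at_right 0. L r < 1 + 1 / r"
    using order_tendstoD(2)[OF lim_L zero_less_one] eventually_pos_right
  proof eventually_elim
    case (elim r)
    then have "1 / r > 0" by simp
    then show ?case using elim by linarith
  qed
  show "\<forall>\<^sub>F r in at_right 0. M r / W r < t" if "t > 1" for t
    by (rule order_tendstoD(2)[OF lim_slope that])
  show "\<forall>\<^sub>F r in at_right 0. r / 5 < M r / (W r)\<^sup>2"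
  proof -
    have "((\<lambda>r. (1 + r * m r) / (1 + r * v r)\<^sup>2) \<longlongrightarrow> 1 / 1\<^sup>2) (at_right 0)" by (intro tendsto_intros lim_rm lim_rv) simp
    then have "\<forall>\<^sub>F r in at_right 0. (1 + r * m r) / (1 + r * v r)\<^sup>2 > 1 / 5" by (rule order_tendstoD(1)) simp
    then show ?thesis using eventually_pos_right
    proof eventually_elim
      case (elim r)
      have "M r / (W r)\<^sup>2 = r * ((1 + r * m r) / (1 + r * v r)\<^sup>2)"
        using elim(2) by (simp add: MW_eq power_divide power2_eq_square)
      moreover have "r * (1 / 5) < r * ((1 + r * m r) / (1 + r * v r)\<^sup>2)" using elim by (intro mult_strict_left_mono)
      ultimately show ?case by simp
    qed
  qed
  show "((\<lambda>r. 1 / W r) \<longlongrightarrow> 0) (at_right 0)"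
  proof -
    have "((\<lambda>r. r / (1 + r * v r)) \<longlongrightarrow> 0 / 1) (at_right 0)" by (intro tendsto_intros lim_rv) simp
    then have "((\<lambda>r. r / (1 + r * v r)) \<longlongrightarrow> 0) (at_right 0)" by simp
    then show ?thesis
    proof (rule Lim_transform_eventually)
      show "\<forall>\<^sub>F r in at_right 0. r / (1 + r * v r) = 1 / W r"
        using eventually_pos_right by eventually_elim (simp add: MW_eq)
    qed
  qed
  show "\<forall>\<^sub>F r in at_right 0. 3 * c / 6 * r < q r"
  proof -
    have "\<forall>\<^sub>F r in at_right 0. u r $ I2 > c / 2" by (rule order_tendstoD(1)[OF lims(2)]) (use c_pos in simp)
    then show ?thesis using eventually_pos_right by eventually_elim (simp add: q_def mult.commute)
  qed
  show "\<forall>\<^sub>F r in at_right 0. (1 + (W r)\<^sup>2) / M r - X r + M r < 0" if "3 * c > 2"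
  proof -
    have "\<forall>\<^sub>F r in at_right 0. 1 + (W r)\<^sup>2 - X r * M r + (M r)\<^sup>2 < 0"
      by (rule order_tendstoD(2)[OF lim_concavity]) (use that in simp)
    then show ?thesis using eventually_pos_right
    proof eventually_elim
      case (elim r)
      have M: "M r > 0" using M_pos[of r] elim by simp
      have "(1 + (W r)\<^sup>2) / M r - X r + M r = (1 + (W r)\<^sup>2 - X r * M r + (M r)\<^sup>2) / M r"
        using M by (simp add: field_simps power2_eq_square)
      then show ?case using elim(1) M by (simp add: divide_neg_pos)
    qed
  qed
qed

lemma Ck_u: "Ck n (\<lambda>r. u r $ i)"
proof (rule sing_sol_smooth[OF global])
  fix n i assume "\<And>j. Ck n (\<lambda>r. u r $ j)"
  then show "Ck n (\<lambda>r. fieldS1 r (u r) $ i)"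
    by (cases i; simp only: fieldS1_def vec6_nth xS1_def mS1_def vS1_def; intro Ck_intros)
qed

lemma u_0: "u 0 = initS1 c" using global[of 1] unfolding sing_sol_def by simp

text \<open>For r > 0 this is 1/W, written without division by r so that smoothness at 0 can be
  seen; likewise f is (3 c - U)/2.\<close>

definition "b r = r * inverse (1 + r * v r)"
definition "f r = - (1/2) * (r * u r $ I3)"

lemma d_u6: "r \<ge> 0 \<Longrightarrow> ((\<lambda>r. u r $ I6) has_real_derivative L r) (at r within {0..})"
  using sing_sol_deriv[OF global sing_sol_field_continuous[OF global loc_lip_fieldS1], of r I6]
  by (simp add: kS1_def fieldS1_def L_def)

lemma da_0: "r \<ge> 0 \<Longrightarrow> ((\<lambda>r. a0 * a r) has_real_derivative a0 * (L r * a r)) (at r within {0..})"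
  unfolding a_def[abs_def] by (auto intro!: derivative_eq_intros d_u6)

lemma df: "r \<ge> 0 \<Longrightarrow> (f has_real_derivative - q r) (at r within {0..})"
proof (cases "r = 0")
  case True
  have "(f has_real_derivative - (1/2) * (1 * u 0 $ I3 + 0 * (fieldS1 0 (initS1 c) $ I3 / (real (kS1 I3) + 1)))) (at 0 within {0..})"
    unfolding f_def[abs_def]
    by (rule derivative_eq_intros refl sing_sol_deriv_0[OF global loc_lip_fieldS1])+ simp
  then show ?thesis using True by (simp add: u_0 initS1_def q_def)
next
  case False
  assume "r \<ge> 0"
  then have r: "r > 0" using False by simp
  have "((\<lambda>r. (3 * c - U r) / 2) has_real_derivative - q r) (at r)"
    using r by (auto intro!: derivative_eq_intros dU)
  then have "(f has_real_derivative - q r) (at r)"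
    by (rule has_field_derivative_transform_within_open[where S = UNIV]) (auto simp: f_def U_def)
  then show ?thesis by (rule has_field_derivative_at_within)
qed

lemma hderiv_slopes: "r > 0 \<Longrightarrow> hderiv (\<lambda>r. a0 * a r) r = a0 * (L r * a r)" "r > 0 \<Longrightarrow> hderiv b r = M r / W r"
proof -
  assume r: "r > 0"
  then show "hderiv (\<lambda>r. a0 * a r) r = a0 * (L r * a r)" using hderiv_eq[OF da_0] by simp
  have "(b has_real_derivative M r / W r) (at r)"
    by (rule has_field_derivative_transform_within_open[OF d_b[OF r], of "{0<..}"])
       (use r in \<open>auto simp: b_def MW_eq divide_inverse\<close>)
  then show "hderiv b r = M r / W r" using hderiv_eq_pos r by blast
qed

lemma soliton: assumes a0: "a0 > 0" shows "soliton_S1R3 a0 (- c) (\<lambda>r. a0 * a r) b f"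
  unfolding soliton_S1R3_def
proof (intro conjI)
  have "Ck n b" for n unfolding b_def v_def vS1_def
    using rv_pos[unfolded v_def vS1_def] by (intro Ck_intros Ck_inverse Ck_u) force
  moreover have "Ck n f" for n unfolding f_def by (intro Ck_intros Ck_u)
  moreover have "Ck n (\<lambda>r. a0 * a r)" for n unfolding a_def by (intro Ck_intros Ck_exp Ck_u)
  ultimately show "soliton (\<lambda>r. a0 * a r) b f"
  proof (intro soliton_of_phase[OF phase_axioms] Ck_smooth)
    fix r :: real assume r: "r > 0"
    show "a0 * a r > 0" using a0 by (simp add: a_def)
    show "((\<lambda>r. a0 * a r) has_real_derivative L r * (a0 * a r)) (at r)"
      using da_0[of r a0] r by (simp add: at_within_halfline mult_ac)
    show "b r = 1 / W r" using r by (simp add: b_def MW_eq divide_inverse)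
    show "(f has_real_derivative - q r) (at r)" using df[of r] r by (simp add: at_within_halfline)
  qed
  show "a0 * a 0 = a0" "b 0 = 0" "f 0 = 0" by (simp_all add: a_def u_0 initS1_def b_def f_def)
  show "hderiv (\<lambda>r. a0 * a r) 0 = 0" using hderiv_eq[OF da_0, of 0 a0] by (simp add: L_def)
  have hf: "hderiv f r = - q r" if "r \<ge> 0" for r using hderiv_eq[OF df] that by blast
  then show "hderiv f 0 = 0" by (simp add: q_def)
  have "((\<lambda>r. - (r * u r $ I2)) has_real_derivative - (1 * u 0 $ I2 + (fieldS1 0 (initS1 c) $ I2 / (real (kS1 I2) + 1)) * 0)) (at 0 within {0..})"
    by (intro DERIV_minus DERIV_mult DERIV_ident sing_sol_deriv_0[OF global loc_lip_fieldS1])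
  then have "((\<lambda>r. - q r) has_real_derivative - c) (at 0 within {0..})"
    by (simp add: q_def u_0 initS1_def)
  then have "(hderiv f has_real_derivative - c) (at 0 within {0..})"
    by (rule has_field_derivative_transform_within[where d = 1]) (use hf in auto)
  then show "hderiv (hderiv f) 0 = - c" by (rule hderiv_eq) simp
  have dv: "(v has_real_derivative (fieldS1 0 (initS1 c) $ I5 / (real (kS1 I5) + 1) - fieldS1 0 (initS1 c) $ I4 / (real (kS1 I4) + 1))) (at 0 within {0..})"
    unfolding v_def[abs_def] vS1_def by (intro DERIV_diff sing_sol_deriv_0[OF global loc_lip_fieldS1])
  have "(b has_real_derivative 1) (at 0 within {0..})"
    unfolding b_def[abs_def] by (auto intro!: derivative_eq_intros dv)
  then show "hderiv b 0 = 1" by (rule hderiv_eq) simp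
qed

lemma asymptotic_slopes: "has_asymptotic_slopes (\<lambda>r. a0 * a r) b (a0 * slope_a, slope_b)"
  unfolding has_asymptotic_slopes_def fst_conv snd_conv
proof
  show "(hderiv (\<lambda>r. a0 * a r) \<longlongrightarrow> a0 * slope_a) at_top"
  proof (rule Lim_transform_eventually[OF tendsto_mult_left[OF slopes(1), of a0]])
    show "\<forall>\<^sub>F r in at_top. a0 * (L r * a r) = hderiv (\<lambda>r. a0 * a r) r"
      using eventually_gt_at_top[of 0] by eventually_elim (simp add: hderiv_slopes)
  qed
  show "(hderiv b \<longlongrightarrow> slope_b) at_top"
  proof (rule Lim_transform_eventually[OF slopes(2)])
    show "\<forall>\<^sub>F r in at_top. M r / W r = hderiv b r"
      using eventually_gt_at_top[of 0] by eventually_elim (simp add: hderiv_slopes)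
  qed
qed

end

text \<open>This gives the uniqueness behind \<open>F_S1R3\<close>. The boundary conditions do not
  contain all initial values of the regular variables; a''(0), b''(0) and C are extracted from the
  equations as r tends to 0.\<close>

lemma systemS1_of_soliton:
  assumes sol: "soliton_S1R3 a0 (- c) a b f" and a0: "a0 > 0"
  obtains u where "\<And>T. sing_sol kS1 fieldS1 (initS1 c) u T"
    "\<And>r. r > 0 \<Longrightarrow> hderiv a r = a0 * (r * u r $ I1 * exp (u r $ I6))"
    "\<And>r. r > 0 \<Longrightarrow> hderiv b r = (1 / r + mS1 (u r)) / (1 / r + vS1 (u r))"
proof -
  have S: "soliton a b f" and i: "a 0 = a0" "hderiv a 0 = 0" "b 0 = 0" "hderiv b 0 = 1" "f 0 = 0" "hderiv f 0 = 0"
    "hderiv (hderiv f) 0 = - c" using sol unfolding soliton_S1R3_def by auto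
  have sm: "smooth_halfline a" "smooth_halfline b" "smooth_halfline f" using S unfolding soliton_def by auto
  have pos: "a r > 0" "b r > 0" if "r > 0" for r using S that unfolding soliton_def by auto
  define L where "L = (\<lambda>r. hderiv a r / a r)"
  define M where "M = (\<lambda>r. hderiv b r / b r)"
  define q where "q = (\<lambda>r. - hderiv f r)"
  define X where "X = (\<lambda>r. L r + 2 * M r + q r)"
  define W where "W = (\<lambda>r. 1 / b r)"
  have dL: "(L has_real_derivative 1 - X r * L r) (at r)" if "r > 0" for r
    unfolding L_def M_def q_def X_def by (rule soliton_system(1)[OF S that])
  have dM: "(M has_real_derivative 1 + (W r)\<^sup>2 - X r * M r) (at r)" if "r > 0" for r
    unfolding L_def M_def q_def X_def W_def by (rule soliton_system(2)[OF S that])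
  have dW: "(W has_real_derivative - (M r * W r)) (at r)" if "r > 0" for r
    unfolding M_def W_def by (rule soliton_system(3)[OF S that])
  obtain C where C: "\<And>r. r > 0 \<Longrightarrow> hderiv (hderiv f) r = X r * q r - (C - 2 * f r)"
    using soliton_system(4)[OF S] unfolding L_def M_def q_def X_def by blast
  have d1: "(g has_real_derivative hderiv g r) (at r)" "(hderiv g has_real_derivative hderiv (hderiv g) r) (at r)"
    if "smooth_halfline g" "r > 0" for g r
    using smooth_halfline_derivs(1,2)[OF that(1), of r] that(2) by (simp_all add: at_within_halfline)
  note la = smooth_limits[OF sm(1), unfolded i] and lb = smooth_limits[OF sm(2), unfolded i] and lf = smooth_limits[OF sm(3), unfolded i]
  have la': "((\<lambda>r. hderiv a r / r) \<longlongrightarrow> hderiv (hderiv a) 0) (at_right 0)" using la(5) by simp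
  have lb': "((\<lambda>r. b r / r) \<longlongrightarrow> 1) (at_right 0)" using lb(4) by simp
  have lf': "((\<lambda>r. f r / r) \<longlongrightarrow> 0) (at_right 0)" "((\<lambda>r. hderiv f r / r) \<longlongrightarrow> - c) (at_right 0)" using lf(4,5) by simp_all
  have id0: "((\<lambda>r::real. r) \<longlongrightarrow> 0) (at_right 0)" by (rule tendsto_ident_at)
  have a00: "a0 \<noteq> 0" using a0 by simp
  \<comment> \<open>(1 - b'^2)/b tends to -2 b''(0) and the other terms to 0, so b''(0) = -2
    b''(0).\<close>
  have b2: "hderiv (hderiv b) 0 = 0"
  proof -
    have "((\<lambda>r. - ((hderiv b r - 1) / r) * (1 + hderiv b r) / (b r / r) - hderiv a r * hderiv b r / a r + hderiv b r * hderiv f r + b r)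
        \<longlongrightarrow> - hderiv (hderiv b) 0 * (1 + 1) / 1 - 0 * 1 / a0 + 1 * 0 + 0) (at_right 0)"
      using a00 by (intro tendsto_intros lb(5) lb(2) lb' la(2) la(1) lf(2) lb(1)) auto
    then have "(hderiv (hderiv b) \<longlongrightarrow> - hderiv (hderiv b) 0 * (1 + 1) / 1 - 0 * 1 / a0 + 1 * 0 + 0) (at_right 0)"
    proof (rule Lim_transform_eventually)
      show "\<forall>\<^sub>F r in at_right 0. - ((hderiv b r - 1) / r) * (1 + hderiv b r) / (b r / r) - hderiv a r * hderiv b r / a r
          + hderiv b r * hderiv f r + b r = hderiv (hderiv b) r"
        using eventually_pos_right
      proof eventually_elim
        case (elim r)
        have "- ((hderiv b r - 1) / r) * (1 + hderiv b r) / (b r / r) = (1 - (hderiv b r)\<^sup>2) / b r"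
          using pos[OF elim] elim by (simp add: field_simps power2_eq_square)
        moreover have "hderiv (hderiv b) r = (1 - (hderiv b r)\<^sup>2) / b r - hderiv a r * hderiv b r / a r + hderiv b r * hderiv f r + b r"
          using S elim unfolding soliton_def by blast
        ultimately show ?case by simp
      qed
    qed
    from tendsto_unique[OF _ this lb(3)] show ?thesis by simp
  qed
  \<comment> \<open>a' b'/b tends to a''(0), so a''(0) = -2 a''(0) + a0.\<close>
  have a2: "hderiv (hderiv a) 0 = a0 / 3"
  proof -
    have "((\<lambda>r. - 2 * ((hderiv a r / r) * hderiv b r / (b r / r)) + hderiv a r * hderiv f r + a r)
        \<longlongrightarrow> - 2 * (hderiv (hderiv a) 0 * 1 / 1) + 0 * 0 + a0) (at_right 0)"
      by (intro tendsto_intros la' lb(2) lb' la(2) la(1) lf(2)) auto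
    then have "(hderiv (hderiv a) \<longlongrightarrow> - 2 * (hderiv (hderiv a) 0 * 1 / 1) + 0 * 0 + a0) (at_right 0)"
    proof (rule Lim_transform_eventually)
      show "\<forall>\<^sub>F r in at_right 0. - 2 * ((hderiv a r / r) * hderiv b r / (b r / r)) + hderiv a r * hderiv f r + a r = hderiv (hderiv a) r"
        using eventually_pos_right
      proof eventually_elim
        case (elim r)
        have "hderiv (hderiv a) r = - 2 * (hderiv a r * hderiv b r / b r) + hderiv a r * hderiv f r + a r"
          using S elim unfolding soliton_def by blast
        then show ?case using pos[OF elim] elim by simp
      qed
    qed
    from tendsto_unique[OF _ this la(3)] show ?thesis by simp
  qed
  \<comment> \<open>X q tends to 2 c, so the equation for f'' becomes -c = 2 c - C.\<close>
  have C_eq: "C = 3 * c"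
  proof -
    have "((\<lambda>r. (r * L r + 2 * (hderiv b r / (b r / r)) + r * q r) * - (hderiv f r / r) - (C - 2 * f r))
        \<longlongrightarrow> (0 * (0 / a0) + 2 * (1 / 1) + 0 * - 0) * - (- c) - (C - 2 * 0)) (at_right 0)"
      unfolding L_def q_def using a00
      by (intro tendsto_intros la(1,2) lb(2) lb' lf(1,2) lf' id0) auto
    then have "(hderiv (hderiv f) \<longlongrightarrow> (0 * (0 / a0) + 2 * (1 / 1) + 0 * - 0) * - (- c) - (C - 2 * 0)) (at_right 0)"
    proof (rule Lim_transform_eventually)
      show "\<forall>\<^sub>F r in at_right 0. (r * L r + 2 * (hderiv b r / (b r / r)) + r * q r) * - (hderiv f r / r) - (C - 2 * f r) = hderiv (hderiv f) r"
        using eventually_pos_right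
      proof eventually_elim
        case (elim r)
        have "r * L r + 2 * (hderiv b r / (b r / r)) + r * q r = r * X r"
          using pos[OF elim] elim by (simp add: X_def M_def field_simps)
        moreover have "r * X r * - (hderiv f r / r) = X r * q r" using elim by (simp add: q_def)
        ultimately show ?case using C[OF elim] by simp
      qed
    qed
    from tendsto_unique[OF _ this lf(3)] show ?thesis by simp
  qed
  have dq: "(q has_real_derivative 3 * c - 2 * f r - X r * q r) (at r)" if "r > 0" for r
    unfolding q_def by (rule DERIV_cong[OF DERIV_minus[OF d1(2)[OF sm(3) that]]]) (use C[OF that] C_eq in \<open>simp add: q_def\<close>)
  have df: "(f has_real_derivative - q r) (at r)" if "r > 0" for r using d1(1)[OF sm(3) that] by (simp add: q_def)
  \<comment> \<open>The value at 0 is set separately, as the quotients by r would be divisions by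
    zero there.\<close>
  define u where "u = (\<lambda>r. if r = 0 then initS1 c else vec6 (L r / r) (q r / r) (- 2 * f r / r)
      ((M r - 1 / r) - 2 * (W r - 1 / r)) ((M r - 1 / r) - (W r - 1 / r)) (ln (a r / a0)))"
  have mv: "mS1 (u r) = M r - 1 / r" "vS1 (u r) = W r - 1 / r" if "r > 0" for r
    using that by (simp_all add: mS1_def vS1_def u_def)
  have xu: "xS1 r (u r) = X r - 2 / r" if "r > 0" for r
    unfolding xS1_def mv[OF that] using that by (simp add: u_def X_def field_simps)
  have transfer: "((\<lambda>s. u s $ i) has_real_derivative d) (at r)"
    if "r > 0" "(g has_real_derivative d) (at r)" "\<And>s. s > 0 \<Longrightarrow> g s = u s $ i" for r i g d
    by (rule has_field_derivative_transform_within_open[OF that(2), of "{0<..}"]) (use that in auto)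
  have sys: "sing_sol kS1 fieldS1 (initS1 c) u T" for T
  proof (rule sing_solI)
    show "u 0 = initS1 c" by (simp add: u_def)
    fix r :: real and i assume r: "r > 0"
    have u_r: "u r = vec6 (L r / r) (q r / r) (- 2 * f r / r)
      ((M r - 1 / r) - 2 * (W r - 1 / r)) ((M r - 1 / r) - (W r - 1 / r)) (ln (a r / a0))" using r by (simp add: u_def)
    have X_r: "X r = L r + 2 * M r + q r" by (simp add: X_def)
    have inv: "((\<lambda>r. 1 / r) has_real_derivative - (1 / r\<^sup>2)) (at r)"
      using r by (auto intro!: derivative_eq_intros simp: power2_eq_square)
    have D1: "((\<lambda>r. L r / r) has_real_derivative ((1 - X r * L r) * r - L r * 1) / (r * r)) (at r)"
      using r by (intro DERIV_divide dL DERIV_ident) auto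
    have D2: "((\<lambda>r. q r / r) has_real_derivative ((3 * c - 2 * f r - X r * q r) * r - q r * 1) / (r * r)) (at r)"
      using r by (intro DERIV_divide dq DERIV_ident) auto
    have D3: "((\<lambda>r. - 2 * f r / r) has_real_derivative (- 2 * - q r * r - - 2 * f r * 1) / (r * r)) (at r)"
      using r by (intro DERIV_divide DERIV_cmult df DERIV_ident) auto
    have D4: "((\<lambda>r. (M r - 1 / r) - 2 * (W r - 1 / r)) has_real_derivative
        (1 + (W r)\<^sup>2 - X r * M r - - (1 / r\<^sup>2)) - 2 * (- (M r * W r) - - (1 / r\<^sup>2))) (at r)"
      by (intro DERIV_diff DERIV_cmult dM dW inv r)
    have D5: "((\<lambda>r. (M r - 1 / r) - (W r - 1 / r)) has_real_derivative
        (1 + (W r)\<^sup>2 - X r * M r - - (1 / r\<^sup>2)) - (- (M r * W r) - - (1 / r\<^sup>2))) (at r)"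
      by (intro DERIV_diff dM dW inv r)
    have D6: "((\<lambda>r. ln (a r / a0)) has_real_derivative L r) (at r)"
      using pos[OF r] a0 by (auto intro!: derivative_eq_intros d1 sm r simp: L_def)
    show "((\<lambda>s. u s $ i) has_real_derivative fieldS1 r (u r) $ i - real (kS1 i) * (u r $ i - initS1 c $ i) / r) (at r)"
    proof (cases i)
      case I1
      show ?thesis unfolding I1
        by (rule transfer[OF r DERIV_cong[OF D1]])
           (use r in \<open>simp_all add: fieldS1_def kS1_def initS1_def xu, simp_all add: u_def field_simps\<close>)
    next
      case I2
      show ?thesis unfolding I2
        by (rule transfer[OF r DERIV_cong[OF D2]])
           (use r in \<open>simp_all add: fieldS1_def kS1_def initS1_def xu, simp_all add: u_def field_simps\<close>)
    next
      case I3
      show ?thesis unfolding I3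
        by (rule transfer[OF r DERIV_cong[OF D3]])
           (use r in \<open>simp_all add: fieldS1_def kS1_def initS1_def, simp_all add: u_def field_simps\<close>)
    next
      case I4
      show ?thesis unfolding I4
        by (rule transfer[OF r DERIV_cong[OF D4]])
           (use r in \<open>simp_all add: fieldS1_def kS1_def initS1_def xu mv, simp_all add: u_def X_r field_simps power2_eq_square\<close>)
    next
      case I5
      show ?thesis unfolding I5
        by (rule transfer[OF r DERIV_cong[OF D5]])
           (use r in \<open>simp_all add: fieldS1_def kS1_def initS1_def xu mv, simp_all add: u_def X_r field_simps power2_eq_square\<close>)
    next
      case I6
      show ?thesis unfolding I6
        by (rule transfer[OF r DERIV_cong[OF D6]])
           (use r in \<open>simp_all add: fieldS1_def kS1_def initS1_def, simp_all add: u_def\<close>)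
    qed
  next
    fix i
    have tr: "((\<lambda>r. u r $ i) \<longlongrightarrow> l) (at_right 0)" if "(g \<longlongrightarrow> l) (at_right 0)" "\<And>s. s > 0 \<Longrightarrow> g s = u s $ i" for i g l
    proof (rule Lim_transform_eventually[OF that(1)])
      show "\<forall>\<^sub>F r in at_right 0. g r = u r $ i" using eventually_pos_right by eventually_elim (rule that(2))
    qed
    have l1: "((\<lambda>r. (hderiv a r / r) / a r) \<longlongrightarrow> (a0 / 3) / a0) (at_right 0)"
      by (rule tendsto_divide[OF la'[unfolded a2] la(1) a00])
    have l2: "((\<lambda>r. - (hderiv f r / r)) \<longlongrightarrow> - (- c)) (at_right 0)" by (intro tendsto_intros lf')
    have l3: "((\<lambda>r. - 2 * (f r / r)) \<longlongrightarrow> - 2 * 0) (at_right 0)" by (intro tendsto_intros lf')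
    note so = second_order_limits[OF sm(2) i(3,4) b2 pos(2)]
    have l4: "((\<lambda>r. (hderiv b r / b r - 1 / r) - 2 * (1 / b r - 1 / r)) \<longlongrightarrow> 0 - 2 * 0) (at_right 0)" by (intro tendsto_intros so)
    have l5: "((\<lambda>r. (hderiv b r / b r - 1 / r) - (1 / b r - 1 / r)) \<longlongrightarrow> 0 - 0) (at_right 0)" by (intro tendsto_intros so)
    have l6: "((\<lambda>r. ln (a r / a0)) \<longlongrightarrow> ln (a0 / a0)) (at_right 0)" using a00 by (intro tendsto_intros la(1)) auto
    show "((\<lambda>r. u r $ i) \<longlongrightarrow> initS1 c $ i) (at_right 0)"
    proof (cases i)
      case I1 show ?thesis unfolding I1 by (rule tr[OF l1[THEN tendsto_eq_rhs]]) (use a00 in \<open>simp_all add: u_def initS1_def L_def\<close>)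
    next
      case I2 show ?thesis unfolding I2 by (rule tr[OF l2[THEN tendsto_eq_rhs]]) (simp_all add: u_def initS1_def q_def)
    next
      case I3 show ?thesis unfolding I3 by (rule tr[OF l3[THEN tendsto_eq_rhs]]) (simp_all add: u_def initS1_def)
    next
      case I4 show ?thesis unfolding I4 by (rule tr[OF l4[THEN tendsto_eq_rhs]]) (simp_all add: u_def initS1_def M_def W_def)
    next
      case I5 show ?thesis unfolding I5 by (rule tr[OF l5[THEN tendsto_eq_rhs]]) (simp_all add: u_def initS1_def M_def W_def)
    next
      case I6 show ?thesis unfolding I6 by (rule tr[OF l6[THEN tendsto_eq_rhs]]) (use a00 in \<open>simp_all add: u_def initS1_def\<close>)
    qed
  qed
  show ?thesis
  proof (rule that[OF sys])
    fix r :: real assume r: "r > 0"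
    have "exp (ln (a r / a0)) = a r / a0" using pos(1)[OF r] a0 by simp
    then show "hderiv a r = a0 * (r * u r $ I1 * exp (u r $ I6))" using r pos(1)[OF r] a0 by (simp add: u_def L_def)
    show "hderiv b r = (1 / r + mS1 (u r)) / (1 / r + vS1 (u r))"
      unfolding mv[OF r] using pos(2)[OF r] by (simp add: M_def W_def)
  qed
qed

lemma limits_unique_if_eq:
  fixes g h :: "real \<Rightarrow> real"
  assumes "(g \<longlongrightarrow> l) at_top" "(h \<longlongrightarrow> l') at_top" "\<And>r. r > 0 \<Longrightarrow> g r = h r"
  shows "l = l'"
proof (rule tendsto_unique[OF _ assms(1)])
  show "(g \<longlongrightarrow> l') at_top"
  proof (rule Lim_transform_eventually[OF assms(2)])
    show "\<forall>\<^sub>F r in at_top. h r = g r" using eventually_gt_at_top[of 0] by eventually_elim (simp add: assms(3))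
  qed
qed simp

context systemS1_global
begin

lemma F_S1R3_eq: assumes a0: "a0 > 0" shows "F_S1R3 (a0, c) = (a0 * slope_a, slope_b)"
  unfolding F_S1R3_def split
proof (rule the_equality)
  show "\<exists>a b f. soliton_S1R3 a0 (- c) a b f \<and> has_asymptotic_slopes a b (a0 * slope_a, slope_b)"
    using soliton[OF a0] asymptotic_slopes by blast
  fix P assume "\<exists>a b f. soliton_S1R3 a0 (- c) a b f \<and> has_asymptotic_slopes a b P"
  then obtain a' b' f' where s: "soliton_S1R3 a0 (- c) a' b' f'" "has_asymptotic_slopes a' b' P" by blast
  obtain u' where u': "\<And>T. sing_sol kS1 fieldS1 (initS1 c) u' T"
    "\<And>r. r > 0 \<Longrightarrow> hderiv a' r = a0 * (r * u' r $ I1 * exp (u' r $ I6))"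
    "\<And>r. r > 0 \<Longrightarrow> hderiv b' r = (1 / r + mS1 (u' r)) / (1 / r + vS1 (u' r))"
    using systemS1_of_soliton[OF s(1) a0] by metis
  \<comment> \<open>Both solve the same singular problem, so an arbitrary competitor has the same
    derivatives for r > 0 and hence the same limits.\<close>
  have uu: "u' r = u r" if "r > 0" for r
    by (rule sing_sol_unique[OF loc_lip_fieldS1 u'(1) global, of r "r + 1" "r + 1"]) (use that in auto)
  have lim: "(hderiv a' \<longlongrightarrow> fst P) at_top" "(hderiv b' \<longlongrightarrow> snd P) at_top"
    using s(2) unfolding has_asymptotic_slopes_def by auto
  have lim': "(hderiv (\<lambda>r. a0 * a r) \<longlongrightarrow> a0 * slope_a) at_top" "(hderiv b \<longlongrightarrow> slope_b) at_top"
    using asymptotic_slopes[of a0] unfolding has_asymptotic_slopes_def by auto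
  have "fst P = a0 * slope_a"
  proof (rule limits_unique_if_eq[OF lim(1) lim'(1)])
    fix r :: real assume r: "r > 0"
    show "hderiv a' r = hderiv (\<lambda>r. a0 * a r) r"
      unfolding u'(2)[OF r] hderiv_slopes(1)[OF r] uu[OF r] by (simp add: L_def a_def)
  qed
  moreover have "snd P = slope_b"
  proof (rule limits_unique_if_eq[OF lim(2) lim'(2)])
    fix r :: real assume r: "r > 0"
    show "hderiv b' r = hderiv b r"
      unfolding u'(3)[OF r] hderiv_slopes(2)[OF r] uu[OF r] by (simp add: M_def W_def m_def v_def)
  qed
  ultimately show "P = (a0 * slope_a, slope_b)" by (simp add: prod_eq_iff)
qed

end

text \<open>A compact subset of the open quadrant lies in a square [k1, k2]^2 with k1 > 0, so it
  suffices to confine the preimages of such squares. The preimage of the compact set is then closed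
  in the compact B.\<close>

lemma is_proper_map_quadrant:
  fixes F :: "real \<times> real \<Rightarrow> real \<times> real"
  assumes F: "F \<in> quadrant \<rightarrow> quadrant" and cont: "continuous_on quadrant F"
    and bdd: "\<And>k1 k2. 0 < k1 \<Longrightarrow> k1 \<le> k2 \<Longrightarrow> \<exists>B. compact B \<and> B \<subseteq> quadrant \<and>
      (\<forall>p\<in>quadrant. k1 \<le> fst (F p) \<longrightarrow> fst (F p) \<le> k2 \<longrightarrow> k1 \<le> snd (F p) \<longrightarrow> snd (F p) \<le> k2 \<longrightarrow> p \<in> B)"
  shows "is_proper_map quadrant quadrant F"
  unfolding is_proper_map_def
proof (intro conjI F allI impI; elim conjE)
  fix K :: "(real \<times> real) set" assume K: "K \<subseteq> quadrant" "compact K"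
  show "compact (quadrant \<inter> F -` K)"
  proof (cases "K = {}")
    case False
    have c: "continuous_on K fst" "continuous_on K snd" by (intro continuous_intros)+
    obtain p1 where p1: "p1 \<in> K" "\<And>p. p \<in> K \<Longrightarrow> fst p1 \<le> fst p" using continuous_attains_inf[OF K(2) False c(1)] by auto
    obtain p2 where p2: "p2 \<in> K" "\<And>p. p \<in> K \<Longrightarrow> snd p2 \<le> snd p" using continuous_attains_inf[OF K(2) False c(2)] by auto
    obtain p3 where p3: "p3 \<in> K" "\<And>p. p \<in> K \<Longrightarrow> fst p \<le> fst p3" using continuous_attains_sup[OF K(2) False c(1)] by auto
    obtain p4 where p4: "p4 \<in> K" "\<And>p. p \<in> K \<Longrightarrow> snd p \<le> snd p4" using continuous_attains_sup[OF K(2) False c(2)] by auto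
    define k1 where "k1 = min (fst p1) (snd p2)"
    define k2 where "k2 = max (fst p3) (snd p4)"
    have k1: "0 < k1" using p1(1) p2(1) K(1) unfolding k1_def quadrant_def by auto
    have kle: "k1 \<le> fst p" "fst p \<le> k2" "k1 \<le> snd p" "snd p \<le> k2" if "p \<in> K" for p
      using p1(2)[OF that] p2(2)[OF that] p3(2)[OF that] p4(2)[OF that] by (auto simp: k1_def k2_def)
    have "k1 \<le> k2" using order_trans[OF kle(1)[OF p1(1)] kle(2)[OF p1(1)]] .
    then obtain B where B: "compact B" "B \<subseteq> quadrant"
      "\<And>p. p \<in> quadrant \<Longrightarrow> k1 \<le> fst (F p) \<Longrightarrow> fst (F p) \<le> k2 \<Longrightarrow> k1 \<le> snd (F p) \<Longrightarrow> snd (F p) \<le> k2 \<Longrightarrow> p \<in> B"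
      using bdd[OF k1] by metis
    have "quadrant \<inter> F -` K = B \<inter> F -` K" using B(2,3) kle by auto
    moreover have "closed (B \<inter> F -` K)"
      by (rule continuous_closed_preimage[OF continuous_on_subset[OF cont B(2)]])
         (use B(1) K(2) compact_imp_closed in auto)
    moreover have "B \<inter> F -` K = B \<inter> (B \<inter> F -` K)" by blast
    ultimately show ?thesis using compact_Int_closed[OF B(1)] by metis
  qed simp
qed

section \<open>Properness for S^1 x R^3\<close>

definition "solS1 c = (SOME u. \<forall>T. sing_sol kS1 fieldS1 (initS1 c) u T)"

lemma systemS1_global_solS1: "c > 0 \<Longrightarrow> systemS1_global (solS1 c) c"
  using someI_ex[OF ex_systemS1] unfolding solS1_def by unfold_locales auto

definition "slope_aS1 c = expander.slope_a (systemS1.L (solS1 c)) (systemS1.a (solS1 c))"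
definition "slope_bS1 c = expander.slope_b (systemS1.M (solS1 c)) (systemS1.W (solS1 c))"

lemma slopesS1_continuous: "continuous_on {0<..} slope_aS1" "continuous_on {0<..} slope_bS1"
proof -
  have cu: "continuous_on {0<..} (\<lambda>c. solS1 c s)" if "s > 0" for s
  proof (rule sing_sol_continuous_in_init[OF loc_lip_fieldS1])
    show "continuous_on {0<..} initS1" unfolding initS1_def[abs_def] by (intro continuous_on_vec6 continuous_intros)
    show "sing_sol kS1 fieldS1 (initS1 c) (solS1 c) T" if "c \<in> {0<..}" for c T
      using systemS1_global.global[OF systemS1_global_solS1] that by simp
  qed (use that in auto)
  have ex: "expander (systemS1.L (solS1 c)) (systemS1.M (solS1 c)) (systemS1.X (solS1 c)) (systemS1.W (solS1 c))
      (systemS1.q (solS1 c)) (systemS1.U (solS1 c) c) (systemS1.a (solS1 c)) (3 * c)" if "c \<in> {0<..}" for c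
  proof -
    interpret systemS1_global "solS1 c" c using systemS1_global_solS1 that by simp
    show ?thesis by (rule expander_axioms)
  qed
  have eqs: "systemS1.L (solS1 c) s = s * solS1 c s $ I1"
    "systemS1.M (solS1 c) s = 1 / s + (2 * solS1 c s $ I5 - solS1 c s $ I4)"
    "systemS1.X (solS1 c) s = 2 / s + (2 * (2 * solS1 c s $ I5 - solS1 c s $ I4) + s * (solS1 c s $ I1 + solS1 c s $ I2))"
    "systemS1.W (solS1 c) s = 1 / s + (solS1 c s $ I5 - solS1 c s $ I4)"
    "systemS1.U (solS1 c) c s = 3 * c + s * solS1 c s $ I3"
    "systemS1.a (solS1 c) s = exp (solS1 c s $ I6)" if "c \<in> {0<..}" for c s
  proof -
    interpret systemS1_global "solS1 c" c using systemS1_global_solS1 that by simp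
    show "L s = s * solS1 c s $ I1" "M s = 1 / s + (2 * solS1 c s $ I5 - solS1 c s $ I4)"
      "X s = 2 / s + (2 * (2 * solS1 c s $ I5 - solS1 c s $ I4) + s * (solS1 c s $ I1 + solS1 c s $ I2))"
      "W s = 1 / s + (solS1 c s $ I5 - solS1 c s $ I4)" "U s = 3 * c + s * solS1 c s $ I3" "a s = exp (solS1 c s $ I6)"
      by (simp_all add: L_def M_def X_def W_def U_def a_def m_def v_def x_def mS1_def vS1_def xS1_def)
  qed
  have "continuous_on {0<..} (\<lambda>c. systemS1.L (solS1 c) s)" "continuous_on {0<..} (\<lambda>c. systemS1.M (solS1 c) s)"
    "continuous_on {0<..} (\<lambda>c. systemS1.X (solS1 c) s)" "continuous_on {0<..} (\<lambda>c. systemS1.W (solS1 c) s)"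
    "continuous_on {0<..} (\<lambda>c. systemS1.U (solS1 c) c s)" "continuous_on {0<..} (\<lambda>c. systemS1.a (solS1 c) s)"
    if "s > 0" for s
    by (subst continuous_on_cong[OF refl eqs(1)], assumption, intro continuous_intros cu[OF that])
       (subst continuous_on_cong[OF refl eqs(2)], assumption, intro continuous_intros cu[OF that],
        subst continuous_on_cong[OF refl eqs(3)], assumption, intro continuous_intros cu[OF that],
        subst continuous_on_cong[OF refl eqs(4)], assumption, intro continuous_intros cu[OF that],
        subst continuous_on_cong[OF refl eqs(5)], assumption, intro continuous_intros cu[OF that],
        subst continuous_on_cong[OF refl eqs(6)], assumption, intro continuous_intros cu[OF that])
  from slopes_continuous[OF ex this]
  show "continuous_on {0<..} slope_aS1" "continuous_on {0<..} slope_bS1"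
    unfolding slope_aS1_def[abs_def] slope_bS1_def[abs_def] by auto
qed

lemma slopesS1:
  assumes "c > 0"
  shows "slope_aS1 c > 0" "slope_bS1 c > 0" "a0 > 0 \<Longrightarrow> F_S1R3 (a0, c) = (a0 * slope_aS1 c, slope_bS1 c)"
    "R > 43 \<Longrightarrow> 3 * c * exp (2 * R) \<le> 1 \<Longrightarrow> (R - 3) / 40 \<le> slope_bS1 c"
    "c = \<sigma>\<^sup>2 \<Longrightarrow> \<sigma> \<ge> 20480 \<Longrightarrow> (slope_bS1 c)\<^sup>2 \<le> 5 / \<sigma>"
proof -
  interpret systemS1_global "solS1 c" c using systemS1_global_solS1 assms by simp
  have eq: "slope_aS1 c = slope_a" "slope_bS1 c = slope_b" by (simp_all add: slope_aS1_def slope_bS1_def)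
  show "slope_aS1 c > 0" "slope_bS1 c > 0" "a0 > 0 \<Longrightarrow> F_S1R3 (a0, c) = (a0 * slope_aS1 c, slope_bS1 c)"
    unfolding eq by (rule slopes_pos slopes_pos F_S1R3_eq)+
  show "R > 43 \<Longrightarrow> 3 * c * exp (2 * R) \<le> 1 \<Longrightarrow> (R - 3) / 40 \<le> slope_bS1 c" unfolding eq by (rule slope_b_large)
  show "c = \<sigma>\<^sup>2 \<Longrightarrow> \<sigma> \<ge> 20480 \<Longrightarrow> (slope_bS1 c)\<^sup>2 \<le> 5 / \<sigma>" unfolding eq by (rule slope_b_small) simp_all
qed

lemma proper_S1R3: "is_proper_map quadrant quadrant F_S1R3"
proof (rule is_proper_map_quadrant)
  have F: "F_S1R3 p = (fst p * slope_aS1 (snd p), slope_bS1 (snd p))" if "p \<in> quadrant" for p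
    using slopesS1(3)[of "snd p" "fst p"] that by (auto simp: quadrant_def)
  show "F_S1R3 \<in> quadrant \<rightarrow> quadrant"
  proof
    fix p assume p: "p \<in> quadrant"
    then show "F_S1R3 p \<in> quadrant" using F[OF p] slopesS1(1,2)[of "snd p"] by (auto simp: quadrant_def)
  qed
  have "continuous_on quadrant (\<lambda>p. (fst p * slope_aS1 (snd p), slope_bS1 (snd p)))"
    by (intro continuous_intros continuous_on_compose2[OF slopesS1_continuous(1)] continuous_on_compose2[OF slopesS1_continuous(2)])
       (auto simp: quadrant_def)
  then show "continuous_on quadrant F_S1R3" by (simp add: continuous_on_cong[OF refl F])
  fix k1 k2 :: real assume k: "0 < k1" "k1 \<le> k2"
  \<comment> \<open>(R - 3)/40 exceeds k2, and c < \<open>c1\<close> entails 3 c exp(2 R) < 1; so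
    small c is ruled out by the limit of b'.\<close>
  define R where "R = 40 * k2 + 44"
  define c1 where "c1 = exp (- 2 * R) / 3"
  \<comment> \<open>With \<sigma> = sqrt c > 5/k1^2 the bound 5/\<sigma> on the squared limit of b'
    falls below k1^2.\<close>
  define S where "S = max 20480 (5 / k1\<^sup>2)"
  have R: "R > 43" "(R - 3) / 40 > k2" using k by (auto simp: R_def)
  have c1: "c1 > 0" by (simp add: c1_def)
  have c_bounds: "c1 \<le> c" "c \<le> S\<^sup>2" if c: "c > 0" and b: "k1 \<le> slope_bS1 c" "slope_bS1 c \<le> k2" for c
  proof -
    show "c1 \<le> c"
    proof (rule ccontr)
      assume "\<not> c1 \<le> c"
      then have "3 * c \<le> exp (- 2 * R)" by (simp add: c1_def)
      then have "3 * c * exp (2 * R) \<le> exp (- 2 * R) * exp (2 * R)" by (intro mult_right_mono) auto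
      then have "3 * c * exp (2 * R) \<le> 1" by (simp flip: exp_add)
      then show False using slopesS1(4)[OF c R(1)] R(2) b by simp
    qed
    have "sqrt c \<le> S"
    proof (rule ccontr)
      assume "\<not> sqrt c \<le> S"
      then have big: "sqrt c > 20480" "sqrt c > 5 / k1\<^sup>2" by (auto simp: S_def)
      have "k1\<^sup>2 \<le> (slope_bS1 c)\<^sup>2" using k b by (intro power_mono) auto
      also have "\<dots> \<le> 5 / sqrt c" by (rule slopesS1(5)[OF c]) (use c big in auto)
      finally have "k1\<^sup>2 * sqrt c \<le> 5" by (subst (asm) pos_le_divide_eq) (use c in auto)
      moreover have "5 < k1\<^sup>2 * sqrt c" using big(2) k by (subst (asm) pos_divide_less_eq) (auto simp: mult.commute)
      ultimately show False by simp
    qed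
    then have "(sqrt c)\<^sup>2 \<le> S\<^sup>2" using c by (intro power_mono) auto
    then show "c \<le> S\<^sup>2" using c by simp
  qed
  show "\<exists>B. compact B \<and> B \<subseteq> quadrant \<and> (\<forall>p\<in>quadrant. k1 \<le> fst (F_S1R3 p) \<longrightarrow> fst (F_S1R3 p) \<le> k2 \<longrightarrow>
      k1 \<le> snd (F_S1R3 p) \<longrightarrow> snd (F_S1R3 p) \<le> k2 \<longrightarrow> p \<in> B)"
  proof (cases "c1 \<le> S\<^sup>2")
    \<comment> \<open>Then no c is compatible with the bounds, and the preimage is empty.\<close>
    case False
    then show ?thesis using c_bounds F by (intro exI[of _ "{}"]) (force simp: quadrant_def)
  next
    case True
    have cont: "continuous_on {c1..S\<^sup>2} slope_aS1"
      using c1 by (intro continuous_on_subset[OF slopesS1_continuous(1)]) auto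
    \<comment> \<open>The limit of a' is a0 times \<open>slope_aS1 c\<close>; positive extrema of
      the latter over the compact range of c confine a0.\<close>
    obtain cl where cl: "cl \<in> {c1..S\<^sup>2}" "\<And>c. c \<in> {c1..S\<^sup>2} \<Longrightarrow> slope_aS1 cl \<le> slope_aS1 c"
      using continuous_attains_inf[OF _ _ cont] True by auto
    obtain ch where ch: "ch \<in> {c1..S\<^sup>2}" "\<And>c. c \<in> {c1..S\<^sup>2} \<Longrightarrow> slope_aS1 c \<le> slope_aS1 ch"
      using continuous_attains_sup[OF _ _ cont] True by auto
    have p: "slope_aS1 cl > 0" "slope_aS1 ch > 0" using slopesS1(1) cl(1) ch(1) c1 by auto
    define B where "B = {k1 / slope_aS1 ch..k2 / slope_aS1 cl} \<times> {c1..S\<^sup>2}"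
    have "0 < k1 / slope_aS1 ch" using k p by simp
    then have "B \<subseteq> quadrant" using c1 unfolding B_def quadrant_def by auto
    moreover have "compact B" unfolding B_def by (intro compact_Times compact_Icc)
    moreover have "p \<in> B" if "p \<in> quadrant" "k1 \<le> fst (F_S1R3 p)" "fst (F_S1R3 p) \<le> k2" "k1 \<le> snd (F_S1R3 p)" "snd (F_S1R3 p) \<le> k2" for p
    proof -
      obtain a0 c where pc: "p = (a0, c)" by fastforce
      have ac: "a0 > 0" "c > 0" using that(1) by (auto simp: pc quadrant_def)
      have b: "k1 \<le> a0 * slope_aS1 c" "a0 * slope_aS1 c \<le> k2" "k1 \<le> slope_bS1 c" "slope_bS1 c \<le> k2"
        using that(2-5) unfolding F[OF that(1)] by (simp_all add: pc)
      have cI: "c \<in> {c1..S\<^sup>2}" using c_bounds[OF ac(2) b(3,4)] by simp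
      have "a0 * slope_aS1 c \<le> a0 * slope_aS1 ch" "a0 * slope_aS1 cl \<le> a0 * slope_aS1 c"
        using cl(2)[OF cI] ch(2)[OF cI] ac by (auto intro: mult_left_mono)
      then have "k1 / slope_aS1 ch \<le> a0" "a0 \<le> k2 / slope_aS1 cl"
        using b p by (simp_all add: pos_divide_le_eq pos_le_divide_eq)
      then show ?thesis using cI by (simp add: pc B_def)
    qed
    ultimately show ?thesis by blast
  qed
qed

section \<open>The case of S^2 x R^2\<close>

text \<open>The regular variables \<open>X - 1/r\<close>, \<open>M\<close>, \<open>q\<close>, \<open>U\<close>, \<open>W\<close> and \<open>ln (a/r)\<close>.\<close>

definition fieldS2 :: "real \<Rightarrow> real^idx \<Rightarrow> real^idx" where
  "fieldS2 r u = vec6 (3 + 2 * (u $ I5 * u $ I5) + u $ I4 - u $ I1 * u $ I1) (1 + u $ I5 * u $ I5 - u $ I1 * u $ I2)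
     (u $ I4 - u $ I1 * u $ I3) (2 * u $ I3) (0 - u $ I2 * u $ I5) (u $ I1 - 2 * u $ I2 - u $ I3)"

text \<open>X is 1/r + x. The term -X^2 in X' contributes -2 x / r, and the damping by X contributes
  1 for M and q; the remaining equations have no singular term.\<close>

definition kS2 :: "idx \<Rightarrow> nat" where
  "kS2 i = (case i of I1 \<Rightarrow> 2 | I2 \<Rightarrow> 1 | I3 \<Rightarrow> 1 | I4 \<Rightarrow> 0 | I5 \<Rightarrow> 0 | I6 \<Rightarrow> 0)"

text \<open>The value 2 c of U is forced by q ~ c r in q' = U - q/r up to terms tending to
  0.\<close>

definition initS2 :: "real \<Rightarrow> real \<Rightarrow> real^idx" where "initS2 w0 c = vec6 0 0 0 (2 * c) w0 0"

lemma loc_lip_fieldS2: "loc_lip_field fieldS2"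
  unfolding loc_lip_field_def
proof
  fix i show "loc_lip (\<lambda>r u. fieldS2 r u $ i)"
    by (cases i; simp only: fieldS2_def vec6_nth; intro loc_lip_intros)
qed

text \<open>(r g)' = r h, so l'Hopital's rule applies to r g / r^2.\<close>

lemma singular_quotient_limit:
  fixes g h :: "real \<Rightarrow> real"
  assumes g: "(g \<longlongrightarrow> 0) (at_right 0)" and h: "(h \<longlongrightarrow> l) (at_right 0)"
    and deriv: "\<forall>\<^sub>F r in at_right 0. (g has_real_derivative h r - g r / r) (at r)"
  shows "((\<lambda>r. g r / r) \<longlongrightarrow> l / 2) (at_right 0)"
proof -
  have "((\<lambda>r. (r * g r) / r\<^sup>2) \<longlongrightarrow> l / 2) (at_right 0)"
  proof (rule lhopital_right_0[where f' = "\<lambda>r. r * h r" and g' = "\<lambda>r. 2 * r"])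
    show "((\<lambda>r. r * g r) \<longlongrightarrow> 0) (at_right 0)"
      using tendsto_mult[OF tendsto_ident_at[of 0 "{0<..}"] g] by simp
    show "((\<lambda>r::real. r\<^sup>2) \<longlongrightarrow> 0) (at_right 0)"
      using tendsto_power[OF tendsto_ident_at[of "0::real" "{0<..}"], of 2] by simp
    show "\<forall>\<^sub>F r in at_right 0. (r::real)\<^sup>2 \<noteq> 0" "\<forall>\<^sub>F r in at_right 0. 2 * (r::real) \<noteq> 0"
      using eventually_pos_right by (eventually_elim, simp)+
    show "\<forall>\<^sub>F r in at_right 0. ((\<lambda>r. r * g r) has_real_derivative r * h r) (at r)"
      using deriv eventually_pos_right
    proof eventually_elim
      case (elim r)
      have "((\<lambda>r. r * g r) has_real_derivative 1 * g r + (h r - g r / r) * r) (at r)"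
        by (intro DERIV_mult DERIV_ident elim)
      then show ?case by (rule DERIV_cong) (use elim in \<open>simp add: field_simps\<close>)
    qed
    show "\<forall>\<^sub>F r in at_right 0. ((\<lambda>r::real. r\<^sup>2) has_real_derivative 2 * r) (at r)"
      by (auto intro!: always_eventually derivative_eq_intros)
    have "((\<lambda>r. h r / 2) \<longlongrightarrow> l / 2) (at_right 0)" by (intro tendsto_intros h) simp
    then show "((\<lambda>r. r * h r / (2 * r)) \<longlongrightarrow> l / 2) (at_right 0)"
    proof (rule Lim_transform_eventually)
      show "\<forall>\<^sub>F r in at_right 0. h r / 2 = r * h r / (2 * r)" using eventually_pos_right by eventually_elim simp
    qed
  qed
  then show ?thesis
  proof (rule Lim_transform_eventually)
    show "\<forall>\<^sub>F r in at_right 0. r * g r / r\<^sup>2 = g r / r"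
      using eventually_pos_right by eventually_elim (simp add: power2_eq_square)
  qed
qed

locale systemS2 =
  fixes u :: "real \<Rightarrow> real^idx" and w0 c :: real and I :: "real set"
  assumes w0: "w0 > 0" and c: "c > 0" and I_pos: "r \<in> I \<Longrightarrow> 0 < r" and I_down: "r \<in> I \<Longrightarrow> 0 < s \<Longrightarrow> s \<le> r \<Longrightarrow> s \<in> I"
    and I_ne: "I \<noteq> {}" and sol: "r \<in> I \<Longrightarrow> \<exists>T>r. sing_sol kS2 fieldS2 (initS2 w0 c) u T"
begin

definition "x r = u r $ I1"
definition "M r = u r $ I2"
definition "q r = u r $ I3"
definition "U r = u r $ I4"
definition "W r = u r $ I5"
definition "X r = 1 / r + x r"
definition "L r = X r - 2 * M r - q r"
definition "a r = r * exp (u r $ I6)"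

lemma d_comp:
  assumes "r \<in> I"
  shows "(x has_real_derivative 3 + 2 * (W r)\<^sup>2 + U r - (x r)\<^sup>2 - 2 * x r / r) (at r)"
    "(M has_real_derivative 1 + (W r)\<^sup>2 - x r * M r - M r / r) (at r)"
    "(q has_real_derivative U r - x r * q r - q r / r) (at r)"
    "(U has_real_derivative 2 * q r) (at r)"
    "(W has_real_derivative - (M r * W r)) (at r)"
    "((\<lambda>s. u s $ I6) has_real_derivative x r - 2 * M r - q r) (at r)"
proof -
  obtain T where "T > r" "sing_sol kS2 fieldS2 (initS2 w0 c) u T" using sol[OF assms] by blast
  then have d: "((\<lambda>s. u s $ i) has_real_derivative fieldS2 r (u r) $ i - real (kS2 i) * (u r $ i - initS2 w0 c $ i) / r) (at r)" for i
    using I_pos[OF assms] unfolding sing_sol_def by blast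
  show "(x has_real_derivative 3 + 2 * (W r)\<^sup>2 + U r - (x r)\<^sup>2 - 2 * x r / r) (at r)"
    "(M has_real_derivative 1 + (W r)\<^sup>2 - x r * M r - M r / r) (at r)"
    "(q has_real_derivative U r - x r * q r - q r / r) (at r)"
    "(U has_real_derivative 2 * q r) (at r)"
    "(W has_real_derivative - (M r * W r)) (at r)"
    "((\<lambda>s. u s $ I6) has_real_derivative x r - 2 * M r - q r) (at r)"
    using d[of I1] d[of I2] d[of I3] d[of I4] d[of I5] d[of I6]
    by (simp_all add: fieldS2_def kS2_def initS2_def x_def[abs_def] M_def[abs_def] q_def[abs_def] U_def[abs_def]
        W_def[abs_def] power2_eq_square)
qed

lemma ev_I: "\<forall>\<^sub>F r in at_right 0. r \<in> I"
proof -
  obtain r where r: "r \<in> I" using I_ne by blast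
  have "\<forall>\<^sub>F s in at_right 0. s \<in> {0<..<r}" by (rule eventually_at_right_real) (use I_pos[OF r] in auto)
  then show ?thesis by eventually_elim (use I_down[OF r] in auto)
qed

lemma lim_comp: "((\<lambda>r. u r $ i) \<longlongrightarrow> initS2 w0 c $ i) (at_right 0)"
proof -
  obtain r where r: "r \<in> I" using I_ne by blast
  then obtain T where "T > r" "sing_sol kS2 fieldS2 (initS2 w0 c) u T" using sol by blast
  then show ?thesis using sing_sol_lim_0 I_pos[OF r] by force
qed

lemma lims: "(x \<longlongrightarrow> 0) (at_right 0)" "(M \<longlongrightarrow> 0) (at_right 0)" "(q \<longlongrightarrow> 0) (at_right 0)"
    "(U \<longlongrightarrow> 2 * c) (at_right 0)" "(W \<longlongrightarrow> w0) (at_right 0)" "((\<lambda>r. u r $ I6) \<longlongrightarrow> 0) (at_right 0)"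
  using lim_comp[of I1] lim_comp[of I2] lim_comp[of I3] lim_comp[of I4] lim_comp[of I5] lim_comp[of I6]
  by (simp_all add: initS2_def x_def[abs_def] M_def[abs_def] q_def[abs_def] U_def[abs_def] W_def[abs_def])

lemma lim_quotients: "((\<lambda>r. M r / r) \<longlongrightarrow> (1 + w0\<^sup>2) / 2) (at_right 0)" "((\<lambda>r. q r / r) \<longlongrightarrow> c) (at_right 0)"
proof -
  have "((\<lambda>r. 1 + (W r)\<^sup>2 - x r * M r) \<longlongrightarrow> 1 + w0\<^sup>2 - 0 * 0) (at_right 0)" "((\<lambda>r. U r - x r * q r) \<longlongrightarrow> 2 * c - 0 * 0) (at_right 0)"
    by (intro tendsto_intros lims)+
  then have l: "((\<lambda>r. 1 + (W r)\<^sup>2 - x r * M r) \<longlongrightarrow> 1 + w0\<^sup>2) (at_right 0)" "((\<lambda>r. U r - x r * q r) \<longlongrightarrow> 2 * c) (at_right 0)"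
    by simp_all
  show "((\<lambda>r. M r / r) \<longlongrightarrow> (1 + w0\<^sup>2) / 2) (at_right 0)"
  proof (rule singular_quotient_limit[OF lims(2) l(1)])
    show "\<forall>\<^sub>F r in at_right 0. (M has_real_derivative 1 + (W r)\<^sup>2 - x r * M r - M r / r) (at r)"
      using ev_I by eventually_elim (rule d_comp)
  qed
  have "((\<lambda>r. q r / r) \<longlongrightarrow> (2 * c) / 2) (at_right 0)"
  proof (rule singular_quotient_limit[OF lims(3) l(2)])
    show "\<forall>\<^sub>F r in at_right 0. (q has_real_derivative U r - x r * q r - q r / r) (at r)"
      using ev_I by eventually_elim (rule d_comp)
  qed
  then show "((\<lambda>r. q r / r) \<longlongrightarrow> c) (at_right 0)" by simp
qed

lemma dinv: "r \<in> I \<Longrightarrow> ((\<lambda>r. 1 / r) has_real_derivative - (1 / r\<^sup>2)) (at r)"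
  using I_pos[of r] by (auto intro!: derivative_eq_intros simp: power2_eq_square)

text \<open>This amounts to L' + 2 M' + q'; the form of X' required by \<open>phase\<close> follows
  in \<open>dX\<close> once the defect vanishes.\<close>

lemma dX0: assumes r: "r \<in> I" shows "(X has_real_derivative 3 + 2 * (W r)\<^sup>2 + U r - (X r)\<^sup>2) (at r)"
  unfolding X_def[abs_def]
  by (rule DERIV_cong[OF DERIV_add[OF dinv[OF r] d_comp(1)[OF r]]])
     (use I_pos[OF r] in \<open>simp add: field_simps power2_eq_square\<close>)

lemma dM: assumes r: "r \<in> I" shows "(M has_real_derivative 1 + (W r)\<^sup>2 - X r * M r) (at r)"
  by (rule DERIV_cong[OF d_comp(2)[OF r]]) (simp add: X_def algebra_simps)

lemma dq: assumes r: "r \<in> I" shows "(q has_real_derivative U r - X r * q r) (at r)"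
  by (rule DERIV_cong[OF d_comp(3)[OF r]]) (simp add: X_def algebra_simps)

lemma dL: assumes r: "r \<in> I" shows "(L has_real_derivative 1 - X r * L r) (at r)"
  unfolding L_def[abs_def]
  by (rule DERIV_cong[OF DERIV_diff[OF DERIV_diff[OF dX0[OF r] DERIV_cmult[OF dM[OF r]]] dq[OF r]]])
     (simp add: L_def power2_eq_square algebra_simps)

lemma da: assumes r: "r \<in> I" shows "(a has_real_derivative L r * a r) (at r)"
  unfolding a_def[abs_def]
  by (rule DERIV_cong[OF DERIV_mult[OF DERIV_ident DERIV_fun_exp[OF d_comp(6)[OF r]]]])
     (use I_pos[OF r] in \<open>simp add: L_def X_def field_simps\<close>)

definition "defect r = 2 + 2 * (W r)\<^sup>2 + (L r)\<^sup>2 + 2 * (M r)\<^sup>2 - (X r)\<^sup>2 + U r"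

text \<open>Here X = 1/r + x, so the factor r^2 cancels the singular part of Q' = -2 X Q.\<close>

lemma defect_zero: assumes r: "r \<in> I" shows "defect r = 0"
proof -
  define Y where "Y = (\<lambda>r. 2 * r\<^sup>2 + 2 * r\<^sup>2 * (W r)\<^sup>2 + (1 + r * (x r - 2 * M r - q r))\<^sup>2 + 2 * r\<^sup>2 * (M r)\<^sup>2 - (1 + r * x r)\<^sup>2 + r\<^sup>2 * U r)"
  have YQ: "Y s = s\<^sup>2 * defect s" if "s > 0" for s
  proof -
    have "1 + s * (x s - 2 * M s - q s) = s * L s" "1 + s * x s = s * X s"
      using that by (simp_all add: L_def X_def field_simps)
    then show ?thesis unfolding Y_def defect_def by (simp only: power_mult_distrib) (simp add: algebra_simps)
  qed
  obtain T where T: "T > r" "sing_sol kS2 fieldS2 (initS2 w0 c) u T" using sol[OF r] by blast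
  then have cu: "continuous_on {0..r} u" unfolding sing_sol_def by (auto elim: continuous_on_subset)
  have r0: "r > 0" using I_pos[OF r] .
  have "Y r = 0"
  proof (rule linear_ode_zero[OF r0, where x = x])
    show "continuous_on {0..r} Y" "continuous_on {0..r} x"
      unfolding Y_def M_def q_def U_def W_def x_def by (intro continuous_intros cu)+
    show "Y 0 = 0" by (simp add: Y_def)
    fix s assume s: "0 < s" "s < r"
    then have sI: "s \<in> I" using I_down[OF r] by auto
    have dQ: "(defect has_real_derivative - 2 * X s * defect s) (at s)"
    proof -
      have "(defect has_real_derivative 4 * W s * (- (M s * W s)) + 2 * L s * (1 - X s * L s) + 4 * M s * (1 + (W s)\<^sup>2 - X s * M s)
          - 2 * X s * (3 + 2 * (W s)\<^sup>2 + U s - (X s)\<^sup>2) + 2 * q s) (at s)"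
        unfolding defect_def[abs_def]
        by (auto intro!: derivative_eq_intros d_comp(4,5) dL dM dX0 sI)
      moreover have "q s = X s - L s - 2 * M s" by (simp add: L_def)
      ultimately show ?thesis by (auto elim!: DERIV_cong simp: defect_def power2_eq_square algebra_simps)
    qed
    have "((\<lambda>s. s\<^sup>2 * defect s) has_real_derivative - 2 * x s * (s\<^sup>2 * defect s)) (at s)"
      by (rule derivative_eq_intros dQ refl)+ (use s in \<open>simp add: X_def field_simps power2_eq_square\<close>)
    then have "(Y has_real_derivative - 2 * x s * (s\<^sup>2 * defect s)) (at s)"
      by (rule has_field_derivative_transform_within_open[where S = "{0<..}"]) (use s YQ in auto)
    then show "(Y has_real_derivative - 2 * x s * Y s) (at s)" using YQ[OF s(1)] by simp
  qed
  then show ?thesis using YQ[OF r0] r0 by simp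
qed

lemma dX: assumes r: "r \<in> I" shows "(X has_real_derivative 1 - (L r)\<^sup>2 - 2 * (M r)\<^sup>2) (at r)"
  by (rule DERIV_cong[OF dX0[OF r]]) (use defect_zero[OF r] in \<open>simp add: defect_def\<close>)

lemma lim_La: "((\<lambda>r. 1 + r * (x r - 2 * M r - q r)) \<longlongrightarrow> 1) (at_right 0)" and lim_reg: "((\<lambda>r. x r - 2 * M r - q r) \<longlongrightarrow> 0) (at_right 0)"
proof -
  have "((\<lambda>r. 1 + r * (x r - 2 * M r - q r)) \<longlongrightarrow> 1 + 0 * (0 - 2 * 0 - 0)) (at_right 0)"
    "((\<lambda>r. x r - 2 * M r - q r) \<longlongrightarrow> 0 - 2 * 0 - 0) (at_right 0)" by (intro tendsto_intros lims)+
  then show "((\<lambda>r. 1 + r * (x r - 2 * M r - q r)) \<longlongrightarrow> 1) (at_right 0)" "((\<lambda>r. x r - 2 * M r - q r) \<longlongrightarrow> 0) (at_right 0)" by simp_all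
qed

lemma rL_eq: "r > 0 \<Longrightarrow> 1 + r * (x r - 2 * M r - q r) = r * L r"
  by (simp add: L_def X_def field_simps)

sublocale phase L M X W q U I
proof
  fix r assume r: "r \<in> I"
  show "0 < r" by (rule I_pos[OF r])
  show "s \<in> I" if "0 < s" "s \<le> r" for s by (rule I_down[OF r that])
  show "(L has_real_derivative 1 - X r * L r) (at r)" by (rule dL[OF r])
  show "(M has_real_derivative 1 + (W r)\<^sup>2 - X r * M r) (at r)" by (rule dM[OF r])
  show "(W has_real_derivative - (M r * W r)) (at r)" by (rule d_comp(5)[OF r])
  show "(q has_real_derivative U r - X r * q r) (at r)" by (rule dq[OF r])
  show "(U has_real_derivative 2 * q r) (at r)" by (rule d_comp(4)[OF r])
  show "X r = L r + 2 * M r + q r" by (simp add: L_def)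
  show "(X has_real_derivative 1 - (L r)\<^sup>2 - 2 * (M r)\<^sup>2) (at r)" by (rule dX[OF r])
  show "(X r)\<^sup>2 = 2 + 2 * (W r)\<^sup>2 + (L r)\<^sup>2 + 2 * (M r)\<^sup>2 + U r" using defect_zero[OF r] unfolding defect_def by simp
next
  have "((\<lambda>r. U r - q r / r - x r * q r) \<longlongrightarrow> 2 * c - c - 0 * 0) (at_right 0)"
    by (intro tendsto_intros lims lim_quotients)
  then have "\<forall>\<^sub>F r in at_right 0. U r - q r / r - x r * q r > 0" by (rule order_tendstoD(1)) (use c in simp)
  moreover have "\<forall>\<^sub>F r in at_right 0. 1 + r * (x r - 2 * M r - q r) > 0" by (rule order_tendstoD(1)[OF lim_La]) simp
  moreover have "\<forall>\<^sub>F r in at_right 0. M r / r > 0" by (rule order_tendstoD(1)[OF lim_quotients(1)]) (simp add: add_pos_nonneg)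
  moreover have "\<forall>\<^sub>F r in at_right 0. q r / r > 0" by (rule order_tendstoD(1)[OF lim_quotients(2) c])
  moreover have "\<forall>\<^sub>F r in at_right 0. W r > 0" by (rule order_tendstoD(1)[OF lims(5) w0])
  moreover have "\<forall>\<^sub>F r in at_right 0. U r > 0" by (rule order_tendstoD(1)[OF lims(4)]) (use c in simp)
  ultimately show "\<forall>\<^sub>F r in at_right 0. L r > 0 \<and> M r > 0 \<and> W r > 0 \<and> q r > 0 \<and> U r - X r * q r > 0 \<and> U r > 0"
    using eventually_pos_right
  proof eventually_elim
    case (elim r)
    have "U r - X r * q r = U r - q r / r - x r * q r" by (simp add: X_def algebra_simps)
    then show ?case using elim by (simp add: rL_eq zero_less_divide_iff zero_less_mult_iff)
  qed
qed

end

text \<open>As in the other case \<open>bounds\<close> controls the state on (0, T). The last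
  component is ln (a/r), whose derivative L - 1/r is bounded away from r = 0.\<close>

lemma ex_systemS2:
  assumes w0: "w0 > 0" and c: "c > 0" shows "\<exists>u. \<forall>T. sing_sol kS2 fieldS2 (initS2 w0 c) u T"
proof -
  have "bounded (u ` {0..<T})" if T: "T > 0" and u: "sing_sol kS2 fieldS2 (initS2 w0 c) u T" for T u
  proof -
    interpret systemS2 u w0 c "{0<..<T}"
      by unfold_locales (use w0 c T u in \<open>auto intro: dense\<close>)
    define s where "s = T / 2"
    have s: "0 < s" "s < T" "s \<in> {0<..<T}" using T by (auto simp: s_def)
    have sub: "{0<..<T} \<subseteq> {..<T}" by auto
    obtain B where B: "\<And>r. r \<in> {0<..<T} \<Longrightarrow> s \<le> r \<Longrightarrow> \<bar>L r\<bar> \<le> B \<and> \<bar>M r\<bar> \<le> B \<and> \<bar>W r\<bar> \<le> B \<and> \<bar>q r\<bar> \<le> B \<and> \<bar>U r\<bar> \<le> B"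
      using bounds[OF sub s(3)] by blast
    have B0: "B \<ge> 0" using B[OF s(3)] by fastforce
    define D where "D = B + 1 / s"
    define K where "K = 4 * B + 1 / s + \<bar>u s $ I6\<bar> + D * T"
    have D0: "D \<ge> 0" "D * T \<ge> 0" "1 / s > 0" using B0 s T by (auto simp: D_def)
    have "\<bar>u r $ i\<bar> \<le> K" if r: "s \<le> r" "r < T" for r i
    proof -
      have inI: "t \<in> {0<..<T}" if "s \<le> t" "t \<le> r" for t using that s r by auto
      have rs: "r - s \<le> T" "r > 0" using r s by auto
      have reg: "\<bar>L t - 1 / t\<bar> \<le> D" "0 < 1 / t" "1 / t \<le> 1 / s" if t: "s \<le> t" "t \<le> r" for t
      proof -
        have "0 < 1 / t" "1 / t \<le> 1 / s" using s t by (auto intro: divide_left_mono)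
        moreover have "\<bar>L t\<bar> \<le> B" using B[OF inI[OF t] t(1)] by blast
        ultimately show "\<bar>L t - 1 / t\<bar> \<le> D" "0 < 1 / t" "1 / t \<le> 1 / s" unfolding D_def by linarith+
      qed
      have d6: "((\<lambda>s. u s $ I6) has_real_derivative L t - 1 / t) (at t)" if "s \<le> t" "t \<le> r" for t
        by (rule DERIV_cong[OF d_comp(6)[OF inI[OF that]]]) (simp add: L_def X_def)
      have "u r $ I6 - D * r \<le> u s $ I6 - D * s"
      proof (rule deriv_nonpos_ge[OF r(1), where g = "\<lambda>r. u r $ I6 - D * r" and g' = "\<lambda>t. L t - 1 / t - D"])
        fix t assume t: "s \<le> t" "t \<le> r"
        show "((\<lambda>r. u r $ I6 - D * r) has_real_derivative L t - 1 / t - D) (at t)"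
          using d6[OF t] by (auto intro!: derivative_eq_intros)
        show "L t - 1 / t - D \<le> 0" using reg(1)[OF t] by linarith
      qed
      moreover have "u s $ I6 + D * s \<le> u r $ I6 + D * r"
      proof (rule deriv_nonneg_le[OF r(1), where g = "\<lambda>r. u r $ I6 + D * r" and g' = "\<lambda>t. L t - 1 / t + D"])
        fix t assume t: "s \<le> t" "t \<le> r"
        show "((\<lambda>r. u r $ I6 + D * r) has_real_derivative L t - 1 / t + D) (at t)"
          using d6[OF t] by (auto intro!: derivative_eq_intros)
        show "0 \<le> L t - 1 / t + D" using reg(1)[OF t] by linarith
      qed
      moreover have "D * r - D * s \<le> D * T" using mult_left_mono[OF rs(1) D0(1)] by (simp add: algebra_simps)
      ultimately have i6: "\<bar>u r $ I6\<bar> \<le> \<bar>u s $ I6\<bar> + D * T" by linarith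
      have b: "\<bar>L r\<bar> \<le> B" "\<bar>M r\<bar> \<le> B" "\<bar>W r\<bar> \<le> B" "\<bar>q r\<bar> \<le> B" "\<bar>U r\<bar> \<le> B" using B[OF inI[OF r(1) order_refl] r(1)] by auto
      have bound: "\<bar>x r\<bar> \<le> k" if "k = 4 * B + 1 / s" for k
      proof -
        have "x r = L r + 2 * M r + q r - 1 / r" by (simp add: L_def X_def)
        then show ?thesis using b reg(2,3)[OF r(1) order_refl] unfolding that by linarith
      qed
      have "\<bar>u r $ i\<bar> \<le> 4 * B + k + \<bar>u s $ I6\<bar> + k2" if k: "\<bar>x r\<bar> \<le> 4 * B + k" "k > 0" "\<bar>u r $ I6\<bar> \<le> \<bar>u s $ I6\<bar> + k2" "k2 \<ge> 0" for k k2
      proof (cases i)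
        case I1
        show ?thesis unfolding I1 using k unfolding x_def by linarith
      next
        case I2
        show ?thesis unfolding I2 using b(2) k B0 unfolding M_def by linarith
      next
        case I3
        show ?thesis unfolding I3 using b(4) k B0 unfolding q_def by linarith
      next
        case I4
        show ?thesis unfolding I4 using b(5) k B0 unfolding U_def by linarith
      next
        case I5
        show ?thesis unfolding I5 using b(3) k B0 unfolding W_def by linarith
      next
        case I6
        show ?thesis unfolding I6 using k B0 by linarith
      qed
      from this[OF bound[OF refl] D0(3) i6 D0(2)] show ?thesis unfolding K_def .
    qed
    then show ?thesis by (rule sing_sol_bounded_from_tail[OF u s(2)])
  qed
  then show ?thesis using sing_sol_global[OF loc_lip_fieldS2, of kS2 "initS2 w0 c"] by metis
qed

section \<open>Global solutions and the solitons they define\<close>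

locale systemS2_global =
  fixes u :: "real \<Rightarrow> real^idx" and w0 c :: real
  assumes w0_pos: "w0 > 0" and c_pos: "c > 0" and global: "\<And>T. sing_sol kS2 fieldS2 (initS2 w0 c) u T"
begin

sublocale systemS2 u w0 c "{0<..}"
proof
  show "\<exists>T>r. sing_sol kS2 fieldS2 (initS2 w0 c) u T" for r using global gt_ex by blast
qed (use w0_pos c_pos in auto)

sublocale expander_S2 L M X W q U a "2 * c" w0
proof
  fix r :: real assume "r > 0"
  then show "a r > 0" "(a has_real_derivative L r * a r) (at r)" using da by (auto simp: a_def)
next
  show "2 * c > 0" "w0 > 0" using c_pos w0_pos by simp_all
  show "(q \<longlongrightarrow> 0) (at_right 0)" "(U \<longlongrightarrow> 2 * c) (at_right 0)" "(W \<longlongrightarrow> w0) (at_right 0)" "(M \<longlongrightarrow> 0) (at_right 0)"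
    by (rule lims)+
  show "\<forall>\<^sub>F r in at_right 0. L r < 1 + 1 / r"
    using order_tendstoD(2)[OF lim_reg zero_less_one] by eventually_elim (simp add: L_def X_def)
  have "((\<lambda>r. M r / W r) \<longlongrightarrow> 0 / w0) (at_right 0)" by (intro tendsto_intros lims) (use w0_pos in simp)
  then show "\<forall>\<^sub>F r in at_right 0. M r / W r < t" if "t > 1" for t by (rule order_tendstoD(2)) (use that in simp)
  show "\<forall>\<^sub>F r in at_right 0. r / 5 < M r / (W r)\<^sup>2"
  proof -
    have "((\<lambda>r. (M r / r) / (W r)\<^sup>2) \<longlongrightarrow> ((1 + w0\<^sup>2) / 2) / w0\<^sup>2) (at_right 0)"
      by (intro tendsto_intros lims lim_quotients) (use w0_pos in simp)
    moreover have "((1 + w0\<^sup>2) / 2) / w0\<^sup>2 > 1 / 5" using w0_pos by (simp add: field_simps add_pos_pos)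
    ultimately have "\<forall>\<^sub>F r in at_right 0. (M r / r) / (W r)\<^sup>2 > 1 / 5" by (rule order_tendstoD(1))
    then show ?thesis using eventually_pos_right
    proof eventually_elim
      case (elim r)
      have "r * (1 / 5) < r * ((M r / r) / (W r)\<^sup>2)" using elim by (intro mult_strict_left_mono)
      then show ?case using elim by simp
    qed
  qed
  have a: "((\<lambda>r. r * exp (u r $ I6)) \<longlongrightarrow> 0 * exp 0) (at_right 0)" by (intro tendsto_intros lims)
  then show "(a \<longlongrightarrow> 0) (at_right 0)" unfolding a_def[abs_def] by simp
  have "((\<lambda>r. (1 + r * (x r - 2 * M r - q r)) * exp (u r $ I6)) \<longlongrightarrow> 1 * exp 0) (at_right 0)" by (intro tendsto_intros lim_La lims)
  then have "((\<lambda>r. (1 + r * (x r - 2 * M r - q r)) * exp (u r $ I6)) \<longlongrightarrow> 1) (at_right 0)" by simp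
  then show "((\<lambda>r. L r * a r) \<longlongrightarrow> 1) (at_right 0)"
  proof (rule Lim_transform_eventually)
    show "\<forall>\<^sub>F r in at_right 0. (1 + r * (x r - 2 * M r - q r)) * exp (u r $ I6) = L r * a r"
      using eventually_pos_right by eventually_elim (simp add: rL_eq a_def)
  qed
  have "(1 + w0\<^sup>2) / 2 > 1 / 4" by (rule less_le_trans[of _ "1 / 2"]) simp_all
  then have "\<forall>\<^sub>F r in at_right 0. M r / r > 1 / 4" by (rule order_tendstoD(1)[OF lim_quotients(1)])
  then show "\<forall>\<^sub>F r in at_right 0. M r > r / 4"
    using eventually_pos_right by eventually_elim (simp add: field_simps)
qed

lemma Ck_u: "Ck n (\<lambda>r. u r $ i)"
proof (rule sing_sol_smooth[OF global])
  fix n i assume "\<And>j. Ck n (\<lambda>r. u r $ j)"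
  then show "Ck n (\<lambda>r. fieldS2 r (u r) $ i)"
    by (cases i; simp only: fieldS2_def vec6_nth; intro Ck_intros)
qed

lemma u_0: "u 0 = initS2 w0 c" using global[of 1] unfolding sing_sol_def by simp

definition "b r = inverse (W r)"
definition "f r = - (1/2) * (u r $ I4 - 2 * c)"

lemma df: "r \<ge> 0 \<Longrightarrow> (f has_real_derivative - q r) (at r within {0..})"
proof -
  assume "r \<ge> 0"
  then have "((\<lambda>r. u r $ I4) has_real_derivative 2 * q r) (at r within {0..})"
    using sing_sol_deriv[OF global sing_sol_field_continuous[OF global loc_lip_fieldS2], of r I4]
    by (simp add: kS2_def fieldS2_def q_def)
  then show ?thesis unfolding f_def[abs_def] by (auto intro!: derivative_eq_intros)
qed

lemma hderiv_slopes: "r > 0 \<Longrightarrow> hderiv a r = L r * a r" "r > 0 \<Longrightarrow> hderiv b r = M r / W r"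
proof -
  assume r: "r > 0"
  then show "hderiv a r = L r * a r" using hderiv_eq_pos da by simp
  have "(b has_real_derivative M r / W r) (at r)"
    using d_b[OF r] by (simp add: b_def[abs_def] inverse_eq_divide)
  then show "hderiv b r = M r / W r" using hderiv_eq_pos r by blast
qed

lemma W_pos_0: "r \<ge> 0 \<Longrightarrow> W r > 0"
  using W_pos[of r] w0_pos by (cases "r = 0") (auto simp: W_def u_0 initS2_def)

lemma soliton: "soliton_S2R2 (1 / w0) (- c) a b f"
  unfolding soliton_S2R2_def
proof (intro conjI)
  have "Ck n b" for n unfolding b_def[abs_def] W_def
    using W_pos_0[unfolded W_def] by (intro Ck_intros Ck_inverse Ck_u) force
  moreover have "Ck n f" for n unfolding f_def[abs_def] by (intro Ck_intros Ck_u)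
  moreover have "Ck n a" for n unfolding a_def[abs_def] by (intro Ck_intros Ck_exp Ck_u)
  ultimately show "soliton a b f"
  proof (intro soliton_of_phase[OF phase_axioms] Ck_smooth)
    fix r :: real assume r: "r > 0"
    show "a r > 0" "(a has_real_derivative L r * a r) (at r)" using r da by (auto simp: a_def)
    show "b r = 1 / W r" by (simp add: b_def divide_inverse)
    show "(f has_real_derivative - q r) (at r)" using df[of r] r by (simp add: at_within_halfline)
  qed
  show "a 0 = 0" by (simp add: a_def)
  show "b 0 = 1 / w0" by (simp add: b_def W_def u_0 initS2_def inverse_eq_divide)
  show "f 0 = 0" by (simp add: f_def u_0 initS2_def)
  note d0 = sing_sol_deriv_0[OF global loc_lip_fieldS2]
  have "(a has_real_derivative 1) (at 0 within {0..})"
    unfolding a_def[abs_def] by (rule derivative_eq_intros d0 refl)+ (simp add: u_0 initS2_def)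
  then show "hderiv a 0 = 1" by (rule hderiv_eq) simp
  have "((\<lambda>r. u r $ I5) has_real_derivative 0) (at 0 within {0..})"
    using d0[of I5] by (simp add: fieldS2_def initS2_def kS2_def)
  then have "(b has_real_derivative 0) (at 0 within {0..})"
    unfolding b_def[abs_def] W_def using w0_pos
    by (auto intro!: derivative_eq_intros simp: u_0 initS2_def)
  then show "hderiv b 0 = 0" by (rule hderiv_eq) simp
  have hf: "hderiv f r = - q r" if "r \<ge> 0" for r using hderiv_eq[OF df] that by blast
  then show "hderiv f 0 = 0" by (simp add: q_def u_0 initS2_def)
  have "(q has_real_derivative c) (at 0 within {0..})"
    using d0[of I3] by (simp add: q_def[abs_def] fieldS2_def initS2_def kS2_def)
  then have "((\<lambda>r. - q r) has_real_derivative - c) (at 0 within {0..})" by (rule DERIV_minus)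
  then have "(hderiv f has_real_derivative - c) (at 0 within {0..})"
    by (rule has_field_derivative_transform_within[where d = 1]) (use hf in auto)
  then show "hderiv (hderiv f) 0 = - c" by (rule hderiv_eq) simp
qed

lemma asymptotic_slopes: "has_asymptotic_slopes a b (slope_a, slope_b)"
  unfolding has_asymptotic_slopes_def fst_conv snd_conv
proof
  show "(hderiv a \<longlongrightarrow> slope_a) at_top"
  proof (rule Lim_transform_eventually[OF slopes(1)])
    show "\<forall>\<^sub>F r in at_top. L r * a r = hderiv a r"
      using eventually_gt_at_top[of 0] by eventually_elim (simp add: hderiv_slopes)
  qed
  show "(hderiv b \<longlongrightarrow> slope_b) at_top"
  proof (rule Lim_transform_eventually[OF slopes(2)])
    show "\<forall>\<^sub>F r in at_top. M r / W r = hderiv b r"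
      using eventually_gt_at_top[of 0] by eventually_elim (simp add: hderiv_slopes)
  qed
qed

end

text \<open>The values to be extracted from the equations are a''(0) = 0, which makes L - 1/r tend
  to 0, and C = 2 c; M and W are regular at 0 here.\<close>

lemma systemS2_of_soliton:
  assumes sol: "soliton_S2R2 b0 (- c) a b f" and b0: "b0 > 0"
  obtains u where "\<And>T. sing_sol kS2 fieldS2 (initS2 (1 / b0) c) u T"
    "\<And>r. r > 0 \<Longrightarrow> hderiv a r = (1 / r + u r $ I1 - 2 * u r $ I2 - u r $ I3) * (r * exp (u r $ I6))"
    "\<And>r. r > 0 \<Longrightarrow> hderiv b r = u r $ I2 / u r $ I5"
proof -
  have S: "soliton a b f" and i: "a 0 = 0" "hderiv a 0 = 1" "b 0 = b0" "hderiv b 0 = 0" "f 0 = 0" "hderiv f 0 = 0"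
    "hderiv (hderiv f) 0 = - c" using sol unfolding soliton_S2R2_def by auto
  have sm: "smooth_halfline a" "smooth_halfline b" "smooth_halfline f" using S unfolding soliton_def by auto
  have pos: "a r > 0" "b r > 0" if "r > 0" for r using S that unfolding soliton_def by auto
  define L where "L = (\<lambda>r. hderiv a r / a r)"
  define M where "M = (\<lambda>r. hderiv b r / b r)"
  define q where "q = (\<lambda>r. - hderiv f r)"
  define X where "X = (\<lambda>r. L r + 2 * M r + q r)"
  define W where "W = (\<lambda>r. 1 / b r)"
  have dL: "(L has_real_derivative 1 - X r * L r) (at r)" if "r > 0" for r
    unfolding L_def M_def q_def X_def by (rule soliton_system(1)[OF S that])
  have dM: "(M has_real_derivative 1 + (W r)\<^sup>2 - X r * M r) (at r)" if "r > 0" for r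
    unfolding L_def M_def q_def X_def W_def by (rule soliton_system(2)[OF S that])
  have dW: "(W has_real_derivative - (M r * W r)) (at r)" if "r > 0" for r
    unfolding M_def W_def by (rule soliton_system(3)[OF S that])
  obtain C where C: "\<And>r. r > 0 \<Longrightarrow> hderiv (hderiv f) r = X r * q r - (C - 2 * f r)"
    using soliton_system(4)[OF S] unfolding L_def M_def q_def X_def by blast
  have d1: "(g has_real_derivative hderiv g r) (at r)" "(hderiv g has_real_derivative hderiv (hderiv g) r) (at r)"
    if "smooth_halfline g" "r > 0" for g r
    using smooth_halfline_derivs(1,2)[OF that(1), of r] that(2) by (simp_all add: at_within_halfline)
  note la = smooth_limits[OF sm(1), unfolded i] and lb = smooth_limits[OF sm(2), unfolded i] and lf = smooth_limits[OF sm(3), unfolded i]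
  have la': "((\<lambda>r. a r / r) \<longlongrightarrow> 1) (at_right 0)" using la(4) by simp
  have lf': "((\<lambda>r. hderiv f r / r) \<longlongrightarrow> - c) (at_right 0)" using lf(5) by simp
  have id0: "((\<lambda>r::real. r) \<longlongrightarrow> 0) (at_right 0)" by (rule tendsto_ident_at)
  have b00: "b0 \<noteq> 0" using b0 by simp
  have a2: "hderiv (hderiv a) 0 = 0"
  proof -
    have "((\<lambda>r. - 2 * (hderiv a r * hderiv b r / b r) + hderiv a r * hderiv f r + a r)
        \<longlongrightarrow> - 2 * (1 * 0 / b0) + 1 * 0 + 0) (at_right 0)"
      by (intro tendsto_intros la(1,2) lb(1,2) lf(2) b00)
    then have "(hderiv (hderiv a) \<longlongrightarrow> - 2 * (1 * 0 / b0) + 1 * 0 + 0) (at_right 0)"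
    proof (rule Lim_transform_eventually)
      show "\<forall>\<^sub>F r in at_right 0. - 2 * (hderiv a r * hderiv b r / b r) + hderiv a r * hderiv f r + a r = hderiv (hderiv a) r"
        using eventually_pos_right
      proof eventually_elim
        case (elim r)
        show ?case using S elim unfolding soliton_def by metis
      qed
    qed
    from tendsto_unique[OF _ this la(3)] show ?thesis by simp
  qed
  note so = second_order_limits(1)[OF sm(1) i(1,2) a2 pos(1)]
  \<comment> \<open>Since L ~ 1/r and q ~ c r, X q tends to c, and the equation for f'' becomes -c =
    c - C.\<close>
  have C_eq: "C = 2 * c"
  proof -
    have "((\<lambda>r. (hderiv a r / (a r / r) + 2 * (r * (hderiv b r / b r)) + r * q r) * - (hderiv f r / r) - (C - 2 * f r))
        \<longlongrightarrow> (1 / 1 + 2 * (0 * (0 / b0)) + 0 * - 0) * - (- c) - (C - 2 * 0)) (at_right 0)"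
      unfolding q_def
      by (intro tendsto_intros la(2) la' lb(1,2) lf(1,2) lf' id0 b00) simp
    then have "(hderiv (hderiv f) \<longlongrightarrow> (1 / 1 + 2 * (0 * (0 / b0)) + 0 * - 0) * - (- c) - (C - 2 * 0)) (at_right 0)"
    proof (rule Lim_transform_eventually)
      show "\<forall>\<^sub>F r in at_right 0. (hderiv a r / (a r / r) + 2 * (r * (hderiv b r / b r)) + r * q r) * - (hderiv f r / r) - (C - 2 * f r)
          = hderiv (hderiv f) r"
        using eventually_pos_right
      proof eventually_elim
        case (elim r)
        have "hderiv a r / (a r / r) + 2 * (r * (hderiv b r / b r)) + r * q r = r * X r"
          using pos[OF elim] elim by (simp add: X_def M_def L_def field_simps)
        moreover have "r * X r * - (hderiv f r / r) = X r * q r" using elim by (simp add: q_def)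
        ultimately show ?case using C[OF elim] by simp
      qed
    qed
    from tendsto_unique[OF _ this lf(3)] show ?thesis by simp
  qed
  have dq: "(q has_real_derivative 2 * c - 2 * f r - X r * q r) (at r)" if "r > 0" for r
    unfolding q_def by (rule DERIV_cong[OF DERIV_minus[OF d1(2)[OF sm(3) that]]]) (use C[OF that] C_eq in \<open>simp add: q_def\<close>)
  have df: "(f has_real_derivative - q r) (at r)" if "r > 0" for r using d1(1)[OF sm(3) that] by (simp add: q_def)
  define u where "u = (\<lambda>r. if r = 0 then initS2 (1 / b0) c else vec6 (X r - 1 / r) (M r) (q r) (2 * c - 2 * f r) (W r) (ln (a r / r)))"
  have u_r: "u r = vec6 (X r - 1 / r) (M r) (q r) (2 * c - 2 * f r) (W r) (ln (a r / r))" if "r > 0" for r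
    using that by (simp add: u_def)
  have transfer: "((\<lambda>s. u s $ i) has_real_derivative d) (at r)"
    if "r > 0" "(g has_real_derivative d) (at r)" "\<And>s. s > 0 \<Longrightarrow> g s = u s $ i" for r i g d
    by (rule has_field_derivative_transform_within_open[OF that(2), of "{0<..}"]) (use that in auto)
  have sys: "sing_sol kS2 fieldS2 (initS2 (1 / b0) c) u T" for T
  proof (rule sing_solI)
    show "u 0 = initS2 (1 / b0) c" by (simp add: u_def)
    fix r :: real and i assume r: "r > 0"
    have X_r: "X r = L r + 2 * M r + q r" by (simp add: X_def)
    have inv: "((\<lambda>r. 1 / r) has_real_derivative - (1 / r\<^sup>2)) (at r)"
      using r by (auto intro!: derivative_eq_intros simp: power2_eq_square)
    have dX: "(X has_real_derivative 1 - X r * L r + 2 * (1 + (W r)\<^sup>2 - X r * M r) + (2 * c - 2 * f r - X r * q r)) (at r)"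
      using DERIV_add[OF DERIV_add[OF dL[OF r] DERIV_cmult[OF dM[OF r], of 2]] dq[OF r]] by (simp only: X_def)
    have "1 - X r * L r + 2 * (1 + (W r)\<^sup>2 - X r * M r) + (2 * c - 2 * f r - X r * q r)
        = 3 + 2 * (W r)\<^sup>2 + (2 * c - 2 * f r) - X r * (L r + 2 * M r + q r)" by (simp add: algebra_simps)
    also have "\<dots> = 3 + 2 * (W r)\<^sup>2 + (2 * c - 2 * f r) - X r * X r" by (simp only: X_r)
    finally have X'_eq: "1 - X r * L r + 2 * (1 + (W r)\<^sup>2 - X r * M r) + (2 * c - 2 * f r - X r * q r)
        = 3 + 2 * (W r)\<^sup>2 + (2 * c - 2 * f r) - X r * X r" .
    have D1: "((\<lambda>r. X r - 1 / r) has_real_derivative 3 + 2 * (W r)\<^sup>2 + (2 * c - 2 * f r) - X r * X r - - (1 / r\<^sup>2)) (at r)"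
      using DERIV_diff[OF dX inv] unfolding X'_eq .
    have D4: "((\<lambda>r. 2 * c - 2 * f r) has_real_derivative 0 - 2 * - q r) (at r)"
      by (intro DERIV_diff DERIV_const DERIV_cmult df r)
    have D6: "((\<lambda>r. ln (a r / r)) has_real_derivative L r - 1 / r) (at r)"
      using pos[OF r] r by (auto intro!: derivative_eq_intros d1 sm simp: L_def field_simps)
    show "((\<lambda>s. u s $ i) has_real_derivative fieldS2 r (u r) $ i - real (kS2 i) * (u r $ i - initS2 (1 / b0) c $ i) / r) (at r)"
    proof (cases i)
      case I1
      show ?thesis unfolding I1
        by (rule transfer[OF r DERIV_cong[OF D1]])
           (use r in \<open>simp_all add: fieldS2_def kS2_def initS2_def u_r field_simps power2_eq_square\<close>)
    next
      case I2
      show ?thesis unfolding I2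
        by (rule transfer[OF r DERIV_cong[OF dM[OF r]]])
           (use r in \<open>simp_all add: fieldS2_def kS2_def initS2_def u_r field_simps power2_eq_square\<close>)
    next
      case I3
      show ?thesis unfolding I3
        by (rule transfer[OF r DERIV_cong[OF dq[OF r]]])
           (use r in \<open>simp_all add: fieldS2_def kS2_def initS2_def u_r field_simps\<close>)
    next
      case I4
      show ?thesis unfolding I4
        by (rule transfer[OF r DERIV_cong[OF D4]])
           (use r in \<open>simp_all add: fieldS2_def kS2_def initS2_def u_r\<close>)
    next
      case I5
      show ?thesis unfolding I5
        by (rule transfer[OF r DERIV_cong[OF dW[OF r]]])
           (use r in \<open>simp_all add: fieldS2_def kS2_def initS2_def u_r\<close>)
    next
      case I6
      show ?thesis unfolding I6
        by (rule transfer[OF r DERIV_cong[OF D6]])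
           (use r in \<open>simp_all add: fieldS2_def kS2_def initS2_def u_r X_r\<close>)
    qed
  next
    fix i
    have tr: "((\<lambda>r. u r $ i) \<longlongrightarrow> l) (at_right 0)" if "(g \<longlongrightarrow> l) (at_right 0)" "\<And>s. s > 0 \<Longrightarrow> g s = u s $ i" for i g l
    proof (rule Lim_transform_eventually[OF that(1)])
      show "\<forall>\<^sub>F r in at_right 0. g r = u r $ i" using eventually_pos_right by eventually_elim (rule that(2))
    qed
    have l1: "((\<lambda>r. (hderiv a r / a r - 1 / r) + 2 * (hderiv b r / b r) + - hderiv f r) \<longlongrightarrow> 0 + 2 * (0 / b0) + - 0) (at_right 0)"
      by (intro tendsto_intros so lb(1,2) lf(2) b00)
    have l2: "((\<lambda>r. hderiv b r / b r) \<longlongrightarrow> 0 / b0) (at_right 0)" by (intro tendsto_intros lb(1,2) b00)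
    have l3: "((\<lambda>r. - hderiv f r) \<longlongrightarrow> - 0) (at_right 0)" by (intro tendsto_intros lf(2))
    have l4: "((\<lambda>r. 2 * c - 2 * f r) \<longlongrightarrow> 2 * c - 2 * 0) (at_right 0)" by (intro tendsto_intros lf(1))
    have l5: "((\<lambda>r. 1 / b r) \<longlongrightarrow> 1 / b0) (at_right 0)" by (intro tendsto_intros lb(1) b00)
    have l6: "((\<lambda>r. ln (a r / r)) \<longlongrightarrow> ln 1) (at_right 0)" by (intro tendsto_intros la') simp
    show "((\<lambda>r. u r $ i) \<longlongrightarrow> initS2 (1 / b0) c $ i) (at_right 0)"
    proof (cases i)
      case I1 show ?thesis unfolding I1
        by (rule tr[OF l1[THEN tendsto_eq_rhs]]) (simp_all add: u_r initS2_def X_def L_def M_def q_def)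
    next
      case I2 show ?thesis unfolding I2 by (rule tr[OF l2[THEN tendsto_eq_rhs]]) (simp_all add: u_r initS2_def M_def)
    next
      case I3 show ?thesis unfolding I3 by (rule tr[OF l3[THEN tendsto_eq_rhs]]) (simp_all add: u_r initS2_def q_def)
    next
      case I4 show ?thesis unfolding I4 by (rule tr[OF l4[THEN tendsto_eq_rhs]]) (simp_all add: u_r initS2_def)
    next
      case I5 show ?thesis unfolding I5 by (rule tr[OF l5[THEN tendsto_eq_rhs]]) (simp_all add: u_r initS2_def W_def)
    next
      case I6 show ?thesis unfolding I6 by (rule tr[OF l6[THEN tendsto_eq_rhs]]) (simp_all add: u_r initS2_def)
    qed
  qed
  show ?thesis
  proof (rule that[OF sys])
    fix r :: real assume r: "r > 0"
    have "r * exp (ln (a r / r)) = a r" using pos(1)[OF r] r by simp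
    then show "hderiv a r = (1 / r + u r $ I1 - 2 * u r $ I2 - u r $ I3) * (r * exp (u r $ I6))"
      using r pos(1)[OF r] by (simp add: u_r X_def L_def)
    show "hderiv b r = u r $ I2 / u r $ I5"
      using pos(2)[OF r] r by (simp add: u_r M_def W_def)
  qed
qed

context systemS2_global
begin

lemma F_S2R2_eq: assumes b0: "b0 > 0" "w0 = 1 / b0" shows "F_S2R2 (b0, c) = (slope_a, slope_b)"
  unfolding F_S2R2_def split
proof (rule the_equality)
  have "b0 = 1 / w0" using b0 by simp
  then show "\<exists>a b f. soliton_S2R2 b0 (- c) a b f \<and> has_asymptotic_slopes a b (slope_a, slope_b)"
    using soliton asymptotic_slopes by blast
  fix P assume "\<exists>a b f. soliton_S2R2 b0 (- c) a b f \<and> has_asymptotic_slopes a b P"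
  then obtain a' b' f' where s: "soliton_S2R2 b0 (- c) a' b' f'" "has_asymptotic_slopes a' b' P" by blast
  obtain u' where u': "\<And>T. sing_sol kS2 fieldS2 (initS2 w0 c) u' T"
    "\<And>r. r > 0 \<Longrightarrow> hderiv a' r = (1 / r + u' r $ I1 - 2 * u' r $ I2 - u' r $ I3) * (r * exp (u' r $ I6))"
    "\<And>r. r > 0 \<Longrightarrow> hderiv b' r = u' r $ I2 / u' r $ I5"
    using systemS2_of_soliton[OF s(1) b0(1)] unfolding b0(2) by metis
  have uu: "u' r = u r" if "r > 0" for r
    by (rule sing_sol_unique[OF loc_lip_fieldS2 u'(1) global, of r "r + 1" "r + 1"]) (use that in auto)
  have lim: "(hderiv a' \<longlongrightarrow> fst P) at_top" "(hderiv b' \<longlongrightarrow> snd P) at_top"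
    using s(2) unfolding has_asymptotic_slopes_def by auto
  have lim': "(hderiv a \<longlongrightarrow> slope_a) at_top" "(hderiv b \<longlongrightarrow> slope_b) at_top"
    using asymptotic_slopes unfolding has_asymptotic_slopes_def by auto
  have "fst P = slope_a"
  proof (rule limits_unique_if_eq[OF lim(1) lim'(1)])
    fix r :: real assume r: "r > 0"
    show "hderiv a' r = hderiv a r"
      unfolding u'(2)[OF r] hderiv_slopes(1)[OF r] uu[OF r] by (simp add: L_def a_def X_def x_def M_def q_def)
  qed
  moreover have "snd P = slope_b"
  proof (rule limits_unique_if_eq[OF lim(2) lim'(2)])
    fix r :: real assume r: "r > 0"
    show "hderiv b' r = hderiv b r"
      unfolding u'(3)[OF r] hderiv_slopes(2)[OF r] uu[OF r] by (simp add: M_def W_def)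
  qed
  ultimately show "P = (slope_a, slope_b)" by (simp add: prod_eq_iff)
qed

end

section \<open>Properness for S^2 x R^2\<close>

definition "solS2 p = (SOME u. \<forall>T. sing_sol kS2 fieldS2 (initS2 (1 / fst p) (snd p)) u T)"

lemma systemS2_global_solS2: "p \<in> quadrant \<Longrightarrow> systemS2_global (solS2 p) (1 / fst p) (snd p)"
  using someI_ex[OF ex_systemS2[of "1 / fst p" "snd p"]] unfolding solS2_def
  by unfold_locales (auto simp: quadrant_def)

definition "slope_aS2 p = expander.slope_a (systemS2.L (solS2 p)) (systemS2.a (solS2 p))"
definition "slope_bS2 p = expander.slope_b (systemS2.M (solS2 p)) (systemS2.W (solS2 p))"

lemma slopesS2_continuous: "continuous_on quadrant slope_aS2" "continuous_on quadrant slope_bS2"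
proof -
  have cu: "continuous_on quadrant (\<lambda>p. solS2 p s)" if "s > 0" for s
  proof (rule sing_sol_continuous_in_init[OF loc_lip_fieldS2])
    show "continuous_on quadrant (\<lambda>p. initS2 (1 / fst p) (snd p))"
      unfolding initS2_def by (intro continuous_on_vec6 continuous_intros) (auto simp: quadrant_def)
    show "sing_sol kS2 fieldS2 (initS2 (1 / fst p) (snd p)) (solS2 p) T" if "p \<in> quadrant" for p T
      by (rule systemS2_global.global[OF systemS2_global_solS2[OF that]])
  qed (use that in auto)
  have ex: "expander (systemS2.L (solS2 p)) (systemS2.M (solS2 p)) (systemS2.X (solS2 p)) (systemS2.W (solS2 p))
      (systemS2.q (solS2 p)) (systemS2.U (solS2 p)) (systemS2.a (solS2 p)) (2 * snd p)" if "p \<in> quadrant" for p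
  proof -
    interpret systemS2_global "solS2 p" "1 / fst p" "snd p" by (rule systemS2_global_solS2[OF that])
    show ?thesis by (rule expander_axioms)
  qed
  have eqs: "systemS2.L (solS2 p) s = 1 / s + solS2 p s $ I1 - 2 * solS2 p s $ I2 - solS2 p s $ I3"
    "systemS2.M (solS2 p) s = solS2 p s $ I2" "systemS2.X (solS2 p) s = 1 / s + solS2 p s $ I1"
    "systemS2.W (solS2 p) s = solS2 p s $ I5" "systemS2.U (solS2 p) s = solS2 p s $ I4"
    "systemS2.a (solS2 p) s = s * exp (solS2 p s $ I6)" if "p \<in> quadrant" for p s
  proof -
    interpret systemS2_global "solS2 p" "1 / fst p" "snd p" by (rule systemS2_global_solS2[OF that])
    show "L s = 1 / s + solS2 p s $ I1 - 2 * solS2 p s $ I2 - solS2 p s $ I3" "M s = solS2 p s $ I2"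
      "X s = 1 / s + solS2 p s $ I1" "W s = solS2 p s $ I5" "U s = solS2 p s $ I4" "a s = s * exp (solS2 p s $ I6)"
      by (simp_all add: L_def M_def X_def W_def U_def a_def x_def q_def)
  qed
  have "continuous_on quadrant (\<lambda>p. systemS2.L (solS2 p) s)" "continuous_on quadrant (\<lambda>p. systemS2.M (solS2 p) s)"
    "continuous_on quadrant (\<lambda>p. systemS2.X (solS2 p) s)" "continuous_on quadrant (\<lambda>p. systemS2.W (solS2 p) s)"
    "continuous_on quadrant (\<lambda>p. systemS2.U (solS2 p) s)" "continuous_on quadrant (\<lambda>p. systemS2.a (solS2 p) s)"
    if "s > 0" for s
    by (subst continuous_on_cong[OF refl eqs(1)], assumption, intro continuous_intros cu[OF that])
       (subst continuous_on_cong[OF refl eqs(2)], assumption, intro continuous_intros cu[OF that],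
        subst continuous_on_cong[OF refl eqs(3)], assumption, intro continuous_intros cu[OF that],
        subst continuous_on_cong[OF refl eqs(4)], assumption, intro continuous_intros cu[OF that],
        subst continuous_on_cong[OF refl eqs(5)], assumption, intro continuous_intros cu[OF that],
        subst continuous_on_cong[OF refl eqs(6)], assumption, intro continuous_intros cu[OF that])
  from slopes_continuous[OF ex this]
  show "continuous_on quadrant slope_aS2" "continuous_on quadrant slope_bS2"
    unfolding slope_aS2_def[abs_def] slope_bS2_def[abs_def] by auto
qed

lemma slopesS2:
  assumes "b0 > 0" "c > 0"
  shows "slope_aS2 (b0, c) > 0" "slope_bS2 (b0, c) > 0" "F_S2R2 (b0, c) = (slope_aS2 (b0, c), slope_bS2 (b0, c))"
    "R > 43 \<Longrightarrow> 2 * c * exp (2 * R) \<le> 1 \<Longrightarrow> (R - 3) / 40 \<le> slope_bS2 (b0, c)"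
    "\<tau> \<ge> 1 \<Longrightarrow> 2 * c \<ge> 6 * \<tau> ^ 4 * exp \<tau> \<or> (1 / b0)\<^sup>2 \<ge> 3 * \<tau> ^ 3 * exp \<tau> \<Longrightarrow>
      slope_aS2 (b0, c) \<le> exp 40 * (6 / \<tau>) * (1 + slope_bS2 (b0, c))"
    "1 \<le> b0 \<Longrightarrow> 2 * c \<le> \<Lambda> \<Longrightarrow> \<mu> = 1 / (8 + 9 * \<Lambda>) \<Longrightarrow> \<mu> * b0 > 1 \<Longrightarrow> slope_bS2 (b0, c) \<ge> \<mu> * b0"
proof -
  have p: "(b0, c) \<in> quadrant" using assms by (simp add: quadrant_def)
  interpret systemS2_global "solS2 (b0, c)" "1 / b0" c using systemS2_global_solS2[OF p] by simp
  have eq: "slope_aS2 (b0, c) = slope_a" "slope_bS2 (b0, c) = slope_b" by (simp_all add: slope_aS2_def slope_bS2_def)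
  show "slope_aS2 (b0, c) > 0" "slope_bS2 (b0, c) > 0" unfolding eq by (rule slopes_pos)+
  show "F_S2R2 (b0, c) = (slope_aS2 (b0, c), slope_bS2 (b0, c))" unfolding eq by (rule F_S2R2_eq[OF assms(1) refl])
  show "R > 43 \<Longrightarrow> 2 * c * exp (2 * R) \<le> 1 \<Longrightarrow> (R - 3) / 40 \<le> slope_bS2 (b0, c)" unfolding eq by (rule slope_b_large)
  show "slope_aS2 (b0, c) \<le> exp 40 * (6 / \<tau>) * (1 + slope_bS2 (b0, c))"
    if "\<tau> \<ge> 1" "2 * c \<ge> 6 * \<tau> ^ 4 * exp \<tau> \<or> (1 / b0)\<^sup>2 \<ge> 3 * \<tau> ^ 3 * exp \<tau>"
  proof -
    have "exp 40 * a 1 * (1 + slope_b) \<le> exp 40 * (6 / \<tau>) * (1 + slope_b)"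
      using a1_small[OF that] slopes_pos by (intro mult_right_mono mult_left_mono) auto
    then show ?thesis unfolding eq using slope_a_le by linarith
  qed
  show "slope_bS2 (b0, c) \<ge> \<mu> * b0" if "1 \<le> b0" "2 * c \<le> \<Lambda>" "\<mu> = 1 / (8 + 9 * \<Lambda>)" "\<mu> * b0 > 1"
    using slope_b_large_b0[of \<Lambda> \<mu>] that by (simp add: eq)
qed

lemma proper_S2R2: "is_proper_map quadrant quadrant F_S2R2"
proof (rule is_proper_map_quadrant)
  have F: "F_S2R2 p = (slope_aS2 p, slope_bS2 p)" if "p \<in> quadrant" for p
    using slopesS2(3)[of "fst p" "snd p"] that by (auto simp: quadrant_def)
  show "F_S2R2 \<in> quadrant \<rightarrow> quadrant"
  proof
    fix p assume p: "p \<in> quadrant"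
    then show "F_S2R2 p \<in> quadrant" using F[OF p] slopesS2(1,2)[of "fst p" "snd p"] by (auto simp: quadrant_def)
  qed
  have "continuous_on quadrant (\<lambda>p. (slope_aS2 p, slope_bS2 p))" by (intro continuous_intros slopesS2_continuous)
  then show "continuous_on quadrant F_S2R2" by (simp add: continuous_on_cong[OF refl F])
  fix k1 k2 :: real assume k: "0 < k1" "k1 \<le> k2"
  define R where "R = 40 * k2 + 44"
  define c1 where "c1 = exp (- 2 * R) / 2"
  \<comment> \<open>For this \<open>\<tau>\<close> the hypothesis of \<open>a1_small\<close> would
    push the limit of a' below k1; the 7 in place of 6 gives strictness.\<close>
  define \<tau> where "\<tau> = max 1 (7 * exp 40 * (1 + k2) / k1)"
  \<comment> \<open>The upper bound for 2 c that the choice of \<open>\<tau>\<close> leaves.\<close>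
  define \<Lambda> where "\<Lambda> = 6 * \<tau> ^ 4 * exp \<tau>"
  define \<mu> where "\<mu> = 1 / (8 + 9 * \<Lambda>)"
  \<comment> \<open>If b0 < \<open>b1\<close>, then 1/b0 exceeds 3 \<tau>^3 exp \<tau> > 1, and so
    does its square.\<close>
  define b1 where "b1 = 1 / (3 * \<tau> ^ 3 * exp \<tau>)"
  \<comment> \<open>For b0 > \<open>b2\<close> one has \<mu> b0 > max 1 k2, so the limit of b' would
    exceed k2.\<close>
  define b2 where "b2 = max 1 (max 1 k2 / \<mu> + 1)"
  have \<tau>: "\<tau> \<ge> 1" "7 * exp 40 * (1 + k2) / k1 \<le> \<tau>" by (auto simp: \<tau>_def)
  have small: "exp 40 * (6 / \<tau>) * (1 + k2) < k1"
  proof -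
    have "7 * exp 40 * (1 + k2) \<le> \<tau> * k1" using \<tau>(2) k by (simp add: pos_divide_le_eq)
    moreover have "0 < exp 40 * (1 + k2)" using k by simp
    ultimately have "6 * (exp 40 * (1 + k2)) < k1 * \<tau>" by (simp add: mult.commute)
    then have "6 * (exp 40 * (1 + k2)) / \<tau> < k1" by (subst pos_divide_less_eq) (use \<tau> in auto)
    then show ?thesis by (simp add: mult_ac)
  qed
  have \<Lambda>: "\<Lambda> > 0" using \<tau> unfolding \<Lambda>_def by simp
  then have \<mu>: "\<mu> > 0" unfolding \<mu>_def by simp
  have D: "3 * \<tau> ^ 3 * exp \<tau> > 1"
  proof -
    have "1 * 1 * 1 < 3 * \<tau> ^ 3 * exp \<tau>" using \<tau> one_le_power[OF \<tau>(1), of 3] by (intro mult_le_less_imp_less mult_mono) auto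
    then show ?thesis by simp
  qed
  have pos: "c1 > 0" "b1 > 0" using \<tau> by (simp_all add: c1_def b1_def)
  have box: "b1 \<le> b0 \<and> b0 \<le> b2 \<and> c1 \<le> c \<and> c \<le> \<Lambda> / 2"
    if bc: "b0 > 0" "c > 0" and s: "k1 \<le> slope_aS2 (b0, c)" "slope_bS2 (b0, c) \<le> k2" for b0 c
  proof -
    note sl = slopesS2[OF bc]
    have "c1 \<le> c"
    proof (rule ccontr)
      assume "\<not> c1 \<le> c"
      then have "2 * c \<le> exp (- 2 * R)" by (simp add: c1_def)
      then have "2 * c * exp (2 * R) \<le> exp (- 2 * R) * exp (2 * R)" by (intro mult_right_mono) auto
      then have "2 * c * exp (2 * R) \<le> 1" by (simp flip: exp_add)
      then show False using sl(4)[of R] s k by (simp add: R_def)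
    qed
    have "exp 40 * (6 / \<tau>) * (1 + slope_bS2 (b0, c)) \<le> exp 40 * (6 / \<tau>) * (1 + k2)"
      using s \<tau> by (intro mult_left_mono) auto
    then have n: "\<not> (2 * c \<ge> 6 * \<tau> ^ 4 * exp \<tau> \<or> (1 / b0)\<^sup>2 \<ge> 3 * \<tau> ^ 3 * exp \<tau>)"
      using sl(5)[OF \<tau>(1)] s(1) small by (meson not_le order_trans)
    then have c2: "2 * c \<le> \<Lambda>" and w: "(1 / b0)\<^sup>2 < 3 * \<tau> ^ 3 * exp \<tau>" unfolding \<Lambda>_def by auto
    have "b1 \<le> b0"
    proof (rule ccontr)
      assume "\<not> b1 \<le> b0"
      then have le: "3 * \<tau> ^ 3 * exp \<tau> \<le> 1 / b0" using bc D by (simp add: b1_def field_simps)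
      then have ge1: "1 \<le> 1 / b0" using D by (rule order_trans[OF less_imp_le, rotated])
      have "1 / b0 * 1 \<le> 1 / b0 * (1 / b0)" using ge1 bc by (intro mult_left_mono) simp_all
      then show False using le w by (simp add: power2_eq_square)
    qed
    moreover have "b0 \<le> b2"
    proof (rule ccontr)
      assume "\<not> b0 \<le> b2"
      then have b: "1 \<le> b0" "max 1 k2 / \<mu> < b0" by (auto simp: b2_def)
      then have m: "max 1 k2 < \<mu> * b0" using \<mu> by (simp add: pos_divide_less_eq mult.commute)
      then show False using sl(6)[OF b(1) c2 \<mu>_def] s(2) by auto
    qed
    ultimately show ?thesis using \<open>c1 \<le> c\<close> c2 by simp
  qed
  show "\<exists>B. compact B \<and> B \<subseteq> quadrant \<and> (\<forall>p\<in>quadrant. k1 \<le> fst (F_S2R2 p) \<longrightarrow> fst (F_S2R2 p) \<le> k2 \<longrightarrow>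
      k1 \<le> snd (F_S2R2 p) \<longrightarrow> snd (F_S2R2 p) \<le> k2 \<longrightarrow> p \<in> B)"
  proof (intro exI[of _ "{b1..b2} \<times> {c1..\<Lambda> / 2}"] conjI ballI impI)
    show "compact ({b1..b2} \<times> {c1..\<Lambda> / 2})" by (intro compact_Times compact_Icc)
    show "{b1..b2} \<times> {c1..\<Lambda> / 2} \<subseteq> quadrant" using pos unfolding quadrant_def by auto
    fix p assume p: "p \<in> quadrant" "k1 \<le> fst (F_S2R2 p)" "snd (F_S2R2 p) \<le> k2"
    then show "p \<in> {b1..b2} \<times> {c1..\<Lambda> / 2}"
      using box[of "fst p" "snd p"] F[OF p(1)] by (auto simp: quadrant_def)
  qed
qed

theorem theorem9p1:
  shows "is_proper_map quadrant quadrant F_S1R3 \<and> is_proper_map quadrant quadrant F_S2R2"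
  using proper_S1R3 proper_S2R2 by blast

end
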